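(* Let $(M,\nabla,\langle\cdot,\cdot\rangle)$ be an affine-Riemann manifold whose difference tensor satisfies $D(\gamma)=0$. Then, for every $k\ge1$, $(T^kM,J_k,g_k)$ is locally conformally balanced.
   Context: An affine-Riemann manifold $(M,\nabla,\langle\cdot,\cdot\rangle)$ is a manifold with a flat torsionless connection $\nabla$ and a Riemannian metric. $D$ is the Levi-Civita connection of the metric; the difference tensor is $\gamma_XY=D_XY-\nabla_XY$; $D(\gamma)$ is its covariant derivative. Canonical sequence: for a vector field $X$ on $M$, $X^h$ is the horizontal lift to $TM$ with respect to $\nabla$ and $X^v$ the vertical lift; $\pi_1:TM\to M$ is the projection. On $TM$: $J_1X^h=X^v$, $J_1X^v=-X^h$; $g_1(X^h,Y^h)=g_1(X^v,Y^v)=\langle X,Y\rangle\circ\pi_1$, $g_1(X^h,Y^v)=0$; $\nabla^1_{X^h}Y^h=(\nabla_XY)^h$, $\nabla^1_{X^h}Y^v=(\nabla_XY)^v$, $\nabla^1_{X^v}Y^h=\nabla^1_{X^v}Y^v=0$. Then $(TM,J_1,g_1)$ is Hermitian and $\nabla^1$ is flat torsionless. Inductively, with $T^1M=TM$, $T^kM=T(T^{k-1}M)$, applying the construction to $(T^{k-1}M,\nabla^{k-1},g_{k-1})$ gives $(J_k,g_k,\nabla^k)$ on $T^kM$. For a Hermitian manifold $(N,J,g)$ with Levi-Civita connection $\nabla^{LC}$: $\omega=g(J\cdot,\cdot)$, $d^*\omega(\cdot)=-\sum_i(\nabla^{LC}_{E_i}\omega)(E_i,\cdot)$ for a local $g$-orthonormal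 frame, Lee form $\theta=-d^*\omega\circ J$; it is locally conformally balanced if $d\theta=0$. *)

theory Defs
  imports "HOL-Analysis.Analysis" "HOL-Library.Function_Algebras"
begin

section \<open>Smooth functions on open subsets of Euclidean space\<close>

text \<open>
  Euclidean \<open>n\<close>-space is the library's \<^const>\<open>Euclidean_space\<close>, i.e. the functions
  \<open>nat \<Rightarrow> real\<close> that vanish from \<open>n\<close> on. A numerical dimension (instead of a type-indexed one) is
  needed because the dimension of the iterated tangent bundles varies with a natural number.
\<close>

definition pderiv_at :: "nat \<Rightarrow> ((nat \<Rightarrow> real) \<Rightarrow> real) \<Rightarrow> (nat \<Rightarrow> real) \<Rightarrow> real" where
  "pderiv_at a f x = deriv (\<lambda>t. f (x(a := t))) (x a)"

primrec Ck_on :: "nat \<Rightarrow> nat \<Rightarrow> (nat \<Rightarrow> real) set \<Rightarrow> ((nat \<Rightarrow> real) \<Rightarrow> real) \<Rightarrow> bool" where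
  "Ck_on n 0 U f \<longleftrightarrow> continuous_map (subtopology (Euclidean_space n) U) euclideanreal f"
| "Ck_on n (Suc k) U f \<longleftrightarrow>
     continuous_map (subtopology (Euclidean_space n) U) euclideanreal f \<and>
     (\<forall>a<n. (\<forall>x\<in>U. (\<lambda>t. f (x(a := t))) differentiable (at (x a))) \<and> Ck_on n k U (pderiv_at a f))"

definition smooth_real_on :: "nat \<Rightarrow> (nat \<Rightarrow> real) set \<Rightarrow> ((nat \<Rightarrow> real) \<Rightarrow> real) \<Rightarrow> bool" where
  "smooth_real_on n U f \<longleftrightarrow> (\<forall>k. Ck_on n k U f)"


section \<open>Smooth manifolds\<close>

text \<open>A manifold is given by a smooth atlas whose charts are indexed by a set in a type \<open>'i\<close>.\<close>

record ('p, 'i) manifold =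
  mtop :: "'p topology"
  mdim :: nat
  charts :: "'i set"
  cdom :: "'i \<Rightarrow> 'p set"
  coord :: "'i \<Rightarrow> 'p \<Rightarrow> nat \<Rightarrow> real"

definition cinv :: "('p, 'i) manifold \<Rightarrow> 'i \<Rightarrow> (nat \<Rightarrow> real) \<Rightarrow> 'p" where
  "cinv M i = inv_into (cdom M i) (coord M i)"

definition second_countable_space :: "'p topology \<Rightarrow> bool" where
  "second_countable_space T \<longleftrightarrow>
     (\<exists>\<B>. countable \<B> \<and> (\<forall>V\<in>\<B>. openin T V) \<and>
          (\<forall>U x. openin T U \<and> x \<in> U \<longrightarrow> (\<exists>V\<in>\<B>. x \<in> V \<and> V \<subseteq> U)))"

definition smooth_manifold :: "('p, 'i) manifold \<Rightarrow> bool" where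
  "smooth_manifold M \<longleftrightarrow>
     Hausdorff_space (mtop M) \<and> second_countable_space (mtop M) \<and>
     topspace (mtop M) = (\<Union>i\<in>charts M. cdom M i) \<and>
     (\<forall>i\<in>charts M.
        openin (mtop M) (cdom M i) \<and>
        openin (Euclidean_space (mdim M)) (coord M i ` cdom M i) \<and>
        homeomorphic_map (subtopology (mtop M) (cdom M i))
          (subtopology (Euclidean_space (mdim M)) (coord M i ` cdom M i)) (coord M i)) \<and>
     (\<forall>i\<in>charts M. \<forall>j\<in>charts M. \<forall>k<mdim M.
        smooth_real_on (mdim M) (coord M i ` (cdom M i \<inter> cdom M j)) (\<lambda>x. coord M j (cinv M i x) k))"

definition charts_at :: "('p, 'i) manifold \<Rightarrow> 'p \<Rightarrow> 'i set" where
  "charts_at M p = {i \<in> charts M. p \<in> cdom M i}"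

definition smooth_fun :: "('p, 'i) manifold \<Rightarrow> 'p set \<Rightarrow> ('p \<Rightarrow> real) \<Rightarrow> bool" where
  "smooth_fun M U f \<longleftrightarrow>
     (\<forall>i\<in>charts M. smooth_real_on (mdim M) (coord M i ` (U \<inter> cdom M i)) (\<lambda>x. f (cinv M i x)))"


section \<open>Tangent vectors and vector fields\<close>

text \<open>
  A tangent vector at \<open>p\<close> is the family of its components in all charts around \<open>p\<close>; components in
  different charts are related by the Jacobian matrix of the transition map. All other entries are
  zero, so that \<open>tangent_space M p\<close> is a vector space under the pointwise operations.
\<close>

type_synonym 'i tvec = "'i \<Rightarrow> nat \<Rightarrow> real"
type_synonym ('p, 'i) field = "'p \<Rightarrow> 'i tvec"

definition tscale :: "real \<Rightarrow> 'i tvec \<Rightarrow> 'i tvec" where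
  "tscale c v = (\<lambda>i k. c * v i k)"

definition jacobian :: "('p, 'i) manifold \<Rightarrow> 'i \<Rightarrow> 'i \<Rightarrow> 'p \<Rightarrow> nat \<Rightarrow> nat \<Rightarrow> real" where
  "jacobian M i j p k a = pderiv_at a (\<lambda>x. coord M j (cinv M i x) k) (coord M i p)"

definition tangent_space :: "('p, 'i) manifold \<Rightarrow> 'p \<Rightarrow> 'i tvec set" where
  "tangent_space M p =
     {v. (\<forall>i. i \<notin> charts_at M p \<longrightarrow> v i = 0) \<and>
         (\<forall>i. \<forall>k\<ge>mdim M. v i k = 0) \<and>
         (\<forall>i\<in>charts_at M p. \<forall>j\<in>charts_at M p. \<forall>k<mdim M.
            v j k = (\<Sum>a<mdim M. jacobian M i j p k a * v i a))}"

text \<open>The derivative of \<open>f\<close> along a tangent vector at \<open>p\<close>, computed in some chart around \<open>p\<close>.\<close>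

definition dirder :: "('p, 'i) manifold \<Rightarrow> 'p \<Rightarrow> 'i tvec \<Rightarrow> ('p \<Rightarrow> real) \<Rightarrow> real" where
  "dirder M p v f =
     (let i = (SOME i. i \<in> charts_at M p)
      in \<Sum>a<mdim M. v i a * pderiv_at a (\<lambda>x. f (cinv M i x)) (coord M i p))"

definition vfield :: "('p, 'i) manifold \<Rightarrow> 'p set \<Rightarrow> ('p, 'i) field \<Rightarrow> bool" where
  "vfield M U X \<longleftrightarrow>
     (\<forall>p\<in>U. X p \<in> tangent_space M p) \<and>
     (\<forall>i\<in>charts M. \<forall>k<mdim M.
        smooth_real_on (mdim M) (coord M i ` (U \<inter> cdom M i)) (\<lambda>x. X (cinv M i x) i k))"

definition fscale :: "('p \<Rightarrow> real) \<Rightarrow> ('p, 'i) field \<Rightarrow> ('p, 'i) field" where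
  "fscale f X = (\<lambda>p. tscale (f p) (X p))"

definition bracket :: "('p, 'i) manifold \<Rightarrow> ('p, 'i) field \<Rightarrow> ('p, 'i) field \<Rightarrow> ('p, 'i) field" where
  "bracket M X Y = (\<lambda>p i k.
     if i \<in> charts_at M p \<and> k < mdim M
     then dirder M p (X p) (\<lambda>q. Y q i k) - dirder M p (Y p) (\<lambda>q. X q i k) else 0)"

definition coord_field :: "('p, 'i) manifold \<Rightarrow> 'i \<Rightarrow> nat \<Rightarrow> ('p, 'i) field" where
  "coord_field M i a = (\<lambda>p j k. if j \<in> charts_at M p \<and> k < mdim M then jacobian M i j p k a else 0)"


section \<open>Connections and metrics\<close>

text \<open>
  A connection acts on vector fields defined on open subsets, compatibly with restriction (the last
  clause); every connection on the module of global vector fields extends uniquely to such an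
  operator. Its values on arguments that are not smooth vector fields near the point are irrelevant.
\<close>

type_synonym ('p, 'i) conn = "('p, 'i) field \<Rightarrow> ('p, 'i) field \<Rightarrow> ('p, 'i) field"
type_synonym ('p, 'i) metric = "'p \<Rightarrow> 'i tvec \<Rightarrow> 'i tvec \<Rightarrow> real"
type_synonym ('p, 'i) endo = "'p \<Rightarrow> 'i tvec \<Rightarrow> 'i tvec"

definition connection :: "('p, 'i) manifold \<Rightarrow> ('p, 'i) conn \<Rightarrow> bool" where
  "connection M nab \<longleftrightarrow>
     (\<forall>U X X' Y Y' f.
        openin (mtop M) U \<and> vfield M U X \<and> vfield M U X' \<and> vfield M U Y \<and> vfield M U Y' \<and>
        smooth_fun M U f \<longrightarrow>
        vfield M U (nab X Y) \<and>
        (\<forall>p\<in>U. nab (X + X') Y p = nab X Y p + nab X' Y p) \<and>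
        (\<forall>p\<in>U. nab (fscale f X) Y p = tscale (f p) (nab X Y p)) \<and>
        (\<forall>p\<in>U. nab X (Y + Y') p = nab X Y p + nab X Y' p) \<and>
        (\<forall>p\<in>U. nab X (fscale f Y) p =
                  tscale (dirder M p (X p) f) (Y p) + tscale (f p) (nab X Y p)) \<and>
        ((\<forall>p\<in>U. X p = X' p \<and> Y p = Y' p) \<longrightarrow> (\<forall>p\<in>U. nab X Y p = nab X' Y' p)))"

definition torsionless :: "('p, 'i) manifold \<Rightarrow> ('p, 'i) conn \<Rightarrow> bool" where
  "torsionless M nab \<longleftrightarrow>
     (\<forall>U X Y. openin (mtop M) U \<and> vfield M U X \<and> vfield M U Y \<longrightarrow>
        (\<forall>p\<in>U. nab X Y p - nab Y X p = bracket M X Y p))"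

definition flat :: "('p, 'i) manifold \<Rightarrow> ('p, 'i) conn \<Rightarrow> bool" where
  "flat M nab \<longleftrightarrow>
     (\<forall>U X Y Z. openin (mtop M) U \<and> vfield M U X \<and> vfield M U Y \<and> vfield M U Z \<longrightarrow>
        (\<forall>p\<in>U. nab X (nab Y Z) p - nab Y (nab X Z) p - nab (bracket M X Y) Z p = 0))"

definition riemannian_metric :: "('p, 'i) manifold \<Rightarrow> ('p, 'i) metric \<Rightarrow> bool" where
  "riemannian_metric M g \<longleftrightarrow>
     (\<forall>p\<in>topspace (mtop M). \<forall>u\<in>tangent_space M p.
        (u \<noteq> 0 \<longrightarrow> g p u u > 0) \<and>
        (\<forall>v\<in>tangent_space M p. g p u v = g p v u \<and>
           (\<forall>c. g p (tscale c u) v = c * g p u v) \<and>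
           (\<forall>w\<in>tangent_space M p. g p (u + v) w = g p u w + g p v w))) \<and>
     (\<forall>U X Y. openin (mtop M) U \<and> vfield M U X \<and> vfield M U Y \<longrightarrow>
        smooth_fun M U (\<lambda>p. g p (X p) (Y p)))"

definition metric_connection ::
  "('p, 'i) manifold \<Rightarrow> ('p, 'i) metric \<Rightarrow> ('p, 'i) conn \<Rightarrow> bool" where
  "metric_connection M g D \<longleftrightarrow>
     (\<forall>U X Y Z. openin (mtop M) U \<and> vfield M U X \<and> vfield M U Y \<and> vfield M U Z \<longrightarrow>
        (\<forall>p\<in>U. dirder M p (X p) (\<lambda>q. g q (Y q) (Z q)) = g p (D X Y p) (Z p) + g p (Y p) (D X Z p)))"

definition levi_civita :: "('p, 'i) manifold \<Rightarrow> ('p, 'i) metric \<Rightarrow> ('p, 'i) conn \<Rightarrow> bool" where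
  "levi_civita M g D \<longleftrightarrow> connection M D \<and> torsionless M D \<and> metric_connection M g D"

definition affine_riemann_manifold ::
  "('p, 'i) manifold \<Rightarrow> ('p, 'i) conn \<Rightarrow> ('p, 'i) metric \<Rightarrow> bool" where
  "affine_riemann_manifold M nab g \<longleftrightarrow>
     smooth_manifold M \<and> connection M nab \<and> flat M nab \<and> torsionless M nab \<and> riemannian_metric M g"

definition difference_tensor ::
  "('p, 'i) conn \<Rightarrow> ('p, 'i) conn \<Rightarrow> ('p, 'i) field \<Rightarrow> ('p, 'i) field \<Rightarrow> ('p, 'i) field" where
  "difference_tensor D nab X Y = D X Y - nab X Y"

definition cov_deriv_21 ::
  "('p, 'i) conn \<Rightarrow> (('p, 'i) field \<Rightarrow> ('p, 'i) field \<Rightarrow> ('p, 'i) field) \<Rightarrow>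
   ('p, 'i) field \<Rightarrow> ('p, 'i) field \<Rightarrow> ('p, 'i) field \<Rightarrow> ('p, 'i) field" where
  "cov_deriv_21 D S X Y Z = D X (S Y Z) - S (D X Y) Z - S Y (D X Z)"

definition parallel_21 ::
  "('p, 'i) manifold \<Rightarrow> ('p, 'i) conn \<Rightarrow>
   (('p, 'i) field \<Rightarrow> ('p, 'i) field \<Rightarrow> ('p, 'i) field) \<Rightarrow> bool" where
  "parallel_21 M D S \<longleftrightarrow>
     (\<forall>U X Y Z. openin (mtop M) U \<and> vfield M U X \<and> vfield M U Y \<and> vfield M U Z \<longrightarrow>
        (\<forall>p\<in>U. cov_deriv_21 D S X Y Z p = 0))"


section \<open>Hermitian manifolds and the Lee form\<close>

definition apply_endo :: "('p, 'i) endo \<Rightarrow> ('p, 'i) field \<Rightarrow> ('p, 'i) field" where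
  "apply_endo J X = (\<lambda>p. J p (X p))"

definition almost_complex :: "('p, 'i) manifold \<Rightarrow> ('p, 'i) endo \<Rightarrow> bool" where
  "almost_complex M J \<longleftrightarrow>
     (\<forall>p\<in>topspace (mtop M). \<forall>u\<in>tangent_space M p.
        J p u \<in> tangent_space M p \<and> J p (J p u) = - u \<and>
        (\<forall>c. J p (tscale c u) = tscale c (J p u)) \<and>
        (\<forall>v\<in>tangent_space M p. J p (u + v) = J p u + J p v)) \<and>
     (\<forall>U X. openin (mtop M) U \<and> vfield M U X \<longrightarrow> vfield M U (apply_endo J X))"

definition nijenhuis ::
  "('p, 'i) manifold \<Rightarrow> ('p, 'i) endo \<Rightarrow> ('p, 'i) field \<Rightarrow> ('p, 'i) field \<Rightarrow> ('p, 'i) field" where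
  "nijenhuis M J X Y =
     bracket M (apply_endo J X) (apply_endo J Y)
     - apply_endo J (bracket M (apply_endo J X) Y)
     - apply_endo J (bracket M X (apply_endo J Y))
     - bracket M X Y"

definition complex_structure :: "('p, 'i) manifold \<Rightarrow> ('p, 'i) endo \<Rightarrow> bool" where
  "complex_structure M J \<longleftrightarrow> almost_complex M J \<and>
     (\<forall>U X Y. openin (mtop M) U \<and> vfield M U X \<and> vfield M U Y \<longrightarrow>
        (\<forall>p\<in>U. nijenhuis M J X Y p = 0))"

definition hermitian_manifold ::
  "('p, 'i) manifold \<Rightarrow> ('p, 'i) endo \<Rightarrow> ('p, 'i) metric \<Rightarrow> bool" where
  "hermitian_manifold M J g \<longleftrightarrow>
     smooth_manifold M \<and> complex_structure M J \<and> riemannian_metric M g \<and>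
     (\<forall>p\<in>topspace (mtop M). \<forall>u\<in>tangent_space M p. \<forall>v\<in>tangent_space M p.
        g p (J p u) (J p v) = g p u v)"

definition fundamental_form ::
  "('p, 'i) endo \<Rightarrow> ('p, 'i) metric \<Rightarrow> ('p, 'i) field \<Rightarrow> ('p, 'i) field \<Rightarrow> 'p \<Rightarrow> real" where
  "fundamental_form J g X Y = (\<lambda>p. g p (J p (X p)) (Y p))"

definition cov_deriv_20 ::
  "('p, 'i) manifold \<Rightarrow> ('p, 'i) conn \<Rightarrow> (('p, 'i) field \<Rightarrow> ('p, 'i) field \<Rightarrow> 'p \<Rightarrow> real) \<Rightarrow>
   ('p, 'i) field \<Rightarrow> ('p, 'i) field \<Rightarrow> ('p, 'i) field \<Rightarrow> 'p \<Rightarrow> real" where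
  "cov_deriv_20 M D w X Y Z =
     (\<lambda>p. dirder M p (X p) (w Y Z) - w (D X Y) Z p - w Y (D X Z) p)"

definition orthonormal_frame ::
  "('p, 'i) manifold \<Rightarrow> ('p, 'i) metric \<Rightarrow> 'p set \<Rightarrow> (nat \<Rightarrow> ('p, 'i) field) \<Rightarrow> bool" where
  "orthonormal_frame M g U E \<longleftrightarrow>
     openin (mtop M) U \<and> (\<forall>a<mdim M. vfield M U (E a)) \<and>
     (\<forall>p\<in>U. \<forall>a<mdim M. \<forall>b<mdim M. g p (E a p) (E b p) = (if a = b then 1 else 0))"

text \<open>
  The value at \<open>p\<close> is computed with some orthonormal frame around \<open>p\<close>. One-forms are represented as
  operators on (locally defined) vector fields.
\<close>

definition codifferential ::
  "('p, 'i) manifold \<Rightarrow> ('p, 'i) metric \<Rightarrow> ('p, 'i) conn \<Rightarrow>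
   (('p, 'i) field \<Rightarrow> ('p, 'i) field \<Rightarrow> 'p \<Rightarrow> real) \<Rightarrow> ('p, 'i) field \<Rightarrow> 'p \<Rightarrow> real" where
  "codifferential M g D w Z p =
     (let E = (SOME E. \<exists>U. p \<in> U \<and> orthonormal_frame M g U E)
      in - (\<Sum>a<mdim M. cov_deriv_20 M D w (E a) (E a) Z p))"

definition lee_form ::
  "('p, 'i) manifold \<Rightarrow> ('p, 'i) endo \<Rightarrow> ('p, 'i) metric \<Rightarrow> ('p, 'i) conn \<Rightarrow>
   ('p, 'i) field \<Rightarrow> 'p \<Rightarrow> real" where
  "lee_form M J g D X p = - codifferential M g D (fundamental_form J g) (apply_endo J X) p"

definition ext_deriv1 ::
  "('p, 'i) manifold \<Rightarrow> (('p, 'i) field \<Rightarrow> 'p \<Rightarrow> real) \<Rightarrow>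
   ('p, 'i) field \<Rightarrow> ('p, 'i) field \<Rightarrow> 'p \<Rightarrow> real" where
  "ext_deriv1 M \<theta> X Y p = dirder M p (X p) (\<theta> Y) - dirder M p (Y p) (\<theta> X) - \<theta> (bracket M X Y) p"

definition closed_1form :: "('p, 'i) manifold \<Rightarrow> (('p, 'i) field \<Rightarrow> 'p \<Rightarrow> real) \<Rightarrow> bool" where
  "closed_1form M \<theta> \<longleftrightarrow>
     (\<forall>U X Y. openin (mtop M) U \<and> vfield M U X \<and> vfield M U Y \<longrightarrow> (\<forall>p\<in>U. ext_deriv1 M \<theta> X Y p = 0))"

definition locally_conformally_balanced ::
  "('p, 'i) manifold \<Rightarrow> ('p, 'i) endo \<Rightarrow> ('p, 'i) metric \<Rightarrow> bool" where
  "locally_conformally_balanced M J g \<longleftrightarrow>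
     hermitian_manifold M J g \<and> (\<exists>D. levi_civita M g D \<and> closed_1form M (lee_form M J g D))"


section \<open>The tangent bundle\<close>

text \<open>
  \<open>Tan p v\<close> is the tangent vector \<open>v\<close> attached to the point \<open>p\<close>. The point type is recursive so that
  all iterated tangent bundles of a manifold live in one type; the type \<open>'a\<close> of the points \<open>Base x\<close>
  is arbitrary, hence so is the underlying set of a manifold with points of this type.
\<close>

datatype ('a, 'i) tpoint = Base 'a | Tan (tbase: "('a, 'i) tpoint") (tfib: "'i \<Rightarrow> nat \<Rightarrow> real")

type_synonym ('a, 'i) tmanifold = "(('a, 'i) tpoint, 'i) manifold"
type_synonym ('a, 'i) tfield = "(('a, 'i) tpoint, 'i) field"
type_synonym ('a, 'i) tconn = "(('a, 'i) tpoint, 'i) conn"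
type_synonym ('a, 'i) tmetric = "(('a, 'i) tpoint, 'i) metric"
type_synonym ('a, 'i) tendo = "(('a, 'i) tpoint, 'i) endo"

definition bundle_over :: "('a, 'i) tmanifold \<Rightarrow> ('a, 'i) tpoint set \<Rightarrow> ('a, 'i) tpoint set" where
  "bundle_over M U = {Tan p v | p v. p \<in> U \<and> v \<in> tangent_space M p}"

text \<open>
  The chart of the tangent bundle induced by chart \<open>i\<close>: the first \<open>mdim M\<close> coordinates are those of
  the base point, the next \<open>mdim M\<close> the components of the vector.
\<close>

definition tcoord :: "('a, 'i) tmanifold \<Rightarrow> 'i \<Rightarrow> ('a, 'i) tpoint \<Rightarrow> nat \<Rightarrow> real" where
  "tcoord M i \<xi> k =
     (if k < mdim M then coord M i (tbase \<xi>) k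
      else if k < 2 * mdim M then tfib \<xi> i (k - mdim M) else 0)"

definition tangent_bundle :: "('a, 'i) tmanifold \<Rightarrow> ('a, 'i) tmanifold" where
  "tangent_bundle M =
     \<lparr> mtop = topology_generated_by
         {{\<xi> \<in> bundle_over M (cdom M i). tcoord M i \<xi> \<in> V} | i V.
            i \<in> charts M \<and> openin (Euclidean_space (2 * mdim M)) V},
       mdim = 2 * mdim M,
       charts = charts M,
       cdom = (\<lambda>i. bundle_over M (cdom M i)),
       coord = tcoord M \<rparr>"

definition christoffel ::
  "('p, 'i) manifold \<Rightarrow> ('p, 'i) conn \<Rightarrow> 'i \<Rightarrow> nat \<Rightarrow> nat \<Rightarrow> nat \<Rightarrow> 'p \<Rightarrow> real" where
  "christoffel M nab i a b k p = nab (coord_field M i a) (coord_field M i b) p i k"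

text \<open>
  Components with respect to \<open>tcoord\<close>: the vertical lift of \<open>u\<close> at \<open>Tan p v\<close> is \<open>(0, u)\<close>, the
  horizontal lift is \<open>(u, - \<Gamma>(u, v))\<close>.
\<close>

definition vert_at :: "('a, 'i) tmanifold \<Rightarrow> ('a, 'i) tpoint \<Rightarrow> 'i tvec \<Rightarrow> 'i tvec" where
  "vert_at M \<xi> u = (\<lambda>i k.
     if i \<in> charts_at M (tbase \<xi>) \<and> mdim M \<le> k \<and> k < 2 * mdim M then u i (k - mdim M) else 0)"

definition gamma_at ::
  "('a, 'i) tmanifold \<Rightarrow> ('a, 'i) tconn \<Rightarrow> 'i \<Rightarrow> ('a, 'i) tpoint \<Rightarrow> 'i tvec \<Rightarrow> 'i tvec \<Rightarrow> nat \<Rightarrow> real" where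
  "gamma_at M nab i p u v k =
     (\<Sum>a<mdim M. \<Sum>b<mdim M. christoffel M nab i a b k p * u i a * v i b)"

definition hor_at ::
  "('a, 'i) tmanifold \<Rightarrow> ('a, 'i) tconn \<Rightarrow> ('a, 'i) tpoint \<Rightarrow> 'i tvec \<Rightarrow> 'i tvec" where
  "hor_at M nab \<xi> u = (\<lambda>i k.
     if i \<in> charts_at M (tbase \<xi>) \<and> k < mdim M then u i k
     else if i \<in> charts_at M (tbase \<xi>) \<and> k < 2 * mdim M
       then - gamma_at M nab i (tbase \<xi>) u (tfib \<xi>) (k - mdim M)
     else 0)"

definition vert_lift :: "('a, 'i) tmanifold \<Rightarrow> ('a, 'i) tfield \<Rightarrow> ('a, 'i) tfield" where
  "vert_lift M X = (\<lambda>\<xi>. vert_at M \<xi> (X (tbase \<xi>)))"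

definition hor_lift ::
  "('a, 'i) tmanifold \<Rightarrow> ('a, 'i) tconn \<Rightarrow> ('a, 'i) tfield \<Rightarrow> ('a, 'i) tfield" where
  "hor_lift M nab X = (\<lambda>\<xi>. hor_at M nab \<xi> (X (tbase \<xi>)))"

text \<open>
  A tangent vector \<open>w\<close> of the bundle at \<open>\<xi>\<close> is the sum of the horizontal lift of \<open>hor_part\<close> (its
  image under the differential of the projection) and the vertical lift of \<open>vert_part\<close> (its image
  under the connector).
\<close>

definition hor_part :: "('a, 'i) tmanifold \<Rightarrow> 'i tvec \<Rightarrow> 'i tvec" where
  "hor_part M w = (\<lambda>i k. if k < mdim M then w i k else 0)"

definition vert_part ::
  "('a, 'i) tmanifold \<Rightarrow> ('a, 'i) tconn \<Rightarrow> ('a, 'i) tpoint \<Rightarrow> 'i tvec \<Rightarrow> 'i tvec" where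
  "vert_part M nab \<xi> w = (\<lambda>i k.
     if i \<in> charts_at M (tbase \<xi>) \<and> k < mdim M
     then w i (mdim M + k) + gamma_at M nab i (tbase \<xi>) (hor_part M w) (tfib \<xi>) k else 0)"


section \<open>The canonical sequence\<close>

text \<open>
  The complex structure and the metric are the (bi)linear extensions of their values on horizontal
  and vertical lifts, via the decomposition \<open>w = hor_at (hor_part w) + vert_at (vert_part w)\<close>; see
  the lemmas below. The connection is the one determined by its values on lifts: lifts of local
  fields span every tangent space of the bundle, so any two connections satisfying the four
  equations agree on all smooth vector fields.
\<close>

definition lift_J :: "('a, 'i) tmanifold \<Rightarrow> ('a, 'i) tconn \<Rightarrow> ('a, 'i) tendo" where
  "lift_J M nab \<xi> w = vert_at M \<xi> (hor_part M w) - hor_at M nab \<xi> (vert_part M nab \<xi> w)"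

definition lift_metric ::
  "('a, 'i) tmanifold \<Rightarrow> ('a, 'i) tconn \<Rightarrow> ('a, 'i) tmetric \<Rightarrow> ('a, 'i) tmetric" where
  "lift_metric M nab g \<xi> w w' =
     g (tbase \<xi>) (hor_part M w) (hor_part M w')
     + g (tbase \<xi>) (vert_part M nab \<xi> w) (vert_part M nab \<xi> w')"

definition canonical_conn ::
  "('a, 'i) tmanifold \<Rightarrow> ('a, 'i) tconn \<Rightarrow> ('a, 'i) tconn \<Rightarrow> bool" where
  "canonical_conn M nab nab1 \<longleftrightarrow>
     connection (tangent_bundle M) nab1 \<and>
     (\<forall>U X Y. openin (mtop M) U \<and> vfield M U X \<and> vfield M U Y \<longrightarrow>
        (\<forall>\<xi>\<in>bundle_over M U.
           nab1 (hor_lift M nab X) (hor_lift M nab Y) \<xi> = hor_lift M nab (nab X Y) \<xi> \<and>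
           nab1 (hor_lift M nab X) (vert_lift M Y) \<xi> = vert_lift M (nab X Y) \<xi> \<and>
           nab1 (vert_lift M X) (hor_lift M nab Y) \<xi> = 0 \<and>
           nab1 (vert_lift M X) (vert_lift M Y) \<xi> = 0))"

definition lift_conn :: "('a, 'i) tmanifold \<Rightarrow> ('a, 'i) tconn \<Rightarrow> ('a, 'i) tconn" where
  "lift_conn M nab = (SOME nab1. canonical_conn M nab nab1)"

primrec iter_tangent :: "('a, 'i) tmanifold \<Rightarrow> nat \<Rightarrow> ('a, 'i) tmanifold" where
  "iter_tangent M 0 = M"
| "iter_tangent M (Suc k) = tangent_bundle (iter_tangent M k)"

primrec iter_conn :: "('a, 'i) tmanifold \<Rightarrow> ('a, 'i) tconn \<Rightarrow> nat \<Rightarrow> ('a, 'i) tconn" where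
  "iter_conn M nab 0 = nab"
| "iter_conn M nab (Suc k) = lift_conn (iter_tangent M k) (iter_conn M nab k)"

primrec iter_metric ::
  "('a, 'i) tmanifold \<Rightarrow> ('a, 'i) tconn \<Rightarrow> ('a, 'i) tmetric \<Rightarrow> nat \<Rightarrow> ('a, 'i) tmetric" where
  "iter_metric M nab g 0 = g"
| "iter_metric M nab g (Suc k) =
     lift_metric (iter_tangent M k) (iter_conn M nab k) (iter_metric M nab g k)"

text \<open>Only meaningful for \<open>k \<ge> 1\<close>.\<close>

definition iter_J :: "('a, 'i) tmanifold \<Rightarrow> ('a, 'i) tconn \<Rightarrow> nat \<Rightarrow> ('a, 'i) tendo" where
  "iter_J M nab k = lift_J (iter_tangent M (k - 1)) (iter_conn M nab (k - 1))"


subsection \<open>The defining equations on lifts\<close>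

lemma tangent_space_zero: "0 \<in> tangent_space M p"
  by (simp add: tangent_space_def)

lemma hor_vert_decomposition:
  assumes "\<And>i. i \<notin> charts_at M (tbase \<xi>) \<Longrightarrow> w i = 0" "\<And>i k. k \<ge> 2 * mdim M \<Longrightarrow> w i k = 0"
  shows "w = hor_at M nab \<xi> (hor_part M w) + vert_at M \<xi> (vert_part M nab \<xi> w)"
  using assms by (auto simp: fun_eq_iff hor_at_def vert_at_def hor_part_def vert_part_def)

lemma parts_hor_at:
  assumes "u \<in> tangent_space M (tbase \<xi>)"
  shows "hor_part M (hor_at M nab \<xi> u) = u" "vert_part M nab \<xi> (hor_at M nab \<xi> u) = 0"
proof -
  show *: "hor_part M (hor_at M nab \<xi> u) = u"
    using assms by (auto simp: fun_eq_iff hor_part_def hor_at_def tangent_space_def)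
  show "vert_part M nab \<xi> (hor_at M nab \<xi> u) = 0"
    unfolding vert_part_def * by (auto simp: fun_eq_iff hor_at_def)
qed

lemma parts_vert_at:
  assumes "u \<in> tangent_space M (tbase \<xi>)"
  shows "hor_part M (vert_at M \<xi> u) = 0" "vert_part M nab \<xi> (vert_at M \<xi> u) = u"
proof -
  show *: "hor_part M (vert_at M \<xi> u) = 0"
    by (auto simp: fun_eq_iff hor_part_def vert_at_def)
  show "vert_part M nab \<xi> (vert_at M \<xi> u) = u"
    unfolding vert_part_def * using assms
    by (auto simp: fun_eq_iff vert_at_def gamma_at_def tangent_space_def)
qed

lemma lift_J_lifts:
  assumes "X (tbase \<xi>) \<in> tangent_space M (tbase \<xi>)"
  shows "lift_J M nab \<xi> (hor_lift M nab X \<xi>) = vert_lift M X \<xi>"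
    and "lift_J M nab \<xi> (vert_lift M X \<xi>) = - hor_lift M nab X \<xi>"
  unfolding lift_J_def hor_lift_def vert_lift_def parts_hor_at[OF assms] parts_vert_at[OF assms]
  by (auto simp: fun_eq_iff hor_at_def vert_at_def gamma_at_def)

lemma lift_metric_lifts:
  fixes M :: "('a, 'i) tmanifold"
  assumes "riemannian_metric M g" "tbase \<xi> \<in> topspace (mtop M)"
    and X: "X (tbase \<xi>) \<in> tangent_space M (tbase \<xi>)"
    and Y: "Y (tbase \<xi>) \<in> tangent_space M (tbase \<xi>)"
  shows "lift_metric M nab g \<xi> (hor_lift M nab X \<xi>) (hor_lift M nab Y \<xi>)
           = g (tbase \<xi>) (X (tbase \<xi>)) (Y (tbase \<xi>))"
    and "lift_metric M nab g \<xi> (vert_lift M X \<xi>) (vert_lift M Y \<xi>)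
           = g (tbase \<xi>) (X (tbase \<xi>)) (Y (tbase \<xi>))"
    and "lift_metric M nab g \<xi> (hor_lift M nab X \<xi>) (vert_lift M Y \<xi>) = 0"
proof -
  have z: "g (tbase \<xi>) 0 v = 0" "g (tbase \<xi>) v 0 = 0" if v: "v \<in> tangent_space M (tbase \<xi>)" for v
  proof -
    note g = conjunct1[OF assms(1)[unfolded riemannian_metric_def], THEN bspec, OF assms(2),
        THEN bspec, OF tangent_space_zero, THEN conjunct2, THEN bspec, OF v]
    have "g (tbase \<xi>) (tscale 0 0) v = 0"
      using g[THEN conjunct2, THEN conjunct1, THEN spec, of 0] by simp
    moreover have "tscale 0 0 = (0 :: 'i tvec)"
      by (simp add: fun_eq_iff tscale_def)
    ultimately show "g (tbase \<xi>) 0 v = 0" by simp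
    with g[THEN conjunct1] show "g (tbase \<xi>) v 0 = 0" by simp
  qed
  show "lift_metric M nab g \<xi> (hor_lift M nab X \<xi>) (hor_lift M nab Y \<xi>)
           = g (tbase \<xi>) (X (tbase \<xi>)) (Y (tbase \<xi>))"
    "lift_metric M nab g \<xi> (vert_lift M X \<xi>) (vert_lift M Y \<xi>)
           = g (tbase \<xi>) (X (tbase \<xi>)) (Y (tbase \<xi>))"
    "lift_metric M nab g \<xi> (hor_lift M nab X \<xi>) (vert_lift M Y \<xi>) = 0"
    unfolding lift_metric_def hor_lift_def vert_lift_def
      parts_hor_at[OF X] parts_vert_at[OF X] parts_hor_at[OF Y] parts_vert_at[OF Y]
    by (simp_all add: z[OF X] z[OF Y] z[OF tangent_space_zero])
qed

end

theory Submission
  imports Defs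
begin

text \<open>
  Let \<open>C = \<nabla>g\<close>. Since \<open>D = \<nabla> + \<gamma>\<close> with
  \<open>2 g(\<gamma>\<^sub>u v, w) = C(u, v, w) + C(v, u, w) - C(w, u, v)\<close>, everything is governed by two traces of
  \<open>C\<close> over orthonormal bases \<open>e\<close>: \<open>\<alpha>(u) = 1/2 \<Sum> C(u, e, e)\<close> and \<open>\<beta>(u) = \<Sum> C(e, e, u)\<close>.
  If a Hermitian structure \<open>J\<close> is \<open>\<nabla>\<close>-parallel, as \<open>J\<^sub>k\<close> is for \<open>\<nabla>\<^sup>k\<close>, its Lee form is
  \<open>\<alpha> - \<beta>\<close>. On the tangent bundle, \<open>C\<^sub>1(u, v, w) = C(hu, hv, hw) + C(hu, vv, vw)\<close> with
  \<open>h\<close> and \<open>v\<close> the horizontal and vertical parts, whence \<open>\<alpha>\<^sub>1 = 2 \<pi>\<^sup>*\<alpha>\<close> and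
  \<open>\<beta>\<^sub>1 = \<pi>\<^sup>*\<beta>\<close>; so closedness of \<open>\<alpha>\<close> and \<open>\<beta>\<close> propagates through the canonical sequence.
  On \<open>M\<close> itself \<open>D\<gamma> = 0\<close> makes \<open>C\<close>, \<open>\<alpha>\<close> and \<open>\<beta>\<close> parallel for \<open>D\<close>, hence closed.
\<close>

section \<open>Calculus with finitely many partial derivatives\<close>

text \<open>The charts of \<open>M\<close> are arbitrary, not affine, so \<nabla> enters through its
  Christoffel symbols and \<open>C\<close> through the derivatives of the metric components. Three
  existence questions shape the work. \<open>lift_conn\<close> is a choice among connections with
  prescribed values on lifts, so such a connection must exist and be unique on smooth fields; the
  witness differentiates horizontal and vertical parts by the pullback of \<nabla>. The Levi-Civita
  connection of the lifted metric must be constructed, as \<nabla> + \<gamma>. The codifferential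
  chooses a local orthonormal frame, so frames must exist and traces must not depend on them. The
  factor 2 in front of \<alpha> comes from the orthonormal basis of horizontal and vertical lifts:
  both halves contribute the same trace to \<alpha>, while the vertical half drops out of \<beta>,
  since the lifted \<open>C\<close> vanishes on a vertical first argument. Flatness of \<nabla>
  makes the lifted connection torsionless, which in turn makes the parallel \<open>J\<close>
  integrable. Only closedness of \<alpha> and \<beta> is handed from level to level; the parallel
  difference tensor acts on \<open>M\<close> alone.\<close>

lemma Euclidean_space_eq_top_of_set: "Euclidean_space n = top_of_set {x. \<forall>i\<ge>n. x i = 0}"
  by (simp add: Euclidean_space_def euclidean_product_topology)

lemma openin_Euclidean_spaceD: "openin (Euclidean_space n) U \<Longrightarrow> x \<in> U \<Longrightarrow> i \<ge> n \<Longrightarrow> x i = 0"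
  using openin_subset[of "Euclidean_space n" U] by (auto simp: topspace_Euclidean_space)

text \<open>A product neighbourhood has one factor for every natural number, but points of the space
  vary in the first \<open>n\<close> coordinates only. So finitely many radii matter, and their
  minimum is positive.\<close>

lemma openin_Euclidean_space_box:
  assumes "openin (Euclidean_space n) U" "x \<in> U"
  obtains d where "d > 0"
    "\<And>y. (\<And>i. i \<ge> n \<Longrightarrow> y i = 0) \<Longrightarrow> (\<And>i. i < n \<Longrightarrow> \<bar>y i - x i\<bar> < d) \<Longrightarrow> y \<in> U"
proof -
  obtain T where T: "open T" "U = {x. \<forall>i\<ge>n. x i = 0} \<inter> T"
    using assms(1) by (auto simp: Euclidean_space_eq_top_of_set openin_open)
  with assms(2) have "openin (product_topology (\<lambda>i::nat. euclidean :: real topology) UNIV) T" "x \<in> T"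
    by (auto simp: euclidean_product_topology)
  then obtain X where X: "x \<in> Pi\<^sub>E UNIV X" "\<And>i. open (X i)" "Pi\<^sub>E UNIV X \<subseteq> T"
    using product_topology_open_contains_basis[of "\<lambda>i. euclidean" UNIV T x] by (metis open_openin)
  have "\<exists>e>0. ball (x i) e \<subseteq> X i" for i
    using X(1,2) by (metis PiE_mem UNIV_I open_contains_ball)
  then obtain e where e: "\<And>i. e i > 0" "\<And>i. ball (x i) (e i) \<subseteq> X i" by metis
  \<comment> \<open>The 1 keeps the set nonempty when \<open>n = 0\<close>.\<close>
  let ?d = "Min (insert 1 (e ` {..<n}))"
  show ?thesis
  proof (rule that)
    show "?d > 0" using e(1) by (subst Min_gr_iff) auto
    fix y assume y: "\<And>i. i \<ge> n \<Longrightarrow> y i = 0" "\<And>i. i < n \<Longrightarrow> \<bar>y i - x i\<bar> < ?d"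
    have "y i \<in> X i" for i
    proof (cases "i < n")
      case True
      then have "?d \<le> e i" by (intro Min_le) auto
      with y(2)[OF True] have "\<bar>y i - x i\<bar> < e i" by (rule less_le_trans)
      then have "y i \<in> ball (x i) (e i)" by (auto simp: dist_real_def abs_minus_commute)
      with e(2) show ?thesis by blast
    next
      case False
      with y(1) assms T(2) have "y i = x i" by auto
      with X(1) show ?thesis by auto
    qed
    with X(3) have "y \<in> T" by auto
    with y(1) T(2) show "y \<in> U" by auto
  qed
qed

lemma openin_Euclidean_space_boxI:
  assumes "U \<subseteq> {x. \<forall>i\<ge>n. x i = 0}"
    "\<And>x. x \<in> U \<Longrightarrow> \<exists>d>0. \<forall>y. (\<forall>i\<ge>n. y i = 0) \<and> (\<forall>i<n. \<bar>y i - x i\<bar> < d) \<longrightarrow> y \<in> U"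
  shows "openin (Euclidean_space n) U"
proof (subst openin_subopen, intro ballI)
  fix x assume x: "x \<in> U"
  then obtain d where d: "d > 0" "\<forall>y. (\<forall>i\<ge>n. y i = 0) \<and> (\<forall>i<n. \<bar>y i - x i\<bar> < d) \<longrightarrow> y \<in> U"
    using assms(2) by blast
  have "open {f::nat\<Rightarrow>real. \<forall>i\<in>{..<n}. f (id i) \<in> ball (x i) d}"
    by (rule product_topology_basis') auto
  then have "openin (Euclidean_space n) ({x. \<forall>i\<ge>n. x i = 0} \<inter> {f. \<forall>i\<in>{..<n}. f (id i) \<in> ball (x i) d})"
    by (auto simp: Euclidean_space_eq_top_of_set openin_open)
  moreover have "x \<in> {x. \<forall>i\<ge>n. x i = 0} \<inter> {f. \<forall>i\<in>{..<n}. f (id i) \<in> ball (x i) d}"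
    using x assms(1) d(1) by auto
  moreover have "{x. \<forall>i\<ge>n. x i = 0} \<inter> {f. \<forall>i\<in>{..<n}. f (id i) \<in> ball (x i) d} \<subseteq> U"
    using d(2) by (auto simp: dist_real_def abs_minus_commute)
  ultimately show "\<exists>T. openin (Euclidean_space n) T \<and> x \<in> T \<and> T \<subseteq> U" by blast
qed

lemma continuous_map_Euclidean_subspace:
  assumes "openin (Euclidean_space n) U"
  shows "continuous_map (subtopology (Euclidean_space n) U) euclideanreal f \<longleftrightarrow> continuous_on U f"
proof -
  have "U \<subseteq> {x. \<forall>i\<ge>n. x i = 0}"
    using openin_subset[OF assms] by (simp add: topspace_Euclidean_space)
  then have "{x. \<forall>i\<ge>n. x i = 0} \<inter> U = U" by blast
  then have "subtopology (Euclidean_space n) U = top_of_set U"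
    by (simp add: Euclidean_space_eq_top_of_set subtopology_subtopology)
  then show ?thesis by simp
qed

lemma continuous_on_box:
  assumes "openin (Euclidean_space n) U" "continuous_on U f" "x \<in> U" "(e::real) > 0"
  obtains d where "d > 0"
    "\<And>y. (\<And>i. i \<ge> n \<Longrightarrow> y i = 0) \<Longrightarrow> (\<And>i. i < n \<Longrightarrow> \<bar>y i - x i\<bar> < d) \<Longrightarrow> y \<in> U \<and> \<bar>f y - f x\<bar> < e"
proof -
  have "openin (top_of_set U) (U \<inter> f -` ball (f x) e)"
    using assms(2) by (simp add: continuous_openin_preimage_gen)
  moreover have "top_of_set U = subtopology (Euclidean_space n) U"
    using openin_subset[OF assms(1)]
    by (simp add: topspace_Euclidean_space Euclidean_space_eq_top_of_set subtopology_subtopology Int_absorb1)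
  ultimately have "openin (Euclidean_space n) (U \<inter> f -` ball (f x) e)"
    using assms(1) openin_trans_full by metis
  moreover have "x \<in> U \<inter> f -` ball (f x) e" using assms by auto
  ultimately obtain d where "d > 0" "\<And>y. (\<And>i. i \<ge> n \<Longrightarrow> y i = 0) \<Longrightarrow>
      (\<And>i. i < n \<Longrightarrow> \<bar>y i - x i\<bar> < d) \<Longrightarrow> y \<in> U \<inter> f -` ball (f x) e"
    using openin_Euclidean_space_box by (metis (no_types, lifting))
  then show ?thesis using that[of d] by (auto simp: dist_real_def abs_minus_commute)
qed

text \<open>A short piece of every coordinate line through a point of an open set stays in that set.
  This is what makes partial derivatives depend only on the values of a function on
  \<open>U\<close>.\<close>

lemma eventually_fun_upd_in:
  assumes "openin (Euclidean_space n) U" "x \<in> U" "a < n"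
  shows "\<forall>\<^sub>F t in nhds (x a). x(a := t) \<in> U"
proof -
  obtain d where d: "d > 0" "\<And>y. (\<And>i. i \<ge> n \<Longrightarrow> y i = 0) \<Longrightarrow> (\<And>i. i < n \<Longrightarrow> \<bar>y i - x i\<bar> < d) \<Longrightarrow> y \<in> U"
    using openin_Euclidean_space_box[OF assms(1,2)] by metis
  have "\<forall>\<^sub>F t in nhds (x a). dist t (x a) < d"
    using d(1) by (auto simp: eventually_nhds_metric)
  then show ?thesis
  proof eventually_elim
    case (elim t)
    then show ?case
      using openin_Euclidean_spaceD[OF assms(1,2)] assms(3) d(1)
      by (intro d(2)) (auto simp: dist_real_def)
  qed
qed

section \<open>Partial derivatives and functions of class C^k on open sets\<close>

lemma pderiv_at_cong:
  assumes "openin (Euclidean_space n) U" "x \<in> U" "a < n" "\<And>y. y \<in> U \<Longrightarrow> f y = g y"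
  shows "pderiv_at a f x = pderiv_at a g x"
  unfolding pderiv_at_def
  by (intro deriv_cong_ev eventually_mono[OF eventually_fun_upd_in[OF assms(1-3)]]) (auto intro: assms(4))

lemma partial_differentiable_cong:
  fixes f g :: "(nat \<Rightarrow> real) \<Rightarrow> real"
  assumes "openin (Euclidean_space n) U" "x \<in> U" "a < n" "\<And>y. y \<in> U \<Longrightarrow> f y = g y"
    "(\<lambda>t. f (x(a := t))) differentiable (at (x a))"
  shows "(\<lambda>t. g (x(a := t))) differentiable (at (x a))"
proof -
  have ev: "\<forall>\<^sub>F t in nhds (x a). f (x(a := t)) = g (x(a := t))"
    by (intro eventually_mono[OF eventually_fun_upd_in[OF assms(1-3)]]) (auto intro: assms(4))
  obtain D where "((\<lambda>t. f (x(a := t))) has_real_derivative D) (at (x a))"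
    using assms(5) by (auto simp: real_differentiable_def)
  then have "((\<lambda>t. g (x(a := t))) has_real_derivative D) (at (x a))"
    using DERIV_cong_ev[OF refl ev refl] by blast
  then show ?thesis by (auto simp: real_differentiable_def)
qed

lemma Ck_on_continuous:
  assumes "openin (Euclidean_space n) U" "Ck_on n k U f"
  shows "continuous_on U f"
  using assms(2) by (cases k) (auto simp: continuous_map_Euclidean_subspace[OF assms(1)])

lemma Ck_on_cong:
  assumes "openin (Euclidean_space n) U" "\<And>y. y \<in> U \<Longrightarrow> f y = g y" "Ck_on n k U f"
  shows "Ck_on n k U g"
  using assms(2,3)
proof (induction k arbitrary: f g)
  case 0
  then show ?case by (auto simp: continuous_map_Euclidean_subspace[OF assms(1)] cong: continuous_on_cong)
next
  case (Suc k)
  have "continuous_on U f" using Suc.prems(2) Ck_on_continuous[OF assms(1)] by blast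
  then have "continuous_on U g" using Suc.prems(1) by (simp cong: continuous_on_cong)
  moreover have "Ck_on n k U (pderiv_at a g)" if "a < n" for a
  proof (rule Suc.IH)
    show "Ck_on n k U (pderiv_at a f)" using Suc.prems(2) that by simp
    show "\<And>y. y \<in> U \<Longrightarrow> pderiv_at a f y = pderiv_at a g y"
      using pderiv_at_cong[OF assms(1) _ that] Suc.prems(1) by blast
  qed
  ultimately show ?case
    using Suc.prems partial_differentiable_cong[OF assms(1)]
    by (auto simp: continuous_map_Euclidean_subspace[OF assms(1)]) blast
qed

lemma Ck_on_subset:
  assumes "V \<subseteq> U" "Ck_on n k U f"
  shows "Ck_on n k V f"
  using assms(2)
  by (induction k arbitrary: f)
     (use assms(1) in \<open>auto intro: continuous_map_from_subtopology_mono\<close>)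

lemma Ck_on_Suc_D:
  assumes "Ck_on n (Suc k) U f"
  shows "Ck_on n k U f"
  using assms by (induction k arbitrary: f) auto

lemma Ck_on_local:
  assumes "openin (Euclidean_space n) U"
    "\<And>x. x \<in> U \<Longrightarrow> \<exists>V. openin (Euclidean_space n) V \<and> x \<in> V \<and> Ck_on n k V f"
  shows "Ck_on n k U f"
  using assms(2)
proof (induction k arbitrary: f)
  have c: "continuous_on U f"
    if "\<And>x. x \<in> U \<Longrightarrow> \<exists>V. openin (Euclidean_space n) V \<and> x \<in> V \<and> Ck_on n k V f" for k f
  proof -
    have "\<forall>x\<in>U. \<exists>V. openin (Euclidean_space n) V \<and> x \<in> V \<and> continuous_on V f"
      using that Ck_on_continuous by metis
    then obtain V where V: "\<And>x. x \<in> U \<Longrightarrow> openin (Euclidean_space n) (V x) \<and> x \<in> V x \<and> continuous_on (V x) f"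
      by metis
    show ?thesis
      unfolding continuous_on_eq_continuous_within
    proof
      fix x assume x: "x \<in> U"
      obtain T where T: "open T" "V x = {x. \<forall>i\<ge>n. x i = 0} \<inter> T"
        using V[OF x] by (auto simp: Euclidean_space_eq_top_of_set openin_open)
      have "continuous (at x within V x) f"
        using V[OF x] by (auto simp: continuous_on_eq_continuous_within)
      then have "continuous (at x within (U \<inter> T)) f"
        by (rule continuous_within_subset) (use T openin_Euclidean_spaceD[OF assms(1)] in auto)
      moreover have "at x within (U \<inter> T) = at x within U"
        by (rule at_within_nhd[of _ T]) (use T V[OF x] in auto)
      ultimately show "continuous (at x within U) f" by simp
    qed
  qed
  { case 0
    show ?case using c[OF 0] by (simp add: continuous_map_Euclidean_subspace[OF assms(1)]) }
  { case (Suc k)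
    have "Ck_on n k U (pderiv_at a f)" if "a < n" for a
      using Suc.prems that by (intro Suc.IH) fastforce
    moreover have "(\<lambda>t. f (x(a := t))) differentiable (at (x a))" if "a < n" "x \<in> U" for a x
      using Suc.prems[OF that(2)] that(1) by auto
    ultimately show ?case
      using c[OF Suc.prems] by (simp add: continuous_map_Euclidean_subspace[OF assms(1)]) }
qed

lemma Ck_on_const:
  assumes "openin (Euclidean_space n) U"
  shows "Ck_on n k U (\<lambda>x. c)"
proof (induction k arbitrary: c)
  case (Suc k)
  have "pderiv_at a (\<lambda>x. c) = (\<lambda>x. 0)" for a by (auto simp: pderiv_at_def)
  with Suc show ?case by simp
qed simp

lemma Ck_on_partial:
  assumes "Ck_on n (Suc k) U f" "x \<in> U" "a < n"
  shows "((\<lambda>t. f (x(a := t))) has_real_derivative pderiv_at a f x) (at (x a))"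
  using assms unfolding pderiv_at_def DERIV_deriv_iff_real_differentiable by simp

lemma partialI:
  assumes "((\<lambda>t. f (x(a := t))) has_real_derivative D) (at (x a))"
  shows "(\<lambda>t. f (x(a := t))) differentiable (at (x a))" "pderiv_at a f x = D"
  using assms by (auto simp: pderiv_at_def real_differentiable_def intro: DERIV_imp_deriv)

text \<open>The introduction rule for differentiation formulas: \<open>f'\<close> has to give the
  partial derivatives on \<open>U\<close> only, whereas \<open>Ck_on\<close> speaks of the total
  function \<open>pderiv_at a f\<close>; congruence on open sets bridges the gap.\<close>

lemma Ck_on_SucI:
  assumes U: "openin (Euclidean_space n) U" and "continuous_on U f"
    and "\<And>a x. a < n \<Longrightarrow> x \<in> U \<Longrightarrow> ((\<lambda>t. f (x(a := t))) has_real_derivative f' a x) (at (x a))"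
    and "\<And>a. a < n \<Longrightarrow> Ck_on n k U (f' a)"
  shows "Ck_on n (Suc k) U f"
proof -
  have p: "(\<lambda>t. f (x(a := t))) differentiable (at (x a))" "pderiv_at a f x = f' a x"
    if "a < n" "x \<in> U" for a x
    by (rule partialI, rule assms(3)[OF that])+
  then have "Ck_on n k U (pderiv_at a f)" if "a < n" for a
    using that by (intro Ck_on_cong[OF U _ assms(4)[OF that]]) auto
  then show ?thesis
    using assms(2) p(1) by (auto simp: continuous_map_Euclidean_subspace[OF U])
qed

lemma Ck_on_coordinate:
  assumes U: "openin (Euclidean_space n) U"
  shows "Ck_on n k U (\<lambda>x. x b)"
proof -
  have c: "continuous_on U (\<lambda>x. x b)"
    by (rule continuous_on_subset[OF continuous_on_product_coordinates]) auto
  show ?thesis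
  proof (cases k)
    case 0 with c show ?thesis by (simp add: continuous_map_Euclidean_subspace[OF U])
  next
    case (Suc l)
    have "Ck_on n (Suc l) U (\<lambda>x. x b)"
    proof (rule Ck_on_SucI[OF U c])
      show "((\<lambda>t. (x(a := t)) b) has_real_derivative (if a = b then 1 else 0)) (at (x a))" for a x
        by auto
    qed (auto intro: Ck_on_const[OF U])
    with Suc show ?thesis by simp
  qed
qed

lemma Ck_on_add:
  assumes U: "openin (Euclidean_space n) U" and "Ck_on n k U f" "Ck_on n k U g"
  shows "Ck_on n k U (\<lambda>x. f x + g x)"
  using assms(2,3)
proof (induction k arbitrary: f g)
  case 0
  then show ?case by (auto simp: continuous_map_Euclidean_subspace[OF U] intro: continuous_intros)
next
  case (Suc k)
  show ?case
  proof (rule Ck_on_SucI[OF U])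
    show "continuous_on U (\<lambda>x. f x + g x)"
      using Suc.prems Ck_on_continuous[OF U] by (blast intro: continuous_intros)
    show "((\<lambda>t. f (x(a := t)) + g (x(a := t))) has_real_derivative pderiv_at a f x + pderiv_at a g x) (at (x a))"
      if "a < n" "x \<in> U" for a x
      using Ck_on_partial[OF Suc.prems(1) that(2,1)] Ck_on_partial[OF Suc.prems(2) that(2,1)] by (rule DERIV_add)
    show "Ck_on n k U (\<lambda>x. pderiv_at a f x + pderiv_at a g x)" if "a < n" for a
      using Suc.prems that by (intro Suc.IH) auto
  qed
qed

lemma Ck_on_mult:
  assumes U: "openin (Euclidean_space n) U" and "Ck_on n k U f" "Ck_on n k U g"
  shows "Ck_on n k U (\<lambda>x. f x * g x)"
  using assms(2,3)
proof (induction k arbitrary: f g)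
  case 0
  then show ?case by (auto simp: continuous_map_Euclidean_subspace[OF U] intro: continuous_intros)
next
  case (Suc k)
  show ?case
  proof (rule Ck_on_SucI[OF U])
    show "continuous_on U (\<lambda>x. f x * g x)"
      using Suc.prems Ck_on_continuous[OF U] by (blast intro: continuous_intros)
    show "((\<lambda>t. f (x(a := t)) * g (x(a := t))) has_real_derivative pderiv_at a f x * g x + pderiv_at a g x * f x) (at (x a))"
      if "a < n" "x \<in> U" for a x
      by (rule DERIV_cong[OF DERIV_mult[OF Ck_on_partial[OF Suc.prems(1) that(2,1)]
              Ck_on_partial[OF Suc.prems(2) that(2,1)]]]) simp
    show "Ck_on n k U (\<lambda>x. pderiv_at a f x * g x + pderiv_at a g x * f x)" if "a < n" for a
      using Suc.prems that Ck_on_Suc_D[OF Suc.prems(1)] Ck_on_Suc_D[OF Suc.prems(2)]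
      by (intro Ck_on_add[OF U] Suc.IH) auto
  qed
qed

lemma Ck_on_sum:
  assumes U: "openin (Euclidean_space n) U" and "\<And>a. a \<in> A \<Longrightarrow> Ck_on n k U (f a)"
  shows "Ck_on n k U (\<lambda>x. \<Sum>a\<in>A. f a x)"
  using assms(2) by (induction A rule: infinite_finite_induct) (auto intro: Ck_on_add[OF U] Ck_on_const[OF U])

text \<open>Needed to normalise vectors in the Gram-Schmidt process. Each partial derivative is a
  polynomial in the one of \<open>f\<close> and in \<open>1 / sqrt (f x)\<close> itself, namely -1/2
  times the former times the cube of the latter, so the induction closes with the product rule
  alone.\<close>

lemma Ck_on_inverse_sqrt:
  assumes U: "openin (Euclidean_space n) U" and "Ck_on n k U f" and pos: "\<And>x. x \<in> U \<Longrightarrow> f x > 0"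
  shows "Ck_on n k U (\<lambda>x. 1 / sqrt (f x))"
  using assms(2)
proof (induction k)
  have c: "continuous_on U (\<lambda>x. 1 / sqrt (f x))" if "Ck_on n k U f" for k
    using Ck_on_continuous[OF U that] pos by (force intro!: continuous_intros)
  { case 0 then show ?case using c[OF 0] by (auto simp: continuous_map_Euclidean_subspace[OF U]) }
  { case (Suc k)
    let ?r = "\<lambda>x. 1 / sqrt (f x)"
    show ?case
    proof (rule Ck_on_SucI[OF U c[OF Suc.prems]])
      show "((\<lambda>t. 1 / sqrt (f (x(a := t)))) has_real_derivative (- 1 / 2) * pderiv_at a f x * (?r x * (?r x * ?r x))) (at (x a))"
        if "a < n" "x \<in> U" for a x
      proof -
        have "((\<lambda>y. 1 / sqrt y) has_real_derivative (- 1 / 2) * (?r x * (?r x * ?r x))) (at (f (x(a := x a))))"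
          using pos[OF that(2)] by (auto intro!: derivative_eq_intros simp: field_simps)
        from DERIV_chain2[OF this Ck_on_partial[OF Suc.prems that(2,1)]]
        show ?thesis by (rule DERIV_cong) simp
      qed
      show "Ck_on n k U (\<lambda>x. (- 1 / 2) * pderiv_at a f x * (?r x * (?r x * ?r x)))" if "a < n" for a
        using Suc that Ck_on_Suc_D[OF Suc.prems] by (intro Ck_on_mult[OF U] Ck_on_const[OF U]) auto
    qed }
qed

text \<open>
  The coefficients are partial derivatives at intermediate points of a path that moves from
  \<open>x\<close> to \<open>y\<close> one coordinate at a time.
\<close>

lemma C1_Caratheodory:
  assumes U: "openin (Euclidean_space n) U" and f: "Ck_on n 1 U f" and x: "x \<in> U"
  obtains d A where "d > 0"
    "\<And>y. (\<And>i. i \<ge> n \<Longrightarrow> y i = 0) \<Longrightarrow> (\<And>i. i < n \<Longrightarrow> \<bar>y i - x i\<bar> < d) \<Longrightarrow>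
       f y - f x = (\<Sum>a<n. A a y * (y a - x a))"
    "\<And>a e. a < n \<Longrightarrow> e > 0 \<Longrightarrow> \<exists>c>0. \<forall>y. (\<forall>i\<ge>n. y i = 0) \<longrightarrow> (\<forall>i<n. \<bar>y i - x i\<bar> < c) \<longrightarrow>
       \<bar>A a y - pderiv_at a f x\<bar> < e"
proof -
  define near where "near c y \<longleftrightarrow> (\<forall>i\<ge>n. y i = 0) \<and> (\<forall>i<n. \<bar>y i - x i\<bar> < c)" for c y
  obtain d where d: "d > 0" "\<And>y. near d y \<Longrightarrow> y \<in> U"
    using openin_Euclidean_space_box[OF U x] unfolding near_def by metis
  have x0: "x i = 0" if "i \<ge> n" for i using openin_Euclidean_spaceD[OF U x that] .
  define z where "z a y = (\<lambda>i. if i < a then y i else x i)" for a and y :: "nat \<Rightarrow> real"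
  have step: "\<exists>t. (f (z (Suc a) y) - f (z a y) = pderiv_at a f ((z a y)(a := t)) * (y a - x a))
                \<and> \<bar>t - x a\<bar> \<le> \<bar>y a - x a\<bar>" if "a < n" "near d y" for a y
  \<comment> \<open>If this coordinate does not move, there is no interval for the mean value
    theorem; both sides are 0 and \<open>x a\<close> serves as the intermediate point.\<close>
  proof (cases "y a = x a")
    case True
    then have "z (Suc a) y = z a y" by (auto simp: z_def fun_eq_iff less_Suc_eq)
    with True show ?thesis by (auto intro!: exI[of _ "x a"])
  next
    case False
    let ?F = "\<lambda>t. f ((z a y)(a := t))"
    have der: "(?F has_real_derivative pderiv_at a f ((z a y)(a := t))) (at t)"
      if t: "\<bar>t - x a\<bar> \<le> \<bar>y a - x a\<bar>" for t
    proof -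
      have "near d ((z a y)(a := t))"
        unfolding near_def
      proof (intro conjI allI impI)
        show "((z a y)(a := t)) i = 0" if "i \<ge> n" for i
          using that \<open>a < n\<close> x0 \<open>near d y\<close> by (auto simp: z_def near_def)
        show "\<bar>((z a y)(a := t)) i - x i\<bar> < d" if "i < n" for i
          using that \<open>near d y\<close> t d(1) by (cases "i = a") (force simp: z_def near_def)+
      qed
      then have "(z a y)(a := t) \<in> U" by (rule d(2))
      from Ck_on_partial[OF f[unfolded One_nat_def] this \<open>a < n\<close>] show ?thesis by simp
    qed
    have F: "?F (x a) = f (z a y)" "?F (y a) = f (z (Suc a) y)"
      by (auto intro!: arg_cong[where f=f] simp: z_def fun_eq_iff less_Suc_eq)
    consider "x a < y a" | "y a < x a" using False by linarith
    then show ?thesis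
    proof cases
      case 1
      have "\<exists>t. x a < t \<and> t < y a \<and> ?F (y a) - ?F (x a) = (y a - x a) * pderiv_at a f ((z a y)(a := t))"
        by (rule MVT2[OF 1 der]) auto
      then obtain t where "x a < t" "t < y a"
        "f (z (Suc a) y) - f (z a y) = (y a - x a) * pderiv_at a f ((z a y)(a := t))" unfolding F by blast
      then show ?thesis by (intro exI[of _ t]) auto
    next
      case 2
      have "\<exists>t. y a < t \<and> t < x a \<and> ?F (x a) - ?F (y a) = (x a - y a) * pderiv_at a f ((z a y)(a := t))"
        by (rule MVT2[OF 2 der]) auto
      then obtain t where t: "y a < t" "t < x a"
        "f (z a y) - f (z (Suc a) y) = (x a - y a) * pderiv_at a f ((z a y)(a := t))" unfolding F by blast
      have "f (z (Suc a) y) - f (z a y) = pderiv_at a f ((z a y)(a := t)) * (y a - x a)"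
        using t(3) by (simp add: algebra_simps)
      with t(1,2) show ?thesis by (intro exI[of _ t]) auto
    qed
  qed
  then obtain \<tau> where \<tau>: "\<And>a y. a < n \<Longrightarrow> near d y \<Longrightarrow>
      f (z (Suc a) y) - f (z a y) = pderiv_at a f ((z a y)(a := \<tau> a y)) * (y a - x a)"
    "\<And>a y. a < n \<Longrightarrow> near d y \<Longrightarrow> \<bar>\<tau> a y - x a\<bar> \<le> \<bar>y a - x a\<bar>" by metis
  define A where "A a y = pderiv_at a f ((z a y)(a := \<tau> a y))" for a y
  show ?thesis
  proof (rule that[OF d(1), of A])
    fix y assume "\<And>i. i \<ge> n \<Longrightarrow> y i = 0" "\<And>i. i < n \<Longrightarrow> \<bar>y i - x i\<bar> < d"
    then have ny: "near d y" by (auto simp: near_def)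
    have "z n y = y" "z 0 y = x" using ny x0 by (auto simp: z_def near_def fun_eq_iff)
    then have "f y - f x = (\<Sum>a<n. f (z (Suc a) y) - f (z a y))"
      using sum_lessThan_telescope[of "\<lambda>a. f (z a y)" n] by simp
    also have "\<dots> = (\<Sum>a<n. A a y * (y a - x a))"
      using \<tau>(1) ny by (auto simp: A_def intro: sum.cong)
    finally show "f y - f x = (\<Sum>a<n. A a y * (y a - x a))" .
  next
    fix a and e :: real assume a: "a < n" and e: "e > 0"
    have "continuous_on U (pderiv_at a f)"
      using f a by (intro Ck_on_continuous[OF U, of 0]) auto
    from continuous_on_box[OF U this x e] obtain c where c: "c > 0"
      "\<And>y. near c y \<Longrightarrow> \<bar>pderiv_at a f y - pderiv_at a f x\<bar> < e" unfolding near_def by metis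
    show "\<exists>c>0. \<forall>y. (\<forall>i\<ge>n. y i = 0) \<longrightarrow> (\<forall>i<n. \<bar>y i - x i\<bar> < c) \<longrightarrow> \<bar>A a y - pderiv_at a f x\<bar> < e"
    \<comment> \<open>The radius \<open>d\<close> provides the bound on the intermediate points
      \<open>\<tau> a y\<close>, the radius \<open>c\<close> the continuity of the partial
      derivative at \<open>x\<close>.\<close>
    proof (intro exI[of _ "min c d"] conjI allI impI)
      show "min c d > 0" using c(1) d(1) by simp
      fix y assume y: "\<forall>i\<ge>n. y i = 0" "\<forall>i<n. \<bar>y i - x i\<bar> < min c d"
      then have "near d y" by (auto simp: near_def)
      from \<tau>(2)[OF a this] have t: "\<bar>\<tau> a y - x a\<bar> < c" using y(2) a by fastforce
      have "near c ((z a y)(a := \<tau> a y))"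
        unfolding near_def using y x0 a t c(1) by (auto simp: z_def)
      then show "\<bar>A a y - pderiv_at a f x\<bar> < e" unfolding A_def by (rule c(2))
    qed
  qed
qed

text \<open>Divide the increment formula of \<open>C1_Caratheodory\<close> by \<open>t - t0\<close>:
  the coefficients converge because the curve is continuous at \<open>t0\<close>, the quotients of
  the coordinates converge to \<open>\<phi>'\<close>. Curves suffice, since a partial derivative is
  a derivative along a coordinate line.\<close>

lemma C1_chain_rule:
  fixes \<phi> :: "real \<Rightarrow> nat \<Rightarrow> real"
  assumes U: "openin (Euclidean_space n) U" and f: "Ck_on n 1 U f" and x: "\<phi> t0 \<in> U"
    and d\<phi>: "\<And>a. a < n \<Longrightarrow> ((\<lambda>t. \<phi> t a) has_real_derivative \<phi>' a) (at t0)"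
    and \<phi>0: "\<And>t i. i \<ge> n \<Longrightarrow> \<phi> t i = 0"
  shows "((\<lambda>t. f (\<phi> t)) has_real_derivative (\<Sum>a<n. pderiv_at a f (\<phi> t0) * \<phi>' a)) (at t0)"
proof -
  obtain d A where d: "d > 0" and
    eq: "\<And>y. (\<And>i. i \<ge> n \<Longrightarrow> y i = 0) \<Longrightarrow> (\<And>i. i < n \<Longrightarrow> \<bar>y i - \<phi> t0 i\<bar> < d) \<Longrightarrow>
       f y - f (\<phi> t0) = (\<Sum>a<n. A a y * (y a - \<phi> t0 a))" and
    lim: "\<And>a e. a < n \<Longrightarrow> e > 0 \<Longrightarrow> \<exists>c>0. \<forall>y. (\<forall>i\<ge>n. y i = 0) \<longrightarrow> (\<forall>i<n. \<bar>y i - \<phi> t0 i\<bar> < c) \<longrightarrow>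
       \<bar>A a y - pderiv_at a f (\<phi> t0)\<bar> < e"
    by (rule C1_Caratheodory[OF U f x]) blast
  have near: "\<forall>\<^sub>F t in at t0. \<forall>i<n. \<bar>\<phi> t i - \<phi> t0 i\<bar> < c" if "c > 0" for c
  proof -
    have "\<forall>\<^sub>F t in at t0. \<forall>i\<in>{..<n}. \<bar>\<phi> t i - \<phi> t0 i\<bar> < c"
    proof (rule eventually_ball_finite)
      show "\<forall>i\<in>{..<n}. \<forall>\<^sub>F t in at t0. \<bar>\<phi> t i - \<phi> t0 i\<bar> < c"
      proof
        fix i assume "i \<in> {..<n}"
        then have "isCont (\<lambda>t. \<phi> t i) t0" using d\<phi> DERIV_isCont by blast
        then have "((\<lambda>t. \<phi> t i) \<longlongrightarrow> \<phi> t0 i) (at t0)" by (simp add: isCont_def)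
        from tendstoD[OF this that] show "\<forall>\<^sub>F t in at t0. \<bar>\<phi> t i - \<phi> t0 i\<bar> < c"
          by (simp add: dist_real_def)
      qed
    qed simp
    then show ?thesis by (auto elim: eventually_mono)
  qed
  have A: "((\<lambda>t. A a (\<phi> t)) \<longlongrightarrow> pderiv_at a f (\<phi> t0)) (at t0)" if "a < n" for a
  proof (rule tendstoI)
    fix e :: real assume "e > 0"
    from lim[OF that this] obtain c where c: "c > 0" "\<And>y. (\<forall>i\<ge>n. y i = 0) \<longrightarrow> (\<forall>i<n. \<bar>y i - \<phi> t0 i\<bar> < c) \<longrightarrow>
       \<bar>A a y - pderiv_at a f (\<phi> t0)\<bar> < e" by blast
    show "\<forall>\<^sub>F t in at t0. dist (A a (\<phi> t)) (pderiv_at a f (\<phi> t0)) < e"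
      using near[OF c(1)] by (rule eventually_mono) (use c(2) \<phi>0 in \<open>auto simp: dist_real_def\<close>)
  qed
  have "((\<lambda>t. \<Sum>a<n. A a (\<phi> t) * ((\<phi> t a - \<phi> t0 a) / (t - t0))) \<longlongrightarrow> (\<Sum>a<n. pderiv_at a f (\<phi> t0) * \<phi>' a)) (at t0)"
    using d\<phi> by (intro tendsto_sum tendsto_mult A) (auto simp: has_field_derivative_iff)
  moreover have "\<forall>\<^sub>F t in at t0. (\<Sum>a<n. A a (\<phi> t) * ((\<phi> t a - \<phi> t0 a) / (t - t0))) = (f (\<phi> t) - f (\<phi> t0)) / (t - t0)"
    using near[OF d] by (rule eventually_mono) (simp add: eq \<phi>0 sum_divide_distrib)
  ultimately show ?thesis
    unfolding has_field_derivative_iff by (rule Lim_transform_eventually)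
qed

text \<open>Induction on \<open>k\<close> for all \<open>f\<close> at once: a partial derivative of
  the composite is a sum of products of a partial derivative of \<open>f\<close> after
  \<open>\<phi>\<close>, to which the induction hypothesis applies, and one of
  \<open>\<phi>\<close>. That \<open>\<phi>\<close> vanishes from \<open>n\<close> on at all points,
  not only on \<open>V\<close>, places whole coordinate lines in Euclidean space for the chain
  rule.\<close>

lemma Ck_on_comp:
  assumes U: "openin (Euclidean_space n) U" and V: "openin (Euclidean_space m) V"
    and "Ck_on n k U f" and "\<And>a. a < n \<Longrightarrow> Ck_on m k V (\<lambda>x. \<phi> x a)"
    and \<phi>0: "\<And>x i. i \<ge> n \<Longrightarrow> \<phi> x i = 0" and \<phi>: "\<And>x. x \<in> V \<Longrightarrow> \<phi> x \<in> U"
  shows "Ck_on m k V (\<lambda>x. f (\<phi> x))"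
  using assms(3,4)
proof (induction k arbitrary: f)
  have c: "continuous_on V (\<lambda>x. f (\<phi> x))"
    if "Ck_on n k U f" "\<And>a. a < n \<Longrightarrow> Ck_on m k V (\<lambda>x. \<phi> x a)" for k f
  proof (rule continuous_on_compose2[OF Ck_on_continuous[OF U that(1)]])
    show "continuous_on V \<phi>"
    proof (rule continuous_on_coordinatewise_then_product)
      show "continuous_on V (\<lambda>x. \<phi> x i)" for i
        using Ck_on_continuous[OF V that(2)] \<phi>0 by (cases "i < n") auto
    qed
  qed (use \<phi> in auto)
  { case 0 then show ?case using c[OF 0] by (simp add: continuous_map_Euclidean_subspace[OF V]) }
  { case (Suc k)
    show ?case
    proof (rule Ck_on_SucI[OF V c[OF Suc.prems]])
      fix b assume b: "b < m"
      have f1: "Ck_on n 1 U f"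
      proof -
        have "Ck_on n 0 U (pderiv_at a f)" if "a < n" for a
          using Suc.prems(1) that Ck_on_continuous[OF U, of k "pderiv_at a f"] by (simp add: continuous_map_Euclidean_subspace[OF U])
        with Suc.prems(1) show ?thesis by simp
      qed
      show "((\<lambda>t. f (\<phi> (x(b := t)))) has_real_derivative
          (\<Sum>a<n. pderiv_at a f (\<phi> x) * pderiv_at b (\<lambda>x. \<phi> x a) x)) (at (x b))" if "x \<in> V" for x
        using C1_chain_rule[OF U f1, of "\<lambda>t. \<phi> (x(b := t))" "x b" "\<lambda>a. pderiv_at b (\<lambda>x. \<phi> x a) x"]
          Ck_on_partial[OF Suc.prems(2) that b] \<phi>[OF that] \<phi>0 by simp
      have "Ck_on m k V (\<lambda>x. \<phi> x a)" if "a < n" for a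
        using Suc.prems(2)[OF that] by (rule Ck_on_Suc_D)
      then have "Ck_on m k V (\<lambda>x. pderiv_at a f (\<phi> x))" if "a < n" for a
        using Suc.prems(1) that by (auto intro!: Suc.IH[of "pderiv_at a f"])
      moreover have "Ck_on m k V (pderiv_at b (\<lambda>x. \<phi> x a))" if "a < n" for a
        using Suc.prems(2)[OF that] b by simp
      ultimately show "Ck_on m k V (\<lambda>x. \<Sum>a<n. pderiv_at a f (\<phi> x) * pderiv_at b (\<lambda>x. \<phi> x a) x)"
        by (auto intro!: Ck_on_sum[OF V] Ck_on_mult[OF V])
    qed }
qed

text \<open>Schwarz's argument: the second difference of \<open>f\<close> over a square of side
  \<open>h\<close> can be evaluated by the mean value theorem in either order. It is
  \<open>h * h\<close> times each mixed partial derivative at some point of the square, and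
  continuity puts both of these values within \<open>e\<close> of the values at
  \<open>x\<close>.\<close>

lemma C2_mixed_partials_le:
  assumes U: "openin (Euclidean_space n) U" and f: "Ck_on n 2 U f" and x: "x \<in> U"
    and ab: "a < n" "b < n" "a \<noteq> b" and e: "e > (0::real)"
  shows "\<bar>pderiv_at a (pderiv_at b f) x - pderiv_at b (pderiv_at a f) x\<bar> < 2 * e"
proof -
  have f2: "Ck_on n (Suc (Suc 0)) U f" using f by (simp add: numeral_2_eq_2 del: Ck_on.simps)
  have cont: "continuous_on U (pderiv_at c (pderiv_at c' f))" if "c < n" "c' < n" for c c'
    using f2 that by (intro Ck_on_continuous[OF U, of 0]) auto
  have f1: "Ck_on n (Suc 0) U (pderiv_at c f)" if "c < n" for c
    using f2 that by auto
  obtain d1 where d1: "d1 > 0" "\<And>y. (\<And>i. i \<ge> n \<Longrightarrow> y i = 0) \<Longrightarrow> (\<And>i. i < n \<Longrightarrow> \<bar>y i - x i\<bar> < d1) \<Longrightarrow>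
      y \<in> U \<and> \<bar>pderiv_at a (pderiv_at b f) y - pderiv_at a (pderiv_at b f) x\<bar> < e"
    using continuous_on_box[OF U cont[OF ab(1,2)] x e] by metis
  obtain d2 where d2: "d2 > 0" "\<And>y. (\<And>i. i \<ge> n \<Longrightarrow> y i = 0) \<Longrightarrow> (\<And>i. i < n \<Longrightarrow> \<bar>y i - x i\<bar> < d2) \<Longrightarrow>
      y \<in> U \<and> \<bar>pderiv_at b (pderiv_at a f) y - pderiv_at b (pderiv_at a f) x\<bar> < e"
    using continuous_on_box[OF U cont[OF ab(2,1)] x e] by metis
  \<comment> \<open>Halving keeps the closed square of side \<open>h\<close> inside both open
    boxes.\<close>
  define h where "h = min d1 d2 / 2"
  have h: "h > 0" "h < d1" "h < d2" using d1(1) d2(1) by (auto simp: h_def)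
  define P where "P s t = x(a := s, b := t)" for s t
  have P0: "P s t i = 0" if "i \<ge> n" for s t i
    using openin_Euclidean_spaceD[OF U x that] ab that by (auto simp: P_def)
  have Pn: "\<bar>P s t i - x i\<bar> \<le> h" if "\<bar>s - x a\<bar> \<le> h" "\<bar>t - x b\<bar> \<le> h" for s t i
    using that h by (auto simp: P_def)
  have PU: "P s t \<in> U" "\<bar>pderiv_at a (pderiv_at b f) (P s t) - pderiv_at a (pderiv_at b f) x\<bar> < e"
     "\<bar>pderiv_at b (pderiv_at a f) (P s t) - pderiv_at b (pderiv_at a f) x\<bar> < e"
    if "\<bar>s - x a\<bar> \<le> h" "\<bar>t - x b\<bar> \<le> h" for s t
    using d1(2)[of "P s t", OF P0] d2(2)[of "P s t", OF P0] Pn[OF that] h by (meson le_less_trans)+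
  have Pa: "(P s t)(a := s') = P s' t" "P s t a = s" for s t s' using ab(3) by (auto simp: P_def fun_eq_iff)
  have Pb: "(P s t)(b := t') = P s t'" "P s t b = t" for s t t' by (auto simp: P_def fun_eq_iff)
  have da: "((\<lambda>s. g (P s t)) has_real_derivative pderiv_at a g (P s t)) (at s)"
    if "Ck_on n (Suc k) U g" "\<bar>s - x a\<bar> \<le> h" "\<bar>t - x b\<bar> \<le> h" for g k s t
    using Ck_on_partial[OF that(1) PU(1)[OF that(2,3)] ab(1)] by (simp add: Pa)
  have db: "((\<lambda>t. g (P s t)) has_real_derivative pderiv_at b g (P s t)) (at t)"
    if "Ck_on n (Suc k) U g" "\<bar>s - x a\<bar> \<le> h" "\<bar>t - x b\<bar> \<le> h" for g k s t
    using Ck_on_partial[OF that(1) PU(1)[OF that(2,3)] ab(2)] by (simp add: Pb)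
  let ?a = "x a" and ?b = "x b"
  let ?Q = "f (P (?a + h) (?b + h)) - f (P (?a + h) ?b) - f (P ?a (?b + h)) + f (P ?a ?b)"
  have "\<exists>s. ?a < s \<and> s < ?a + h \<and> (f (P (?a + h) (?b + h)) - f (P (?a + h) ?b)) - (f (P ?a (?b + h)) - f (P ?a ?b))
       = (?a + h - ?a) * (pderiv_at a f (P s (?b + h)) - pderiv_at a f (P s ?b))"
    by (rule MVT2) (use h in \<open>auto intro!: DERIV_diff da[OF f2]\<close>)
  then obtain s where s: "?a < s" "s < ?a + h" "?Q = h * (pderiv_at a f (P s (?b + h)) - pderiv_at a f (P s ?b))"
    by (auto simp: algebra_simps)
  have "\<exists>t. ?b < t \<and> t < ?b + h \<and> pderiv_at a f (P s (?b + h)) - pderiv_at a f (P s ?b)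
       = (?b + h - ?b) * pderiv_at b (pderiv_at a f) (P s t)"
    by (rule MVT2) (use h s in \<open>auto intro!: db[OF f1[OF ab(1)]]\<close>)
  then obtain t where t: "?b < t" "t < ?b + h" "?Q = h * (h * pderiv_at b (pderiv_at a f) (P s t))"
    using s(3) by auto
  have "\<exists>t. ?b < t \<and> t < ?b + h \<and> (f (P (?a + h) (?b + h)) - f (P ?a (?b + h))) - (f (P (?a + h) ?b) - f (P ?a ?b))
       = (?b + h - ?b) * (pderiv_at b f (P (?a + h) t) - pderiv_at b f (P ?a t))"
    by (rule MVT2) (use h in \<open>auto intro!: DERIV_diff db[OF f2]\<close>)
  then obtain t' where t': "?b < t'" "t' < ?b + h" "?Q = h * (pderiv_at b f (P (?a + h) t') - pderiv_at b f (P ?a t'))"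
    by (auto simp: algebra_simps)
  have "\<exists>s. ?a < s \<and> s < ?a + h \<and> pderiv_at b f (P (?a + h) t') - pderiv_at b f (P ?a t')
       = (?a + h - ?a) * pderiv_at a (pderiv_at b f) (P s t')"
    by (rule MVT2) (use h t' in \<open>auto intro!: da[OF f1[OF ab(2)]]\<close>)
  then obtain s' where s': "?a < s'" "s' < ?a + h" "?Q = h * (h * pderiv_at a (pderiv_at b f) (P s' t'))"
    using t'(3) by auto
  have "pderiv_at b (pderiv_at a f) (P s t) = pderiv_at a (pderiv_at b f) (P s' t')"
    using t(3) s'(3) h by simp
  moreover have "\<bar>pderiv_at b (pderiv_at a f) (P s t) - pderiv_at b (pderiv_at a f) x\<bar> < e"
    using PU(3)[of s t] s t by auto
  moreover have "\<bar>pderiv_at a (pderiv_at b f) (P s' t') - pderiv_at a (pderiv_at b f) x\<bar> < e"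
    using PU(2)[of s' t'] s' t' by auto
  ultimately show ?thesis by linarith
qed

lemma C2_mixed_partials:
  assumes U: "openin (Euclidean_space n) U" and f: "Ck_on n 2 U f" and x: "x \<in> U"
    and ab: "a < n" "b < n"
  shows "pderiv_at a (pderiv_at b f) x = pderiv_at b (pderiv_at a f) x"
proof (cases "a = b")
  case False
  show ?thesis
  proof (rule ccontr)
    assume "\<not> ?thesis"
    then show False
      using C2_mixed_partials_le[OF U f x ab False,
          of "\<bar>pderiv_at a (pderiv_at b f) x - pderiv_at b (pderiv_at a f) x\<bar> / 2"] by simp
  qed
qed simp

section \<open>Rules for smooth functions of finitely many coordinates\<close>

lemma smooth_real_on_subset: "V \<subseteq> U \<Longrightarrow> smooth_real_on n U f \<Longrightarrow> smooth_real_on n V f"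
  by (auto simp: smooth_real_on_def intro: Ck_on_subset)

lemma smooth_real_on_local:
  assumes "openin (Euclidean_space n) U"
    "\<And>x. x \<in> U \<Longrightarrow> \<exists>V. openin (Euclidean_space n) V \<and> x \<in> V \<and> smooth_real_on n V f"
  shows "smooth_real_on n U f"
  unfolding smooth_real_on_def by (intro allI Ck_on_local[OF assms(1)]) (meson assms(2) smooth_real_on_def)

lemma smooth_real_on_pderiv: "smooth_real_on n U f \<Longrightarrow> a < n \<Longrightarrow> smooth_real_on n U (pderiv_at a f)"
  unfolding smooth_real_on_def by (meson Ck_on.simps(2))

lemma smooth_real_on_Ck: "smooth_real_on n U f \<Longrightarrow> Ck_on n k U f"
  by (simp add: smooth_real_on_def)

lemma smooth_real_on_partial:
  assumes "smooth_real_on n U f" "x \<in> U" "a < n"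
  shows "((\<lambda>t. f (x(a := t))) has_real_derivative pderiv_at a f x) (at (x a))"
  using Ck_on_partial[OF smooth_real_on_Ck[OF assms(1)] assms(2,3)] .

lemma smooth_real_on_cong:
  assumes "openin (Euclidean_space n) U" "smooth_real_on n U f" "\<And>y. y \<in> U \<Longrightarrow> f y = g y"
  shows "smooth_real_on n U g"
  using assms Ck_on_cong unfolding smooth_real_on_def by metis

lemma smooth_real_on_comp:
  assumes "openin (Euclidean_space n) U" "openin (Euclidean_space m) V"
    "smooth_real_on n U f" "\<And>a. a < n \<Longrightarrow> smooth_real_on m V (\<lambda>x. \<phi> x a)"
    "\<And>x i. i \<ge> n \<Longrightarrow> \<phi> x i = 0" "\<And>x. x \<in> V \<Longrightarrow> \<phi> x \<in> U"
  shows "smooth_real_on m V (\<lambda>x. f (\<phi> x))"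
  unfolding smooth_real_on_def
proof
  show "Ck_on m k V (\<lambda>x. f (\<phi> x))" for k
    by (rule Ck_on_comp[OF assms(1,2) smooth_real_on_Ck[OF assms(3)] smooth_real_on_Ck[OF assms(4)] assms(5,6)])
qed

lemma sum_fun_apply: "(\<Sum>a\<in>A. f a) x = (\<Sum>a\<in>A. f a x)"
  by (induction A rule: infinite_finite_induct) auto


lemma tscale_apply: "tscale c u i k = c * u i k"
  by (simp add: tscale_def)

lemma fscale_apply: "fscale f X p = tscale (f p) (X p)"
  by (simp add: fscale_def)

lemma tscale_minus_one: "tscale (-1) u = - u"
  by (simp add: tscale_def fun_eq_iff)

lemma tscale_plus: "tscale c (u + v) = tscale c u + tscale c v"
  by (simp add: tscale_def fun_eq_iff distrib_left)


section \<open>Germs of smooth functions on a manifold\<close>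

text \<open>Germs are handled through this quantifier: directional derivatives at \<open>p\<close>
  see a function only near \<open>p\<close>, so identities between functions are needed on some
  neighbourhood only, often one cut down to a chart.\<close>

definition near :: "('p, 'i) manifold \<Rightarrow> 'p \<Rightarrow> ('p \<Rightarrow> bool) \<Rightarrow> bool" where
  "near M p P \<longleftrightarrow> (\<exists>U. openin (mtop M) U \<and> p \<in> U \<and> (\<forall>q\<in>U. P q))"

definition smooth_at :: "('p, 'i) manifold \<Rightarrow> ('p \<Rightarrow> real) \<Rightarrow> 'p \<Rightarrow> bool" where
  "smooth_at M f p \<longleftrightarrow> (\<exists>U. openin (mtop M) U \<and> p \<in> U \<and> smooth_fun M U f)"

definition cpd :: "('p, 'i) manifold \<Rightarrow> 'i \<Rightarrow> nat \<Rightarrow> ('p \<Rightarrow> real) \<Rightarrow> 'p \<Rightarrow> real" where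
  "cpd M i a f p = pderiv_at a (\<lambda>x. f (cinv M i x)) (coord M i p)"

text \<open>The derivative along \<open>u\<close> in a prescribed chart \<open>i\<close>. In
  contrast, \<open>dirder\<close> selects a chart itself; the two agree for tangent vectors and
  smooth germs by \<open>dirder_eq\<close>, and computations are done with
  \<open>vd\<close>.\<close>

definition vd :: "('p, 'i) manifold \<Rightarrow> 'i \<Rightarrow> 'p \<Rightarrow> 'i tvec \<Rightarrow> ('p \<Rightarrow> real) \<Rightarrow> real" where
  "vd M i p u f = (\<Sum>a<mdim M. u i a * cpd M i a f p)"

lemma jacobian_cpd: "jacobian M i j p k a = cpd M i a (\<lambda>q. coord M j q k) p"
  by (simp add: jacobian_def cpd_def)

lemma near_mono: "near M p P \<Longrightarrow> (\<And>q. P q \<Longrightarrow> Q q) \<Longrightarrow> near M p Q"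
  unfolding near_def by blast

lemma near_conj: "near M p P \<Longrightarrow> near M p Q \<Longrightarrow> near M p (\<lambda>q. P q \<and> Q q)"
  unfolding near_def by (elim exE conjE, rule_tac x="U \<inter> Ua" in exI) auto

lemma nearI: "openin (mtop M) U \<Longrightarrow> p \<in> U \<Longrightarrow> (\<And>q. q \<in> U \<Longrightarrow> P q) \<Longrightarrow> near M p P"
  unfolding near_def by blast

lemma smooth_fun_subset: "V \<subseteq> U \<Longrightarrow> smooth_fun M U f \<Longrightarrow> smooth_fun M V f"
  unfolding smooth_fun_def by (meson Int_mono image_mono order_refl smooth_real_on_subset)

locale smooth_mfd =
  fixes M :: "('p, 'i) manifold"
  assumes smooth: "smooth_manifold M"
begin

abbreviation n where "n \<equiv> mdim M"

section \<open>Charts and open sets of a smooth manifold\<close>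

lemma cdom_open: "i \<in> charts M \<Longrightarrow> openin (mtop M) (cdom M i)"
  using smooth by (auto simp: smooth_manifold_def)

lemma charts_at_iff: "i \<in> charts_at M p \<longleftrightarrow> i \<in> charts M \<and> p \<in> cdom M i"
  by (auto simp: charts_at_def)

lemma topspace_charts: "p \<in> topspace (mtop M) \<longleftrightarrow> (\<exists>i. i \<in> charts_at M p)"
  using smooth by (auto simp: smooth_manifold_def charts_at_def)

lemma charts_at_topspace: "i \<in> charts_at M p \<Longrightarrow> p \<in> topspace (mtop M)"
  by (auto simp: topspace_charts)

lemma open_charts_at: "openin (mtop M) U \<Longrightarrow> p \<in> U \<Longrightarrow> \<exists>i. i \<in> charts_at M p"
  using openin_subset topspace_charts by blast

lemma near_chart: "i \<in> charts_at M p \<Longrightarrow> near M p (\<lambda>q. i \<in> charts_at M q)"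
  by (intro nearI[OF cdom_open[of i]]) (auto simp: charts_at_iff)

lemma coord_homeo:
  assumes "i \<in> charts M"
  shows "homeomorphic_map (subtopology (mtop M) (cdom M i))
          (subtopology (Euclidean_space n) (coord M i ` cdom M i)) (coord M i)"
  using smooth assms by (auto simp: smooth_manifold_def)

lemma coord_image_open: "i \<in> charts M \<Longrightarrow> openin (Euclidean_space n) (coord M i ` cdom M i)"
  using smooth by (auto simp: smooth_manifold_def)

lemma coord_zero: "i \<in> charts_at M p \<Longrightarrow> k \<ge> n \<Longrightarrow> coord M i p k = 0"
  using openin_Euclidean_spaceD[OF coord_image_open] by (auto simp: charts_at_iff)

lemma coord_inj: "i \<in> charts M \<Longrightarrow> inj_on (coord M i) (cdom M i)"
proof -
  assume i: "i \<in> charts M"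
  have "topspace (subtopology (mtop M) (cdom M i)) = cdom M i"
    using openin_subset[OF cdom_open[OF i]] by auto
  then show ?thesis
    using coord_homeo[OF i] by (metis homeomorphic_imp_injective_map)
qed

lemma cinv_coord: "i \<in> charts_at M p \<Longrightarrow> cinv M i (coord M i p) = p"
  using coord_inj by (auto simp: charts_at_iff cinv_def)

lemma coord_cinv: "x \<in> coord M i ` cdom M i \<Longrightarrow> coord M i (cinv M i x) = x"
  by (simp add: cinv_def f_inv_into_f)

lemma coord_open:
  assumes "i \<in> charts M" "openin (mtop M) U" "U \<subseteq> cdom M i"
  shows "openin (Euclidean_space n) (coord M i ` U)"
proof -
  have "openin (subtopology (mtop M) (cdom M i)) U"
    using assms by (simp add: cdom_open openin_open_subtopology)
  then have "openin (subtopology (Euclidean_space n) (coord M i ` cdom M i)) (coord M i ` U)"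
    using homeomorphic_imp_open_map[OF coord_homeo[OF assms(1)]] by (auto simp: open_map_def)
  then show ?thesis using coord_image_open[OF assms(1)] openin_trans_full by metis
qed

lemma coord_Int_open:
  assumes "i \<in> charts M" "openin (mtop M) U"
  shows "openin (Euclidean_space n) (coord M i ` (U \<inter> cdom M i))"
  using assms cdom_open by (intro coord_open) auto

lemma coord_preimage_open:
  assumes "i \<in> charts M" "openin (Euclidean_space n) W"
  shows "openin (mtop M) {p \<in> cdom M i. coord M i p \<in> W}"
proof -
  have t: "topspace (subtopology (mtop M) (cdom M i)) = cdom M i"
    using openin_subset[OF cdom_open[OF assms(1)]] by auto
  have c: "continuous_map (subtopology (mtop M) (cdom M i)) (subtopology (Euclidean_space n) (coord M i ` cdom M i)) (coord M i)"
    using homeomorphic_imp_continuous_map[OF coord_homeo[OF assms(1)]] .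
  have "continuous_map (subtopology (mtop M) (cdom M i)) (Euclidean_space n) (coord M i)"
    using c by (simp add: continuous_map_in_subtopology)
  from openin_continuous_map_preimage[OF this assms(2)]
  have "openin (subtopology (mtop M) (cdom M i)) {p \<in> cdom M i. coord M i p \<in> W}" unfolding t .
  then show ?thesis using cdom_open[OF assms(1)] openin_trans_full by metis
qed

text \<open>The cut-off at \<open>n\<close> prepares composition: \<open>smooth_real_on_comp\<close>
  wants an inner map that vanishes from \<open>n\<close> on everywhere, while \<open>cinv\<close> is
  arbitrary off the image of the chart.\<close>

lemma transition_smooth:
  assumes "i \<in> charts M" "j \<in> charts M"
  shows "smooth_real_on n (coord M i ` (cdom M i \<inter> cdom M j)) (\<lambda>x. if k < n then coord M j (cinv M i x) k else 0)"
proof (cases "k < n")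
  case True
  then show ?thesis using smooth assms by (simp add: smooth_manifold_def)
next
  case False
  have "openin (Euclidean_space n) (coord M i ` (cdom M i \<inter> cdom M j))"
    using coord_Int_open[OF assms(1) cdom_open[OF assms(2)]] by (simp add: Int_commute)
  with False show ?thesis by (auto simp: smooth_real_on_def intro: Ck_on_const)
qed

text \<open>The expression of \<open>f\<close> in another chart \<open>j\<close> is the one in chart
  \<open>i\<close> composed with the transition map, because \<open>U\<close> lies in the domain of
  \<open>i\<close>. So smoothness needs to be checked in one chart only.\<close>

lemma smooth_fun_chartI:
  assumes i: "i \<in> charts M" and U: "openin (mtop M) U" "U \<subseteq> cdom M i"
    and f: "smooth_real_on n (coord M i ` U) (\<lambda>x. f (cinv M i x))"
  shows "smooth_fun M U f"
  unfolding smooth_fun_def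
proof
  fix j assume j: "j \<in> charts M"
  let ?V = "coord M j ` (U \<inter> cdom M j)"
  let ?t = "\<lambda>x k. if k < n then coord M i (cinv M j x) k else 0"
  have V: "openin (Euclidean_space n) ?V" by (rule coord_Int_open[OF j U(1)])
  have t: "?t x = coord M i (cinv M j x)" if "x \<in> ?V" for x
    using that U(2) i j by (auto simp: fun_eq_iff cinv_coord charts_at_iff intro!: coord_zero)
  have "smooth_real_on n ?V (\<lambda>x. f (cinv M i (?t x)))"
  proof (rule smooth_real_on_comp[OF coord_open[OF i U] V f])
    show "smooth_real_on n ?V (\<lambda>x. ?t x a)" for a
      by (rule smooth_real_on_subset[OF _ transition_smooth[OF j i]]) (use U(2) in auto)
    show "?t x \<in> coord M i ` U" if "x \<in> ?V" for x
      unfolding t[OF that] using that j by (auto simp: cinv_coord charts_at_iff)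
  qed auto
  then show "smooth_real_on n ?V (\<lambda>x. f (cinv M j x))"
  proof (rule smooth_real_on_cong[OF V])
    fix x assume x: "x \<in> ?V"
    show "f (cinv M i (?t x)) = f (cinv M j x)"
      unfolding t[OF x] using x U(2) i j by (auto simp: cinv_coord charts_at_iff)
  qed
qed

lemma smooth_at_chartD:
  assumes "smooth_at M f p" "i \<in> charts_at M p"
  obtains W where "openin (Euclidean_space n) W" "coord M i p \<in> W" "W \<subseteq> coord M i ` cdom M i"
    "smooth_real_on n W (\<lambda>x. f (cinv M i x))"
proof -
  obtain U where U: "openin (mtop M) U" "p \<in> U" "smooth_fun M U f" using assms(1) by (auto simp: smooth_at_def)
  show ?thesis
    by (rule that[of "coord M i ` (U \<inter> cdom M i)"])
       (use U assms(2) coord_Int_open in \<open>auto simp: charts_at_iff smooth_fun_def\<close>)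
qed

lemma smooth_at_chartI:
  assumes i: "i \<in> charts_at M p" and W: "openin (Euclidean_space n) W" "coord M i p \<in> W"
    "smooth_real_on n W (\<lambda>x. f (cinv M i x))"
  shows "smooth_at M f p"
proof -
  let ?U = "{q \<in> cdom M i. coord M i q \<in> W}"
  have U: "openin (mtop M) ?U" using i W by (intro coord_preimage_open) (auto simp: charts_at_iff)
  have "smooth_fun M ?U f"
    using i U by (intro smooth_fun_chartI[of i] smooth_real_on_subset[OF _ W(3)]) (auto simp: charts_at_iff)
  with U i W show ?thesis unfolding smooth_at_def by (intro exI[of _ ?U]) (auto simp: charts_at_iff)
qed

lemma smooth_fun_iff:
  assumes U: "openin (mtop M) U"
  shows "smooth_fun M U f \<longleftrightarrow> (\<forall>p\<in>U. smooth_at M f p)"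
proof
  show "smooth_fun M U f \<Longrightarrow> \<forall>p\<in>U. smooth_at M f p" using U by (auto simp: smooth_at_def)
  assume *: "\<forall>p\<in>U. smooth_at M f p"
  show "smooth_fun M U f"
    unfolding smooth_fun_def
  proof (intro ballI smooth_real_on_local[OF coord_Int_open[OF _ U]])
    fix i x assume i: "i \<in> charts M" and "x \<in> coord M i ` (U \<inter> cdom M i)"
    then obtain p where p: "x = coord M i p" "p \<in> U" "p \<in> cdom M i" by auto
    with * i smooth_at_chartD[of f p i]
    show "\<exists>V. openin (Euclidean_space n) V \<and> x \<in> V \<and> smooth_real_on n V (\<lambda>x. f (cinv M i x))"
      by (metis charts_at_iff)
  qed auto
qed

section \<open>The algebra of smooth germs\<close>

lemma smooth_at_cong:
  assumes "near M p (\<lambda>q. f q = g q)" "smooth_at M f p"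
  shows "smooth_at M g p"
proof -
  obtain U where U: "openin (mtop M) U" "p \<in> U" "\<And>q. q \<in> U \<Longrightarrow> f q = g q" using assms(1) by (auto simp: near_def)
  obtain V where V: "openin (mtop M) V" "p \<in> V" "smooth_fun M V f" using assms(2) by (auto simp: smooth_at_def)
  have "smooth_fun M (U \<inter> V) g"
    unfolding smooth_fun_def
  proof
    fix i assume i: "i \<in> charts M"
    show "smooth_real_on n (coord M i ` (U \<inter> V \<inter> cdom M i)) (\<lambda>x. g (cinv M i x))"
    proof (rule smooth_real_on_cong)
      show "openin (Euclidean_space n) (coord M i ` (U \<inter> V \<inter> cdom M i))"
        using U V i by (intro coord_Int_open) auto
      show "smooth_real_on n (coord M i ` (U \<inter> V \<inter> cdom M i)) (\<lambda>x. f (cinv M i x))"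
        using smooth_fun_subset[OF _ V(3), of "U \<inter> V"] i by (auto simp: smooth_fun_def)
      show "f (cinv M i y) = g (cinv M i y)" if "y \<in> coord M i ` (U \<inter> V \<inter> cdom M i)" for y
        using that U i by (auto simp: cinv_coord charts_at_iff)
    qed
  qed
  with U V show ?thesis unfolding smooth_at_def by blast
qed

lemma smooth_at_binop:
  assumes f: "smooth_at M f p" and g: "smooth_at M g p" and p: "i \<in> charts_at M p"
    and op: "\<And>W f g. openin (Euclidean_space n) W \<Longrightarrow> smooth_real_on n W f \<Longrightarrow> smooth_real_on n W g \<Longrightarrow>
       smooth_real_on n W (\<lambda>x. h (f x) (g x))"
  shows "smooth_at M (\<lambda>q. h (f q) (g q)) p"
proof -
  obtain W where W: "openin (Euclidean_space n) W" "coord M i p \<in> W" "smooth_real_on n W (\<lambda>x. f (cinv M i x))"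
    using smooth_at_chartD[OF f p] .
  obtain W' where W': "openin (Euclidean_space n) W'" "coord M i p \<in> W'" "smooth_real_on n W' (\<lambda>x. g (cinv M i x))"
    using smooth_at_chartD[OF g p] .
  show ?thesis
  proof (rule smooth_at_chartI[OF p, of "W \<inter> W'"])
    show "smooth_real_on n (W \<inter> W') (\<lambda>x. h (f (cinv M i x)) (g (cinv M i x)))"
      using W W' by (intro op openin_Int) (auto intro: smooth_real_on_subset[of _ W] smooth_real_on_subset[of _ W'])
  qed (use W W' in auto)
qed

lemma smooth_at_topspace: "smooth_at M f p \<Longrightarrow> \<exists>i. i \<in> charts_at M p"
  unfolding smooth_at_def using open_charts_at by blast

lemma smooth_at_add: "smooth_at M f p \<Longrightarrow> smooth_at M g p \<Longrightarrow> smooth_at M (\<lambda>q. f q + g q) p"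
  using smooth_at_topspace[of f p] by (auto simp: smooth_real_on_def intro!: smooth_at_binop[where h="(+)"] Ck_on_add)

lemma smooth_at_mult: "smooth_at M f p \<Longrightarrow> smooth_at M g p \<Longrightarrow> smooth_at M (\<lambda>q. f q * g q) p"
  using smooth_at_topspace[of f p] by (auto simp: smooth_real_on_def intro!: smooth_at_binop[where h="(*)"] Ck_on_mult)

lemma smooth_at_const: "i \<in> charts_at M p \<Longrightarrow> smooth_at M (\<lambda>q. c) p"
  by (rule smooth_at_chartI[OF _ coord_image_open])
     (auto simp: charts_at_iff smooth_real_on_def intro!: Ck_on_const coord_image_open)

lemma smooth_fun_const: "smooth_fun M U (\<lambda>q. c)" if "openin (mtop M) U"
  using that by (auto simp: smooth_fun_iff dest: open_charts_at intro: smooth_at_const)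

lemma smooth_at_minus: "smooth_at M f p \<Longrightarrow> smooth_at M (\<lambda>q. - f q) p"
  using smooth_at_mult[of "\<lambda>q. -1" p f] smooth_at_const smooth_at_topspace[of f p] by fastforce

lemma smooth_at_diff: "smooth_at M f p \<Longrightarrow> smooth_at M g p \<Longrightarrow> smooth_at M (\<lambda>q. f q - g q) p"
  using smooth_at_add[of f p "\<lambda>q. - g q"] smooth_at_minus[of g p] by simp

lemma smooth_at_sum:
  "p \<in> topspace (mtop M) \<Longrightarrow> (\<And>a. a \<in> A \<Longrightarrow> smooth_at M (f a) p) \<Longrightarrow> smooth_at M (\<lambda>q. \<Sum>a\<in>A. f a q) p"
  by (induction A rule: infinite_finite_induct) (auto intro: smooth_at_add smooth_at_const simp: topspace_charts)

lemma smooth_at_coord: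
  assumes "i \<in> charts_at M p"
  shows "smooth_at M (\<lambda>q. coord M i q k) p"
proof (rule smooth_at_chartI[OF assms coord_image_open])
  have o: "openin (Euclidean_space n) (coord M i ` cdom M i)" using assms by (auto simp: charts_at_iff coord_image_open)
  show "smooth_real_on n (coord M i ` cdom M i) (\<lambda>x. coord M i (cinv M i x) k)"
    by (rule smooth_real_on_cong[OF o, of "\<lambda>x. x k"])
       (auto simp: smooth_real_on_def intro: Ck_on_coordinate[OF o] simp: coord_cinv)
qed (use assms in \<open>auto simp: charts_at_iff\<close>)

lemma smooth_at_inverse_sqrt:
  assumes f: "smooth_at M f p" and pos: "near M p (\<lambda>q. f q > 0)"
  shows "smooth_at M (\<lambda>q. 1 / sqrt (f q)) p"
proof -
  obtain i where p: "i \<in> charts_at M p" using smooth_at_topspace[OF f] ..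
  obtain W where W: "openin (Euclidean_space n) W" "coord M i p \<in> W" "smooth_real_on n W (\<lambda>x. f (cinv M i x))"
    using smooth_at_chartD[OF f p] .
  obtain U where U: "openin (mtop M) U" "p \<in> U" "\<And>q. q \<in> U \<Longrightarrow> f q > 0" using pos by (auto simp: near_def)
  let ?W = "W \<inter> coord M i ` (U \<inter> cdom M i)"
  have o: "openin (Euclidean_space n) ?W" using W U p by (intro openin_Int coord_Int_open) (auto simp: charts_at_iff)
  show ?thesis
  proof (rule smooth_at_chartI[OF p o])
    show "smooth_real_on n ?W (\<lambda>x. 1 / sqrt (f (cinv M i x)))"
      unfolding smooth_real_on_def
    proof (intro allI Ck_on_inverse_sqrt[OF o])
      show "Ck_on n k ?W (\<lambda>x. f (cinv M i x))" for k
        using smooth_real_on_subset[OF _ W(3), of ?W] by (auto simp: smooth_real_on_def)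
      show "f (cinv M i x) > 0" if "x \<in> ?W" for x
        using that U(3) p by (auto simp: charts_at_iff cinv_coord)
    qed
  qed (use U W p in \<open>auto simp: charts_at_iff\<close>)
qed

section \<open>Coordinate derivatives and the Jacobian of a change of charts\<close>

lemma smooth_at_cpd:
  assumes f: "smooth_at M f p" and p: "i \<in> charts_at M p" and a: "a < n"
  shows "smooth_at M (cpd M i a f) p"
proof -
  obtain W where W: "openin (Euclidean_space n) W" "coord M i p \<in> W" "W \<subseteq> coord M i ` cdom M i"
    "smooth_real_on n W (\<lambda>x. f (cinv M i x))" using smooth_at_chartD[OF f p] .
  show ?thesis
  proof (rule smooth_at_chartI[OF p W(1,2)])
    show "smooth_real_on n W (\<lambda>x. cpd M i a f (cinv M i x))"
    proof (rule smooth_real_on_cong[OF W(1) smooth_real_on_pderiv[OF W(4) a]])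
      show "pderiv_at a (\<lambda>x. f (cinv M i x)) y = cpd M i a f (cinv M i y)" if "y \<in> W" for y
        using that W(3) coord_cinv[of y i] by (auto simp: cpd_def)
    qed
  qed
qed

lemma cpd_has_derivative:
  assumes f: "smooth_at M f p" and p: "i \<in> charts_at M p" and a: "a < n"
  shows "((\<lambda>t. f (cinv M i ((coord M i p)(a := t)))) has_real_derivative cpd M i a f p) (at (coord M i p a))"
proof -
  obtain W where W: "openin (Euclidean_space n) W" "coord M i p \<in> W" "W \<subseteq> coord M i ` cdom M i"
    "smooth_real_on n W (\<lambda>x. f (cinv M i x))" using smooth_at_chartD[OF f p] .
  from smooth_real_on_partial[OF W(4,2) a] show ?thesis unfolding cpd_def .
qed

lemma cpdI:
  assumes "((\<lambda>t. f (cinv M i ((coord M i p)(a := t)))) has_real_derivative D) (at (coord M i p a))"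
  shows "cpd M i a f p = D"
  using DERIV_imp_deriv[OF assms] by (simp add: cpd_def pderiv_at_def)

lemma cpd_add:
  "smooth_at M f p \<Longrightarrow> smooth_at M g p \<Longrightarrow> i \<in> charts_at M p \<Longrightarrow> a < n \<Longrightarrow>
   cpd M i a (\<lambda>q. f q + g q) p = cpd M i a f p + cpd M i a g p"
  by (rule cpdI[OF DERIV_add[OF cpd_has_derivative cpd_has_derivative]])

lemma cpd_mult:
  "smooth_at M f p \<Longrightarrow> smooth_at M g p \<Longrightarrow> i \<in> charts_at M p \<Longrightarrow> a < n \<Longrightarrow>
   cpd M i a (\<lambda>q. f q * g q) p = cpd M i a f p * g p + f p * cpd M i a g p"
  by (rule cpdI, rule DERIV_cong[OF DERIV_mult[OF cpd_has_derivative cpd_has_derivative]])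
     (auto simp: cinv_coord)

lemma cpd_const: "cpd M i a (\<lambda>q. c) p = 0"
  by (rule cpdI) simp

lemma cpd_cong:
  assumes "near M p (\<lambda>q. f q = g q)" "i \<in> charts_at M p" "a < n"
  shows "cpd M i a f p = cpd M i a g p"
proof -
  obtain U where U: "openin (mtop M) U" "p \<in> U" "\<And>q. q \<in> U \<Longrightarrow> f q = g q" using assms(1) by (auto simp: near_def)
  show ?thesis
    unfolding cpd_def
  proof (rule pderiv_at_cong)
    show "openin (Euclidean_space n) (coord M i ` (U \<inter> cdom M i))"
      using assms(2) U by (intro coord_Int_open) (auto simp: charts_at_iff)
  qed (use U assms in \<open>auto simp: charts_at_iff cinv_coord\<close>)
qed

lemma cpd_coord:
  assumes "i \<in> charts_at M p" "a < n" "b < n"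
  shows "cpd M i a (\<lambda>q. coord M i q b) p = (if a = b then 1 else 0)"
proof -
  have o: "openin (Euclidean_space n) (coord M i ` cdom M i)" using assms by (auto simp: charts_at_iff coord_image_open)
  have "cpd M i a (\<lambda>q. coord M i q b) p = pderiv_at a (\<lambda>x. x b) (coord M i p)"
    unfolding cpd_def by (rule pderiv_at_cong[OF o]) (use assms in \<open>auto simp: charts_at_iff coord_cinv\<close>)
  also have "\<dots> = (if a = b then 1 else 0)" by (auto simp: pderiv_at_def)
  finally show ?thesis .
qed

lemma cpd_commute:
  assumes f: "smooth_at M f p" and p: "i \<in> charts_at M p" and ab: "a < n" "b < n"
  shows "cpd M i a (cpd M i b f) p = cpd M i b (cpd M i a f) p"
proof -
  obtain W where W: "openin (Euclidean_space n) W" "coord M i p \<in> W" "W \<subseteq> coord M i ` cdom M i"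
    "smooth_real_on n W (\<lambda>x. f (cinv M i x))" using smooth_at_chartD[OF f p] .
  have *: "cpd M i a (cpd M i b f) p = pderiv_at a (pderiv_at b (\<lambda>x. f (cinv M i x))) (coord M i p)" if "a < n" for a b
    unfolding cpd_def[of M i a]
    by (rule pderiv_at_cong[OF W(1,2) that]) (use W(3) coord_cinv[of _ i] in \<open>auto simp: cpd_def\<close>)
  show ?thesis
    unfolding *[OF ab(1)] *[OF ab(2)]
    by (rule C2_mixed_partials[OF W(1) smooth_real_on_Ck[OF W(4)] W(2) ab])
qed

text \<open>The chain rule for the expression of \<open>f\<close> in chart \<open>j\<close>,
  composed with the transition map along the \<open>a\<close>-th coordinate line of chart
  \<open>i\<close>. The cut-off transition \<open>?t\<close> agrees with the true one only over the
  overlap, which contains a piece of that line around \<open>p\<close>.\<close>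

lemma cpd_chain:
  assumes f: "smooth_at M f p" and i: "i \<in> charts_at M p" and j: "j \<in> charts_at M p" and a: "a < n"
  shows "cpd M i a f p = (\<Sum>b<n. jacobian M i j p b a * cpd M j b f p)"
proof -
  obtain W where W: "openin (Euclidean_space n) W" "coord M j p \<in> W" "W \<subseteq> coord M j ` cdom M j"
    "smooth_real_on n W (\<lambda>x. f (cinv M j x))" using smooth_at_chartD[OF f j] .
  let ?t = "\<lambda>x k. if k < n then coord M j (cinv M i x) k else 0"
  let ?\<phi> = "\<lambda>s. ?t ((coord M i p)(a := s))"
  have o: "openin (Euclidean_space n) (coord M i ` (cdom M j \<inter> cdom M i))"
    using i j coord_Int_open[OF _ cdom_open] by (auto simp: charts_at_iff)
  have t: "?t x = coord M j (cinv M i x)" if "x \<in> coord M i ` (cdom M j \<inter> cdom M i)" for x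
    using that i j by (auto simp: fun_eq_iff cinv_coord charts_at_iff intro!: coord_zero)
  have tp: "?\<phi> (coord M i p a) = coord M j p"
    unfolding fun_upd_triv using t[of "coord M i p"] i j by (simp add: cinv_coord charts_at_iff)
  have "((\<lambda>s. f (cinv M j (?\<phi> s))) has_real_derivative
     (\<Sum>b<n. pderiv_at b (\<lambda>x. f (cinv M j x)) (?\<phi> (coord M i p a)) * jacobian M i j p b a)) (at (coord M i p a))"
  proof (rule C1_chain_rule[OF W(1) smooth_real_on_Ck[OF W(4)]])
    show "?\<phi> (coord M i p a) \<in> W" unfolding tp by (rule W(2))
    show "((\<lambda>s. ?\<phi> s b) has_real_derivative jacobian M i j p b a) (at (coord M i p a))" if "b < n" for b
      using cpd_has_derivative[OF smooth_at_coord[OF j] i a, of b] that by (simp add: jacobian_cpd)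
  qed auto
  note D = this
  have ev: "\<forall>\<^sub>F s in nhds (coord M i p a). f (cinv M j (?\<phi> s)) = f (cinv M i ((coord M i p)(a := s)))"
  proof (rule eventually_mono[OF eventually_fun_upd_in[OF o _ a]])
    show "coord M i p \<in> coord M i ` (cdom M j \<inter> cdom M i)" using i j by (auto simp: charts_at_iff)
    show "f (cinv M j (?\<phi> s)) = f (cinv M i ((coord M i p)(a := s)))"
      if "(coord M i p)(a := s) \<in> coord M i ` (cdom M j \<inter> cdom M i)" for s
      unfolding t[OF that] using that i j by (auto simp: cinv_coord charts_at_iff)
  qed
  have "((\<lambda>s. f (cinv M i ((coord M i p)(a := s)))) has_real_derivative
     (\<Sum>b<n. pderiv_at b (\<lambda>x. f (cinv M j x)) (?\<phi> (coord M i p a)) * jacobian M i j p b a)) (at (coord M i p a))"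
    by (rule iffD1[OF DERIV_cong_ev[OF refl ev refl] D])
  from cpdI[OF this] show ?thesis unfolding tp by (simp add: cpd_def mult.commute)
qed

lemma cpd_sum:
  assumes "\<And>b. b \<in> B \<Longrightarrow> smooth_at M (f b) p" "i \<in> charts_at M p" "a < n"
  shows "cpd M i a (\<lambda>q. \<Sum>b\<in>B. f b q) p = (\<Sum>b\<in>B. cpd M i a (f b) p)"
  using assms(1)
  by (induction B rule: infinite_finite_induct)
     (auto simp: cpd_const cpd_add[OF _ _ assms(2,3)] smooth_at_sum charts_at_topspace[OF assms(2)])

lemma smooth_at_jacobian:
  "i \<in> charts_at M p \<Longrightarrow> j \<in> charts_at M p \<Longrightarrow> a < n \<Longrightarrow> smooth_at M (\<lambda>q. jacobian M i j q k a) p"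
  unfolding jacobian_cpd by (intro smooth_at_cpd smooth_at_coord)

lemma jacobian_self: "i \<in> charts_at M p \<Longrightarrow> a < n \<Longrightarrow> k < n \<Longrightarrow> jacobian M i i p k a = (if k = a then 1 else 0)"
  unfolding jacobian_cpd using cpd_coord by auto

text \<open>The chain rule applied to the coordinate functions of the third chart
  \<open>l\<close>.\<close>

lemma jacobian_cocycle:
  assumes "i \<in> charts_at M p" "j \<in> charts_at M p" "l \<in> charts_at M p" "a < n"
  shows "jacobian M i l p k a = (\<Sum>b<n. jacobian M j l p k b * jacobian M i j p b a)"
  unfolding jacobian_cpd[of M i l] cpd_chain[OF smooth_at_coord[OF assms(3)] assms(1,2,4)]
  by (simp add: jacobian_cpd mult.commute)


subsection \<open>Tangent vectors\<close>

lemma tangentI: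
  assumes "\<And>i. i \<notin> charts_at M p \<Longrightarrow> u i = 0" "\<And>i k. k \<ge> n \<Longrightarrow> u i k = 0"
    "\<And>i j k. i \<in> charts_at M p \<Longrightarrow> j \<in> charts_at M p \<Longrightarrow> k < n \<Longrightarrow>
       u j k = (\<Sum>a<n. jacobian M i j p k a * u i a)"
  shows "u \<in> tangent_space M p"
  unfolding tangent_space_def using assms(1,2) by (auto intro: assms(3) simp del: fun_eq_iff)

lemma tangent_transform:
  "u \<in> tangent_space M p \<Longrightarrow> i \<in> charts_at M p \<Longrightarrow> j \<in> charts_at M p \<Longrightarrow> k < n \<Longrightarrow>
   u j k = (\<Sum>a<n. jacobian M i j p k a * u i a)"
  by (simp add: tangent_space_def)

lemma tangent_outside: "u \<in> tangent_space M p \<Longrightarrow> i \<notin> charts_at M p \<Longrightarrow> u i = 0"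
  by (simp add: tangent_space_def)

lemma tangent_beyond: "u \<in> tangent_space M p \<Longrightarrow> k \<ge> n \<Longrightarrow> u i k = 0"
  by (simp add: tangent_space_def)

lemma tangent_add:
  assumes u: "u \<in> tangent_space M p" and v: "v \<in> tangent_space M p" shows "u + v \<in> tangent_space M p"
proof (rule tangentI)
  fix i j k assume c: "i \<in> charts_at M p" "j \<in> charts_at M p" "k < n"
  show "(u + v) j k = (\<Sum>a<n. jacobian M i j p k a * (u + v) i a)"
    unfolding plus_fun_apply tangent_transform[OF u c] tangent_transform[OF v c]
    by (simp add: sum.distrib distrib_left)
qed (use assms in \<open>auto simp: tangent_outside tangent_beyond\<close>)

lemma tangent_scale:
  assumes u: "u \<in> tangent_space M p" shows "tscale c u \<in> tangent_space M p"
proof (rule tangentI)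
  fix i j k assume c: "i \<in> charts_at M p" "j \<in> charts_at M p" "k < n"
  show "tscale c u j k = (\<Sum>a<n. jacobian M i j p k a * tscale c u i a)"
    unfolding tscale_def tangent_transform[OF u c] by (simp add: sum_distrib_left mult_ac)
qed (use assms in \<open>auto simp: tangent_outside tangent_beyond tscale_def\<close>)

lemma tangent_minus: "u \<in> tangent_space M p \<Longrightarrow> - u \<in> tangent_space M p"
  using tangent_scale[of u p "-1"] by (simp add: tscale_minus_one)

lemma tangent_diff: "u \<in> tangent_space M p \<Longrightarrow> v \<in> tangent_space M p \<Longrightarrow> u - v \<in> tangent_space M p"
  using tangent_add[of u p "- v"] tangent_minus by simp

lemma tangent_sum: "(\<And>a. a \<in> A \<Longrightarrow> f a \<in> tangent_space M p) \<Longrightarrow> (\<Sum>a\<in>A. f a) \<in> tangent_space M p"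
  by (induction A rule: infinite_finite_induct) (auto simp: tangent_space_zero intro: tangent_add)

lemma tangent_eqI:
  assumes "u \<in> tangent_space M p" "v \<in> tangent_space M p" "i \<in> charts_at M p" "\<And>k. k < n \<Longrightarrow> u i k = v i k"
  shows "u = v"
proof (intro ext)
  fix j k
  show "u j k = v j k"
  proof (cases "j \<in> charts_at M p \<and> k < n")
    case True
    then show ?thesis
      using tangent_transform[OF assms(1,3), of j k] tangent_transform[OF assms(2,3), of j k] assms(4) by simp
  next
    case False
    then show ?thesis using assms(1,2) by (auto simp: tangent_outside tangent_beyond not_less)
  qed
qed

lemma coord_field_tangent:
  assumes "i \<in> charts_at M p" "a < n"
  shows "coord_field M i a p \<in> tangent_space M p"
proof (rule tangentI)
  fix j l k assume c: "j \<in> charts_at M p" "l \<in> charts_at M p" "k < n"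
  show "coord_field M i a p l k = (\<Sum>b<n. jacobian M j l p k b * coord_field M i a p j b)"
    using c jacobian_cocycle[OF assms(1) c(1,2) assms(2), of k] by (simp add: coord_field_def)
qed (auto simp: coord_field_def fun_eq_iff)

lemma coord_field_self:
  "i \<in> charts_at M p \<Longrightarrow> a < n \<Longrightarrow> k < n \<Longrightarrow> coord_field M i a p i k = (if k = a then 1 else 0)"
  by (simp add: coord_field_def jacobian_self)

lemma tangent_expand:
  assumes "u \<in> tangent_space M p" "i \<in> charts_at M p"
  shows "u = (\<Sum>a<n. tscale (u i a) (coord_field M i a p))"
proof (rule tangent_eqI[OF assms(1) _ assms(2)])
  show "(\<Sum>a<n. tscale (u i a) (coord_field M i a p)) \<in> tangent_space M p"
    by (intro tangent_sum tangent_scale coord_field_tangent assms) auto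
  show "u i k = (\<Sum>a<n. tscale (u i a) (coord_field M i a p)) i k" if "k < n" for k
    using that by (simp add: sum_fun_apply tscale_def coord_field_self[OF assms(2)] if_distrib cong: if_cong)
qed

lemma tangent_of_comps:
  assumes "i \<in> charts_at M p"
  obtains u where "u \<in> tangent_space M p" "\<And>k. k < n \<Longrightarrow> u i k = c k"
proof (rule that[of "\<Sum>a<n. tscale (c a) (coord_field M i a p)"])
  show "(\<Sum>a<n. tscale (c a) (coord_field M i a p)) \<in> tangent_space M p"
    by (intro tangent_sum tangent_scale coord_field_tangent assms) auto
  show "(\<Sum>a<n. tscale (c a) (coord_field M i a p)) i k = c k" if "k < n" for k
    using that by (simp add: sum_fun_apply tscale_def coord_field_self[OF assms] if_distrib cong: if_cong)
qed


subsection \<open>Directional derivatives\<close>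

text \<open>The Jacobian in the chain rule for \<open>f\<close> is the one that transforms the
  components of \<open>u\<close>. This is what gives \<open>dirder\<close>, with its arbitrary
  chart, a meaning.\<close>

lemma vd_chart:
  assumes "u \<in> tangent_space M p" "smooth_at M f p" "i \<in> charts_at M p" "j \<in> charts_at M p"
  shows "vd M i p u f = vd M j p u f"
proof -
  have "vd M i p u f = (\<Sum>a<n. \<Sum>b<n. u i a * (jacobian M i j p b a * cpd M j b f p))"
    unfolding vd_def using cpd_chain[OF assms(2-4)] by (simp add: sum_distrib_left)
  also have "\<dots> = (\<Sum>b<n. (\<Sum>a<n. jacobian M i j p b a * u i a) * cpd M j b f p)"
    by (subst sum.swap) (simp add: sum_distrib_right sum_distrib_left mult_ac)
  also have "\<dots> = vd M j p u f"
    unfolding vd_def by (intro sum.cong) (use tangent_transform[OF assms(1,3,4)] in auto)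
  finally show ?thesis .
qed

lemma dirder_eq:
  assumes "u \<in> tangent_space M p" "smooth_at M f p" "i \<in> charts_at M p"
  shows "dirder M p u f = vd M i p u f"
proof -
  have "(SOME i. i \<in> charts_at M p) \<in> charts_at M p" using assms(3) by (rule someI)
  from vd_chart[OF assms(1,2) this assms(3)] show ?thesis
    by (simp add: dirder_def vd_def cpd_def)
qed

lemma dirder_cong:
  assumes "near M p (\<lambda>q. f q = g q)"
  shows "dirder M p u f = dirder M p u g"
proof -
  have "\<exists>i. i \<in> charts_at M p" using assms open_charts_at by (auto simp: near_def)
  then have "(SOME i. i \<in> charts_at M p) \<in> charts_at M p" by (rule someI_ex)
  from cpd_cong[OF assms this] show ?thesis by (simp add: dirder_def cpd_def)
qed

lemma vd_cong: "near M p (\<lambda>q. f q = g q) \<Longrightarrow> i \<in> charts_at M p \<Longrightarrow> vd M i p u f = vd M i p u g"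
  unfolding vd_def by (intro sum.cong refl arg_cong2[where f="(*)"] cpd_cong) auto

lemma vd_add: "smooth_at M f p \<Longrightarrow> smooth_at M g p \<Longrightarrow> i \<in> charts_at M p \<Longrightarrow>
   vd M i p u (\<lambda>q. f q + g q) = vd M i p u f + vd M i p u g"
  unfolding vd_def by (simp add: cpd_add distrib_left sum.distrib)

lemma vd_mult: "smooth_at M f p \<Longrightarrow> smooth_at M g p \<Longrightarrow> i \<in> charts_at M p \<Longrightarrow>
   vd M i p u (\<lambda>q. f q * g q) = vd M i p u f * g p + f p * vd M i p u g"
  unfolding vd_def by (simp add: cpd_mult distrib_left sum.distrib sum_distrib_left sum_distrib_right mult_ac)

lemma vd_const: "vd M i p u (\<lambda>q. c) = 0"
  unfolding vd_def by (simp add: cpd_const)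

lemma vd_sum: "(\<And>b. b \<in> B \<Longrightarrow> smooth_at M (f b) p) \<Longrightarrow> i \<in> charts_at M p \<Longrightarrow>
   vd M i p u (\<lambda>q. \<Sum>b\<in>B. f b q) = (\<Sum>b\<in>B. vd M i p u (f b))"
  unfolding vd_def by (simp add: cpd_sum sum_distrib_left) (rule sum.swap)

lemma vd_minus: "smooth_at M f p \<Longrightarrow> i \<in> charts_at M p \<Longrightarrow> vd M i p u (\<lambda>q. - f q) = - vd M i p u f"
  using vd_mult[OF smooth_at_const, of i p f i u "-1"] by (simp add: vd_const)

lemma vd_plus_vec: "vd M i p (u + v) f = vd M i p u f + vd M i p v f"
  unfolding vd_def by (simp add: distrib_right sum.distrib)

lemma vd_scale_vec: "vd M i p (tscale c u) f = c * vd M i p u f"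
  unfolding vd_def by (simp add: tscale_def sum_distrib_left mult_ac)

lemma vd_coord_field: "i \<in> charts_at M p \<Longrightarrow> a < n \<Longrightarrow> vd M i p (coord_field M i a p) f = cpd M i a f p"
  unfolding vd_def by (simp add: coord_field_self if_distrib[of "\<lambda>x. x * _"] cong: if_cong)


subsection \<open>Vector fields\<close>

lemma vfield_subset: "V \<subseteq> U \<Longrightarrow> vfield M U X \<Longrightarrow> vfield M V X"
  unfolding vfield_def by (meson Int_mono image_mono order_refl smooth_real_on_subset subset_eq)

lemma vfield_tangent: "vfield M U X \<Longrightarrow> p \<in> U \<Longrightarrow> X p \<in> tangent_space M p"
  by (auto simp: vfield_def)

lemma vfield_smooth_at:
  assumes U: "openin (mtop M) U" and X: "vfield M U X" and p: "p \<in> U" and i: "i \<in> charts_at M p" and k: "k < n"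
  shows "smooth_at M (\<lambda>q. X q i k) p"
  by (rule smooth_at_chartI[OF i coord_Int_open[OF _ U]])
     (use X p i k in \<open>auto simp: vfield_def charts_at_iff\<close>)

text \<open>Smooth components in a single chart around each point suffice: components in another
  chart are combinations of these with entries of the Jacobian as coefficients, which are
  smooth.\<close>

lemma vfieldI:
  assumes U: "openin (mtop M) U" and t: "\<And>p. p \<in> U \<Longrightarrow> X p \<in> tangent_space M p"
    and s: "\<And>p. p \<in> U \<Longrightarrow> \<exists>i\<in>charts_at M p. \<forall>k<n. smooth_at M (\<lambda>q. X q i k) p"
  shows "vfield M U X"
  unfolding vfield_def
proof (intro conjI ballI allI impI t)
  fix j k assume j: "j \<in> charts M" and k: "k < n"
  have "smooth_at M (\<lambda>q. X q j k) p" if p: "p \<in> U \<inter> cdom M j" for p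
  proof -
    obtain i where i: "i \<in> charts_at M p" "\<And>k. k < n \<Longrightarrow> smooth_at M (\<lambda>q. X q i k) p" using s p by blast
    have jp: "j \<in> charts_at M p" using j p by (auto simp: charts_at_iff)
    have "near M p (\<lambda>q. q \<in> U)" using p U by (auto simp: near_def)
    then have "near M p (\<lambda>q. (\<Sum>a<n. jacobian M i j q k a * X q i a) = X q j k)"
      by (rule near_mono[OF near_conj[OF near_conj[OF near_chart[OF i(1)] near_chart[OF jp]]]])
         (use t k in \<open>simp add: tangent_transform[symmetric]\<close>)
    then show ?thesis
      by (rule smooth_at_cong) (use i jp charts_at_topspace in \<open>auto intro!: smooth_at_sum smooth_at_mult smooth_at_jacobian\<close>)
  qed
  moreover have o: "openin (mtop M) (U \<inter> cdom M j)" using U cdom_open[OF j] by auto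
  ultimately have "smooth_fun M (U \<inter> cdom M j) (\<lambda>q. X q j k)" by (simp add: smooth_fun_iff)
  then show "smooth_real_on n (coord M j ` (U \<inter> cdom M j)) (\<lambda>x. X (cinv M j x) j k)"
    using j by (auto simp: smooth_fun_def)
qed

lemma vfield_add:
  assumes "openin (mtop M) U" "vfield M U X" "vfield M U Y" shows "vfield M U (X + Y)"
proof (rule vfieldI[OF assms(1)])
  fix p assume p: "p \<in> U"
  show "(X + Y) p \<in> tangent_space M p" using vfield_tangent[OF _ p] assms by (auto intro: tangent_add)
  obtain i where i: "i \<in> charts_at M p" using open_charts_at[OF assms(1) p] ..
  show "\<exists>i\<in>charts_at M p. \<forall>k<n. smooth_at M (\<lambda>q. (X + Y) q i k) p"
    using i vfield_smooth_at[OF assms(1,2) p i] vfield_smooth_at[OF assms(1,3) p i]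
    by (auto intro!: bexI[of _ i] smooth_at_add)
qed

lemma vfield_fscale:
  assumes "openin (mtop M) U" "smooth_fun M U f" "vfield M U X" shows "vfield M U (fscale f X)"
proof (rule vfieldI[OF assms(1)])
  fix p assume p: "p \<in> U"
  show "fscale f X p \<in> tangent_space M p"
    using vfield_tangent[OF _ p] assms by (auto simp: fscale_def intro: tangent_scale)
  obtain i where i: "i \<in> charts_at M p" using open_charts_at[OF assms(1) p] ..
  show "\<exists>i\<in>charts_at M p. \<forall>k<n. smooth_at M (\<lambda>q. fscale f X q i k) p"
    using i vfield_smooth_at[OF assms(1,3) p i] assms(1,2) p
    by (auto intro!: bexI[of _ i] smooth_at_mult simp: fscale_def tscale_def smooth_fun_iff)
qed

lemma vfield_zero: "openin (mtop M) U \<Longrightarrow> vfield M U 0"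
  by (rule vfieldI) (auto simp: tangent_space_zero dest: open_charts_at intro: smooth_at_const)

lemma vfield_uminus:
  assumes "openin (mtop M) U" "vfield M U X" shows "vfield M U (- X)"
proof (rule vfieldI[OF assms(1)])
  fix p assume p: "p \<in> U"
  show "(- X) p \<in> tangent_space M p" using vfield_tangent[OF _ p] assms by (auto intro: tangent_minus)
  obtain i where i: "i \<in> charts_at M p" using open_charts_at[OF assms(1) p] ..
  show "\<exists>i\<in>charts_at M p. \<forall>k<n. smooth_at M (\<lambda>q. (- X) q i k) p"
    using i vfield_smooth_at[OF assms(1,2) p i] by (auto intro!: bexI[of _ i] smooth_at_minus)
qed

lemma vfield_diff:
  assumes "openin (mtop M) U" "vfield M U X" "vfield M U Y" shows "vfield M U (X - Y)"
  using vfield_add[OF assms(1,2) vfield_uminus[OF assms(1,3)]] by simp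

lemma vfield_sum:
  assumes "openin (mtop M) U" "\<And>a. a \<in> A \<Longrightarrow> vfield M U (X a)" shows "vfield M U (\<Sum>a\<in>A. X a)"
  using assms(2) by (induction A rule: infinite_finite_induct) (auto intro: vfield_add vfield_zero assms(1))

lemma vfield_cong:
  assumes "openin (mtop M) U" "vfield M U X" "\<And>p. p \<in> U \<Longrightarrow> X p = Y p" shows "vfield M U Y"
proof (rule vfieldI[OF assms(1)])
  fix p assume p: "p \<in> U"
  show "Y p \<in> tangent_space M p" using vfield_tangent[OF _ p] assms p by metis
  obtain i where i: "i \<in> charts_at M p" using open_charts_at[OF assms(1) p] ..
  have "near M p (\<lambda>q. q \<in> U)" using p assms(1) by (auto simp: near_def)
  then have "near M p (\<lambda>q. X q i k = Y q i k)" for k by (rule near_mono) (simp add: assms(3))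
  then show "\<exists>i\<in>charts_at M p. \<forall>k<n. smooth_at M (\<lambda>q. Y q i k) p"
    using i by (intro bexI[of _ i] allI impI smooth_at_cong[OF _ vfield_smooth_at[OF assms(1,2) p i]])
qed

lemma coord_field_vfield:
  assumes i: "i \<in> charts M" and a: "a < n"
  shows "vfield M (cdom M i) (coord_field M i a)"
proof (rule vfieldI[OF cdom_open[OF i]])
  fix p assume p: "p \<in> cdom M i"
  then have ip: "i \<in> charts_at M p" using i by (auto simp: charts_at_iff)
  show "coord_field M i a p \<in> tangent_space M p" by (rule coord_field_tangent[OF ip a])
  have "smooth_at M (\<lambda>q. coord_field M i a q i k) p" if "k < n" for k
  proof (rule smooth_at_cong[OF _ smooth_at_jacobian[OF ip ip a, of k]])
    show "near M p (\<lambda>q. jacobian M i i q k a = coord_field M i a q i k)"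
      by (rule near_mono[OF near_chart[OF ip]]) (use that in \<open>auto simp: coord_field_def\<close>)
  qed
  with ip show "\<exists>i'\<in>charts_at M p. \<forall>k<n. smooth_at M (\<lambda>q. coord_field M i a q i' k) p" by blast
qed

end

section \<open>Connections in charts\<close>

text \<open>The connection form in the coordinate frame of chart \<open>i\<close>: the derivative of
  the \<open>b\<close>-th coordinate field along \<open>u\<close> has \<open>k\<close>-th component
  \<open>conn_matrix M nab i p u k b\<close>.\<close>

definition conn_matrix ::
  "('p, 'i) manifold \<Rightarrow> ('p, 'i) conn \<Rightarrow> 'i \<Rightarrow> 'p \<Rightarrow> 'i tvec \<Rightarrow> nat \<Rightarrow> nat \<Rightarrow> real" where
  "conn_matrix M nab i p u k b = (\<Sum>a<mdim M. christoffel M nab i a b k p * u i a)"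

lemma sum_mult_delta_add:
  fixes f g :: "nat \<Rightarrow> real"
  assumes "k < m"
  shows "(\<Sum>b<m. x * (f b * (if k = b then 1 else 0) + g b)) = x * f k + (\<Sum>b<m. x * g b)"
proof -
  have "(\<Sum>b<m. x * (f b * (if k = b then 1 else 0))) = (\<Sum>b<m. if k = b then x * f b else 0)"
    by (intro sum.cong) auto
  also have "\<dots> = x * f k" using assms by simp
  finally show ?thesis by (simp only: distrib_left sum.distrib)
qed

locale conn_mfd = smooth_mfd M for M :: "('p, 'i) manifold" +
  fixes nab :: "('p, 'i) conn"
  assumes conn: "connection M nab"
begin

section \<open>Additivity, locality and expansion of a connection\<close>

lemma nab_props:
  assumes "openin (mtop M) U" "vfield M U X" "vfield M U X'" "vfield M U Y" "vfield M U Y'" "smooth_fun M U f"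
  shows "vfield M U (nab X Y)"
    "\<And>p. p \<in> U \<Longrightarrow> nab (X + X') Y p = nab X Y p + nab X' Y p"
    "\<And>p. p \<in> U \<Longrightarrow> nab (fscale f X) Y p = tscale (f p) (nab X Y p)"
    "\<And>p. p \<in> U \<Longrightarrow> nab X (Y + Y') p = nab X Y p + nab X Y' p"
    "\<And>p. p \<in> U \<Longrightarrow> nab X (fscale f Y) p = tscale (dirder M p (X p) f) (Y p) + tscale (f p) (nab X Y p)"
    "\<And>p. p \<in> U \<Longrightarrow> (\<And>q. q \<in> U \<Longrightarrow> X q = X' q) \<Longrightarrow> (\<And>q. q \<in> U \<Longrightarrow> Y q = Y' q) \<Longrightarrow> nab X Y p = nab X' Y' p"
  using conn[unfolded connection_def, rule_format, of U X X' Y Y' f] assms by blast+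

lemma nab_vfield: "openin (mtop M) U \<Longrightarrow> vfield M U X \<Longrightarrow> vfield M U Y \<Longrightarrow> vfield M U (nab X Y)"
  using nab_props(1)[of U X X Y Y "\<lambda>q. 0"] smooth_fun_const by blast

lemma nab_add1: "openin (mtop M) U \<Longrightarrow> vfield M U X \<Longrightarrow> vfield M U X' \<Longrightarrow> vfield M U Y \<Longrightarrow> p \<in> U \<Longrightarrow>
   nab (X + X') Y p = nab X Y p + nab X' Y p"
  using nab_props(2)[of U X X' Y Y "\<lambda>q. 0"] smooth_fun_const by blast

lemma nab_add2: "openin (mtop M) U \<Longrightarrow> vfield M U X \<Longrightarrow> vfield M U Y \<Longrightarrow> vfield M U Y' \<Longrightarrow> p \<in> U \<Longrightarrow>
   nab X (Y + Y') p = nab X Y p + nab X Y' p"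
  using nab_props(4)[of U X X Y Y' "\<lambda>q. 0"] smooth_fun_const by blast

lemma nab_scale1: "openin (mtop M) U \<Longrightarrow> vfield M U X \<Longrightarrow> vfield M U Y \<Longrightarrow> smooth_fun M U f \<Longrightarrow> p \<in> U \<Longrightarrow>
   nab (fscale f X) Y p = tscale (f p) (nab X Y p)"
  using nab_props(3)[of U X X Y Y f] by blast

lemma nab_leibniz: "openin (mtop M) U \<Longrightarrow> vfield M U X \<Longrightarrow> vfield M U Y \<Longrightarrow> smooth_fun M U f \<Longrightarrow> p \<in> U \<Longrightarrow>
   nab X (fscale f Y) p = tscale (dirder M p (X p) f) (Y p) + tscale (f p) (nab X Y p)"
  using nab_props(5)[of U X X Y Y f] by blast

lemma nab_local: "openin (mtop M) U \<Longrightarrow> vfield M U X \<Longrightarrow> vfield M U X' \<Longrightarrow> vfield M U Y \<Longrightarrow> vfield M U Y' \<Longrightarrow> p \<in> U \<Longrightarrow>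
   (\<And>q. q \<in> U \<Longrightarrow> X q = X' q) \<Longrightarrow> (\<And>q. q \<in> U \<Longrightarrow> Y q = Y' q) \<Longrightarrow> nab X Y p = nab X' Y' p"
  by (rule nab_props(6)[of U X X' Y Y' "\<lambda>q. 0"]) (auto intro: smooth_fun_const)

lemma nab_zero1: "openin (mtop M) U \<Longrightarrow> vfield M U Y \<Longrightarrow> p \<in> U \<Longrightarrow> nab 0 Y p = 0"
  using nab_add1[of U 0 0 Y p] vfield_zero by simp

lemma nab_zero2: "openin (mtop M) U \<Longrightarrow> vfield M U X \<Longrightarrow> p \<in> U \<Longrightarrow> nab X 0 p = 0"
  using nab_add2[of U X 0 0 p] vfield_zero by simp

lemma nab_sum1:
  assumes "openin (mtop M) U" "\<And>a. a \<in> A \<Longrightarrow> vfield M U (X a)" "vfield M U Y" "p \<in> U"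
  shows "nab (\<Sum>a\<in>A. X a) Y p = (\<Sum>a\<in>A. nab (X a) Y p)"
  using assms(2)
proof (induction A rule: infinite_finite_induct)
  case (insert x F)
  then have "nab (X x + sum X F) Y p = nab (X x) Y p + nab (sum X F) Y p"
    by (intro nab_add1[OF assms(1) _ vfield_sum[OF assms(1)] assms(3,4)]) auto
  also have "nab (sum X F) Y p = (\<Sum>a\<in>F. nab (X a) Y p)" using insert by blast
  finally show ?case unfolding sum.insert[OF insert.hyps] .
qed (auto simp: nab_zero1[OF assms(1,3,4)])

lemma nab_sum2:
  assumes "openin (mtop M) U" "\<And>a. a \<in> A \<Longrightarrow> vfield M U (Y a)" "vfield M U X" "p \<in> U"
  shows "nab X (\<Sum>a\<in>A. Y a) p = (\<Sum>a\<in>A. nab X (Y a) p)"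
  using assms(2)
proof (induction A rule: infinite_finite_induct)
  case (insert x F)
  then have "nab X (Y x + sum Y F) p = nab X (Y x) p + nab X (sum Y F) p"
    by (intro nab_add2[OF assms(1,3) _ vfield_sum[OF assms(1)] assms(4)]) auto
  also have "nab X (sum Y F) p = (\<Sum>a\<in>F. nab X (Y a) p)" using insert by blast
  finally show ?case unfolding sum.insert[OF insert.hyps] .
qed (auto simp: nab_zero2[OF assms(1,3,4)])

text \<open>A connection is determined by its values on any fields in which both arguments can be
  expanded. Used with coordinate fields for the formula in a chart, and with lifts of coordinate
  fields for the uniqueness of the canonical connection.\<close>

lemma nab_expand:
  assumes U: "openin (mtop M) U" and E: "\<And>a. a \<in> A \<Longrightarrow> vfield M U (E a)" and F: "\<And>b. b \<in> B \<Longrightarrow> vfield M U (F b)"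
    and f: "\<And>a. a \<in> A \<Longrightarrow> smooth_fun M U (f a)" and h: "\<And>b. b \<in> B \<Longrightarrow> smooth_fun M U (h b)"
    and X: "vfield M U X" and Y: "vfield M U Y"
    and Xe: "\<And>q. q \<in> U \<Longrightarrow> X q = (\<Sum>a\<in>A. tscale (f a q) (E a q))"
    and Ye: "\<And>q. q \<in> U \<Longrightarrow> Y q = (\<Sum>b\<in>B. tscale (h b q) (F b q))" and p: "p \<in> U"
  shows "nab X Y p = (\<Sum>a\<in>A. \<Sum>b\<in>B. tscale (f a p)
     (tscale (dirder M p (E a p) (h b)) (F b p) + tscale (h b p) (nab (E a) (F b) p)))"
proof -
  have v1: "vfield M U (fscale (f a) (E a))" if "a \<in> A" for a using vfield_fscale[OF U f E] that by blast
  have v2: "vfield M U (fscale (h b) (F b))" if "b \<in> B" for b using vfield_fscale[OF U h F] that by blast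
  have sY: "vfield M U (\<Sum>b\<in>B. fscale (h b) (F b))" by (rule vfield_sum[OF U v2])
  have "nab X Y p = nab (\<Sum>a\<in>A. fscale (f a) (E a)) (\<Sum>b\<in>B. fscale (h b) (F b)) p"
    by (rule nab_local[OF U X vfield_sum[OF U v1] Y sY p])
       (auto simp: Xe Ye sum_fun_apply fscale_def)
  also have "\<dots> = (\<Sum>a\<in>A. nab (fscale (f a) (E a)) (\<Sum>b\<in>B. fscale (h b) (F b)) p)"
    by (rule nab_sum1[OF U v1 sY p])
  also have "\<dots> = (\<Sum>a\<in>A. tscale (f a p) (\<Sum>b\<in>B. nab (E a) (fscale (h b) (F b)) p))"
  proof (rule sum.cong[OF refl])
    fix a assume a: "a \<in> A"
    have "nab (E a) (\<Sum>b\<in>B. fscale (h b) (F b)) p = (\<Sum>b\<in>B. nab (E a) (fscale (h b) (F b)) p)"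
      by (rule nab_sum2[OF U v2 E[OF a] p])
    then show "nab (fscale (f a) (E a)) (\<Sum>b\<in>B. fscale (h b) (F b)) p
       = tscale (f a p) (\<Sum>b\<in>B. nab (E a) (fscale (h b) (F b)) p)"
      by (simp only: nab_scale1[OF U E[OF a] sY f[OF a] p])
  qed
  also have "\<dots> = (\<Sum>a\<in>A. tscale (f a p) (\<Sum>b\<in>B.
      tscale (dirder M p (E a p) (h b)) (F b p) + tscale (h b p) (nab (E a) (F b) p)))"
    using nab_leibniz[OF U E F h p] by (intro sum.cong arg_cong2[where f=tscale]) auto
  finally show ?thesis
    by (simp add: tscale_def fun_eq_iff sum_fun_apply sum_distrib_left)
qed

lemma conn_matrix_coord_field:
  "i \<in> charts_at M p \<Longrightarrow> a < n \<Longrightarrow> conn_matrix M nab i p (coord_field M i a p) k b = christoffel M nab i a b k p"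
  by (simp add: conn_matrix_def coord_field_self if_distrib cong: if_cong)

text \<open>Both fields are expanded in coordinate fields over the part of \<open>U\<close> in the
  chart. The Leibniz rule contributes the derivatives of the components of \<open>Y\<close>, the
  values on coordinate fields contribute the Christoffel symbols.\<close>

lemma nab_formula:
  assumes U: "openin (mtop M) U" and X: "vfield M U X" and Y: "vfield M U Y" and p: "p \<in> U"
    and i: "i \<in> charts_at M p" and k: "k < n"
  shows "nab X Y p i k = vd M i p (X p) (\<lambda>q. Y q i k) + (\<Sum>b<n. conn_matrix M nab i p (X p) k b * Y p i b)"
proof -
  let ?V = "U \<inter> cdom M i" and ?E = "coord_field M i"
  have ic: "i \<in> charts M" using i by (simp add: charts_at_iff)
  have V: "openin (mtop M) ?V" using U cdom_open[OF ic] by auto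
  have pV: "p \<in> ?V" using p i by (simp add: charts_at_iff)
  have XV: "vfield M ?V X" and YV: "vfield M ?V Y" using vfield_subset X Y by blast+
  have E: "vfield M ?V (?E a)" if "a < n" for a using vfield_subset[OF _ coord_field_vfield[OF ic that]] by blast
  have ch: "i \<in> charts_at M q" if "q \<in> ?V" for q using that ic by (simp add: charts_at_iff)
  have sX: "smooth_fun M ?V (\<lambda>q. X q i a)" if "a < n" for a
    using vfield_smooth_at[OF V XV _ ch that] by (simp add: smooth_fun_iff[OF V])
  have sY: "smooth_fun M ?V (\<lambda>q. Y q i a)" if "a < n" for a
    using vfield_smooth_at[OF V YV _ ch that] by (simp add: smooth_fun_iff[OF V])
  have "nab X Y p = (\<Sum>a<n. \<Sum>b<n. tscale (X p i a)
     (tscale (dirder M p (?E a p) (\<lambda>q. Y q i b)) (?E b p) + tscale (Y p i b) (nab (?E a) (?E b) p)))"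
    by (rule nab_expand[OF V _ _ _ _ XV YV _ _ pV])
       (use E sX sY tangent_expand[OF vfield_tangent[OF XV] ch] tangent_expand[OF vfield_tangent[OF YV] ch] in auto)
  also have "\<dots> = (\<Sum>a<n. \<Sum>b<n. tscale (X p i a)
     (tscale (cpd M i a (\<lambda>q. Y q i b) p) (?E b p) + tscale (Y p i b) (nab (?E a) (?E b) p)))"
    by (intro sum.cong refl arg_cong2[where f=tscale] arg_cong2[where f="(+)"])
       (use dirder_eq[OF coord_field_tangent[OF i] vfield_smooth_at[OF V YV pV i] i] vd_coord_field[OF i] in auto)
  finally have "nab X Y p i k = (\<Sum>a<n. \<Sum>b<n. X p i a * (cpd M i a (\<lambda>q. Y q i b) p * (if k = b then 1 else 0)
      + Y p i b * christoffel M nab i a b k p))"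
    using k by (simp add: sum_fun_apply tscale_def coord_field_self[OF i] christoffel_def)
  also have "\<dots> = (\<Sum>a<n. X p i a * cpd M i a (\<lambda>q. Y q i k) p) + (\<Sum>a<n. \<Sum>b<n. christoffel M nab i a b k p * X p i a * Y p i b)"
    by (simp only: sum_mult_delta_add[OF k]) (simp add: sum.distrib mult_ac)
  also have "(\<Sum>a<n. \<Sum>b<n. christoffel M nab i a b k p * X p i a * Y p i b) = (\<Sum>b<n. conn_matrix M nab i p (X p) k b * Y p i b)"
    unfolding conn_matrix_def by (subst sum.swap) (simp add: sum_distrib_right)
  finally show ?thesis by (simp add: vd_def)
qed

lemma smooth_at_christoffel:
  assumes i: "i \<in> charts_at M p" and "a < n" "b < n" "k < n"
  shows "smooth_at M (christoffel M nab i a b k) p"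
proof -
  have ic: "i \<in> charts M" "p \<in> cdom M i" using i by (simp_all add: charts_at_iff)
  show ?thesis
    unfolding christoffel_def
    by (rule vfield_smooth_at[OF cdom_open[OF ic(1)] nab_vfield[OF cdom_open[OF ic(1)]] ic(2) i])
       (use assms coord_field_vfield[OF ic(1)] in auto)
qed

text \<open>The law expresses that \<open>\<nabla>\<^sub>u \<partial>\<^sub>b\<close>, computed in chart \<open>i\<close> and in chart \<open>j\<close>, is one tangent vector.\<close>

lemma conn_matrix_transform:
  assumes u: "u \<in> tangent_space M p" and i: "i \<in> charts_at M p" and j: "j \<in> charts_at M p"
    and k: "k < n" and b: "b < n"
  shows "(\<Sum>c<n. jacobian M i j p k c * conn_matrix M nab i p u c b) =
     vd M i p u (\<lambda>q. jacobian M i j q k b) + (\<Sum>c<n. conn_matrix M nab j p u k c * jacobian M i j p c b)"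
proof -
  let ?E = "coord_field M i"
  have ic: "i \<in> charts M" "p \<in> cdom M i" using i by (simp_all add: charts_at_iff)
  note U = cdom_open[OF ic(1)] and E = coord_field_vfield[OF ic(1)]
  \<comment> \<open>A field with constant components in chart \<open>i\<close> and value
    \<open>u\<close> at \<open>p\<close>, so that the derivative along the vector \<open>u\<close>
    can be taken as one along a field.\<close>
  define X where "X = (\<Sum>a<n. fscale (\<lambda>q. u i a) (?E a))"
  have X: "vfield M (cdom M i) X"
    unfolding X_def by (intro vfield_sum[OF U] vfield_fscale[OF U] smooth_fun_const[OF U] E) auto
  have Xp: "X p = u" using tangent_expand[OF u i] by (simp add: X_def sum_fun_apply fscale_def)
  let ?w = "nab X (?E b) p"
  have wt: "?w \<in> tangent_space M p" using vfield_tangent[OF nab_vfield[OF U X E[OF b]] ic(2)] .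
  have wi: "?w i c = conn_matrix M nab i p u c b" if c: "c < n" for c
  proof -
    have "near M p (\<lambda>q. ?E b q i c = (if c = b then 1 else 0))"
      by (rule near_mono[OF near_chart[OF i]]) (simp add: coord_field_self c b)
    from vd_cong[OF this i] have "vd M i p u (\<lambda>q. ?E b q i c) = 0" by (simp only: vd_const)
    then show ?thesis
      using nab_formula[OF U X E[OF b] ic(2) i c] b
      by (simp add: Xp coord_field_self[OF i] if_distrib cong: if_cong)
  qed
  have "near M p (\<lambda>q. ?E b q j k = jacobian M i j q k b)"
    by (rule near_mono[OF near_chart[OF j]]) (simp add: coord_field_def k)
  then have "vd M j p u (\<lambda>q. ?E b q j k) = vd M j p u (\<lambda>q. jacobian M i j q k b)"
    by (rule vd_cong[OF _ j])
  also have "\<dots> = vd M i p u (\<lambda>q. jacobian M i j q k b)"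
    by (rule vd_chart[OF u smooth_at_jacobian[OF i j b] j i])
  finally have "?w j k = vd M i p u (\<lambda>q. jacobian M i j q k b) + (\<Sum>c<n. conn_matrix M nab j p u k c * jacobian M i j p c b)"
    using nab_formula[OF U X E[OF b] ic(2) j k] j by (simp add: Xp coord_field_def)
  moreover have "?w j k = (\<Sum>c<n. jacobian M i j p k c * conn_matrix M nab i p u c b)"
    unfolding tangent_transform[OF wt i j k] by (intro sum.cong) (auto simp: wi)
  ultimately show ?thesis by simp
qed

section \<open>Lie brackets in a chart\<close>

lemma bracket_apply:
  assumes U: "openin (mtop M) U" and X: "vfield M U X" and Y: "vfield M U Y" and p: "p \<in> U"
    and i: "i \<in> charts_at M p" and k: "k < n"
  shows "bracket M X Y p i k = vd M i p (X p) (\<lambda>q. Y q i k) - vd M i p (Y p) (\<lambda>q. X q i k)"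
  unfolding bracket_def using i k
    dirder_eq[OF vfield_tangent[OF X p] vfield_smooth_at[OF U Y p i k] i]
    dirder_eq[OF vfield_tangent[OF Y p] vfield_smooth_at[OF U X p i k] i] by simp

text \<open>The second derivatives of \<open>f\<close> cancel by the symmetry of mixed partial
  derivatives; what is left are the derivatives of the components, which make up the
  bracket.\<close>

lemma vd_bracket:
  assumes U: "openin (mtop M) U" and X: "vfield M U X" and Y: "vfield M U Y" and p: "p \<in> U"
    and i: "i \<in> charts_at M p" and f: "smooth_at M f p"
  shows "vd M i p (X p) (\<lambda>q. vd M i q (Y q) f) - vd M i p (Y p) (\<lambda>q. vd M i q (X q) f)
     = vd M i p (bracket M X Y p) f"
proof -
  note sX = vfield_smooth_at[OF U X p i] and sY = vfield_smooth_at[OF U Y p i]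
  note sf = smooth_at_cpd[OF f i]
  have *: "vd M i p (X p) (\<lambda>q. vd M i q (Y q) f) = (\<Sum>b<n. vd M i p (X p) (\<lambda>q. Y q i b) * cpd M i b f p)
      + (\<Sum>b<n. \<Sum>a<n. X p i a * Y p i b * cpd M i a (cpd M i b f) p)"
    if "\<And>k. k < n \<Longrightarrow> smooth_at M (\<lambda>q. Y q i k) p" for X Y
  proof -
    have "vd M i p (X p) (\<lambda>q. vd M i q (Y q) f) = (\<Sum>b<n. vd M i p (X p) (\<lambda>q. Y q i b * cpd M i b f q))"
      unfolding vd_def[of M i _ "Y _"] by (rule vd_sum) (auto intro!: smooth_at_mult that sf i)
    also have "\<dots> = (\<Sum>b<n. vd M i p (X p) (\<lambda>q. Y q i b) * cpd M i b f p + Y p i b * vd M i p (X p) (cpd M i b f))"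
      by (intro sum.cong refl vd_mult that sf i) auto
    finally show ?thesis by (simp add: sum.distrib vd_def[of M i p "X p" "cpd M i _ f"] sum_distrib_left mult_ac)
  qed
  have "(\<Sum>b<n. \<Sum>a<n. Y p i a * X p i b * cpd M i a (cpd M i b f) p)
      = (\<Sum>b<n. \<Sum>a<n. X p i a * Y p i b * cpd M i a (cpd M i b f) p)"
    by (subst sum.swap) (intro sum.cong refl, simp add: cpd_commute[OF f i])
  then show ?thesis
    using *[where X=X and Y=Y, OF sY] *[where X=Y and Y=X, OF sX]
    by (simp add: vd_def[of M i p "bracket M X Y p"] bracket_apply[OF U X Y p i] left_diff_distrib sum_subtractf)
qed

end

locale tf_conn_mfd = conn_mfd M nab for M :: "('p, 'i) manifold" and nab +
  assumes torsionless: "torsionless M nab"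
begin

section \<open>Torsionless connections and vanishing curvature\<close>

lemma bracket_eq: "openin (mtop M) U \<Longrightarrow> vfield M U X \<Longrightarrow> vfield M U Y \<Longrightarrow> p \<in> U \<Longrightarrow>
    bracket M X Y p = nab X Y p - nab Y X p"
  using torsionless unfolding torsionless_def by metis

lemma bracket_vfield:
  assumes "openin (mtop M) U" "vfield M U X" "vfield M U Y" shows "vfield M U (bracket M X Y)"
  by (rule vfield_cong[OF assms(1) vfield_diff[OF assms(1) nab_vfield[OF assms] nab_vfield[OF assms(1,3,2)]]])
     (simp add: bracket_eq[OF assms])

lemma bracket_coord_field:
  assumes i: "i \<in> charts_at M p" and "a < n" "b < n"
  shows "bracket M (coord_field M i a) (coord_field M i b) p = 0"
proof -
  have ic: "i \<in> charts M" "p \<in> cdom M i" using i by (simp_all add: charts_at_iff)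
  note U = cdom_open[OF ic(1)] and E = coord_field_vfield[OF ic(1)]
  have *: "vd M i p u (\<lambda>q. coord_field M i a q i k) = 0" if "a < n" "k < n" for u a k
  proof -
    have "near M p (\<lambda>q. coord_field M i a q i k = (if k = a then 1 else 0))"
      by (rule near_mono[OF near_chart[OF i]]) (simp add: coord_field_self that)
    from vd_cong[OF this i] show ?thesis by (simp only: vd_const)
  qed
  show ?thesis
    by (rule tangent_eqI[OF vfield_tangent[OF bracket_vfield[OF U E E] ic(2)] tangent_space_zero i])
       (use assms in \<open>simp_all add: bracket_apply[OF U E E ic(2) i] *\<close>)
qed

lemma christoffel_sym:
  assumes i: "i \<in> charts_at M p" and "a < n" "b < n"
  shows "christoffel M nab i a b k p = christoffel M nab i b a k p"
proof -
  have ic: "i \<in> charts M" "p \<in> cdom M i" using i by (simp_all add: charts_at_iff)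
  note U = cdom_open[OF ic(1)] and E = coord_field_vfield[OF ic(1)]
  have "nab (coord_field M i a) (coord_field M i b) p - nab (coord_field M i b) (coord_field M i a) p = 0"
    using bracket_eq[OF U E E ic(2)] bracket_coord_field[OF assms] assms by simp
  then show ?thesis by (simp add: christoffel_def)
qed

lemma conn_matrix_sym:
  assumes i: "i \<in> charts_at M p"
  shows "(\<Sum>b<n. conn_matrix M nab i p u k b * v i b) = (\<Sum>b<n. conn_matrix M nab i p v k b * u i b)"
  unfolding conn_matrix_def sum_distrib_right
  by (subst sum.swap) (intro sum.cong refl, simp add: christoffel_sym[OF i] mult_ac)

text \<open>Flatness evaluated on three coordinate fields; the bracket term drops out because
  coordinate fields commute.\<close>

lemma curvature_components:
  assumes flat: "flat M nab" and i: "i \<in> charts_at M p" and abc: "a < n" "b < n" "c < n" "k < n"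
  shows "cpd M i a (christoffel M nab i b c k) p - cpd M i b (christoffel M nab i a c k) p
    + (\<Sum>d<n. christoffel M nab i a d k p * christoffel M nab i b c d p - christoffel M nab i b d k p * christoffel M nab i a c d p) = 0"
proof -
  have ic: "i \<in> charts M" "p \<in> cdom M i" using i by (simp_all add: charts_at_iff)
  let ?E = "coord_field M i"
  note U = cdom_open[OF ic(1)] and E = coord_field_vfield[OF ic(1)]
  have ch: "christoffel M nab i b c = (\<lambda>k q. nab (?E b) (?E c) q i k)" for b c
    by (simp add: fun_eq_iff christoffel_def)
  have *: "nab (?E a) (nab (?E b) (?E c)) p i k = cpd M i a (christoffel M nab i b c k) p
     + (\<Sum>d<n. christoffel M nab i a d k p * christoffel M nab i b c d p)" if "a < n" "b < n" for a b
    using nab_formula[OF U E[OF that(1)] nab_vfield[OF U E[OF that(2)] E[OF abc(3)]] ic(2) i abc(4)]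
    by (simp add: vd_coord_field[OF i that(1)] conn_matrix_coord_field[OF i that(1)] ch[of b c])
  \<comment> \<open>The bracket vanishes on the whole chart domain, so locality replaces it by the
    zero field.\<close>
  have "nab (bracket M (?E a) (?E b)) (?E c) p = nab 0 (?E c) p"
    by (rule nab_local[OF U bracket_vfield[OF U E E] vfield_zero[OF U] E E ic(2)])
       (use abc ic(1) in \<open>auto intro!: bracket_coord_field simp: charts_at_iff\<close>)
  also have "\<dots> = 0" by (rule nab_zero1[OF U E[OF abc(3)] ic(2)])
  finally have "nab (?E a) (nab (?E b) (?E c)) p - nab (?E b) (nab (?E a) (?E c)) p = 0"
    using flat[unfolded flat_def, rule_format, of "cdom M i" "?E a" "?E b" "?E c" p] U E abc ic(2)
    by (simp only: diff_0_right simp_thms)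
  then have "nab (?E a) (nab (?E b) (?E c)) p i k - nab (?E b) (nab (?E a) (?E c)) p i k = 0"
    by (simp add: fun_eq_iff)
  then show ?thesis unfolding *[OF abc(1,2)] *[OF abc(2,1)] by (simp add: sum_subtractf)
qed

text \<open>The equation dA + A \<and> A = 0 for the connection form \<open>A = conn_matrix\<close>,
  evaluated on vectors \<open>u\<close> and \<open>w\<close> with components frozen in chart
  \<open>i\<close>. It is \<open>curvature_components\<close> contracted with both vectors, the form
  needed on the bundle, where \<open>u\<close> and \<open>w\<close> become horizontal parts.\<close>

lemma curvature_zero:
  assumes flat: "flat M nab" and i: "i \<in> charts_at M p" and "k < n" "b < n"
  shows "(\<Sum>a<n. vd M i p u (christoffel M nab i a b k) * w i a) - (\<Sum>a<n. vd M i p w (christoffel M nab i a b k) * u i a)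
    + (\<Sum>d<n. conn_matrix M nab i p u k d * conn_matrix M nab i p w d b - conn_matrix M nab i p w k d * conn_matrix M nab i p u d b) = 0"
proof -
  let ?G = "\<lambda>a b k. christoffel M nab i a b k"
  have 1: "(\<Sum>a<n. vd M i p u (?G a b k) * w i a) = (\<Sum>c<n. \<Sum>a<n. u i c * w i a * cpd M i c (?G a b k) p)" for u w
    unfolding vd_def sum_distrib_right by (subst sum.swap) (simp add: mult_ac)
  have 2: "(\<Sum>a<n. vd M i p w (?G a b k) * u i a) = (\<Sum>c<n. \<Sum>a<n. u i c * w i a * cpd M i a (?G c b k) p)"
    unfolding vd_def sum_distrib_right by (simp add: mult_ac)
  have 3: "(\<Sum>d<n. conn_matrix M nab i p u k d * conn_matrix M nab i p w d b)
      = (\<Sum>c<n. \<Sum>a<n. u i c * w i a * (\<Sum>d<n. ?G c d k p * ?G a b d p))"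
  proof -
    have "(\<Sum>d<n. conn_matrix M nab i p u k d * conn_matrix M nab i p w d b)
      = (\<Sum>d<n. \<Sum>c<n. \<Sum>a<n. u i c * w i a * (?G c d k p * ?G a b d p))"
      unfolding conn_matrix_def sum_product by (simp add: mult_ac)
    also have "\<dots> = (\<Sum>c<n. \<Sum>d<n. \<Sum>a<n. u i c * w i a * (?G c d k p * ?G a b d p))" by (rule sum.swap)
    also have "\<dots> = (\<Sum>c<n. \<Sum>a<n. \<Sum>d<n. u i c * w i a * (?G c d k p * ?G a b d p))"
      by (intro sum.cong refl sum.swap)
    finally show ?thesis by (simp add: sum_distrib_left)
  qed
  have 4: "(\<Sum>d<n. conn_matrix M nab i p w k d * conn_matrix M nab i p u d b)
      = (\<Sum>c<n. \<Sum>a<n. u i c * w i a * (\<Sum>d<n. ?G a d k p * ?G c b d p))"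
  proof -
    have "(\<Sum>d<n. conn_matrix M nab i p w k d * conn_matrix M nab i p u d b)
      = (\<Sum>d<n. \<Sum>a<n. \<Sum>c<n. u i c * w i a * (?G a d k p * ?G c b d p))"
      unfolding conn_matrix_def sum_product by (simp add: mult_ac)
    also have "\<dots> = (\<Sum>d<n. \<Sum>c<n. \<Sum>a<n. u i c * w i a * (?G a d k p * ?G c b d p))"
      by (intro sum.cong refl sum.swap)
    also have "\<dots> = (\<Sum>c<n. \<Sum>d<n. \<Sum>a<n. u i c * w i a * (?G a d k p * ?G c b d p))" by (rule sum.swap)
    also have "\<dots> = (\<Sum>c<n. \<Sum>a<n. \<Sum>d<n. u i c * w i a * (?G a d k p * ?G c b d p))"
      by (intro sum.cong refl sum.swap)
    finally show ?thesis by (simp add: sum_distrib_left)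
  qed
  have "(\<Sum>c<n. \<Sum>a<n. u i c * w i a * (cpd M i c (?G a b k) p - cpd M i a (?G c b k) p
      + (\<Sum>d<n. ?G c d k p * ?G a b d p - ?G a d k p * ?G c b d p))) = 0"
    by (intro sum.neutral ballI) (use curvature_components[OF flat i _ _ assms(4,3)] in auto)
  then show ?thesis
    unfolding sum_subtractf 1[of u w] 2 3 4 by (simp add: sum_subtractf sum.distrib distrib_left right_diff_distrib)
qed

end

section \<open>Riemannian metrics and orthonormal frames\<close>

context smooth_mfd
begin

text \<open>Linearity is asked for on the tangent space only, because metrics and other tensors are
  total functions that are unconstrained off it.\<close>

definition linear_at :: "'p \<Rightarrow> ('i tvec \<Rightarrow> real) \<Rightarrow> bool" where
  "linear_at p \<phi> \<longleftrightarrow> (\<forall>u\<in>tangent_space M p. \<forall>v\<in>tangent_space M p. \<phi> (u + v) = \<phi> u + \<phi> v) \<and>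
     (\<forall>u\<in>tangent_space M p. \<forall>c. \<phi> (tscale c u) = c * \<phi> u)"

lemma linear_at_add: "linear_at p \<phi> \<Longrightarrow> u \<in> tangent_space M p \<Longrightarrow> v \<in> tangent_space M p \<Longrightarrow> \<phi> (u + v) = \<phi> u + \<phi> v"
  and linear_at_scale: "linear_at p \<phi> \<Longrightarrow> u \<in> tangent_space M p \<Longrightarrow> \<phi> (tscale c u) = c * \<phi> u"
  by (auto simp: linear_at_def)

lemma linear_at_zero: "linear_at p \<phi> \<Longrightarrow> \<phi> 0 = 0"
  using linear_at_add[of p \<phi> 0 0] tangent_space_zero[of M p] by auto

lemma linear_at_minus: "linear_at p \<phi> \<Longrightarrow> u \<in> tangent_space M p \<Longrightarrow> \<phi> (- u) = - \<phi> u"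
  using linear_at_scale[of p \<phi> u "-1"] by (simp add: tscale_minus_one)

lemma linear_at_diff: "linear_at p \<phi> \<Longrightarrow> u \<in> tangent_space M p \<Longrightarrow> v \<in> tangent_space M p \<Longrightarrow> \<phi> (u - v) = \<phi> u - \<phi> v"
  using linear_at_add[of p \<phi> u "- v"] linear_at_minus[of p \<phi> v] tangent_minus[of v p]
  by (simp only: add_uminus_conv_diff[symmetric])

lemma linear_at_sum:
  assumes "linear_at p \<phi>" "\<And>a. a \<in> A \<Longrightarrow> u a \<in> tangent_space M p"
  shows "\<phi> (\<Sum>a\<in>A. u a) = (\<Sum>a\<in>A. \<phi> (u a))"
  using assms(2)
proof (induction A rule: infinite_finite_induct)
  case (insert x F)
  then have "\<phi> (u x + sum u F) = \<phi> (u x) + \<phi> (sum u F)"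
    by (intro linear_at_add[OF assms(1)] tangent_sum) auto
  with insert show ?case by (simp only: sum.insert[OF insert.hyps]) auto
qed (auto simp: linear_at_zero[OF assms(1)])

lemma linear_at_comb:
  assumes "linear_at p \<phi>" "\<And>a. a \<in> A \<Longrightarrow> u a \<in> tangent_space M p"
  shows "\<phi> (\<Sum>a\<in>A. tscale (c a) (u a)) = (\<Sum>a\<in>A. c a * \<phi> (u a))"
  using linear_at_sum[OF assms(1), of A "\<lambda>a. tscale (c a) (u a)"] assms(2)
  by (simp add: tangent_scale linear_at_scale[OF assms(1)])

lemma linear_at_chart:
  assumes "linear_at p \<phi>" "u \<in> tangent_space M p" "i \<in> charts_at M p"
  shows "\<phi> u = (\<Sum>a<n. \<phi> (coord_field M i a p) * u i a)"
proof -
  have "\<phi> u = \<phi> (\<Sum>a<n. tscale (u i a) (coord_field M i a p))" using tangent_expand[OF assms(2,3)] by simp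
  then show ?thesis
    using linear_at_comb[OF assms(1), of "{..<n}" "\<lambda>a. coord_field M i a p"] coord_field_tangent[OF assms(3)]
    by (simp add: mult.commute)
qed

text \<open>Take constant components in the chart. Pointwise identities between tensors are derived
  from identities between fields in this way.\<close>

lemma tangent_extend:
  assumes u: "u \<in> tangent_space M p" and i: "i \<in> charts_at M p"
  obtains X where "vfield M (cdom M i) X" "X p = u"
proof (rule that[of "\<Sum>a<n. fscale (\<lambda>q. u i a) (coord_field M i a)"])
  have ic: "i \<in> charts M" "p \<in> cdom M i" using i by (simp_all add: charts_at_iff)
  note U = cdom_open[OF ic(1)] and E = coord_field_vfield[OF ic(1)]
  show "vfield M (cdom M i) (\<Sum>a<n. fscale (\<lambda>q. u i a) (coord_field M i a))"
    by (intro vfield_sum[OF U] vfield_fscale[OF U] E)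
       (use ic(1) in \<open>auto simp: smooth_fun_iff[OF U] charts_at_iff intro: smooth_at_const\<close>)
  show "(\<Sum>a<n. fscale (\<lambda>q. u i a) (coord_field M i a)) p = u"
    using tangent_expand[OF u i] by (simp add: sum_fun_apply fscale_def)
qed

end

locale riem_mfd = smooth_mfd M for M :: "('p, 'i) manifold" +
  fixes g :: "('p, 'i) metric"
  assumes riem: "riemannian_metric M g"
begin

section \<open>Algebra and components of a Riemannian metric\<close>

lemma g_pos: "p \<in> topspace (mtop M) \<Longrightarrow> u \<in> tangent_space M p \<Longrightarrow> u \<noteq> 0 \<Longrightarrow> g p u u > 0"
  using riem by (simp add: riemannian_metric_def)

lemma g_sym: "p \<in> topspace (mtop M) \<Longrightarrow> u \<in> tangent_space M p \<Longrightarrow> v \<in> tangent_space M p \<Longrightarrow> g p u v = g p v u"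
  using riem unfolding riemannian_metric_def by blast

lemma g_linear1:
  assumes p: "p \<in> topspace (mtop M)" and w: "w \<in> tangent_space M p"
  shows "linear_at p (\<lambda>u. g p u w)"
proof -
  have r: "\<forall>v\<in>tangent_space M p. g p u v = g p v u \<and> (\<forall>c. g p (tscale c u) v = c * g p u v) \<and>
      (\<forall>w\<in>tangent_space M p. g p (u + v) w = g p u w + g p v w)" if "u \<in> tangent_space M p" for u
    using riem p that unfolding riemannian_metric_def by blast
  show ?thesis unfolding linear_at_def using r w by blast
qed

lemma g_linear2: "p \<in> topspace (mtop M) \<Longrightarrow> w \<in> tangent_space M p \<Longrightarrow> linear_at p (g p w)"
  using g_linear1[of p w] g_sym[of p w] unfolding linear_at_def by (auto simp: tangent_add tangent_scale)

lemma g_smooth_fun: "openin (mtop M) U \<Longrightarrow> vfield M U X \<Longrightarrow> vfield M U Y \<Longrightarrow> smooth_fun M U (\<lambda>p. g p (X p) (Y p))"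
  by (rule conjunct2[OF riem[unfolded riemannian_metric_def], rule_format]) simp

lemma g_smooth_at: "openin (mtop M) U \<Longrightarrow> vfield M U X \<Longrightarrow> vfield M U Y \<Longrightarrow> p \<in> U \<Longrightarrow> smooth_at M (\<lambda>p. g p (X p) (Y p)) p"
  using g_smooth_fun smooth_fun_iff by blast

lemma g_nonneg: "p \<in> topspace (mtop M) \<Longrightarrow> u \<in> tangent_space M p \<Longrightarrow> g p u u \<ge> 0"
  using g_pos[of p u] linear_at_zero[OF g_linear1[of p u]] by (cases "u = 0") auto

lemma g_eqI:
  assumes p: "p \<in> topspace (mtop M)" and w: "w \<in> tangent_space M p" "w' \<in> tangent_space M p"
    and eq: "\<And>z. z \<in> tangent_space M p \<Longrightarrow> g p w z = g p w' z"
  shows "w = w'"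
proof (rule ccontr)
  assume "w \<noteq> w'"
  then have "w - w' \<noteq> 0" by simp
  from g_pos[OF p tangent_diff[OF w] this]
  show False using linear_at_diff[OF g_linear1[OF p tangent_diff[OF w]] w] eq[OF tangent_diff[OF w]] by simp
qed

definition gcomp :: "'i \<Rightarrow> nat \<Rightarrow> nat \<Rightarrow> 'p \<Rightarrow> real" where
  "gcomp i a b p = g p (coord_field M i a p) (coord_field M i b p)"

lemma smooth_at_gcomp:
  assumes "i \<in> charts_at M p" "a < n" "b < n"
  shows "smooth_at M (gcomp i a b) p"
proof -
  have ic: "i \<in> charts M" "p \<in> cdom M i" using assms by (simp_all add: charts_at_iff)
  show ?thesis
    unfolding gcomp_def[abs_def]
    by (rule g_smooth_at[OF cdom_open[OF ic(1)] coord_field_vfield coord_field_vfield]) (use ic assms in auto)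
qed

lemma gcomp_sym: "i \<in> charts_at M p \<Longrightarrow> a < n \<Longrightarrow> b < n \<Longrightarrow> gcomp i a b p = gcomp i b a p"
  unfolding gcomp_def by (intro g_sym coord_field_tangent charts_at_topspace)

lemma g_chart:
  assumes i: "i \<in> charts_at M p" and u: "u \<in> tangent_space M p" and v: "v \<in> tangent_space M p"
  shows "g p u v = (\<Sum>a<n. \<Sum>b<n. gcomp i a b p * u i a * v i b)"
proof -
  note p = charts_at_topspace[OF i]
  have "g p u v = (\<Sum>a<n. g p (coord_field M i a p) v * u i a)"
    by (rule linear_at_chart[OF g_linear1[OF p v] u i])
  also have "\<dots> = (\<Sum>a<n. (\<Sum>b<n. gcomp i a b p * v i b) * u i a)"
    by (intro sum.cong refl arg_cong2[where f="(*)"])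
       (simp add: linear_at_chart[OF g_linear2[OF p coord_field_tangent[OF i]] v i] gcomp_def)
  finally show ?thesis by (simp add: sum_distrib_right sum_distrib_left mult_ac)
qed

text \<open>Spanning is not part of the definition: that \<open>n\<close> orthonormal vectors span
  the tangent space is the content of \<open>onb_expand\<close>.\<close>

definition onb :: "'p \<Rightarrow> (nat \<Rightarrow> 'i tvec) \<Rightarrow> bool" where
  "onb p e \<longleftrightarrow> (\<forall>a<n. e a \<in> tangent_space M p) \<and> (\<forall>a<n. \<forall>b<n. g p (e a) (e b) = (if a = b then 1 else 0))"

lemma onb_tangent: "onb p e \<Longrightarrow> a < n \<Longrightarrow> e a \<in> tangent_space M p"
  by (simp add: onb_def)

lemma onb_g: "onb p e \<Longrightarrow> a < n \<Longrightarrow> b < n \<Longrightarrow> g p (e a) (e b) = (if a = b then 1 else 0)"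
  unfolding onb_def by blast

lemma onb_sum:
  assumes "onb p e" "b < n"
  shows "(\<Sum>a<n. c a * g p (e a) (e b)) = c b"
proof -
  have "(\<Sum>a<n. c a * g p (e a) (e b)) = (\<Sum>a<n. if a = b then c a else 0)"
    by (intro sum.cong) (auto simp: onb_g[OF assms(1) _ assms(2)])
  with assms(2) show ?thesis by simp
qed

lemma orthonormal_frame_onb: "orthonormal_frame M g U E \<Longrightarrow> p \<in> U \<Longrightarrow> onb p (\<lambda>a. E a p)"
  by (auto simp: orthonormal_frame_def onb_def vfield_tangent)

text \<open>The triangular shape in chart \<open>i\<close>, where \<open>E a\<close> has no
  components beyond the \<open>a\<close>-th, is carried along in order to normalise: subtracting the
  projections from the \<open>m\<close>-th coordinate field leaves its \<open>m\<close>-th component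
  equal to 1, so the difference \<open>W\<close> vanishes nowhere. The last conclusion keeps track
  of the span.\<close>

lemma gram_schmidt_step:
  assumes i: "i \<in> charts M" and m: "m < n" and E: "\<And>a. a < m \<Longrightarrow> vfield M (cdom M i) (E a)"
    and on: "\<And>p a b. p \<in> cdom M i \<Longrightarrow> a < m \<Longrightarrow> b < m \<Longrightarrow> g p (E a p) (E b p) = (if a = b then 1 else 0)"
    and tri: "\<And>p a k. p \<in> cdom M i \<Longrightarrow> a < m \<Longrightarrow> a < k \<Longrightarrow> k < n \<Longrightarrow> E a p i k = 0"
  obtains F where "vfield M (cdom M i) F" "\<And>p. p \<in> cdom M i \<Longrightarrow> g p (F p) (F p) = 1"
    "\<And>p b. p \<in> cdom M i \<Longrightarrow> b < m \<Longrightarrow> g p (F p) (E b p) = 0"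
    "\<And>p k. p \<in> cdom M i \<Longrightarrow> m < k \<Longrightarrow> k < n \<Longrightarrow> F p i k = 0"
    "\<And>p. p \<in> cdom M i \<Longrightarrow> \<exists>c d. coord_field M i m p = tscale d (F p) + (\<Sum>b<m. tscale (c b) (E b p))"
proof -
  note U = cdom_open[OF i] and V = coord_field_vfield[OF i m]
  let ?V = "coord_field M i m"
  define W where "W = ?V - (\<Sum>b<m. fscale (\<lambda>p. g p (?V p) (E b p)) (E b))"
  define N where "N p = g p (W p) (W p)" for p
  define F where "F = fscale (\<lambda>p. 1 / sqrt (N p)) W"
  have W: "vfield M (cdom M i) W"
    unfolding W_def by (intro vfield_diff[OF U V] vfield_sum[OF U] vfield_fscale[OF U] g_smooth_fun[OF U V] E) auto
  have Wp: "W p = ?V p - (\<Sum>b<m. tscale (g p (?V p) (E b p)) (E b p))" for p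
    by (simp add: W_def sum_fun_apply fscale_def)
  have ch: "i \<in> charts_at M p" if "p \<in> cdom M i" for p using that i by (simp add: charts_at_iff)
  note top = charts_at_topspace[OF ch]
  have Et: "E b p \<in> tangent_space M p" if "p \<in> cdom M i" "b < m" for p b using vfield_tangent[OF E] that by blast
  \<comment> \<open>The subtracted vectors have indices below \<open>m\<close> and hence no
    components from \<open>m\<close> on.\<close>
  have Wk: "W p i k = (if k = m then 1 else 0)" if "p \<in> cdom M i" "m \<le> k" "k < n" for p k
    using that m tri[OF that(1)] by (simp add: Wp sum_fun_apply tscale_def coord_field_self[OF ch])
  have WE: "g p (W p) (E b p) = 0" if p: "p \<in> cdom M i" and b: "b < m" for p b
  proof -
    note l = g_linear1[OF top[OF p] Et[OF p b]]
    have "g p (W p) (E b p) = g p (?V p) (E b p) - g p (\<Sum>b<m. tscale (g p (?V p) (E b p)) (E b p)) (E b p)"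
      unfolding Wp by (rule linear_at_diff[OF l vfield_tangent[OF V p] tangent_sum]) (auto intro!: tangent_scale Et[OF p])
    also have "g p (\<Sum>b<m. tscale (g p (?V p) (E b p)) (E b p)) (E b p) = (\<Sum>c<m. g p (?V p) (E c p) * g p (E c p) (E b p))"
      by (rule linear_at_comb[OF l]) (auto intro: Et[OF p])
    also have "\<dots> = g p (?V p) (E b p)" using b by (simp add: on[OF p] if_distrib cong: if_cong)
    finally show ?thesis by simp
  qed
  have N: "N p > 0" if p: "p \<in> cdom M i" for p
    unfolding N_def
  proof (rule g_pos[OF top[OF p] vfield_tangent[OF W p]])
    have "W p i m = 1" using Wk[OF p _ m] by simp
    then show "W p \<noteq> 0" by auto
  qed
  have sN: "smooth_fun M (cdom M i) (\<lambda>p. 1 / sqrt (N p))"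
    unfolding smooth_fun_iff[OF U]
  proof
    fix p assume p: "p \<in> cdom M i"
    show "smooth_at M (\<lambda>p. 1 / sqrt (N p)) p"
      by (rule smooth_at_inverse_sqrt) (use g_smooth_at[OF U W W p] N nearI[OF U p] in \<open>auto simp: N_def[abs_def]\<close>)
  qed
  have F: "vfield M (cdom M i) F" unfolding F_def by (rule vfield_fscale[OF U sN W])
  have Fp: "F p = tscale (1 / sqrt (N p)) (W p)" for p by (simp add: F_def fscale_def)
  show ?thesis
  proof (rule that[OF F])
    fix p assume p: "p \<in> cdom M i"
    note wt = vfield_tangent[OF W p]
    show "g p (F p) (F p) = 1"
      unfolding Fp linear_at_scale[OF g_linear1[OF top[OF p] tangent_scale[OF wt]] wt]
        linear_at_scale[OF g_linear2[OF top[OF p] wt] wt]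
      using N[OF p] by (simp add: N_def[symmetric])
    show "g p (F p) (E b p) = 0" if "b < m" for b
      unfolding Fp linear_at_scale[OF g_linear1[OF top[OF p] Et[OF p that]] wt] by (simp add: WE[OF p that])
    show "F p i k = 0" if "m < k" "k < n" for k using Wk[OF p _ that(2)] that by (simp add: Fp tscale_def)
    have "?V p = tscale (sqrt (N p)) (F p) + (\<Sum>b<m. tscale (g p (?V p) (E b p)) (E b p))"
      using N[OF p] by (simp add: Fp Wp tscale_def fun_eq_iff)
    then show "\<exists>c d. ?V p = tscale d (F p) + (\<Sum>b<m. tscale (c b) (E b p))"
      by (intro exI[of _ "\<lambda>b. g p (?V p) (E b p)"] exI[of _ "sqrt (N p)"])
  qed
qed

definition partial_frame :: "'i \<Rightarrow> nat \<Rightarrow> (nat \<Rightarrow> ('p, 'i) field) \<Rightarrow> bool" where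
  "partial_frame i m E \<longleftrightarrow> (\<forall>a<m. vfield M (cdom M i) (E a)) \<and>
    (\<forall>p\<in>cdom M i. \<forall>a<m. \<forall>b<m. g p (E a p) (E b p) = (if a = b then 1 else 0)) \<and>
    (\<forall>p\<in>cdom M i. \<forall>a<m. \<forall>k. a < k \<and> k < n \<longrightarrow> E a p i k = 0) \<and>
    (\<forall>p\<in>cdom M i. \<forall>a<m. \<exists>c. coord_field M i a p = (\<Sum>b<m. tscale (c b) (E b p)))"

lemma gram_schmidt:
  assumes i: "i \<in> charts M" and "m \<le> n"
  shows "\<exists>E. partial_frame i m E"
  using assms(2)
proof (induction m)
  case 0
  show ?case by (simp add: partial_frame_def)
next
  case (Suc m)
  then obtain E where fr: "partial_frame i m E" by auto
  have E: "\<And>a. a < m \<Longrightarrow> vfield M (cdom M i) (E a)"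
    and on: "\<And>p a b. p \<in> cdom M i \<Longrightarrow> a < m \<Longrightarrow> b < m \<Longrightarrow> g p (E a p) (E b p) = (if a = b then 1 else 0)"
    and tri: "\<And>p a k. p \<in> cdom M i \<Longrightarrow> a < m \<Longrightarrow> a < k \<Longrightarrow> k < n \<Longrightarrow> E a p i k = 0"
    and sp: "\<And>p a. p \<in> cdom M i \<Longrightarrow> a < m \<Longrightarrow> \<exists>c. coord_field M i a p = (\<Sum>b<m. tscale (c b) (E b p))"
    using fr unfolding partial_frame_def by blast+
  obtain F where F: "vfield M (cdom M i) F" "\<And>p. p \<in> cdom M i \<Longrightarrow> g p (F p) (F p) = 1"
    "\<And>p b. p \<in> cdom M i \<Longrightarrow> b < m \<Longrightarrow> g p (F p) (E b p) = 0"
    "\<And>p k. p \<in> cdom M i \<Longrightarrow> m < k \<Longrightarrow> k < n \<Longrightarrow> F p i k = 0"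
    "\<And>p. p \<in> cdom M i \<Longrightarrow> \<exists>c d. coord_field M i m p = tscale d (F p) + (\<Sum>b<m. tscale (c b) (E b p))"
    by (rule gram_schmidt_step[OF i _ E on tri]) (use Suc.prems in auto)
  let ?E = "E(m := F)"
  have F3: "g p (E b p) (F p) = 0" if p: "p \<in> cdom M i" and b: "b < m" for p b
    using F(3)[OF that] g_sym[OF _ vfield_tangent[OF E[OF b] p] vfield_tangent[OF F(1) p]] i p
    by (metis charts_at_iff charts_at_topspace)
  show ?case
    unfolding partial_frame_def
  proof (intro exI[of _ ?E] conjI ballI allI impI)
    show "vfield M (cdom M i) (?E a)" if "a < Suc m" for a using E F(1) that by (auto simp: less_Suc_eq)
    fix p assume p: "p \<in> cdom M i"
    show "g p (?E a p) (?E b p) = (if a = b then 1 else 0)" if "a < Suc m" "b < Suc m" for a b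
      using on[OF p] F(2,3)[OF p] F3[OF p] that by (auto simp: less_Suc_eq)
    show "?E a p i k = 0" if "a < Suc m" "a < k \<and> k < n" for a k
      using tri[OF p] F(4)[OF p] that by (auto simp: less_Suc_eq)
    have sum_eq: "(\<Sum>b<Suc m. tscale (c b) (?E b p)) = tscale (c m) (F p) + (\<Sum>b<m. tscale (c b) (E b p))" for c
      by (simp add: add.commute)
    show "\<exists>c. coord_field M i a p = (\<Sum>b<Suc m. tscale (c b) (?E b p))" if aS: "a < Suc m" for a
    proof (cases "a = m")
      case True
      obtain c d where "coord_field M i m p = tscale d (F p) + (\<Sum>b<m. tscale (c b) (E b p))" using F(5)[OF p] by blast
      with True show ?thesis unfolding sum_eq by (intro exI[of _ "c(m := d)"]) simp
    next
      case False
      then obtain c where "coord_field M i a p = (\<Sum>b<m. tscale (c b) (E b p))" using sp[OF p, of a] aS by auto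
      then show ?thesis unfolding sum_eq by (intro exI[of _ "c(m := 0)"]) (simp add: tscale_def fun_eq_iff)
    qed
  qed
qed

lemma onb_coefficients:
  assumes "onb p e" "p \<in> topspace (mtop M)" "u = (\<Sum>a<n. tscale (c a) (e a))"
  shows "u = (\<Sum>a<n. tscale (g p u (e a)) (e a))"
proof -
  have "g p u (e b) = c b" if "b < n" for b
    using linear_at_comb[OF g_linear1[OF assms(2) onb_tangent[OF assms(1) that]], of "{..<n}" e c] assms(1) that
    unfolding assms(3) by (simp add: onb_sum[OF assms(1)] onb_tangent[OF assms(1)])
  then have "(\<Sum>a<n. tscale (c a) (e a)) = (\<Sum>a<n. tscale (g p u (e a)) (e a))" by simp
  with assms(3) show ?thesis by (rule trans)
qed

lemma spanning_frame:
  assumes i: "i \<in> charts M"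
  obtains E where "orthonormal_frame M g (cdom M i) E"
    "\<And>p u. p \<in> cdom M i \<Longrightarrow> u \<in> tangent_space M p \<Longrightarrow> u = (\<Sum>a<n. tscale (g p u (E a p)) (E a p))"
proof -
  obtain E where pf: "partial_frame i n E" using gram_schmidt[OF i order_refl] ..
  have E: "\<And>a. a < n \<Longrightarrow> vfield M (cdom M i) (E a)"
    and on: "\<And>p a b. p \<in> cdom M i \<Longrightarrow> a < n \<Longrightarrow> b < n \<Longrightarrow> g p (E a p) (E b p) = (if a = b then 1 else 0)"
    and sp: "\<And>p a. p \<in> cdom M i \<Longrightarrow> a < n \<Longrightarrow> \<exists>c. coord_field M i a p = (\<Sum>b<n. tscale (c b) (E b p))"
    using pf unfolding partial_frame_def by blast+
  have fr: "orthonormal_frame M g (cdom M i) E"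
    using E on cdom_open[OF i] by (simp add: orthonormal_frame_def)
  show ?thesis
  proof (rule that[OF fr])
    fix p u assume p: "p \<in> cdom M i" and u: "u \<in> tangent_space M p"
    have ip: "i \<in> charts_at M p" using i p by (simp add: charts_at_iff)
    obtain c where c: "\<And>a. a < n \<Longrightarrow> coord_field M i a p = (\<Sum>b<n. tscale (c a b) (E b p))" using sp[OF p] by metis
    have "u = (\<Sum>a<n. tscale (u i a) (\<Sum>b<n. tscale (c a b) (E b p)))"
      using tangent_expand[OF u ip] c by simp
    also have "\<dots> = (\<Sum>b<n. tscale (\<Sum>a<n. u i a * c a b) (E b p))"
      by (intro ext) (simp add: sum_fun_apply tscale_def sum_distrib_left sum_distrib_right mult.assoc, rule sum.swap)
    finally show "u = (\<Sum>a<n. tscale (g p u (E a p)) (E a p))"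
      by (rule onb_coefficients[OF orthonormal_frame_onb[OF fr p] charts_at_topspace[OF ip]])
  qed
qed

text \<open>
  Bessel's inequality for \<open>f\<close>, summed over a spanning orthonormal basis, is an equality; hence it is
  an equality for every member of that basis.
\<close>

lemma onb_expand:
  assumes f: "onb p f" and p: "p \<in> topspace (mtop M)" and u: "u \<in> tangent_space M p"
  shows "u = (\<Sum>a<n. tscale (g p u (f a)) (f a))"
proof -
  obtain i where i: "i \<in> charts_at M p" using p topspace_charts by blast
  then have ic: "i \<in> charts M" "p \<in> cdom M i" by (simp_all add: charts_at_iff)
  obtain E where E: "orthonormal_frame M g (cdom M i) E" and
    Ex0: "\<And>p u. p \<in> cdom M i \<Longrightarrow> u \<in> tangent_space M p \<Longrightarrow> u = (\<Sum>a<n. tscale (g p u (E a p)) (E a p))"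
    by (rule spanning_frame[OF ic(1)]) blast
  define e where "e = (\<lambda>a. E a p)"
  have Ex: "u = (\<Sum>a<n. tscale (g p u (e a)) (e a))" if "u \<in> tangent_space M p" for u
    unfolding e_def by (rule Ex0[OF ic(2) that])
  have e: "onb p e" unfolding e_def by (rule orthonormal_frame_onb[OF E ic(2)])
  note ft = onb_tangent[OF f] and et = onb_tangent[OF e]
  define Q where "Q a b = g p (f a) (e b)" for a b
  have row: "(\<Sum>b<n. Q a b * Q a b) = 1" if a: "a < n" for a
  proof -
    have "1 = g p (f a) (\<Sum>b<n. tscale (Q a b) (e b))"
      using Ex[OF ft[OF a]] onb_g[OF f a a] unfolding Q_def by simp
    also have "\<dots> = (\<Sum>b<n. Q a b * Q a b)"
      unfolding Q_def by (rule linear_at_comb[OF g_linear2[OF p ft[OF a]]]) (auto intro: et)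
    finally show ?thesis by simp
  qed
  \<comment> \<open>The part of \<open>e b\<close> orthogonal to all \<open>f a\<close>; its squared
    length is the defect in Bessel's inequality.\<close>
  define r where "r b = e b - (\<Sum>a<n. tscale (Q a b) (f a))" for b
  have st: "(\<Sum>a<n. tscale (Q a b) (f a)) \<in> tangent_space M p" for b by (intro tangent_sum tangent_scale ft) auto
  have rt: "r b \<in> tangent_space M p" if "b < n" for b unfolding r_def by (intro tangent_diff et that st)
  have gf: "g p (r b) (f c) = 0" if b: "b < n" and c: "c < n" for b c
  proof -
    note l = g_linear1[OF p ft[OF c]]
    have "g p (r b) (f c) = g p (e b) (f c) - (\<Sum>a<n. Q a b * g p (f a) (f c))"
      unfolding r_def linear_at_diff[OF l et[OF b] st] by (subst linear_at_comb[OF l]) (auto intro: ft)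
    also have "(\<Sum>a<n. Q a b * g p (f a) (f c)) = Q c b"
      by (rule onb_sum[OF f c])
    finally show ?thesis using g_sym[OF p et[OF b] ft[OF c]] by (simp add: Q_def)
  qed
  have nr: "g p (r b) (r b) = 1 - (\<Sum>a<n. Q a b * Q a b)" if b: "b < n" for b
  proof -
    note l = g_linear2[OF p rt[OF b]]
    have "g p (r b) (r b) = g p (r b) (e b) - g p (r b) (\<Sum>a<n. tscale (Q a b) (f a))"
      by (subst (2) r_def, rule linear_at_diff[OF l et[OF b] st])
    also have "g p (r b) (\<Sum>a<n. tscale (Q a b) (f a)) = 0"
      by (subst linear_at_comb[OF l]) (auto intro: ft simp: gf[OF b])
    also have "g p (r b) (e b) = g p (e b) (e b) - (\<Sum>a<n. Q a b * g p (f a) (e b))"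
      unfolding r_def linear_at_diff[OF g_linear1[OF p et[OF b]] et[OF b] st]
      by (subst linear_at_comb[OF g_linear1[OF p et[OF b]]]) (auto intro: ft)
    finally show ?thesis using e b by (simp add: Q_def onb_def)
  qed
  have "(\<Sum>b<n. g p (r b) (r b)) = (\<Sum>b<n. 1 - (\<Sum>a<n. Q a b * Q a b))" by (simp add: nr)
  \<comment> \<open>The entries of \<open>Q\<close> are now summed by rows instead of columns; every
    row has square sum 1, since \<open>e\<close> spans and \<open>f a\<close> has length 1.\<close>
  also have "\<dots> = real n - (\<Sum>a<n. \<Sum>b<n. Q a b * Q a b)"
    by (simp add: sum_subtractf) (rule sum.swap)
  also have "\<dots> = 0" by (simp add: row)
  finally have z: "(\<Sum>b<n. g p (r b) (r b)) = 0" .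
  have "g p (r b) (r b) = 0" if "b < n" for b
    using z that g_nonneg[OF p rt] by (subst (asm) sum_nonneg_eq_0_iff) auto
  then have "r b = 0" if "b < n" for b using g_pos[OF p rt[OF that]] that by force
  then have eb: "e b = (\<Sum>a<n. tscale (Q a b) (f a))" if "b < n" for b using that unfolding r_def by simp
  have "u = (\<Sum>b<n. tscale (g p u (e b)) (\<Sum>a<n. tscale (Q a b) (f a)))"
    by (rule trans[OF Ex[OF u]]) (simp add: eb[symmetric])
  also have "\<dots> = (\<Sum>a<n. tscale (\<Sum>b<n. g p u (e b) * Q a b) (f a))"
    by (intro ext) (simp add: sum_fun_apply tscale_def sum_distrib_left sum_distrib_right mult.assoc, rule sum.swap)
  finally show ?thesis by (rule onb_coefficients[OF f p])
qed

text \<open>Expand each \<open>f a\<close> in the basis \<open>e\<close> twice. The coefficients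
  form a matrix whose columns are orthonormal, as one sees by expanding \<open>e c\<close> in the
  basis \<open>f\<close>, and so only the diagonal terms of \<open>b\<close> on \<open>e\<close>
  survive.\<close>

lemma trace_indep:
  assumes e: "onb p e" and f: "onb p f" and p: "p \<in> topspace (mtop M)"
    and b1: "\<And>v. v \<in> tangent_space M p \<Longrightarrow> linear_at p (\<lambda>u. b u v)"
    and b2: "\<And>u. u \<in> tangent_space M p \<Longrightarrow> linear_at p (b u)"
  shows "(\<Sum>a<n. b (e a) (e a)) = (\<Sum>a<n. b (f a) (f a))"
proof -
  note ft = onb_tangent[OF f] and et = onb_tangent[OF e]
  have "b (f a) (f a) = (\<Sum>c<n. \<Sum>d<n. g p (f a) (e c) * g p (f a) (e d) * b (e c) (e d))" if a: "a < n" for a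
  proof -
    note x = onb_expand[OF e p ft[OF a]]
    have "b (f a) (f a) = (\<Sum>c<n. g p (f a) (e c) * b (e c) (f a))"
      by (subst (1) x, rule linear_at_comb[OF b1[OF ft[OF a]]]) (auto intro: et)
    also have "\<dots> = (\<Sum>c<n. g p (f a) (e c) * (\<Sum>d<n. g p (f a) (e d) * b (e c) (e d)))"
    proof (rule sum.cong[OF refl])
      fix c assume "c \<in> {..<n}"
      then have c: "e c \<in> tangent_space M p" by (auto intro: et)
      have "b (e c) (f a) = (\<Sum>d<n. g p (f a) (e d) * b (e c) (e d))"
        by (subst (1) x, rule linear_at_comb[OF b2[OF c]]) (auto intro: et)
      then show "g p (f a) (e c) * b (e c) (f a) = g p (f a) (e c) * (\<Sum>d<n. g p (f a) (e d) * b (e c) (e d))" by simp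
    qed
    finally show ?thesis by (simp add: sum_distrib_left mult.assoc)
  qed
  then have "(\<Sum>a<n. b (f a) (f a)) = (\<Sum>a<n. \<Sum>c<n. \<Sum>d<n. g p (f a) (e c) * g p (f a) (e d) * b (e c) (e d))" by simp
  also have "\<dots> = (\<Sum>c<n. \<Sum>a<n. \<Sum>d<n. g p (f a) (e c) * g p (f a) (e d) * b (e c) (e d))" by (rule sum.swap)
  also have "\<dots> = (\<Sum>c<n. \<Sum>d<n. \<Sum>a<n. g p (f a) (e c) * g p (f a) (e d) * b (e c) (e d))"
    by (intro sum.cong refl sum.swap)
  also have "\<dots> = (\<Sum>c<n. \<Sum>d<n. (if c = d then 1 else 0) * b (e c) (e d))"
  proof (intro sum.cong refl)
    fix c d assume cd: "c \<in> {..<n}" "d \<in> {..<n}"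
    then have c: "e c \<in> tangent_space M p" and d: "e d \<in> tangent_space M p" by (auto intro: et)
    have "g p (e c) (e d) = (\<Sum>a<n. g p (e c) (f a) * g p (f a) (e d))"
      by (subst (1) onb_expand[OF f p c], rule linear_at_comb[OF g_linear1[OF p d]]) (auto intro: ft)
    also have "\<dots> = (\<Sum>a<n. g p (f a) (e c) * g p (f a) (e d))"
      using g_sym[OF p c ft] by simp
    finally have "(\<Sum>a<n. g p (f a) (e c) * g p (f a) (e d)) = (if c = d then 1 else 0)"
      using e cd by (simp add: onb_def)
    then show "(\<Sum>a<n. g p (f a) (e c) * g p (f a) (e d) * b (e c) (e d)) = (if c = d then 1 else 0) * b (e c) (e d)"
      by (simp only: sum_distrib_right[symmetric])
  qed
  also have "\<dots> = (\<Sum>c<n. b (e c) (e c))" by (simp add: if_distrib[where f="\<lambda>x. x * _"] cong: if_cong)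
  finally show ?thesis by simp
qed

lemma ex_onb: "p \<in> topspace (mtop M) \<Longrightarrow> \<exists>e. onb p e"
  by (metis charts_at_iff orthonormal_frame_onb spanning_frame topspace_charts)

end


section \<open>The Levi-Civita connection as a perturbation of a torsionless connection\<close>

text \<open>Adding and subtracting the terms with \<open>K\<close> turns the product rule for a sum
  of \<open>G b c * W b * W' c\<close> into its covariant form. It is stated for arbitrary numbers
  because it serves twice: for fields on \<open>M\<close>, and for fields along the projection of
  the bundle.\<close>

lemma metric_derivative_expansion:
  fixes G dG K :: "nat \<Rightarrow> nat \<Rightarrow> real"
  shows "(\<Sum>b<m. \<Sum>c<m. dG b c * W b * W' c + G b c * dW b * W' c + G b c * W b * dW' c) =
    (\<Sum>b<m. \<Sum>c<m. (dG b c - (\<Sum>d<m. K d b * G d c) - (\<Sum>d<m. K d c * G b d)) * W b * W' c)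
    + (\<Sum>b<m. \<Sum>c<m. G b c * (dW b + (\<Sum>d<m. K b d * W d)) * W' c)
    + (\<Sum>b<m. \<Sum>c<m. G b c * W b * (dW' c + (\<Sum>d<m. K c d * W' d)))"
proof -
  have 1: "(\<Sum>b<m. \<Sum>c<m. (\<Sum>d<m. K d b * G d c) * W b * W' c) = (\<Sum>b<m. \<Sum>c<m. G b c * (\<Sum>d<m. K b d * W d) * W' c)"
  proof -
    have "(\<Sum>b<m. \<Sum>c<m. (\<Sum>d<m. K d b * G d c) * W b * W' c) = (\<Sum>b<m. \<Sum>c<m. \<Sum>d<m. G d c * K d b * W b * W' c)"
      by (simp add: sum_distrib_left sum_distrib_right mult_ac)
    also have "\<dots> = (\<Sum>b<m. \<Sum>d<m. \<Sum>c<m. G d c * K d b * W b * W' c)" by (intro sum.cong refl sum.swap)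
    also have "\<dots> = (\<Sum>d<m. \<Sum>b<m. \<Sum>c<m. G d c * K d b * W b * W' c)" by (rule sum.swap)
    also have "\<dots> = (\<Sum>d<m. \<Sum>c<m. \<Sum>b<m. G d c * K d b * W b * W' c)" by (intro sum.cong refl sum.swap)
    finally show ?thesis by (simp add: sum_distrib_left sum_distrib_right mult_ac)
  qed
  have 2: "(\<Sum>b<m. \<Sum>c<m. (\<Sum>d<m. K d c * G b d) * W b * W' c) = (\<Sum>b<m. \<Sum>c<m. G b c * W b * (\<Sum>d<m. K c d * W' d))"
  proof -
    have "(\<Sum>b<m. \<Sum>c<m. (\<Sum>d<m. K d c * G b d) * W b * W' c) = (\<Sum>b<m. \<Sum>c<m. \<Sum>d<m. G b d * W b * (K d c * W' c))"
      by (simp add: sum_distrib_left sum_distrib_right mult_ac)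
    also have "\<dots> = (\<Sum>b<m. \<Sum>d<m. \<Sum>c<m. G b d * W b * (K d c * W' c))" by (intro sum.cong refl sum.swap)
    finally show ?thesis by (simp add: sum_distrib_left)
  qed
  show ?thesis
    using 1 2 by (simp add: sum.distrib sum_subtractf left_diff_distrib distrib_left distrib_right)
qed

text \<open>The components of the covariant derivative of the metric along \<open>u\<close> in chart
  \<open>i\<close>: the derivative of the metric matrix, corrected by the connection form in each of
  its two indices.\<close>

definition nabla_g_matrix ::
  "('p, 'i) manifold \<Rightarrow> ('p, 'i) conn \<Rightarrow> ('p, 'i) metric \<Rightarrow> 'i \<Rightarrow> 'p \<Rightarrow> 'i tvec \<Rightarrow> nat \<Rightarrow> nat \<Rightarrow> real" where
  "nabla_g_matrix M nab g i p u b c =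
     (let G = (\<lambda>b c q. g q (coord_field M i b q) (coord_field M i c q)) in
      vd M i p u (G b c) - (\<Sum>d<mdim M. conn_matrix M nab i p u d b * G d c p)
        - (\<Sum>d<mdim M. conn_matrix M nab i p u d c * G b d p))"

text \<open>The tensor is defined on vectors at a point, not on fields, because it is traced over
  bases and compared across the projection of the bundle pointwise. That the chosen chart does not
  matter is \<open>nabla_g_chart\<close>.\<close>

definition nabla_g ::
  "('p, 'i) manifold \<Rightarrow> ('p, 'i) conn \<Rightarrow> ('p, 'i) metric \<Rightarrow> 'p \<Rightarrow> 'i tvec \<Rightarrow> 'i tvec \<Rightarrow> 'i tvec \<Rightarrow> real" where
  "nabla_g M nab g p u v w =
     (let i = SOME i. i \<in> charts_at M p
      in \<Sum>b<mdim M. \<Sum>c<mdim M. nabla_g_matrix M nab g i p u b c * v i b * w i c)"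

text \<open>Koszul's formula relative to a torsionless connection. The description is proper because
  the metric is definite (uniqueness) and has orthonormal bases (existence); see
  \<open>lc_tensor_ex\<close>.\<close>

definition lc_tensor ::
  "('p, 'i) manifold \<Rightarrow> ('p, 'i) conn \<Rightarrow> ('p, 'i) metric \<Rightarrow> 'p \<Rightarrow> 'i tvec \<Rightarrow> 'i tvec \<Rightarrow> 'i tvec" where
  "lc_tensor M nab g p u v =
     (THE w. w \<in> tangent_space M p \<and> (\<forall>z\<in>tangent_space M p.
        g p w z = (nabla_g M nab g p u v z + nabla_g M nab g p v u z - nabla_g M nab g p z u v) / 2))"

definition lc_conn :: "('p, 'i) manifold \<Rightarrow> ('p, 'i) conn \<Rightarrow> ('p, 'i) metric \<Rightarrow> ('p, 'i) conn" where
  "lc_conn M nab g X Y p = nab X Y p + lc_tensor M nab g p (X p) (Y p)"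

locale affine_riem = tf_conn_mfd M nab + riem_mfd M g
  for M :: "('p, 'i) manifold" and nab :: "('p, 'i) conn" and g :: "('p, 'i) metric"
begin

abbreviation "C \<equiv> nabla_g M nab g"
abbreviation "\<gamma> \<equiv> lc_tensor M nab g"

section \<open>The covariant derivative of the metric as a tensor\<close>

lemma nabla_g_matrix_eq:
  "nabla_g_matrix M nab g i p u b c = vd M i p u (gcomp i b c)
     - (\<Sum>d<n. conn_matrix M nab i p u d b * gcomp i d c p) - (\<Sum>d<n. conn_matrix M nab i p u d c * gcomp i b d p)"
  by (simp add: nabla_g_matrix_def gcomp_def[abs_def])

text \<open>The metric is written in components and differentiated by the product rule;
  \<open>metric_derivative_expansion\<close> then collects the covariant derivatives of the two
  fields. Only the matrix term mentions the chart.\<close>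

lemma nabla_g_field_matrix:
  assumes U: "openin (mtop M) U" and X: "vfield M U X" and Y: "vfield M U Y" and Z: "vfield M U Z"
    and p: "p \<in> U" and i: "i \<in> charts_at M p"
  shows "dirder M p (X p) (\<lambda>q. g q (Y q) (Z q)) = (\<Sum>b<n. \<Sum>c<n. nabla_g_matrix M nab g i p (X p) b c * Y p i b * Z p i c)
     + g p (nab X Y p) (Z p) + g p (Y p) (nab X Z p)"
proof -
  note Xt = vfield_tangent[OF X p] and Yt = vfield_tangent[OF Y p] and Zt = vfield_tangent[OF Z p]
  note sY = vfield_smooth_at[OF U Y p i] and sZ = vfield_smooth_at[OF U Z p i] and sG = smooth_at_gcomp[OF i]
  let ?d = "vd M i p (X p)"
  have "near M p (\<lambda>q. q \<in> U)" by (rule nearI[OF U p])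
  then have nr: "near M p (\<lambda>q. g q (Y q) (Z q) = (\<Sum>b<n. \<Sum>c<n. gcomp i b c q * Y q i b * Z q i c))"
    by (rule near_mono[OF near_conj[OF _ near_chart[OF i]]])
       (auto intro!: g_chart vfield_tangent[OF Y] vfield_tangent[OF Z])
  have "dirder M p (X p) (\<lambda>q. g q (Y q) (Z q)) = ?d (\<lambda>q. g q (Y q) (Z q))"
    by (rule dirder_eq[OF Xt g_smooth_at[OF U Y Z p] i])
  also have "\<dots> = ?d (\<lambda>q. \<Sum>b<n. \<Sum>c<n. gcomp i b c q * Y q i b * Z q i c)" by (rule vd_cong[OF nr i])
  also have "\<dots> = (\<Sum>b<n. \<Sum>c<n. ?d (\<lambda>q. gcomp i b c q * Y q i b * Z q i c))"
  proof -
    have s: "smooth_at M (\<lambda>q. gcomp i b c q * Y q i b * Z q i c) p" if "b < n" "c < n" for b c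
      by (rule smooth_at_mult[OF smooth_at_mult[OF sG sY] sZ]) (use that in auto)
    have "?d (\<lambda>q. \<Sum>b<n. \<Sum>c<n. gcomp i b c q * Y q i b * Z q i c) = (\<Sum>b<n. ?d (\<lambda>q. \<Sum>c<n. gcomp i b c q * Y q i b * Z q i c))"
      by (rule vd_sum[OF _ i]) (use s in \<open>auto intro!: smooth_at_sum[OF charts_at_topspace[OF i]]\<close>)
    also have "\<dots> = (\<Sum>b<n. \<Sum>c<n. ?d (\<lambda>q. gcomp i b c q * Y q i b * Z q i c))"
      by (rule sum.cong[OF refl], rule vd_sum[OF _ i]) (use s in auto)
    finally show ?thesis .
  qed
  also have "\<dots> = (\<Sum>b<n. \<Sum>c<n. ?d (gcomp i b c) * Y p i b * Z p i c + gcomp i b c p * ?d (\<lambda>q. Y q i b) * Z p i c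
       + gcomp i b c p * Y p i b * ?d (\<lambda>q. Z q i c))"
    by (intro sum.cong refl)
       (simp add: vd_mult[OF smooth_at_mult[OF sG sY] sZ i] vd_mult[OF sG sY i] distrib_right)
  also have "\<dots> = (\<Sum>b<n. \<Sum>c<n. nabla_g_matrix M nab g i p (X p) b c * Y p i b * Z p i c)
     + (\<Sum>b<n. \<Sum>c<n. gcomp i b c p * nab X Y p i b * Z p i c) + (\<Sum>b<n. \<Sum>c<n. gcomp i b c p * Y p i b * nab X Z p i c)"
    unfolding metric_derivative_expansion[where K="conn_matrix M nab i p (X p)"] nabla_g_matrix_eq
    by (simp add: nab_formula[OF U X Y p i] nab_formula[OF U X Z p i])
  also have "\<dots> = (\<Sum>b<n. \<Sum>c<n. nabla_g_matrix M nab g i p (X p) b c * Y p i b * Z p i c)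
     + g p (nab X Y p) (Z p) + g p (Y p) (nab X Z p)"
    unfolding g_chart[OF i vfield_tangent[OF nab_vfield[OF U X Y] p] Zt] g_chart[OF i Yt vfield_tangent[OF nab_vfield[OF U X Z] p]] ..
  finally show ?thesis .
qed

text \<open>Chart independence without a transformation law: after extending the three vectors to
  fields, \<open>nabla_g_field_matrix\<close> equates the expression in any chart with one that does
  not mention a chart.\<close>

lemma nabla_g_chart:
  assumes u: "u \<in> tangent_space M p" and v: "v \<in> tangent_space M p" and w: "w \<in> tangent_space M p"
    and i: "i \<in> charts_at M p"
  shows "C p u v w = (\<Sum>b<n. \<Sum>c<n. nabla_g_matrix M nab g i p u b c * v i b * w i c)"
proof -
  have ic: "i \<in> charts M" "p \<in> cdom M i" using i by (simp_all add: charts_at_iff)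
  obtain X where X: "vfield M (cdom M i) X" "X p = u" by (rule tangent_extend[OF u i])
  obtain Y where Y: "vfield M (cdom M i) Y" "Y p = v" by (rule tangent_extend[OF v i])
  obtain Z where Z: "vfield M (cdom M i) Z" "Z p = w" by (rule tangent_extend[OF w i])
  note f = nabla_g_field_matrix[OF cdom_open[OF ic(1)] X(1) Y(1) Z(1) ic(2), unfolded X(2) Y(2) Z(2)]
  have "(SOME i. i \<in> charts_at M p) \<in> charts_at M p" using i by (rule someI)
  from f[OF this] f[OF i] show ?thesis unfolding nabla_g_def Let_def by linarith
qed

lemma nabla_g_field:
  assumes U: "openin (mtop M) U" and X: "vfield M U X" and Y: "vfield M U Y" and Z: "vfield M U Z" and p: "p \<in> U"
  shows "dirder M p (X p) (\<lambda>q. g q (Y q) (Z q)) = C p (X p) (Y p) (Z p) + g p (nab X Y p) (Z p) + g p (Y p) (nab X Z p)"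
proof -
  obtain i where i: "i \<in> charts_at M p" using open_charts_at[OF U p] ..
  show ?thesis
    unfolding nabla_g_field_matrix[OF assms i]
      nabla_g_chart[OF vfield_tangent[OF X p] vfield_tangent[OF Y p] vfield_tangent[OF Z p] i] ..
qed

lemma nabla_g_matrix_add: "nabla_g_matrix M nab g i p (u + v) b c = nabla_g_matrix M nab g i p u b c + nabla_g_matrix M nab g i p v b c"
  unfolding nabla_g_matrix_def Let_def vd_plus_vec conn_matrix_def
  by (simp add: distrib_left distrib_right sum.distrib)

lemma nabla_g_matrix_scale: "nabla_g_matrix M nab g i p (tscale r u) b c = r * nabla_g_matrix M nab g i p u b c"
  unfolding nabla_g_matrix_def Let_def vd_scale_vec conn_matrix_def
  by (simp add: right_diff_distrib sum_distrib_left sum_distrib_right tscale_def mult_ac)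

lemma nabla_g_linear:
  assumes p: "p \<in> topspace (mtop M)" and t: "u \<in> tangent_space M p" "v \<in> tangent_space M p"
  shows "linear_at p (\<lambda>w. C p w u v)" "linear_at p (\<lambda>w. C p u w v)" "linear_at p (C p u v)"
proof -
  obtain i where i: "i \<in> charts_at M p" using p topspace_charts by blast
  note c = nabla_g_chart[OF _ _ _ i]
  show "linear_at p (\<lambda>w. C p w u v)"
    unfolding linear_at_def using t
    by (auto simp: c tangent_add tangent_scale nabla_g_matrix_add nabla_g_matrix_scale distrib_right distrib_left sum.distrib sum_distrib_left mult_ac)
  show "linear_at p (\<lambda>w. C p u w v)"
    unfolding linear_at_def using t
    by (auto simp: c tangent_add tangent_scale distrib_right distrib_left sum.distrib sum_distrib_left tscale_apply mult_ac)
  show "linear_at p (C p u v)"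
    unfolding linear_at_def using t
    by (auto simp: c tangent_add tangent_scale distrib_right distrib_left sum.distrib sum_distrib_left tscale_apply mult_ac)
qed

lemma nabla_g_sym:
  assumes p: "p \<in> topspace (mtop M)" and t: "u \<in> tangent_space M p" "v \<in> tangent_space M p" "w \<in> tangent_space M p"
  shows "C p u v w = C p u w v"
proof -
  obtain i where i: "i \<in> charts_at M p" using p topspace_charts by blast
  have "nabla_g_matrix M nab g i p u b c = nabla_g_matrix M nab g i p u c b" if "b < n" "c < n" for b c
  proof -
    have "near M p (\<lambda>q. gcomp i b c q = gcomp i c b q)"
      by (rule near_mono[OF near_chart[OF i]]) (simp add: gcomp_sym that)
    from vd_cong[OF this i, of u] show ?thesis
      unfolding nabla_g_matrix_eq using that by (simp add: gcomp_sym[OF i])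
  qed
  then show ?thesis
    unfolding nabla_g_chart[OF t i] nabla_g_chart[OF t(1,3,2) i]
    by (subst sum.swap) (intro sum.cong refl, simp)
qed

lemma nabla_g_smooth_at:
  assumes U: "openin (mtop M) U" and X: "vfield M U X" and Y: "vfield M U Y" and Z: "vfield M U Z" and p: "p \<in> U"
  shows "smooth_at M (\<lambda>q. C q (X q) (Y q) (Z q)) p"
proof -
  obtain i where i: "i \<in> charts_at M p" using open_charts_at[OF U p] ..
  note sX = vfield_smooth_at[OF U X p i] and sY = vfield_smooth_at[OF U Y p i] and sZ = vfield_smooth_at[OF U Z p i]
    and sG = smooth_at_gcomp[OF i] and top = charts_at_topspace[OF i]
  have "near M p (\<lambda>q. q \<in> U)" by (rule nearI[OF U p])
  then have "near M p (\<lambda>q. (\<Sum>b<n. \<Sum>c<n. nabla_g_matrix M nab g i q (X q) b c * Y q i b * Z q i c) = C q (X q) (Y q) (Z q))"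
    by (rule near_mono[OF near_conj[OF _ near_chart[OF i]]])
       (auto intro!: nabla_g_chart[symmetric] vfield_tangent[OF X] vfield_tangent[OF Y] vfield_tangent[OF Z])
  note nr = this
  have cm: "smooth_at M (\<lambda>q. conn_matrix M nab i q (X q) d b) p" if "d < n" "b < n" for d b
    unfolding conn_matrix_def using that
    by (auto intro!: smooth_at_sum[OF top] smooth_at_mult[OF smooth_at_christoffel[OF i] sX])
  have v: "smooth_at M (\<lambda>q. vd M i q (X q) (gcomp i b c)) p" if "b < n" "c < n" for b c
    unfolding vd_def using that
    by (auto intro!: smooth_at_sum[OF top] smooth_at_mult[OF sX smooth_at_cpd[OF sG i]])
  have m: "smooth_at M (\<lambda>q. nabla_g_matrix M nab g i q (X q) b c) p" if "b < n" "c < n" for b c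
    unfolding nabla_g_matrix_eq using that
    by (auto intro!: smooth_at_diff v smooth_at_sum[OF top] smooth_at_mult[OF cm sG])
  show ?thesis
    by (rule smooth_at_cong[OF nr])
       (auto intro!: smooth_at_sum[OF top] smooth_at_mult[OF smooth_at_mult[OF m sY] sZ])
qed

text \<open>The representing vector of a linear functional has the values of the functional on an
  orthonormal basis as its coefficients. The explicit sum is also what gives smoothness of the
  tensor in a smooth frame.\<close>

lemma lc_tensor_ex:
  assumes p: "p \<in> topspace (mtop M)" and u: "u \<in> tangent_space M p" and v: "v \<in> tangent_space M p" and e: "onb p e"
  shows "\<gamma> p u v = (\<Sum>a<n. tscale ((C p u v (e a) + C p v u (e a) - C p (e a) u v) / 2) (e a))" (is "_ = ?w")
    and "\<gamma> p u v \<in> tangent_space M p"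
    and "z \<in> tangent_space M p \<Longrightarrow> g p (\<gamma> p u v) z = (C p u v z + C p v u z - C p z u v) / 2"
proof -
  have wt: "?w \<in> tangent_space M p" by (intro tangent_sum tangent_scale onb_tangent[OF e]) auto
  have wg: "g p ?w z = (C p u v z + C p v u z - C p z u v) / 2" if z: "z \<in> tangent_space M p" for z
  proof -
    define \<phi> where "\<phi> z = (C p u v z + C p v u z - C p z u v) / 2" for z
    have l: "linear_at p \<phi>"
      unfolding linear_at_def \<phi>_def
      using linear_at_add[OF nabla_g_linear(3)[OF p u v]] linear_at_add[OF nabla_g_linear(3)[OF p v u]]
        linear_at_add[OF nabla_g_linear(1)[OF p u v]] linear_at_scale[OF nabla_g_linear(3)[OF p u v]]
        linear_at_scale[OF nabla_g_linear(3)[OF p v u]] linear_at_scale[OF nabla_g_linear(1)[OF p u v]]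
      by (auto simp: field_simps)
    have "g p ?w z = (\<Sum>a<n. \<phi> (e a) * g p (e a) z)"
      unfolding \<phi>_def by (rule linear_at_comb[OF g_linear1[OF p z]]) (auto intro: onb_tangent[OF e])
    also have "\<dots> = (\<Sum>a<n. g p z (e a) * \<phi> (e a))"
      using g_sym[OF p z onb_tangent[OF e]] by (intro sum.cong) auto
    also have "\<dots> = \<phi> (\<Sum>a<n. tscale (g p z (e a)) (e a))"
      by (rule linear_at_comb[OF l, symmetric]) (auto intro: onb_tangent[OF e])
    also have "\<dots> = \<phi> z" using onb_expand[OF e p z] by simp
    finally show ?thesis unfolding \<phi>_def .
  qed
  show eq: "\<gamma> p u v = ?w"
    unfolding lc_tensor_def
  proof (rule the_equality)
    show "?w \<in> tangent_space M p \<and> (\<forall>z\<in>tangent_space M p. g p ?w z = (C p u v z + C p v u z - C p z u v) / 2)"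
      using wt wg by blast
    fix w assume "w \<in> tangent_space M p \<and> (\<forall>z\<in>tangent_space M p. g p w z = (C p u v z + C p v u z - C p z u v) / 2)"
    then show "w = ?w" by (intro g_eqI[OF p _ wt]) (auto simp: wg)
  qed
  show "\<gamma> p u v \<in> tangent_space M p" unfolding eq by (rule wt)
  show "z \<in> tangent_space M p \<Longrightarrow> g p (\<gamma> p u v) z = (C p u v z + C p v u z - C p z u v) / 2"
    unfolding eq by (rule wg)
qed

lemma lc_tensor_tangent: "p \<in> topspace (mtop M) \<Longrightarrow> u \<in> tangent_space M p \<Longrightarrow> v \<in> tangent_space M p \<Longrightarrow>
    \<gamma> p u v \<in> tangent_space M p"
  using lc_tensor_ex(2) ex_onb by blast

lemma g_lc_tensor: "p \<in> topspace (mtop M) \<Longrightarrow> u \<in> tangent_space M p \<Longrightarrow> v \<in> tangent_space M p \<Longrightarrow> z \<in> tangent_space M p \<Longrightarrow>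
    g p (\<gamma> p u v) z = (C p u v z + C p v u z - C p z u v) / 2"
  using lc_tensor_ex(3) ex_onb by blast

lemma lc_tensor_sym:
  assumes p: "p \<in> topspace (mtop M)" and t: "u \<in> tangent_space M p" "v \<in> tangent_space M p"
  shows "\<gamma> p u v = \<gamma> p v u"
  by (rule g_eqI[OF p]) (use t in \<open>auto simp: lc_tensor_tangent[OF p] g_lc_tensor[OF p] nabla_g_sym[OF p _ t]\<close>)

lemma lc_tensor_add:
  assumes p: "p \<in> topspace (mtop M)" and t: "u \<in> tangent_space M p" "u' \<in> tangent_space M p" "v \<in> tangent_space M p"
  shows "\<gamma> p (u + u') v = \<gamma> p u v + \<gamma> p u' v"
proof (rule g_eqI[OF p])
  fix z assume z: "z \<in> tangent_space M p"
  show "g p (\<gamma> p (u + u') v) z = g p (\<gamma> p u v + \<gamma> p u' v) z"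
    unfolding linear_at_add[OF g_linear1[OF p z] lc_tensor_tangent[OF p t(1,3)] lc_tensor_tangent[OF p t(2,3)]]
      g_lc_tensor[OF p tangent_add[OF t(1,2)] t(3) z] g_lc_tensor[OF p t(1,3) z] g_lc_tensor[OF p t(2,3) z]
      linear_at_add[OF nabla_g_linear(1)[OF p t(3) z] t(1,2)] linear_at_add[OF nabla_g_linear(2)[OF p t(3) z] t(1,2)]
      linear_at_add[OF nabla_g_linear(2)[OF p z t(3)] t(1,2)]
    by (simp add: field_simps)
qed (use t in \<open>auto intro!: tangent_add lc_tensor_tangent[OF p]\<close>)

lemma lc_tensor_scale:
  assumes p: "p \<in> topspace (mtop M)" and t: "u \<in> tangent_space M p" "v \<in> tangent_space M p"
  shows "\<gamma> p (tscale c u) v = tscale c (\<gamma> p u v)"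
proof (rule g_eqI[OF p])
  fix z assume z: "z \<in> tangent_space M p"
  show "g p (\<gamma> p (tscale c u) v) z = g p (tscale c (\<gamma> p u v)) z"
    unfolding linear_at_scale[OF g_linear1[OF p z] lc_tensor_tangent[OF p t]]
      g_lc_tensor[OF p tangent_scale[OF t(1)] t(2) z] g_lc_tensor[OF p t z]
      linear_at_scale[OF nabla_g_linear(1)[OF p t(2) z] t(1)] linear_at_scale[OF nabla_g_linear(2)[OF p t(2) z] t(1)]
      linear_at_scale[OF nabla_g_linear(2)[OF p z t(2)] t(1)]
    by (simp add: field_simps)
qed (use t in \<open>auto intro!: tangent_scale lc_tensor_tangent[OF p]\<close>)

lemma lc_tensor_add2: "p \<in> topspace (mtop M) \<Longrightarrow> u \<in> tangent_space M p \<Longrightarrow> u' \<in> tangent_space M p \<Longrightarrow> v \<in> tangent_space M p \<Longrightarrow>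
    \<gamma> p v (u + u') = \<gamma> p v u + \<gamma> p v u'"
  using lc_tensor_add[of p u u' v] lc_tensor_sym[of p v] tangent_add by simp

lemma lc_tensor_scale2: "p \<in> topspace (mtop M) \<Longrightarrow> u \<in> tangent_space M p \<Longrightarrow> v \<in> tangent_space M p \<Longrightarrow>
    \<gamma> p v (tscale c u) = tscale c (\<gamma> p v u)"
  using lc_tensor_scale[of p u v c] lc_tensor_sym[of p v] tangent_scale by simp

text \<open>In a smooth local orthonormal frame the coefficients are combinations of values of
  \<open>C\<close> on smooth fields.\<close>

lemma lc_tensor_vfield:
  assumes U: "openin (mtop M) U" and X: "vfield M U X" and Y: "vfield M U Y"
  shows "vfield M U (\<lambda>p. \<gamma> p (X p) (Y p))"
proof (rule vfieldI[OF U])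
  fix p assume p: "p \<in> U"
  have top: "p \<in> topspace (mtop M)" using U p openin_subset by blast
  show "\<gamma> p (X p) (Y p) \<in> tangent_space M p"
    by (rule lc_tensor_tangent[OF top vfield_tangent[OF X p] vfield_tangent[OF Y p]])
  obtain i where i: "i \<in> charts_at M p" using open_charts_at[OF U p] ..
  then have ic: "i \<in> charts M" "p \<in> cdom M i" by (simp_all add: charts_at_iff)
  obtain E where E: "orthonormal_frame M g (cdom M i) E" by (rule spanning_frame[OF ic(1)])
  let ?V = "U \<inter> cdom M i"
  have V: "openin (mtop M) ?V" using U cdom_open[OF ic(1)] by auto
  have pV: "p \<in> ?V" using p ic by blast
  have XV: "vfield M ?V X" and YV: "vfield M ?V Y" using vfield_subset X Y by blast+
  have EV: "vfield M ?V (E a)" if "a < n" for a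
    using vfield_subset[of ?V "cdom M i" "E a"] E that by (auto simp: orthonormal_frame_def)
  let ?c = "\<lambda>a q. (C q (X q) (Y q) (E a q) + C q (Y q) (X q) (E a q) - C q (E a q) (X q) (Y q)) * (1 / 2)"
  have "smooth_at M (\<lambda>q. \<gamma> q (X q) (Y q) i k) p" if k: "k < n" for k
  proof (rule smooth_at_cong)
    show "near M p (\<lambda>q. (\<Sum>a<n. ?c a q * E a q i k) = \<gamma> q (X q) (Y q) i k)"
    proof (rule nearI[OF V pV])
      fix q assume q: "q \<in> ?V"
      have qt: "q \<in> topspace (mtop M)" using openin_subset[OF V] q by blast
      show "(\<Sum>a<n. ?c a q * E a q i k) = \<gamma> q (X q) (Y q) i k"
        unfolding lc_tensor_ex(1)[OF qt vfield_tangent[OF XV q] vfield_tangent[OF YV q] orthonormal_frame_onb[OF E IntD2[OF q]]]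
        by (simp add: sum_fun_apply tscale_def)
    qed
    show "smooth_at M (\<lambda>q. \<Sum>a<n. ?c a q * E a q i k) p"
      by (intro smooth_at_sum[OF top] smooth_at_mult smooth_at_add smooth_at_diff smooth_at_const[OF i]
          nabla_g_smooth_at[OF V _ _ _ pV] XV YV EV vfield_smooth_at[OF V EV pV i] k) auto
  qed
  with i show "\<exists>i\<in>charts_at M p. \<forall>k<n. smooth_at M (\<lambda>q. \<gamma> q (X q) (Y q) i k) p" by blast
qed

lemma lc_conn_connection: "connection M (lc_conn M nab g)"
  unfolding connection_def
proof (intro allI impI)
  fix U X X' Y Y' f
  assume A: "openin (mtop M) U \<and> vfield M U X \<and> vfield M U X' \<and> vfield M U Y \<and> vfield M U Y' \<and> smooth_fun M U f"
  then have U: "openin (mtop M) U" and X: "vfield M U X" and X': "vfield M U X'" and Y: "vfield M U Y"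
    and Y': "vfield M U Y'" and f: "smooth_fun M U f" by auto
  have top: "p \<in> topspace (mtop M)" if "p \<in> U" for p using that openin_subset[OF U] by blast
  note Xt = vfield_tangent[OF X] and Xt' = vfield_tangent[OF X'] and Yt = vfield_tangent[OF Y] and Yt' = vfield_tangent[OF Y']
  show "vfield M U (lc_conn M nab g X Y) \<and>
    (\<forall>p\<in>U. lc_conn M nab g (X + X') Y p = lc_conn M nab g X Y p + lc_conn M nab g X' Y p) \<and>
    (\<forall>p\<in>U. lc_conn M nab g (fscale f X) Y p = tscale (f p) (lc_conn M nab g X Y p)) \<and>
    (\<forall>p\<in>U. lc_conn M nab g X (Y + Y') p = lc_conn M nab g X Y p + lc_conn M nab g X Y' p) \<and>
    (\<forall>p\<in>U. lc_conn M nab g X (fscale f Y) p = tscale (dirder M p (X p) f) (Y p) + tscale (f p) (lc_conn M nab g X Y p)) \<and>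
    ((\<forall>p\<in>U. X p = X' p \<and> Y p = Y' p) \<longrightarrow> (\<forall>p\<in>U. lc_conn M nab g X Y p = lc_conn M nab g X' Y' p))"
  proof (intro conjI ballI impI)
    show "vfield M U (lc_conn M nab g X Y)"
      by (rule vfield_cong[OF U vfield_add[OF U nab_vfield[OF U X Y] lc_tensor_vfield[OF U X Y]]])
         (simp add: lc_conn_def)
    fix p assume p: "p \<in> U"
    show "lc_conn M nab g (X + X') Y p = lc_conn M nab g X Y p + lc_conn M nab g X' Y p"
      unfolding lc_conn_def nab_add1[OF U X X' Y p] plus_fun_apply lc_tensor_add[OF top[OF p] Xt[OF p] Xt'[OF p] Yt[OF p]]
      by (simp add: fun_eq_iff)
    show "lc_conn M nab g (fscale f X) Y p = tscale (f p) (lc_conn M nab g X Y p)"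
      unfolding lc_conn_def nab_scale1[OF U X Y f p] fscale_apply lc_tensor_scale[OF top[OF p] Xt[OF p] Yt[OF p]] tscale_plus
      ..
    show "lc_conn M nab g X (Y + Y') p = lc_conn M nab g X Y p + lc_conn M nab g X Y' p"
      unfolding lc_conn_def nab_add2[OF U X Y Y' p] plus_fun_apply lc_tensor_add2[OF top[OF p] Yt[OF p] Yt'[OF p] Xt[OF p]]
      by (simp add: fun_eq_iff)
    show "lc_conn M nab g X (fscale f Y) p = tscale (dirder M p (X p) f) (Y p) + tscale (f p) (lc_conn M nab g X Y p)"
      unfolding lc_conn_def nab_leibniz[OF U X Y f p] fscale_apply lc_tensor_scale2[OF top[OF p] Yt[OF p] Xt[OF p]] tscale_plus
      by (simp add: fun_eq_iff)
    assume eq: "\<forall>p\<in>U. X p = X' p \<and> Y p = Y' p"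
    have "nab X Y p = nab X' Y' p" by (rule nab_local[OF U X X' Y Y' p]) (use eq in auto)
    with eq p show "lc_conn M nab g X Y p = lc_conn M nab g X' Y' p" by (simp add: lc_conn_def)
  qed
qed

text \<open>Symmetry of \<open>\<gamma>\<close> leaves the torsion of \<open>nab\<close> unchanged.
  Compatibility with the metric holds because in g(\<gamma>(X,Y), Z) + g(Y, \<gamma>(X,Z))
  everything cancels except \<open>C\<close> of \<open>X\<close>, \<open>Y\<close>,
  \<open>Z\<close>, the very defect of \<open>nab\<close> from being metric.\<close>

lemma lc_conn_levi_civita: "levi_civita M g (lc_conn M nab g)"
  unfolding levi_civita_def
proof (intro conjI lc_conn_connection)
  show "torsionless M (lc_conn M nab g)"
    unfolding torsionless_def
  proof (intro allI impI ballI)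
    fix U X Y p assume A: "openin (mtop M) U \<and> vfield M U X \<and> vfield M U Y" and p: "p \<in> U"
    then have top: "p \<in> topspace (mtop M)" using openin_subset by blast
    have "\<gamma> p (X p) (Y p) = \<gamma> p (Y p) (X p)" by (rule lc_tensor_sym[OF top]) (use A p vfield_tangent in auto)
    then show "lc_conn M nab g X Y p - lc_conn M nab g Y X p = bracket M X Y p"
      using bracket_eq[of U X Y p] A p by (simp add: lc_conn_def)
  qed
  show "metric_connection M g (lc_conn M nab g)"
    unfolding metric_connection_def
  proof (intro allI impI ballI)
    fix U X Y Z p assume A: "openin (mtop M) U \<and> vfield M U X \<and> vfield M U Y \<and> vfield M U Z" and p: "p \<in> U"
    then have U: "openin (mtop M) U" and X: "vfield M U X" and Y: "vfield M U Y" and Z: "vfield M U Z" by auto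
    have top: "p \<in> topspace (mtop M)" using U p openin_subset by blast
    note t = vfield_tangent[OF X p] vfield_tangent[OF Y p] vfield_tangent[OF Z p]
      vfield_tangent[OF nab_vfield[OF U X Y] p] vfield_tangent[OF nab_vfield[OF U X Z] p]
    note gt = lc_tensor_tangent[OF top t(1,2)] lc_tensor_tangent[OF top t(1,3)]
    have "g p (\<gamma> p (X p) (Y p)) (Z p) + g p (Y p) (\<gamma> p (X p) (Z p)) = C p (X p) (Y p) (Z p)"
      unfolding g_sym[OF top t(2) gt(2)] g_lc_tensor[OF top t(1,2,3)] g_lc_tensor[OF top t(1,3,2)]
        nabla_g_sym[OF top t(1,3,2)] nabla_g_sym[OF top t(3,1,2)] nabla_g_sym[OF top t(2,1,3)]
      by (simp add: field_simps)
    then show "dirder M p (X p) (\<lambda>q. g q (Y q) (Z q)) = g p (lc_conn M nab g X Y p) (Z p) + g p (Y p) (lc_conn M nab g X Z p)"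
      unfolding nabla_g_field[OF U X Y Z p] lc_conn_def
        linear_at_add[OF g_linear1[OF top t(3)] t(4) gt(1)] linear_at_add[OF g_linear2[OF top t(2)] t(5) gt(2)]
      by simp
  qed
qed

end

section \<open>Closed one-forms and the Lee form\<close>

text \<open>A pointwise one-form whose components \<open>c i a\<close> in every chart are smooth and
  satisfy the integrability condition. The components are quantified existentially, so that
  \<open>\<alpha>\<close> is compared with them on tangent vectors only.\<close>

definition closed_form :: "('p, 'i) manifold \<Rightarrow> ('p \<Rightarrow> 'i tvec \<Rightarrow> real) \<Rightarrow> bool" where
  "closed_form M \<alpha> \<longleftrightarrow> (\<exists>c. \<forall>i\<in>charts M. \<forall>p\<in>cdom M i.
     (\<forall>u\<in>tangent_space M p. \<alpha> p u = (\<Sum>a<mdim M. c i a p * u i a)) \<and>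
     (\<forall>a<mdim M. smooth_at M (c i a) p) \<and>
     (\<forall>a<mdim M. \<forall>b<mdim M. cpd M i a (c i b) p = cpd M i b (c i a) p))"

section \<open>Closed one-forms through their components\<close>

lemma closed_formE:
  assumes "closed_form M \<alpha>"
  obtains c where "\<And>i p u. i \<in> charts_at M p \<Longrightarrow> u \<in> tangent_space M p \<Longrightarrow> \<alpha> p u = (\<Sum>a<mdim M. c i a p * u i a)"
    "\<And>i p a. i \<in> charts_at M p \<Longrightarrow> a < mdim M \<Longrightarrow> smooth_at M (c i a) p"
    "\<And>i p a b. i \<in> charts_at M p \<Longrightarrow> a < mdim M \<Longrightarrow> b < mdim M \<Longrightarrow> cpd M i a (c i b) p = cpd M i b (c i a) p"
proof -
  obtain c where c: "\<forall>i\<in>charts M. \<forall>p\<in>cdom M i.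
     (\<forall>u\<in>tangent_space M p. \<alpha> p u = (\<Sum>a<mdim M. c i a p * u i a)) \<and>
     (\<forall>a<mdim M. smooth_at M (c i a) p) \<and>
     (\<forall>a<mdim M. \<forall>b<mdim M. cpd M i a (c i b) p = cpd M i b (c i a) p)"
    using assms unfolding closed_form_def by blast
  show ?thesis by (rule that[of c]) (use c in \<open>auto simp: charts_at_def\<close>)
qed

lemma closed_formI_comps:
  assumes "\<And>i p u. i \<in> charts_at M p \<Longrightarrow> u \<in> tangent_space M p \<Longrightarrow> \<alpha> p u = (\<Sum>a<mdim M. c i a p * u i a)"
    "\<And>i p a. i \<in> charts_at M p \<Longrightarrow> a < mdim M \<Longrightarrow> smooth_at M (c i a) p"
    "\<And>i p a b. i \<in> charts_at M p \<Longrightarrow> a < mdim M \<Longrightarrow> b < mdim M \<Longrightarrow> cpd M i a (c i b) p = cpd M i b (c i a) p"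
  shows "closed_form M \<alpha>"
  unfolding closed_form_def using assms by (intro exI[of _ c]) (simp add: charts_at_def)

context smooth_mfd
begin

lemma closed_form_combine:
  assumes "closed_form M \<alpha>" "closed_form M \<beta>"
  shows "closed_form M (\<lambda>p u. r * \<alpha> p u + s * \<beta> p u)"
proof -
  obtain c where c: "\<And>i p u. i \<in> charts_at M p \<Longrightarrow> u \<in> tangent_space M p \<Longrightarrow> \<alpha> p u = (\<Sum>a<n. c i a p * u i a)"
    "\<And>i p a. i \<in> charts_at M p \<Longrightarrow> a < n \<Longrightarrow> smooth_at M (c i a) p"
    "\<And>i p a b. i \<in> charts_at M p \<Longrightarrow> a < n \<Longrightarrow> b < n \<Longrightarrow> cpd M i a (c i b) p = cpd M i b (c i a) p"
    by (rule closed_formE[OF assms(1)]) blast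
  obtain d where d: "\<And>i p u. i \<in> charts_at M p \<Longrightarrow> u \<in> tangent_space M p \<Longrightarrow> \<beta> p u = (\<Sum>a<n. d i a p * u i a)"
    "\<And>i p a. i \<in> charts_at M p \<Longrightarrow> a < n \<Longrightarrow> smooth_at M (d i a) p"
    "\<And>i p a b. i \<in> charts_at M p \<Longrightarrow> a < n \<Longrightarrow> b < n \<Longrightarrow> cpd M i a (d i b) p = cpd M i b (d i a) p"
    by (rule closed_formE[OF assms(2)]) blast
  show ?thesis
  proof (rule closed_formI_comps[where c="\<lambda>i a p. r * c i a p + s * d i a p"])
    fix i p assume i: "i \<in> charts_at M p"
    show "r * \<alpha> p u + s * \<beta> p u = (\<Sum>a<n. (r * c i a p + s * d i a p) * u i a)" if "u \<in> tangent_space M p" for u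
      by (simp add: c(1)[OF i that] d(1)[OF i that] sum_distrib_left distrib_right distrib_left sum.distrib mult_ac)
    show "smooth_at M (\<lambda>p. r * c i a p + s * d i a p) p" if "a < n" for a
      by (intro smooth_at_add smooth_at_mult smooth_at_const[OF i] c(2)[OF i that] d(2)[OF i that])
    have "cpd M i a (\<lambda>p. r * c i b p + s * d i b p) p = r * cpd M i a (c i b) p + s * cpd M i a (d i b) p"
      if "a < n" "b < n" for a b
      using that by (simp add: cpd_add[OF smooth_at_mult[OF smooth_at_const[OF i]] smooth_at_mult[OF smooth_at_const[OF i]] i]
         cpd_mult[OF smooth_at_const[OF i] _ i] c(2)[OF i] d(2)[OF i] cpd_const)
    then show "cpd M i a (\<lambda>p. r * c i b p + s * d i b p) p = cpd M i b (\<lambda>p. r * c i a p + s * d i a p) p"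
      if "a < n" "b < n" for a b using that by (simp add: c(3)[OF i that] d(3)[OF i that])
  qed
qed

lemma closed_form_cong:
  assumes "closed_form M \<alpha>" "\<And>\<xi> u. \<xi> \<in> topspace (mtop M) \<Longrightarrow> u \<in> tangent_space M \<xi> \<Longrightarrow> \<alpha> \<xi> u = \<beta> \<xi> u"
  shows "closed_form M \<beta>"
proof -
  obtain c where c: "\<And>i p u. i \<in> charts_at M p \<Longrightarrow> u \<in> tangent_space M p \<Longrightarrow> \<alpha> p u = (\<Sum>a<n. c i a p * u i a)"
    "\<And>i p a. i \<in> charts_at M p \<Longrightarrow> a < n \<Longrightarrow> smooth_at M (c i a) p"
    "\<And>i p a b. i \<in> charts_at M p \<Longrightarrow> a < n \<Longrightarrow> b < n \<Longrightarrow> cpd M i a (c i b) p = cpd M i b (c i a) p"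
    by (rule closed_formE[OF assms(1)]) blast
  show ?thesis
  proof (rule closed_formI_comps[where c=c, OF _ c(2,3)])
    show "\<beta> \<xi> u = (\<Sum>a<n. c i a \<xi> * u i a)" if "i \<in> charts_at M \<xi>" "u \<in> tangent_space M \<xi>" for i \<xi> u
      using c(1)[OF that] assms(2)[OF charts_at_topspace[OF that(1)] that(2)] by simp
  qed
qed

lemma linear_closed_formI:
  assumes l: "\<And>p. p \<in> topspace (mtop M) \<Longrightarrow> linear_at p (\<alpha> p)"
    and "\<And>i p a. i \<in> charts_at M p \<Longrightarrow> a < n \<Longrightarrow> smooth_at M (\<lambda>q. \<alpha> q (coord_field M i a q)) p"
    and "\<And>i p a b. i \<in> charts_at M p \<Longrightarrow> a < n \<Longrightarrow> b < n \<Longrightarrow>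
      cpd M i a (\<lambda>q. \<alpha> q (coord_field M i b q)) p = cpd M i b (\<lambda>q. \<alpha> q (coord_field M i a q)) p"
  shows "closed_form M \<alpha>"
  by (rule closed_formI_comps[where c="\<lambda>i a p. \<alpha> p (coord_field M i a p)", OF _ assms(2,3)])
     (use linear_at_chart[OF l] charts_at_topspace in auto)

end

context tf_conn_mfd
begin

text \<open>In the formula for the exterior derivative on two fields, the derivatives of their
  components cancel against the bracket term, and the derivatives of the components of
  \<open>\<alpha>\<close> cancel by their symmetry. The torsionless connection is used to see that
  the bracket is again a vector field.\<close>

lemma closed_form_closed_1form:
  assumes \<alpha>: "closed_form M \<alpha>"
    and \<theta>: "\<And>U X p. openin (mtop M) U \<Longrightarrow> vfield M U X \<Longrightarrow> p \<in> U \<Longrightarrow> \<theta> X p = \<alpha> p (X p)"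
  shows "closed_1form M \<theta>"
  unfolding closed_1form_def
proof (intro allI impI ballI)
  fix U X Y p assume "openin (mtop M) U \<and> vfield M U X \<and> vfield M U Y" and p: "p \<in> U"
  then have U: "openin (mtop M) U" and X: "vfield M U X" and Y: "vfield M U Y" by auto
  obtain c where c: "\<And>i p u. i \<in> charts_at M p \<Longrightarrow> u \<in> tangent_space M p \<Longrightarrow> \<alpha> p u = (\<Sum>a<n. c i a p * u i a)"
    "\<And>i p a. i \<in> charts_at M p \<Longrightarrow> a < n \<Longrightarrow> smooth_at M (c i a) p"
    "\<And>i p a b. i \<in> charts_at M p \<Longrightarrow> a < n \<Longrightarrow> b < n \<Longrightarrow> cpd M i a (c i b) p = cpd M i b (c i a) p"
    by (rule closed_formE[OF \<alpha>]) blast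
  obtain i where i: "i \<in> charts_at M p" using open_charts_at[OF U p] ..
  note top = charts_at_topspace[OF i]
  have *: "dirder M p (X p) (\<theta> Y) = (\<Sum>b<n. \<Sum>a<n. X p i a * Y p i b * cpd M i a (c i b) p)
     + (\<Sum>b<n. c i b p * vd M i p (X p) (\<lambda>q. Y q i b))" if X: "vfield M U X" and Y: "vfield M U Y" for X Y
  proof -
    have nU: "near M p (\<lambda>q. q \<in> U)" by (rule nearI[OF U p])
    have nr: "near M p (\<lambda>q. \<theta> Y q = (\<Sum>b<n. c i b q * Y q i b))"
      by (rule near_mono[OF near_conj[OF nU near_chart[OF i]]])
         (simp add: \<theta>[OF U Y] c(1) vfield_tangent[OF Y])
    note sY = vfield_smooth_at[OF U Y p i]
    have s: "smooth_at M (\<lambda>q. c i b q * Y q i b) p" if "b < n" for b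
      by (rule smooth_at_mult[OF c(2)[OF i that] sY[OF that]])
    have "dirder M p (X p) (\<theta> Y) = dirder M p (X p) (\<lambda>q. \<Sum>b<n. c i b q * Y q i b)" by (rule dirder_cong[OF nr])
    also have "\<dots> = vd M i p (X p) (\<lambda>q. \<Sum>b<n. c i b q * Y q i b)"
      by (rule dirder_eq[OF vfield_tangent[OF X p] _ i]) (use s in \<open>auto intro!: smooth_at_sum[OF top]\<close>)
    also have "\<dots> = (\<Sum>b<n. vd M i p (X p) (\<lambda>q. c i b q * Y q i b))" by (rule vd_sum[OF _ i]) (use s in auto)
    also have "\<dots> = (\<Sum>b<n. vd M i p (X p) (c i b) * Y p i b + c i b p * vd M i p (X p) (\<lambda>q. Y q i b))"
      by (intro sum.cong refl vd_mult c(2) sY i) auto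
    finally show ?thesis by (simp add: sum.distrib vd_def[of M i p "X p" "c i _"] sum_distrib_left mult_ac)
  qed
  have "\<theta> (bracket M X Y) p = (\<Sum>b<n. c i b p * bracket M X Y p i b)"
    using \<theta>[OF U bracket_vfield[OF U X Y] p] c(1)[OF i vfield_tangent[OF bracket_vfield[OF U X Y] p]] by simp
  also have "\<dots> = (\<Sum>b<n. c i b p * vd M i p (X p) (\<lambda>q. Y q i b)) - (\<Sum>b<n. c i b p * vd M i p (Y p) (\<lambda>q. X q i b))"
    by (simp add: bracket_apply[OF U X Y p i] right_diff_distrib sum_subtractf)
  finally have br: "\<theta> (bracket M X Y) p = (\<Sum>b<n. c i b p * vd M i p (X p) (\<lambda>q. Y q i b))
     - (\<Sum>b<n. c i b p * vd M i p (Y p) (\<lambda>q. X q i b))" .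
  have "(\<Sum>b<n. \<Sum>a<n. Y p i a * X p i b * cpd M i a (c i b) p) = (\<Sum>b<n. \<Sum>a<n. X p i a * Y p i b * cpd M i a (c i b) p)"
    by (subst sum.swap) (intro sum.cong refl, simp add: c(3)[OF i])
  then show "ext_deriv1 M \<theta> X Y p = 0"
    unfolding ext_deriv1_def *[OF X Y] *[OF Y X] br by linarith
qed

end

context affine_riem
begin

text \<open>The first Koszul form: the covariant derivative by \<open>nab\<close> of the Riemannian
  volume density along \<open>u\<close> is \<open>aform p u\<close> times that density. The factor
  1/2 is that of a square root of a determinant.\<close>

definition aform :: "'p \<Rightarrow> 'i tvec \<Rightarrow> real" where
  "aform p u = (let e = SOME e. onb p e in \<Sum>a<n. C p u (e a) (e a)) / 2"

text \<open>The divergence of the metric with respect to \<open>nab\<close>: here the direction of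
  differentiation is traced against one slot of \<open>g\<close>.\<close>

definition bform :: "'p \<Rightarrow> 'i tvec \<Rightarrow> real" where
  "bform p u = (let e = SOME e. onb p e in \<Sum>a<n. C p (e a) (e a) u)"

section \<open>The two trace forms and their relation to the Lee form\<close>

lemma aform_eq:
  assumes p: "p \<in> topspace (mtop M)" and u: "u \<in> tangent_space M p" and e: "onb p e"
  shows "aform p u = (\<Sum>a<n. C p u (e a) (e a)) / 2"
proof -
  have "onb p (SOME e. onb p e)" using e by (rule someI[of "onb p"])
  from trace_indep[OF this e p, of "C p u"] nabla_g_linear[OF p] u
  show ?thesis unfolding aform_def Let_def by simp
qed

lemma bform_eq:
  assumes p: "p \<in> topspace (mtop M)" and u: "u \<in> tangent_space M p" and e: "onb p e"
  shows "bform p u = (\<Sum>a<n. C p (e a) (e a) u)"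
proof -
  have "onb p (SOME e. onb p e)" using e by (rule someI[of "onb p"])
  from trace_indep[OF this e p, of "\<lambda>v w. C p v w u"] nabla_g_linear[OF p] u
  show ?thesis unfolding bform_def Let_def by simp
qed

lemma aform_linear:
  assumes p: "p \<in> topspace (mtop M)" shows "linear_at p (aform p)"
proof -
  obtain e where e: "onb p e" using ex_onb[OF p] ..
  note l = nabla_g_linear(1)[OF p onb_tangent[OF e] onb_tangent[OF e]]
  show ?thesis
    unfolding linear_at_def
    by (auto simp: aform_eq[OF p _ e] tangent_add tangent_scale linear_at_add[OF l] linear_at_scale[OF l]
        sum.distrib sum_distrib_left add_divide_distrib)
qed

lemma bform_linear:
  assumes p: "p \<in> topspace (mtop M)" shows "linear_at p (bform p)"
proof -
  obtain e where e: "onb p e" using ex_onb[OF p] ..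
  note l = nabla_g_linear(3)[OF p onb_tangent[OF e] onb_tangent[OF e]]
  show ?thesis
    unfolding linear_at_def
    by (auto simp: bform_eq[OF p _ e] tangent_add tangent_scale linear_at_add[OF l] linear_at_scale[OF l]
        sum.distrib sum_distrib_left)
qed

text \<open>
  For a Hermitian metric whose complex structure is \<open>\<nabla>\<close>-parallel, \<open>D J = [\<gamma>, J]\<close>, and the trace of
  \<open>\<gamma>\<^sub>u J v\<close> vanishes because \<open>J\<close> maps orthonormal bases to orthonormal bases and \<open>\<gamma>\<close> is symmetric.
\<close>

lemma lee_form_eq:
  assumes herm: "hermitian_manifold M J g"
    and par: "\<And>U X Y p. openin (mtop M) U \<Longrightarrow> vfield M U X \<Longrightarrow> vfield M U Y \<Longrightarrow> p \<in> U \<Longrightarrow>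
       nab X (apply_endo J Y) p = J p (nab X Y p)"
    and U: "openin (mtop M) U" and X: "vfield M U X" and p: "p \<in> U"
  shows "lee_form M J g (lc_conn M nab g) X p = aform p (X p) - bform p (X p)"
proof -
  let ?D = "lc_conn M nab g"
  have top: "p \<in> topspace (mtop M)" using U p openin_subset by blast
  have ac: "almost_complex M J" using herm by (auto simp: hermitian_manifold_def complex_structure_def)
  have Jt: "J p u \<in> tangent_space M p" and JJ: "J p (J p u) = - u" if "u \<in> tangent_space M p" for u
    using ac top that unfolding almost_complex_def by blast+
  have Jadd: "J p (u + v) = J p u + J p v" if "u \<in> tangent_space M p" "v \<in> tangent_space M p" for u v
    using ac top that unfolding almost_complex_def by blast
  have Jsc: "J p (tscale c u) = tscale c (J p u)" if "u \<in> tangent_space M p" for c u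
    using ac top that unfolding almost_complex_def by blast
  have Jg: "g p (J p u) (J p v) = g p u v" if "u \<in> tangent_space M p" "v \<in> tangent_space M p" for u v
    using herm top that unfolding hermitian_manifold_def by blast
  have Jv: "vfield M V (apply_endo J Y)" if "openin (mtop M) V" "vfield M V Y" for V Y
    using ac that unfolding almost_complex_def by blast
  \<comment> \<open>The frame chosen in the definition of the codifferential. All that is known of
    it is orthonormality on some neighbourhood of \<open>p\<close>, which is why \<open>U\<close> is
    cut down to \<open>V\<close>.\<close>
  define E where "E = (SOME E. \<exists>U. p \<in> U \<and> orthonormal_frame M g U E)"
  have "\<exists>E U. p \<in> U \<and> orthonormal_frame M g U E"
    using top by (metis charts_at_iff spanning_frame topspace_charts)
  then have "\<exists>U. p \<in> U \<and> orthonormal_frame M g U E" unfolding E_def by (rule someI_ex)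
  then obtain U0 where U0: "p \<in> U0" "orthonormal_frame M g U0 E" by blast
  define V where "V = U \<inter> U0"
  have V: "openin (mtop M) V" "p \<in> V" using U U0 p by (auto simp: V_def orthonormal_frame_def)
  have EV: "vfield M V (E a)" if "a < n" for a
    using U0(2) that vfield_subset[of V U0 "E a"] by (auto simp: orthonormal_frame_def V_def)
  have XV: "vfield M V X" using vfield_subset[OF _ X, of V] by (auto simp: V_def)
  define e where "e = (\<lambda>a. E a p)"
  have e: "onb p e" unfolding e_def by (rule orthonormal_frame_onb[OF U0(2,1)])
  note et = onb_tangent[OF e] and Xt = vfield_tangent[OF XV V(2)]
  let ?Z = "apply_endo J X"
  have Zp: "?Z p = J p (X p)" by (simp add: apply_endo_def)
  have ZV: "vfield M V ?Z" by (rule Jv[OF V(1) XV])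
  have mc: "metric_connection M g ?D" using lc_conn_levi_civita by (simp add: levi_civita_def)
  \<comment> \<open>Compatibility of \<open>?D\<close> with \<open>g\<close> removes the derivative
    of \<open>?Z\<close>; since \<open>J\<close> is parallel for \<open>nab\<close>, the terms with
    \<open>nab\<close> cancel and only those with \<open>\<gamma>\<close> remain. In the second of
    them \<open>J\<close> is dropped from both arguments because it is an isometry.\<close>
  have cd: "cov_deriv_20 M ?D (fundamental_form J g) (E a) (E a) ?Z p
      = g p (\<gamma> p (e a) (J p (e a))) (J p (X p)) - g p (\<gamma> p (e a) (e a)) (X p)" if a: "a < n" for a
  proof -
    note Ea = EV[OF a] and JE = Jv[OF V(1) EV[OF a]]
    have JEp: "apply_endo J (E a) p = J p (e a)" by (simp add: apply_endo_def e_def)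
    have nt: "nab (E a) (E a) p \<in> tangent_space M p" by (rule vfield_tangent[OF nab_vfield[OF V(1) Ea Ea] V(2)])
    have g1: "\<gamma> p (e a) (e a) \<in> tangent_space M p" by (rule lc_tensor_tangent[OF top et[OF a] et[OF a]])
    have g2: "\<gamma> p (e a) (J p (e a)) \<in> tangent_space M p" by (rule lc_tensor_tangent[OF top et[OF a] Jt[OF et[OF a]]])
    note Zt = Jt[OF Xt]
    have "dirder M p (E a p) (\<lambda>q. g q (apply_endo J (E a) q) (?Z q))
        = g p (?D (E a) (apply_endo J (E a)) p) (?Z p) + g p (apply_endo J (E a) p) (?D (E a) ?Z p)"
      using mc V Ea JE ZV unfolding metric_connection_def by blast
    moreover have "?D (E a) (apply_endo J (E a)) p = J p (nab (E a) (E a) p) + \<gamma> p (e a) (J p (e a))"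
      by (simp add: lc_conn_def par[OF V(1) Ea Ea V(2)] JEp e_def)
    moreover have "J p (?D (E a) (E a) p) = J p (nab (E a) (E a) p) + J p (\<gamma> p (e a) (e a))"
      using Jadd[OF nt g1] by (simp add: lc_conn_def e_def)
    ultimately have "cov_deriv_20 M ?D (fundamental_form J g) (E a) (E a) ?Z p
       = g p (\<gamma> p (e a) (J p (e a))) (J p (X p)) - g p (J p (\<gamma> p (e a) (e a))) (J p (X p))"
      using linear_at_add[OF g_linear1[OF top Zt] Jt[OF nt] g2] linear_at_add[OF g_linear1[OF top Zt] Jt[OF nt] Jt[OF g1]]
      by (simp add: cov_deriv_20_def fundamental_form_def apply_endo_def)
    then show ?thesis by (simp only: Jg[OF g1 Xt])
  qed
  \<comment> \<open>The minus signs of the Lee form and of the codifferential cancel.\<close>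
  have "lee_form M J g ?D X p = (\<Sum>a<n. cov_deriv_20 M ?D (fundamental_form J g) (E a) (E a) ?Z p)"
    by (simp add: lee_form_def codifferential_def E_def[symmetric])
  also have "\<dots> = (\<Sum>a<n. g p (\<gamma> p (e a) (J p (e a))) (J p (X p))) - (\<Sum>a<n. g p (\<gamma> p (e a) (e a)) (X p))"
    by (simp add: cd sum_subtractf)
  also have "(\<Sum>a<n. g p (\<gamma> p (e a) (J p (e a))) (J p (X p))) = 0"
  proof -
    define b where "b u v = g p (\<gamma> p u (J p v)) (J p (X p))" for u v
    note l = g_linear1[OF top Jt[OF Xt]]
    have b1: "linear_at p (\<lambda>u. b u v)" if v: "v \<in> tangent_space M p" for v
      unfolding linear_at_def b_def using Jt[OF v]
      by (auto simp: lc_tensor_add[OF top] lc_tensor_scale[OF top] lc_tensor_tangent[OF top] linear_at_add[OF l] linear_at_scale[OF l])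
    have b2: "linear_at p (b v)" if v: "v \<in> tangent_space M p" for v
      unfolding linear_at_def b_def using v
      by (auto simp: Jadd Jsc Jt lc_tensor_add2[OF top] lc_tensor_scale2[OF top] lc_tensor_tangent[OF top] linear_at_add[OF l] linear_at_scale[OF l])
    have Je: "onb p (\<lambda>a. J p (e a))"
      unfolding onb_def using Jt[OF et] by (auto simp: Jg[OF et et] onb_g[OF e])
    have "b (J p (e a)) (J p (e a)) = - b (e a) (e a)" if a: "a < n" for a
    proof -
      have t: "e a \<in> tangent_space M p" "J p (e a) \<in> tangent_space M p" using et[OF a] Jt by auto
      have "\<gamma> p (J p (e a)) (- e a) = - \<gamma> p (J p (e a)) (e a)"
        using lc_tensor_scale2[OF top t, of "-1"] by (simp only: tscale_minus_one)
      also have "\<dots> = - \<gamma> p (e a) (J p (e a))" by (simp only: lc_tensor_sym[OF top t])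
      finally show ?thesis unfolding b_def JJ[OF t(1)]
        by (simp only: linear_at_minus[OF l lc_tensor_tangent[OF top t]])
    qed
    then have "(\<Sum>a<n. b (J p (e a)) (J p (e a))) = - (\<Sum>a<n. b (e a) (e a))" by (simp add: sum_negf)
    with trace_indep[OF Je e top b1 b2] show ?thesis unfolding b_def[symmetric] by linarith
  qed
  \<comment> \<open>With equal first two arguments Koszul's formula reads C(e, e, X) - C(X, e, e) /
    2, and the half matches that in \<open>aform\<close>.\<close>
  also have "(\<Sum>a<n. g p (\<gamma> p (e a) (e a)) (X p)) = bform p (X p) - aform p (X p)"
    unfolding bform_eq[OF top Xt e] aform_eq[OF top Xt e]
    by (simp add: g_lc_tensor[OF top et et Xt] sum_subtractf sum_divide_distrib diff_divide_distrib)
  finally show ?thesis by simp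
qed

lemma parallel_complex_structure_lcb:
  assumes herm: "hermitian_manifold M J g"
    and par: "\<And>U X Y p. openin (mtop M) U \<Longrightarrow> vfield M U X \<Longrightarrow> vfield M U Y \<Longrightarrow> p \<in> U \<Longrightarrow>
       nab X (apply_endo J Y) p = J p (nab X Y p)"
    and "closed_form M aform" "closed_form M bform"
  shows "locally_conformally_balanced M J g"
  unfolding locally_conformally_balanced_def
proof (intro conjI herm exI[of _ "lc_conn M nab g"] lc_conn_levi_civita)
  have "closed_form M (\<lambda>p u. 1 * aform p u + (-1) * bform p u)" by (rule closed_form_combine[OF assms(3,4)])
  then show "closed_1form M (lee_form M J g (lc_conn M nab g))"
    by (rule closed_form_closed_1form) (use lee_form_eq[OF herm par] in auto)
qed


subsection \<open>Parallel difference tensor\<close>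

context
  fixes D :: "('p, 'i) conn"
  assumes lc: "levi_civita M g D" and parallel: "parallel_21 M D (difference_tensor D nab)"
begin

interpretation D: tf_conn_mfd M D
  by unfold_locales (use lc in \<open>auto simp: levi_civita_def\<close>)

lemma D_metric:
  "openin (mtop M) U \<Longrightarrow> vfield M U X \<Longrightarrow> vfield M U Y \<Longrightarrow> vfield M U Z \<Longrightarrow> p \<in> U \<Longrightarrow>
   dirder M p (X p) (\<lambda>q. g q (Y q) (Z q)) = g p (D X Y p) (Z p) + g p (Y p) (D X Z p)"
  using lc unfolding levi_civita_def metric_connection_def by blast

lemma diff_vfield: "openin (mtop M) U \<Longrightarrow> vfield M U X \<Longrightarrow> vfield M U Y \<Longrightarrow> vfield M U (difference_tensor D nab X Y)"
  unfolding difference_tensor_def by (intro vfield_diff D.nab_vfield nab_vfield)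

text \<open>Subtract the metric property of \<open>D\<close> from the Leibniz rule
  \<open>nabla_g_field\<close> for \<open>nab\<close>. This ties \<open>C\<close> directly to the
  given \<open>D\<close> and its difference tensor.\<close>

lemma nabla_g_diff:
  assumes U: "openin (mtop M) U" and X: "vfield M U X" and Y: "vfield M U Y" and Z: "vfield M U Z" and p: "p \<in> U"
  shows "C p (X p) (Y p) (Z p) = g p (difference_tensor D nab X Y p) (Z p) + g p (Y p) (difference_tensor D nab X Z p)"
proof -
  have top: "p \<in> topspace (mtop M)" using U p openin_subset by blast
  note t = vfield_tangent[OF _ p]
  have "g p (difference_tensor D nab X Y p) (Z p) = g p (D X Y p) (Z p) - g p (nab X Y p) (Z p)"
    unfolding difference_tensor_def fun_diff_def
    using linear_at_diff[OF g_linear1[OF top t[OF Z]] t[OF D.nab_vfield[OF U X Y]] t[OF nab_vfield[OF U X Y]]]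
    by (simp add: fun_diff_def)
  moreover have "g p (Y p) (difference_tensor D nab X Z p) = g p (Y p) (D X Z p) - g p (Y p) (nab X Z p)"
    unfolding difference_tensor_def fun_diff_def
    using linear_at_diff[OF g_linear2[OF top t[OF Y]] t[OF D.nab_vfield[OF U X Z]] t[OF nab_vfield[OF U X Z]]]
    by (simp add: fun_diff_def)
  ultimately show ?thesis using nabla_g_field[OF assms] D_metric[OF assms] by linarith
qed

text \<open>By \<open>nabla_g_diff\<close>, \<open>C\<close> is a contraction of the metric with the
  difference tensor, both parallel for \<open>D\<close>; the statement is the Leibniz form of its
  being parallel too.\<close>

lemma nabla_g_parallel:
  assumes U: "openin (mtop M) U" and X: "vfield M U X" and A: "vfield M U A" and B: "vfield M U B" and Z: "vfield M U Z"
    and p: "p \<in> U"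
  shows "dirder M p (X p) (\<lambda>q. C q (A q) (B q) (Z q)) = C p (D X A p) (B p) (Z p) + C p (A p) (D X B p) (Z p) + C p (A p) (B p) (D X Z p)"
proof -
  let ?S = "difference_tensor D nab"
  have top: "p \<in> topspace (mtop M)" using U p openin_subset by blast
  obtain i where i: "i \<in> charts_at M p" using open_charts_at[OF U p] ..
  note t = vfield_tangent[OF _ p] and dv = D.nab_vfield[OF U X] and Sv = diff_vfield[OF U]
  have par: "D X (?S Y W) p = ?S (D X Y) W p + ?S Y (D X W) p" if "vfield M U Y" "vfield M U W" for Y W
  proof -
    have "cov_deriv_21 D ?S X Y W p = 0" using parallel U X that p unfolding parallel_21_def by blast
    then have "D X (?S Y W) p - ?S (D X Y) W p - ?S Y (D X W) p = 0" by (simp add: cov_deriv_21_def)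
    then show ?thesis by (simp only: diff_diff_eq right_minus_eq)
  qed
  have nr: "near M p (\<lambda>q. C q (A q) (B q) (Z q) = g q (?S A B q) (Z q) + g q (B q) (?S A Z q))"
    by (rule nearI[OF U p]) (rule nabla_g_diff[OF U A B Z])
  have s1: "smooth_at M (\<lambda>q. g q (?S A B q) (Z q)) p" by (rule g_smooth_at[OF U Sv[OF A B] Z p])
  have s2: "smooth_at M (\<lambda>q. g q (B q) (?S A Z q)) p" by (rule g_smooth_at[OF U B Sv[OF A Z] p])
  have "dirder M p (X p) (\<lambda>q. C q (A q) (B q) (Z q)) = dirder M p (X p) (\<lambda>q. g q (?S A B q) (Z q) + g q (B q) (?S A Z q))"
    by (rule dirder_cong[OF nr])
  also have "\<dots> = dirder M p (X p) (\<lambda>q. g q (?S A B q) (Z q)) + dirder M p (X p) (\<lambda>q. g q (B q) (?S A Z q))"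
    unfolding dirder_eq[OF t[OF X] smooth_at_add[OF s1 s2] i] dirder_eq[OF t[OF X] s1 i] dirder_eq[OF t[OF X] s2 i]
    by (rule vd_add[OF s1 s2 i])
  also have "\<dots> = g p (D X (?S A B) p) (Z p) + g p (?S A B p) (D X Z p) + g p (D X B p) (?S A Z p) + g p (B p) (D X (?S A Z) p)"
    unfolding D_metric[OF U X Sv[OF A B] Z p] D_metric[OF U X B Sv[OF A Z] p] by simp
  also have "g p (D X (?S A B) p) (Z p) = g p (?S (D X A) B p) (Z p) + g p (?S A (D X B) p) (Z p)"
    unfolding par[OF A B] by (rule linear_at_add[OF g_linear1[OF top t[OF Z]] t[OF Sv[OF dv[OF A] B]] t[OF Sv[OF A dv[OF B]]]])
  also have "g p (B p) (D X (?S A Z) p) = g p (B p) (?S (D X A) Z p) + g p (B p) (?S A (D X Z) p)"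
    unfolding par[OF A Z] by (rule linear_at_add[OF g_linear2[OF top t[OF B]] t[OF Sv[OF dv[OF A] Z]] t[OF Sv[OF A dv[OF Z]]]])
  finally show ?thesis
    unfolding nabla_g_diff[OF U dv[OF A] B Z p] nabla_g_diff[OF U A dv[OF B] Z p] nabla_g_diff[OF U A B dv[OF Z] p]
    by simp
qed

text \<open>The matrix \<open>w\<close> of the derivative of an orthonormal frame is skew, and here
  it is contracted with the symmetrisation of \<open>b\<close>. Hence differentiation by
  \<open>D\<close> passes through traces over orthonormal frames.\<close>

lemma frame_derivative_trace:
  assumes E: "orthonormal_frame M g U E" and X: "vfield M U X" and p: "p \<in> U"
    and b1: "\<And>v. v \<in> tangent_space M p \<Longrightarrow> linear_at p (\<lambda>u. b u v)"
    and b2: "\<And>u. u \<in> tangent_space M p \<Longrightarrow> linear_at p (b u)"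
  shows "(\<Sum>a<n. b (D X (E a) p) (E a p) + b (E a p) (D X (E a) p)) = 0"
proof -
  have U: "openin (mtop M) U" and Ev: "\<And>a. a < n \<Longrightarrow> vfield M U (E a)" using E by (auto simp: orthonormal_frame_def)
  have top: "p \<in> topspace (mtop M)" using U p openin_subset by blast
  note e = orthonormal_frame_onb[OF E p]
  note et = onb_tangent[OF e]
  have Dt: "D X (E a) p \<in> tangent_space M p" if "a < n" for a
    by (rule vfield_tangent[OF D.nab_vfield[OF U X Ev[OF that]] p])
  obtain i where i: "i \<in> charts_at M p" using open_charts_at[OF U p] ..
  define w where "w a c = g p (D X (E a) p) (E c p)" for a c
  have anti: "w a c + w c a = 0" if a: "a < n" and c: "c < n" for a c
  proof -
    have "near M p (\<lambda>q. g q (E a q) (E c q) = (if a = c then 1 else 0))"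
      by (rule nearI[OF U p]) (use E a c in \<open>auto simp: orthonormal_frame_def\<close>)
    from dirder_cong[OF this, of "X p"]
    have "dirder M p (X p) (\<lambda>q. g q (E a q) (E c q)) = 0"
      using dirder_eq[OF vfield_tangent[OF X p] smooth_at_const[OF i] i] by (simp only: vd_const)
    then show ?thesis
      unfolding D_metric[OF U X Ev[OF a] Ev[OF c] p] w_def using g_sym[OF top et[OF a] Dt[OF c]] by simp
  qed
  have "b (D X (E a) p) (E a p) + b (E a p) (D X (E a) p) = (\<Sum>c<n. w a c * (b (E c p) (E a p) + b (E a p) (E c p)))"
    if a: "a < n" for a
  proof -
    note x = onb_expand[OF e top Dt[OF a], folded w_def]
    have "b (D X (E a) p) (E a p) = (\<Sum>c<n. w a c * b (E c p) (E a p))"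
      by (subst x, rule linear_at_comb[OF b1[OF et[OF a]]]) (auto intro: et)
    moreover have "b (E a p) (D X (E a) p) = (\<Sum>c<n. w a c * b (E a p) (E c p))"
      by (subst x, rule linear_at_comb[OF b2[OF et[OF a]]]) (auto intro: et)
    ultimately show ?thesis by (simp add: distrib_left sum.distrib)
  qed
  then have "(\<Sum>a<n. b (D X (E a) p) (E a p) + b (E a p) (D X (E a) p))
     = (\<Sum>a<n. \<Sum>c<n. w a c * (b (E c p) (E a p) + b (E a p) (E c p)))" (is "_ = ?s") by simp
  \<comment> \<open>Renaming the indices and using the skewness of \<open>w\<close> shows that the
    double sum equals its own negative.\<close>
  moreover have "?s = (\<Sum>a<n. \<Sum>c<n. w c a * (b (E c p) (E a p) + b (E a p) (E c p)))"
    by (subst sum.swap) (simp add: add.commute)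
  moreover have "\<dots> = - ?s"
  proof -
    have m: "w c a * r = - (w a c * r)" if "a < n" "c < n" for a c r
    proof -
      have "w c a = - w a c" using anti[OF that] by linarith
      then show ?thesis by simp
    qed
    show ?thesis unfolding sum_negf[symmetric] by (intro sum.cong refl m) auto
  qed
  ultimately show ?thesis by linarith
qed

text \<open>Both traces are differentiated term by term over a local orthonormal frame with
  \<open>nabla_g_parallel\<close>. The derivatives of the frame add up to 0 by
  \<open>frame_derivative_trace\<close>, leaving the derivative of \<open>Z\<close>.\<close>

lemma trace_forms_parallel:
  assumes U: "openin (mtop M) U" and X: "vfield M U X" and Z: "vfield M U Z" and p: "p \<in> U"
  shows "smooth_at M (\<lambda>q. aform q (Z q)) p" "dirder M p (X p) (\<lambda>q. aform q (Z q)) = aform p (D X Z p)"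
    "smooth_at M (\<lambda>q. bform q (Z q)) p" "dirder M p (X p) (\<lambda>q. bform q (Z q)) = bform p (D X Z p)"
proof -
  have top: "p \<in> topspace (mtop M)" using U p openin_subset by blast
  obtain i where i: "i \<in> charts_at M p" using open_charts_at[OF U p] ..
  then have ic: "i \<in> charts M" "p \<in> cdom M i" by (simp_all add: charts_at_iff)
  obtain E where E0: "orthonormal_frame M g (cdom M i) E" by (rule spanning_frame[OF ic(1)])
  define V where "V = U \<inter> cdom M i"
  have V: "openin (mtop M) V" using U cdom_open[OF ic(1)] by (auto simp: V_def)
  have pV: "p \<in> V" using p ic by (simp add: V_def)
  have XV: "vfield M V X" and ZV: "vfield M V Z" using vfield_subset X Z unfolding V_def by blast+
  have EV: "vfield M V (E a)" if "a < n" for a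
    using vfield_subset[of V "cdom M i" "E a"] E0 that by (auto simp: orthonormal_frame_def V_def)
  have E: "orthonormal_frame M g V E" using E0 EV V by (auto simp: orthonormal_frame_def V_def)
  note e = orthonormal_frame_onb[OF E] and ep = orthonormal_frame_onb[OF E pV]
  note et = onb_tangent[OF ep] and Xt = vfield_tangent[OF XV pV] and Zt = vfield_tangent[OF ZV pV]
  have DZt: "D X Z p \<in> tangent_space M p" by (rule vfield_tangent[OF D.nab_vfield[OF V XV ZV] pV])
  have qt: "q \<in> topspace (mtop M)" if "q \<in> V" for q using that openin_subset[OF V] by blast
  have na: "near M p (\<lambda>q. (\<Sum>a<n. C q (Z q) (E a q) (E a q)) * (1 / 2) = aform q (Z q))"
    by (rule nearI[OF V pV]) (simp add: aform_eq[OF qt vfield_tangent[OF ZV] e])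
  have nb: "near M p (\<lambda>q. (\<Sum>a<n. C q (E a q) (E a q) (Z q)) = bform q (Z q))"
    by (rule nearI[OF V pV]) (simp add: bform_eq[OF qt vfield_tangent[OF ZV] e])
  have sa: "smooth_at M (\<lambda>q. C q (Z q) (E a q) (E a q)) p" if "a < n" for a
    by (rule nabla_g_smooth_at[OF V ZV EV[OF that] EV[OF that] pV])
  have sb: "smooth_at M (\<lambda>q. C q (E a q) (E a q) (Z q)) p" if "a < n" for a
    by (rule nabla_g_smooth_at[OF V EV[OF that] EV[OF that] ZV pV])
  have sA: "smooth_at M (\<lambda>q. \<Sum>a<n. C q (Z q) (E a q) (E a q)) p" by (rule smooth_at_sum[OF top]) (use sa in auto)
  have sB: "smooth_at M (\<lambda>q. \<Sum>a<n. C q (E a q) (E a q) (Z q)) p" by (rule smooth_at_sum[OF top]) (use sb in auto)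
  have sA2: "smooth_at M (\<lambda>q. (\<Sum>a<n. C q (Z q) (E a q) (E a q)) * (1 / 2)) p"
    by (rule smooth_at_mult[OF sA smooth_at_const[OF i]])
  show "smooth_at M (\<lambda>q. aform q (Z q)) p" by (rule smooth_at_cong[OF na sA2])
  show "smooth_at M (\<lambda>q. bform q (Z q)) p" by (rule smooth_at_cong[OF nb sB])
  have "dirder M p (X p) (\<lambda>q. aform q (Z q)) = vd M i p (X p) (\<lambda>q. (\<Sum>a<n. C q (Z q) (E a q) (E a q)) * (1 / 2))"
    unfolding dirder_cong[OF na, symmetric] by (rule dirder_eq[OF Xt sA2 i])
  also have "\<dots> = (\<Sum>a<n. vd M i p (X p) (\<lambda>q. C q (Z q) (E a q) (E a q))) * (1 / 2)"
    unfolding vd_mult[OF sA smooth_at_const[OF i] i] vd_const by (subst vd_sum[OF _ i]) (use sa in auto)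
  also have "(\<Sum>a<n. vd M i p (X p) (\<lambda>q. C q (Z q) (E a q) (E a q)))
      = (\<Sum>a<n. C p (D X Z p) (E a p) (E a p) + (C p (Z p) (D X (E a) p) (E a p) + C p (Z p) (E a p) (D X (E a) p)))"
  proof (intro sum.cong refl)
    fix a assume "a \<in> {..<n}"
    then have a: "a < n" by simp
    show "vd M i p (X p) (\<lambda>q. C q (Z q) (E a q) (E a q)) = C p (D X Z p) (E a p) (E a p) + (C p (Z p) (D X (E a) p) (E a p) + C p (Z p) (E a p) (D X (E a) p))"
      using nabla_g_parallel[OF V XV ZV EV[OF a] EV[OF a] pV] dirder_eq[OF Xt sa[OF a] i] by simp
  qed
  also have "\<dots> = (\<Sum>a<n. C p (D X Z p) (E a p) (E a p))"
    using frame_derivative_trace[OF E XV pV nabla_g_linear(2)[OF top Zt] nabla_g_linear(3)[OF top Zt]]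
    by (simp add: sum.distrib)
  finally show "dirder M p (X p) (\<lambda>q. aform q (Z q)) = aform p (D X Z p)"
    by (simp add: aform_eq[OF top DZt ep])
  have "dirder M p (X p) (\<lambda>q. bform q (Z q)) = vd M i p (X p) (\<lambda>q. \<Sum>a<n. C q (E a q) (E a q) (Z q))"
    unfolding dirder_cong[OF nb, symmetric] by (rule dirder_eq[OF Xt sB i])
  also have "\<dots> = (\<Sum>a<n. vd M i p (X p) (\<lambda>q. C q (E a q) (E a q) (Z q)))"
    by (rule vd_sum[OF _ i]) (use sb in auto)
  also have "\<dots> = (\<Sum>a<n. (C p (D X (E a) p) (E a p) (Z p) + C p (E a p) (D X (E a) p) (Z p)) + C p (E a p) (E a p) (D X Z p))"
  proof (intro sum.cong refl)
    fix a assume "a \<in> {..<n}"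
    then have a: "a < n" by simp
    show "vd M i p (X p) (\<lambda>q. C q (E a q) (E a q) (Z q)) = (C p (D X (E a) p) (E a p) (Z p) + C p (E a p) (D X (E a) p) (Z p)) + C p (E a p) (E a p) (D X Z p)"
      using nabla_g_parallel[OF V XV EV[OF a] EV[OF a] ZV pV] dirder_eq[OF Xt sb[OF a] i] by simp
  qed
  also have "\<dots> = (\<Sum>a<n. C p (E a p) (E a p) (D X Z p))"
    using frame_derivative_trace[OF E XV pV, of "\<lambda>u v. C p u v (Z p)"] nabla_g_linear(1,2)[OF top _ Zt]
    by (simp add: sum.distrib)
  finally show "dirder M p (X p) (\<lambda>q. bform q (Z q)) = bform p (D X Z p)"
    by (simp add: bform_eq[OF top DZt ep])
qed

text \<open>A parallel one-form of a torsionless connection is closed: its \<open>b\<close>-th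
  component differentiated in direction \<open>a\<close> is its value on the covariant derivative of
  the \<open>b\<close>-th coordinate field along the \<open>a\<close>-th, which is symmetric in
  \<open>a\<close> and \<open>b\<close>.\<close>

lemma trace_forms_closed: "closed_form M aform" "closed_form M bform"
proof -
  have sym: "D (coord_field M i a) (coord_field M i b) p = D (coord_field M i b) (coord_field M i a) p"
    if "i \<in> charts_at M p" "a < n" "b < n" for i a b p
  proof -
    have ic: "i \<in> charts M" "p \<in> cdom M i" using that by (simp_all add: charts_at_iff)
    note U = cdom_open[OF ic(1)] and E = coord_field_vfield[OF ic(1)]
    have "D (coord_field M i a) (coord_field M i b) p - D (coord_field M i b) (coord_field M i a) p = 0"
      using D.bracket_eq[OF U E E ic(2)] D.bracket_coord_field[OF that] that by simp
    then show ?thesis by simp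
  qed
  have par: "smooth_at M (\<lambda>q. aform q (coord_field M i b q)) p" "smooth_at M (\<lambda>q. bform q (coord_field M i b q)) p"
     "cpd M i a (\<lambda>q. aform q (coord_field M i b q)) p = aform p (D (coord_field M i a) (coord_field M i b) p)"
     "cpd M i a (\<lambda>q. bform q (coord_field M i b q)) p = bform p (D (coord_field M i a) (coord_field M i b) p)"
    if i: "i \<in> charts_at M p" and a: "a < n" and b: "b < n" for i a b p
  proof -
    have ic: "i \<in> charts M" "p \<in> cdom M i" using i by (simp_all add: charts_at_iff)
    note t = trace_forms_parallel[OF cdom_open[OF ic(1)] coord_field_vfield[OF ic(1) a] coord_field_vfield[OF ic(1) b] ic(2)]
    show "smooth_at M (\<lambda>q. aform q (coord_field M i b q)) p" "smooth_at M (\<lambda>q. bform q (coord_field M i b q)) p"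
      by (rule t(1), rule t(3))
    show "cpd M i a (\<lambda>q. aform q (coord_field M i b q)) p = aform p (D (coord_field M i a) (coord_field M i b) p)"
      using t(2) dirder_eq[OF coord_field_tangent[OF i a] t(1) i] vd_coord_field[OF i a] by simp
    show "cpd M i a (\<lambda>q. bform q (coord_field M i b q)) p = bform p (D (coord_field M i a) (coord_field M i b) p)"
      using t(4) dirder_eq[OF coord_field_tangent[OF i a] t(3) i] vd_coord_field[OF i a] by simp
  qed
  show "closed_form M aform"
  proof (rule linear_closed_formI)
    fix i p a assume c: "i \<in> charts_at M p" "a < n"
    show "smooth_at M (\<lambda>q. aform q (coord_field M i a q)) p" by (rule par(1)[OF c c(2)])
    show "cpd M i a (\<lambda>q. aform q (coord_field M i b q)) p = cpd M i b (\<lambda>q. aform q (coord_field M i a q)) p" if b: "b < n" for b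
      unfolding par(3)[OF c b] par(3)[OF c(1) b c(2)] sym[OF c b] ..
  qed (rule aform_linear)
  show "closed_form M bform"
  proof (rule linear_closed_formI)
    fix i p a assume c: "i \<in> charts_at M p" "a < n"
    show "smooth_at M (\<lambda>q. bform q (coord_field M i a q)) p" by (rule par(2)[OF c c(2)])
    show "cpd M i a (\<lambda>q. bform q (coord_field M i b q)) p = cpd M i b (\<lambda>q. bform q (coord_field M i a q)) p" if b: "b < n" for b
      unfolding par(4)[OF c b] par(4)[OF c(1) b c(2)] sym[OF c b] ..
  qed (rule bform_linear)
qed

end

end

section \<open>The tangent bundle as a smooth manifold\<close>

lemma tangent_bundle_simps [simp]:
  "mdim (tangent_bundle M) = 2 * mdim M" "charts (tangent_bundle M) = charts M"
  "cdom (tangent_bundle M) i = bundle_over M (cdom M i)" "coord (tangent_bundle M) = tcoord M"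
  by (simp_all add: tangent_bundle_def)

lemma Tan_in_bundle_over [simp]: "Tan p v \<in> bundle_over M U \<longleftrightarrow> p \<in> U \<and> v \<in> tangent_space M p"
  by (auto simp: bundle_over_def)

lemma bundle_overE:
  assumes "\<xi> \<in> bundle_over M U"
  obtains p v where "\<xi> = Tan p v" "p \<in> U" "v \<in> tangent_space M p"
  using assms by (auto simp: bundle_over_def)

lemma bundle_over_iff: "\<xi> \<in> bundle_over M U \<longleftrightarrow> tbase \<xi> \<in> U \<and> tfib \<xi> \<in> tangent_space M (tbase \<xi>) \<and> \<xi> = Tan (tbase \<xi>) (tfib \<xi>)"
  by (cases \<xi>) (auto simp: bundle_over_def)

lemma bundle_over_Int: "bundle_over M (U \<inter> V) = bundle_over M U \<inter> bundle_over M V"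
  by (auto simp: bundle_over_iff)

definition trunc :: "nat \<Rightarrow> (nat \<Rightarrow> real) \<Rightarrow> nat \<Rightarrow> real" where
  "trunc n x = (\<lambda>k. if k < n then x k else 0)"

text \<open>The product of \<open>W\<close> with an \<open>n\<close>-dimensional vector space,
  realised inside the Euclidean space of dimension \<open>2 * n\<close>. By
  \<open>tcoord_image\<close> these are the coordinate images of the bundle over subsets of a
  chart.\<close>

definition cylinder :: "nat \<Rightarrow> (nat \<Rightarrow> real) set \<Rightarrow> (nat \<Rightarrow> real) set" where
  "cylinder n W = {x. (\<forall>k\<ge>2 * n. x k = 0) \<and> trunc n x \<in> W}"

lemma openin_cylinder:
  assumes "openin (Euclidean_space n) W"
  shows "openin (Euclidean_space (2 * n)) (cylinder n W)"
proof (rule openin_Euclidean_space_boxI)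
  show "cylinder n W \<subseteq> {x. \<forall>i\<ge>2 * n. x i = 0}" by (auto simp: cylinder_def)
  fix x assume "x \<in> cylinder n W"
  then have "trunc n x \<in> W" by (simp add: cylinder_def)
  then obtain d where d: "d > 0" "\<And>y. (\<And>i. i \<ge> n \<Longrightarrow> y i = 0) \<Longrightarrow> (\<And>i. i < n \<Longrightarrow> \<bar>y i - trunc n x i\<bar> < d) \<Longrightarrow> y \<in> W"
    by (rule openin_Euclidean_space_box[OF assms]) blast
  show "\<exists>d>0. \<forall>y. (\<forall>i\<ge>2 * n. y i = 0) \<and> (\<forall>i<2 * n. \<bar>y i - x i\<bar> < d) \<longrightarrow> y \<in> cylinder n W"
  proof (intro exI[of _ d] conjI d(1) allI impI)
    fix y assume "(\<forall>i\<ge>2 * n. y i = 0) \<and> (\<forall>i<2 * n. \<bar>y i - x i\<bar> < d)"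
    then show "y \<in> cylinder n W" by (auto simp: cylinder_def trunc_def intro!: d(2))
  qed
qed

lemma smooth_real_on_cylinder:
  assumes W: "openin (Euclidean_space n) W" and f: "smooth_real_on n W f"
  shows "smooth_real_on (2 * n) (cylinder n W) (\<lambda>x. f (trunc n x))"
proof (rule smooth_real_on_comp[OF W openin_cylinder[OF W] f])
  show "smooth_real_on (2 * n) (cylinder n W) (\<lambda>x. trunc n x a)" for a
    unfolding trunc_def smooth_real_on_def
    by (cases "a < n") (auto intro: Ck_on_coordinate Ck_on_const openin_cylinder[OF W])
qed (auto simp: trunc_def cylinder_def)

lemma sum_lessThan_double: "(\<Sum>a<2 * n. f a) = (\<Sum>a<n. f a) + (\<Sum>a<n. f (n + a))" for f :: "nat \<Rightarrow> 'b::comm_monoid_add"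
  by (simp only: mult_2 sum.nat_group[symmetric] lessThan_atLeast0 sum.atLeastLessThan_concat[of 0 n "n + n", symmetric] le0 le_add1)
     (simp add: sum.shift_bounds_nat_ivl[of f 0 n n, simplified] add.commute)

locale tb_mfd = smooth_mfd M for M :: "('a, 'i) tmanifold"
begin

abbreviation "TM \<equiv> tangent_bundle M"

lemma tcoord_beyond: "k \<ge> 2 * n \<Longrightarrow> tcoord M i \<xi> k = 0"
  by (simp add: tcoord_def)

lemma trunc_tcoord: "i \<in> charts_at M (tbase \<xi>) \<Longrightarrow> trunc n (tcoord M i \<xi>) = coord M i (tbase \<xi>)"
  by (auto simp: trunc_def tcoord_def fun_eq_iff coord_zero)

lemma tcoord_fibre: "a < n \<Longrightarrow> tcoord M i \<xi> (n + a) = tfib \<xi> i a"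
  by (simp add: tcoord_def)

text \<open>The fibre coordinates are unrestricted because any \<open>n\<close> numbers are the
  components in chart \<open>i\<close> of some tangent vector.\<close>

lemma tcoord_image:
  assumes i: "i \<in> charts M" and U: "U \<subseteq> cdom M i"
  shows "tcoord M i ` bundle_over M U = cylinder n (coord M i ` U)"
proof (intro set_eqI iffI)
  fix x assume "x \<in> tcoord M i ` bundle_over M U"
  then obtain p v where pv: "x = tcoord M i (Tan p v)" "p \<in> U" "v \<in> tangent_space M p"
    by (auto elim!: bundle_overE)
  have "trunc n x = coord M i p" using trunc_tcoord[of i "Tan p v"] pv U i by (auto simp: charts_at_iff)
  with pv show "x \<in> cylinder n (coord M i ` U)" by (simp add: cylinder_def tcoord_beyond)
next
  fix x assume x: "x \<in> cylinder n (coord M i ` U)"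
  then obtain p where p: "p \<in> U" "trunc n x = coord M i p" by (auto simp: cylinder_def)
  have ip: "i \<in> charts_at M p" using p U i by (auto simp: charts_at_iff)
  obtain v where v: "v \<in> tangent_space M p" "\<And>k. k < n \<Longrightarrow> v i k = x (n + k)"
    by (rule tangent_of_comps[OF ip, of "\<lambda>k. x (n + k)"]) blast
  have "tcoord M i (Tan p v) = x"
  proof
    fix k
    consider "k < n" | "n \<le> k" "k < 2 * n" | "k \<ge> 2 * n" by linarith
    then show "tcoord M i (Tan p v) k = x k"
    proof cases
      case 1
      then show ?thesis using fun_cong[OF p(2), of k] by (simp add: tcoord_def trunc_def)
    next
      case 2
      then show ?thesis using v(2)[of "k - n"] by (simp add: tcoord_def)
    next
      case 3
      then show ?thesis using x by (simp add: tcoord_def cylinder_def)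
    qed
  qed
  with p v show "x \<in> tcoord M i ` bundle_over M U" by (metis Tan_in_bundle_over image_eqI)
qed

lemma tcoord_inj: assumes i: "i \<in> charts M" shows "inj_on (tcoord M i) (bundle_over M (cdom M i))"
proof (rule inj_onI)
  fix \<xi> \<eta> assume a: "\<xi> \<in> bundle_over M (cdom M i)" "\<eta> \<in> bundle_over M (cdom M i)" and eq: "tcoord M i \<xi> = tcoord M i \<eta>"
  have c: "i \<in> charts_at M (tbase \<xi>)" "i \<in> charts_at M (tbase \<eta>)" using a i by (auto simp: bundle_over_iff charts_at_iff)
  have "coord M i (tbase \<xi>) = coord M i (tbase \<eta>)" using eq trunc_tcoord[OF c(1)] trunc_tcoord[OF c(2)] by simp
  then have b: "tbase \<xi> = tbase \<eta>" using cinv_coord[OF c(1)] cinv_coord[OF c(2)] by metis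
  have t: "tfib \<xi> \<in> tangent_space M (tbase \<xi>)" "tfib \<eta> \<in> tangent_space M (tbase \<xi>)" using a b by (auto simp: bundle_over_iff)
  have "tfib \<xi> i k = tfib \<eta> i k" if "k < n" for k using tcoord_fibre[OF that] eq by metis
  then have "tfib \<xi> = tfib \<eta>" by (rule tangent_eqI[OF t c(1)])
  with b a show "\<xi> = \<eta>" by (metis bundle_over_iff)
qed

text \<open>The transition map of the bundle in coordinates: the transition of the base on the first
  half, its Jacobian matrix applied to the second half.\<close>

definition ttrans :: "'i \<Rightarrow> 'i \<Rightarrow> (nat \<Rightarrow> real) \<Rightarrow> nat \<Rightarrow> real" where
  "ttrans i j x k = (if k < n then coord M j (cinv M i (trunc n x)) k
     else if k < 2 * n then \<Sum>a<n. pderiv_at a (\<lambda>y. coord M j (cinv M i y) (k - n)) (trunc n x) * x (n + a) else 0)"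

lemma ttrans_tcoord:
  assumes \<xi>: "tfib \<xi> \<in> tangent_space M (tbase \<xi>)" and i: "i \<in> charts_at M (tbase \<xi>)" and j: "j \<in> charts_at M (tbase \<xi>)"
  shows "ttrans i j (tcoord M i \<xi>) = tcoord M j \<xi>"
proof
  fix k
  consider "k < n" | "n \<le> k" "k < 2 * n" | "k \<ge> 2 * n" by linarith
  then show "ttrans i j (tcoord M i \<xi>) k = tcoord M j \<xi> k"
  proof cases
    case 1
    then show ?thesis by (simp add: ttrans_def trunc_tcoord[OF i] cinv_coord[OF i]) (simp add: tcoord_def)
  next
    case 2
    then have k: "k - n < n" by linarith
    have "ttrans i j (tcoord M i \<xi>) k = (\<Sum>a<n. jacobian M i j (tbase \<xi>) (k - n) a * tfib \<xi> i a)"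
      using 2 by (simp add: ttrans_def trunc_tcoord[OF i] jacobian_def tcoord_fibre)
    also have "\<dots> = tfib \<xi> j (k - n)" by (rule tangent_transform[OF \<xi> i j k, symmetric])
    finally show ?thesis using 2 by (simp add: tcoord_def)
  next
    case 3
    then show ?thesis by (simp add: ttrans_def tcoord_def)
  qed
qed

lemma overlap_open: "i \<in> charts M \<Longrightarrow> j \<in> charts M \<Longrightarrow> openin (Euclidean_space n) (coord M i ` (cdom M i \<inter> cdom M j))"
  using coord_Int_open[of i "cdom M j"] cdom_open by (simp add: Int_commute)

lemma ttrans_smooth:
  assumes i: "i \<in> charts M" and j: "j \<in> charts M"
  shows "smooth_real_on (2 * n) (cylinder n (coord M i ` (cdom M i \<inter> cdom M j))) (\<lambda>x. ttrans i j x k)"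
proof -
  let ?W = "coord M i ` (cdom M i \<inter> cdom M j)"
  note W = overlap_open[OF i j] and O = openin_cylinder[OF overlap_open[OF i j]]
  have tr: "smooth_real_on n ?W (\<lambda>y. coord M j (cinv M i y) k)" if "k < n" for k
    using transition_smooth[OF i j, of k] that by simp
  consider "k < n" | "n \<le> k" "k < 2 * n" | "k \<ge> 2 * n" by linarith
  then show ?thesis
  proof cases
    case 1
    then show ?thesis using smooth_real_on_cylinder[OF W tr[OF 1]] by (simp add: ttrans_def)
  next
    case 2
    then have k: "k - n < n" by linarith
    have s: "smooth_real_on (2 * n) (cylinder n ?W) (\<lambda>x. pderiv_at a (\<lambda>y. coord M j (cinv M i y) (k - n)) (trunc n x))" if "a < n" for a
      by (rule smooth_real_on_cylinder[OF W smooth_real_on_pderiv[OF tr[OF k] that]])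
    show ?thesis
      using 2 s unfolding smooth_real_on_def ttrans_def
      by (auto intro!: Ck_on_sum[OF O] Ck_on_mult[OF O] Ck_on_coordinate[OF O])
  next
    case 3
    then show ?thesis by (auto simp: ttrans_def smooth_real_on_def intro: Ck_on_const[OF O])
  qed
qed

section \<open>The topology of the tangent bundle\<close>

lemma openin_TM_basic:
  assumes "i \<in> charts M" "openin (Euclidean_space (2 * n)) V"
  shows "openin (mtop TM) {\<xi> \<in> bundle_over M (cdom M i). tcoord M i \<xi> \<in> V}"
  using assms unfolding tangent_bundle_def by (auto intro!: topology_generated_by_Basis)

text \<open>The topology is generated from all charts at once, so openness of a set in one chart is
  proved by induction on its generation. Intersections pass through the chart map by injectivity; a
  basic set of another chart \<open>j\<close> becomes a preimage under the continuous transition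
  map.\<close>

lemma openin_TM_chart:
  assumes i: "i \<in> charts M" and U: "openin (mtop TM) U"
  shows "openin (Euclidean_space (2 * n)) (tcoord M i ` (U \<inter> bundle_over M (cdom M i)))"
proof -
  let ?S = "{{\<xi> \<in> bundle_over M (cdom M i). tcoord M i \<xi> \<in> V} | i V. i \<in> charts M \<and> openin (Euclidean_space (2 * n)) V}"
  let ?B = "bundle_over M (cdom M i)"
  have "generate_topology_on ?S U" using U by (simp add: tangent_bundle_def openin_topology_generated_by_iff)
  then show ?thesis
  proof (induction rule: generate_topology_on.induct)
    case Empty
    then show ?case by simp
  next
    case (Int a b)
    have "tcoord M i ` (a \<inter> b \<inter> ?B) = tcoord M i ` (a \<inter> ?B) \<inter> tcoord M i ` (b \<inter> ?B)"
      using inj_on_image_Int[OF tcoord_inj[OF i], of "a \<inter> ?B" "b \<inter> ?B"] by (simp add: Int_ac)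
    with Int show ?case by (simp add: openin_Int)
  next
    case (UN K)
    have "tcoord M i ` (\<Union> K \<inter> ?B) = (\<Union>k\<in>K. tcoord M i ` (k \<inter> ?B))" by blast
    with UN show ?case by (auto intro: openin_Union)
  next
    case (Basis s)
    then obtain j V where j: "j \<in> charts M" and V: "openin (Euclidean_space (2 * n)) V"
      and s: "s = {\<xi> \<in> bundle_over M (cdom M j). tcoord M j \<xi> \<in> V}" by blast
    let ?W = "cylinder n (coord M i ` (cdom M i \<inter> cdom M j))"
    have W: "openin (Euclidean_space (2 * n)) ?W" by (rule openin_cylinder[OF overlap_open[OF i j]])
    have im: "tcoord M i ` bundle_over M (cdom M i \<inter> cdom M j) = ?W" by (rule tcoord_image[OF i]) blast
    have tt: "ttrans i j (tcoord M i \<xi>) = tcoord M j \<xi>" if "\<xi> \<in> bundle_over M (cdom M i \<inter> cdom M j)" for \<xi>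
      using that i j by (intro ttrans_tcoord) (auto simp: bundle_over_iff charts_at_iff)
    have eq: "tcoord M i ` (s \<inter> ?B) = ?W \<inter> ttrans i j -` V"
    proof (intro set_eqI iffI)
      fix x assume "x \<in> tcoord M i ` (s \<inter> ?B)"
      then obtain \<xi> where "\<xi> \<in> bundle_over M (cdom M i \<inter> cdom M j)" "tcoord M j \<xi> \<in> V" "x = tcoord M i \<xi>"
        using s by (auto simp: bundle_over_Int)
      with tt im show "x \<in> ?W \<inter> ttrans i j -` V" by auto
    next
      fix x assume x: "x \<in> ?W \<inter> ttrans i j -` V"
      then obtain \<xi> where "\<xi> \<in> bundle_over M (cdom M i \<inter> cdom M j)" "x = tcoord M i \<xi>" using im by (metis IntD1 imageE)
      with x tt show "x \<in> tcoord M i ` (s \<inter> ?B)" using s by (auto simp: bundle_over_Int)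
    qed
    have "continuous_on ?W (ttrans i j)"
    proof (rule continuous_on_coordinatewise_then_product)
      show "continuous_on ?W (\<lambda>x. ttrans i j x k)" for k
        by (rule Ck_on_continuous[OF W smooth_real_on_Ck[OF ttrans_smooth[OF i j], of 0]])
    qed
    moreover obtain T where T: "open T" "V = {x. \<forall>i\<ge>2 * n. x i = 0} \<inter> T"
      using V by (auto simp: Euclidean_space_eq_top_of_set openin_open)
    ultimately have "openin (top_of_set ?W) (?W \<inter> ttrans i j -` T)"
      by (simp add: continuous_openin_preimage_gen)
    moreover have "top_of_set ?W = subtopology (Euclidean_space (2 * n)) ?W"
      using openin_subset[OF W]
      by (simp add: topspace_Euclidean_space Euclidean_space_eq_top_of_set subtopology_subtopology Int_absorb1)
    ultimately have "openin (Euclidean_space (2 * n)) (?W \<inter> ttrans i j -` T)"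
      using W openin_trans_full by metis
    \<comment> \<open>The sets \<open>V\<close> and \<open>T\<close> differ only outside the
      coordinate subspace, in which \<open>ttrans\<close> takes its values.\<close>
    moreover have "?W \<inter> ttrans i j -` V = ?W \<inter> ttrans i j -` T" by (auto simp: T(2) ttrans_def)
    ultimately show ?case unfolding eq by simp
  qed
qed

lemma topspace_TM: "topspace (mtop TM) = (\<Union>i\<in>charts M. bundle_over M (cdom M i))"
proof -
  have "topspace (mtop TM) = \<Union>{{\<xi> \<in> bundle_over M (cdom M i). tcoord M i \<xi> \<in> V} | i V.
            i \<in> charts M \<and> openin (Euclidean_space (2 * n)) V}"
    by (simp add: tangent_bundle_def topology_generated_by_topspace)
  also have "\<dots> = (\<Union>i\<in>charts M. bundle_over M (cdom M i))"
  proof (intro equalityI subsetI)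
    fix \<xi> assume "\<xi> \<in> (\<Union>i\<in>charts M. bundle_over M (cdom M i))"
    then obtain i where i: "i \<in> charts M" "\<xi> \<in> bundle_over M (cdom M i)" by blast
    have "tcoord M i \<xi> \<in> topspace (Euclidean_space (2 * n))" by (simp add: topspace_Euclidean_space tcoord_beyond)
    with i show "\<xi> \<in> \<Union>{{\<xi> \<in> bundle_over M (cdom M i). tcoord M i \<xi> \<in> V} | i V.
            i \<in> charts M \<and> openin (Euclidean_space (2 * n)) V}" by blast
  qed blast
  finally show ?thesis .
qed

lemma openin_bundle_over:
  assumes U: "openin (mtop M) U"
  shows "openin (mtop TM) (bundle_over M U)"
proof (subst openin_subopen, intro ballI)
  fix \<xi> assume \<xi>: "\<xi> \<in> bundle_over M U"
  then have "tbase \<xi> \<in> U" by (simp add: bundle_over_iff)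
  then obtain i where i: "i \<in> charts_at M (tbase \<xi>)" using open_charts_at[OF U] by blast
  then have ic: "i \<in> charts M" by (simp add: charts_at_iff)
  let ?T = "{\<eta> \<in> bundle_over M (cdom M i). tcoord M i \<eta> \<in> cylinder n (coord M i ` (U \<inter> cdom M i))}"
  have "openin (mtop TM) ?T"
    by (rule openin_TM_basic[OF ic openin_cylinder[OF coord_Int_open[OF ic U]]])
  moreover have "\<xi> \<in> ?T"
    using \<xi> i tcoord_image[OF ic, of "U \<inter> cdom M i"] by (auto simp: bundle_over_iff charts_at_iff)
  moreover have "?T \<subseteq> bundle_over M U"
  proof
    fix \<eta> assume \<eta>: "\<eta> \<in> ?T"
    then have "tcoord M i \<eta> \<in> tcoord M i ` bundle_over M (U \<inter> cdom M i)"
      using tcoord_image[OF ic, of "U \<inter> cdom M i"] by simp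
    then obtain \<zeta> where z: "\<zeta> \<in> bundle_over M (U \<inter> cdom M i)" "tcoord M i \<zeta> = tcoord M i \<eta>" by auto
    then have "\<zeta> = \<eta>" using tcoord_inj[OF ic] \<eta> by (auto simp: inj_on_def bundle_over_Int)
    with z show "\<eta> \<in> bundle_over M U" by (simp add: bundle_over_Int)
  qed
  ultimately show "\<exists>T. openin (mtop TM) T \<and> \<xi> \<in> T \<and> T \<subseteq> bundle_over M U" by blast
qed

text \<open>Points over different base points are separated by the bundle over disjoint open sets of
  \<open>M\<close>; two points of one fibre lie in a common chart and are separated there.\<close>

lemma Hausdorff_TM: "Hausdorff_space (mtop TM)"
  unfolding Hausdorff_space_def
proof (intro allI impI)
  fix \<xi> \<eta> assume A: "\<xi> \<in> topspace (mtop TM) \<and> \<eta> \<in> topspace (mtop TM) \<and> \<xi> \<noteq> \<eta>"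
  then obtain i j where i: "i \<in> charts M" "\<xi> \<in> bundle_over M (cdom M i)" and j: "j \<in> charts M" "\<eta> \<in> bundle_over M (cdom M j)"
    unfolding topspace_TM by blast
  show "\<exists>U V. openin (mtop TM) U \<and> openin (mtop TM) V \<and> \<xi> \<in> U \<and> \<eta> \<in> V \<and> disjnt U V"
  proof (cases "tbase \<xi> = tbase \<eta>")
    case False
    have "tbase \<xi> \<in> topspace (mtop M)" "tbase \<eta> \<in> topspace (mtop M)"
      using i j topspace_charts by (auto simp: bundle_over_iff charts_at_iff)
    moreover have h: "Hausdorff_space (mtop M)" using smooth by (simp add: smooth_manifold_def)
    ultimately obtain U V where UV: "openin (mtop M) U" "openin (mtop M) V" "tbase \<xi> \<in> U" "tbase \<eta> \<in> V" "disjnt U V"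
      using False h[unfolded Hausdorff_space_def, rule_format, of "tbase \<xi>" "tbase \<eta>"] by blast
    show ?thesis
    proof (rule exI[of _ "bundle_over M U"], rule exI[of _ "bundle_over M V"], intro conjI openin_bundle_over UV(1,2))
      show "\<xi> \<in> bundle_over M U" "\<eta> \<in> bundle_over M V" using UV i j by (auto simp: bundle_over_iff)
      show "disjnt (bundle_over M U) (bundle_over M V)" using UV(5) by (auto simp: disjnt_iff bundle_over_iff)
    qed
  next
    case True
    then have \<eta>: "\<eta> \<in> bundle_over M (cdom M i)" using i j by (auto simp: bundle_over_iff)
    then have ne: "tcoord M i \<xi> \<noteq> tcoord M i \<eta>" using tcoord_inj[OF i(1)] i(2) A by (auto simp: inj_on_def)
    have h: "Hausdorff_space (Euclidean_space (2 * n))"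
      by (simp add: Euclidean_space_eq_top_of_set Hausdorff_space_subtopology Hausdorff_space_euclidean)
    have "tcoord M i \<xi> \<in> topspace (Euclidean_space (2 * n))" "tcoord M i \<eta> \<in> topspace (Euclidean_space (2 * n))"
      by (simp_all add: topspace_Euclidean_space tcoord_beyond)
    then obtain U V where UV: "openin (Euclidean_space (2 * n)) U" "openin (Euclidean_space (2 * n)) V"
        "tcoord M i \<xi> \<in> U" "tcoord M i \<eta> \<in> V" "disjnt U V"
      using h[unfolded Hausdorff_space_def, rule_format, of "tcoord M i \<xi>" "tcoord M i \<eta>"] ne by blast
    let ?B = "\<lambda>W. {\<xi> \<in> bundle_over M (cdom M i). tcoord M i \<xi> \<in> W}"
    show ?thesis
    proof (rule exI[of _ "?B U"], rule exI[of _ "?B V"], intro conjI)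
      show "openin (mtop TM) {\<xi> \<in> bundle_over M (cdom M i). tcoord M i \<xi> \<in> U}" by (rule openin_TM_basic[OF i(1) UV(1)])
      show "openin (mtop TM) {\<xi> \<in> bundle_over M (cdom M i). tcoord M i \<xi> \<in> V}" by (rule openin_TM_basic[OF i(1) UV(2)])
    qed (use UV i \<eta> in \<open>auto simp: disjnt_iff\<close>)
  qed
qed

text \<open>The index set of the atlas may be uncountable. Therefore every basic open set of
  \<open>M\<close> that fits into some chart is given one chosen chart \<open>ch V\<close>, and a
  basis is indexed by pairs of such a set and a member of a countable basis of the coordinate
  space.\<close>

lemma second_countable_TM: "second_countable_space (mtop TM)"
proof -
  obtain \<B> where \<B>: "countable \<B>" "\<And>V. V \<in> \<B> \<Longrightarrow> openin (mtop M) V"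
    "\<And>U x. openin (mtop M) U \<Longrightarrow> x \<in> U \<Longrightarrow> \<exists>V\<in>\<B>. x \<in> V \<and> V \<subseteq> U"
    using smooth unfolding smooth_manifold_def second_countable_space_def by metis
  obtain \<K> :: "(nat \<Rightarrow> real) set set" where \<K>: "countable \<K>" "topological_basis \<K>"
    using ex_countable_basis by blast
  define ch where "ch V = (SOME i. i \<in> charts M \<and> V \<subseteq> cdom M i)" for V
  define \<B>' where "\<B>' = {V \<in> \<B>. \<exists>i. i \<in> charts M \<and> V \<subseteq> cdom M i}"
  have ch: "ch V \<in> charts M" "V \<subseteq> cdom M (ch V)" if "V \<in> \<B>'" for V
    using someI_ex[of "\<lambda>i. i \<in> charts M \<and> V \<subseteq> cdom M i"] that unfolding ch_def \<B>'_def by blast+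
  define bas where "bas V K = {\<xi> \<in> bundle_over M V. tcoord M (ch V) \<xi> \<in> K}" for V K
  show ?thesis
    unfolding second_countable_space_def
  proof (intro exI[of _ "(\<lambda>(V, K). bas V K) ` (\<B>' \<times> \<K>)"] conjI ballI allI impI)
    have "countable \<B>'" using \<B>(1) by (rule countable_subset[rotated]) (auto simp: \<B>'_def)
    then show "countable ((\<lambda>(V, K). bas V K) ` (\<B>' \<times> \<K>))" using \<K>(1) by (intro countable_image countable_SIGMA) auto
    fix Z assume "Z \<in> (\<lambda>(V, K). bas V K) ` (\<B>' \<times> \<K>)"
    then obtain V K where VK: "V \<in> \<B>'" "K \<in> \<K>" "Z = bas V K" by auto
    \<comment> \<open>\<open>K\<close> is open among all sequences; coordinates of bundle points
      vanish from \<open>2 * n\<close> on, so nothing is lost by intersecting.\<close>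
    have "openin (Euclidean_space (2 * n)) ({x. \<forall>i\<ge>2 * n. x i = 0} \<inter> K)"
      using topological_basis_open[OF \<K>(2) VK(2)] by (auto simp: Euclidean_space_eq_top_of_set openin_open)
    from openin_Int[OF openin_TM_basic[OF ch(1)[OF VK(1)] this] openin_bundle_over[OF \<B>(2)[of V]]]
    have "openin (mtop TM) ({\<xi> \<in> bundle_over M (cdom M (ch V)). tcoord M (ch V) \<xi> \<in> {x. \<forall>i\<ge>2 * n. x i = 0} \<inter> K} \<inter> bundle_over M V)"
      using VK(1) by (simp add: \<B>'_def)
    moreover have "{\<xi> \<in> bundle_over M (cdom M (ch V)). tcoord M (ch V) \<xi> \<in> {x. \<forall>i\<ge>2 * n. x i = 0} \<inter> K} \<inter> bundle_over M V = Z"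
      using ch(2)[OF VK(1)] by (auto simp: VK(3) bas_def tcoord_beyond bundle_over_iff)
    ultimately show "openin (mtop TM) Z" by simp
  next
    fix U \<xi> assume A: "openin (mtop TM) U \<and> \<xi> \<in> U"
    then have "\<xi> \<in> topspace (mtop TM)" using openin_subset by blast
    then obtain i where i: "i \<in> charts M" "\<xi> \<in> bundle_over M (cdom M i)" unfolding topspace_TM by blast
    then have "tbase \<xi> \<in> cdom M i" by (simp add: bundle_over_iff)
    then obtain V where V: "V \<in> \<B>" "tbase \<xi> \<in> V" "V \<subseteq> cdom M i" using \<B>(3)[OF cdom_open[OF i(1)]] by blast
    then have V': "V \<in> \<B>'" using i(1) by (auto simp: \<B>'_def)
    define j where "j = ch V"
    have j: "j \<in> charts M" "V \<subseteq> cdom M j" using ch[OF V'] by (auto simp: j_def)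
    have \<xi>V: "\<xi> \<in> bundle_over M V" using i(2) V(2) by (auto simp: bundle_over_iff)
    have \<xi>j: "\<xi> \<in> bundle_over M (cdom M j)" using \<xi>V j(2) by (auto simp: bundle_over_iff)
    have "openin (Euclidean_space (2 * n)) (tcoord M j ` (U \<inter> bundle_over M (cdom M j)))"
      by (rule openin_TM_chart[OF j(1)]) (use A in blast)
    then obtain T where T: "open T" "tcoord M j ` (U \<inter> bundle_over M (cdom M j)) = {x. \<forall>i\<ge>2 * n. x i = 0} \<inter> T"
      by (auto simp: Euclidean_space_eq_top_of_set openin_open)
    have "tcoord M j \<xi> \<in> T" using A \<xi>j T(2) by blast
    then obtain K where K: "K \<in> \<K>" "tcoord M j \<xi> \<in> K" "K \<subseteq> T" using topological_basisE[OF \<K>(2) T(1)] by metis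
    have "bas V K \<subseteq> U"
    proof
      fix \<eta> assume \<eta>: "\<eta> \<in> bas V K"
      then have e: "\<eta> \<in> bundle_over M (cdom M j)" "tcoord M j \<eta> \<in> T"
        using K(3) j(2) by (auto simp: bas_def j_def[symmetric] bundle_over_iff)
      then have "tcoord M j \<eta> \<in> tcoord M j ` (U \<inter> bundle_over M (cdom M j))"
        unfolding T(2) by (simp add: tcoord_beyond)
      then show "\<eta> \<in> U" using tcoord_inj[OF j(1)] e(1) by (auto simp: inj_on_def)
    qed
    moreover have "\<xi> \<in> bas V K" using \<xi>V K(2) by (simp add: bas_def j_def)
    ultimately show "\<exists>Z\<in>(\<lambda>(V, K). bas V K) ` (\<B>' \<times> \<K>). \<xi> \<in> Z \<and> Z \<subseteq> U" using V' K(1) by blast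
  qed
qed

lemma smooth_manifold_TM: "smooth_manifold TM"
  unfolding smooth_manifold_def
proof (intro conjI ballI allI impI Hausdorff_TM second_countable_TM)
  show "topspace (mtop TM) = (\<Union>i\<in>charts TM. cdom TM i)" by (simp add: topspace_TM)
  fix i assume "i \<in> charts TM"
  then have i: "i \<in> charts M" by simp
  let ?B = "bundle_over M (cdom M i)"
  have B: "openin (mtop TM) ?B" by (rule openin_bundle_over[OF cdom_open[OF i]])
  then show "openin (mtop TM) (cdom TM i)" by simp
  have im: "tcoord M i ` ?B = cylinder n (coord M i ` cdom M i)" by (rule tcoord_image[OF i order_refl])
  have imo: "openin (Euclidean_space (2 * n)) (tcoord M i ` ?B)" unfolding im by (rule openin_cylinder[OF coord_image_open[OF i]])
  then show "openin (Euclidean_space (mdim TM)) (coord TM i ` cdom TM i)" by simp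
  have ts: "topspace (subtopology (mtop TM) ?B) = ?B" using openin_subset[OF B] by auto
  have "homeomorphic_map (subtopology (mtop TM) ?B) (subtopology (Euclidean_space (2 * n)) (tcoord M i ` ?B)) (tcoord M i)"
  proof (rule bijective_open_imp_homeomorphic_map)
    show "continuous_map (subtopology (mtop TM) ?B) (subtopology (Euclidean_space (2 * n)) (tcoord M i ` ?B)) (tcoord M i)"
      unfolding continuous_map_in_subtopology
    proof (intro conjI)
      show "continuous_map (subtopology (mtop TM) ?B) (Euclidean_space (2 * n)) (tcoord M i)"
        unfolding continuous_map_def ts
      proof (intro conjI allI impI)
        show "tcoord M i \<in> ?B \<rightarrow> topspace (Euclidean_space (2 * n))"
          by (simp add: topspace_Euclidean_space tcoord_beyond)
        show "openin (subtopology (mtop TM) ?B) {\<xi> \<in> ?B. tcoord M i \<xi> \<in> V}" if "openin (Euclidean_space (2 * n)) V" for V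
          using openin_TM_basic[OF i that] B by (auto simp: openin_open_subtopology)
      qed
    qed (auto simp: ts)
    show "open_map (subtopology (mtop TM) ?B) (subtopology (Euclidean_space (2 * n)) (tcoord M i ` ?B)) (tcoord M i)"
      unfolding open_map_def
    proof (intro allI impI)
      fix U assume "openin (subtopology (mtop TM) ?B) U"
      then have U: "openin (mtop TM) U" "U \<subseteq> ?B" using B by (auto simp: openin_open_subtopology)
      then have "U \<inter> ?B = U" by blast
      then have "openin (Euclidean_space (2 * n)) (tcoord M i ` U)" using openin_TM_chart[OF i U(1)] by simp
      then show "openin (subtopology (Euclidean_space (2 * n)) (tcoord M i ` ?B)) (tcoord M i ` U)"
        using imo U(2) by (auto simp: openin_open_subtopology)
    qed
    show "tcoord M i ` topspace (subtopology (mtop TM) ?B) = topspace (subtopology (Euclidean_space (2 * n)) (tcoord M i ` ?B))"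
      unfolding ts using openin_subset[OF imo] by auto
    show "inj_on (tcoord M i) (topspace (subtopology (mtop TM) ?B))" unfolding ts by (rule tcoord_inj[OF i])
  qed
  then show "homeomorphic_map (subtopology (mtop TM) (cdom TM i))
          (subtopology (Euclidean_space (mdim TM)) (coord TM i ` cdom TM i)) (coord TM i)" by simp
  fix j k assume "j \<in> charts TM" "k < mdim TM"
  then have j: "j \<in> charts M" by simp
  let ?W = "cylinder n (coord M i ` (cdom M i \<inter> cdom M j))"
  have W: "openin (Euclidean_space (2 * n)) ?W" by (rule openin_cylinder[OF overlap_open[OF i j]])
  have imW: "tcoord M i ` bundle_over M (cdom M i \<inter> cdom M j) = ?W" by (rule tcoord_image[OF i]) blast
  have "smooth_real_on (2 * n) ?W (\<lambda>x. tcoord M j (cinv TM i x) k)"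
  proof (rule smooth_real_on_cong[OF W ttrans_smooth[OF i j]])
    fix x assume "x \<in> ?W"
    then obtain \<xi> where \<xi>: "\<xi> \<in> bundle_over M (cdom M i \<inter> cdom M j)" "x = tcoord M i \<xi>" using imW by (metis imageE)
    then have "cinv TM i x = \<xi>" using tcoord_inj[OF i] by (simp add: cinv_def bundle_over_Int)
    then show "ttrans i j x k = tcoord M j (cinv TM i x) k"
      using \<xi> ttrans_tcoord[of \<xi> i j] i j by (simp add: bundle_over_iff charts_at_iff)
  qed
  then show "smooth_real_on (mdim TM) (coord TM i ` (cdom TM i \<inter> cdom TM j)) (\<lambda>x. coord TM j (cinv TM i x) k)"
    by (simp add: imW bundle_over_Int[symmetric])
qed

sublocale T: smooth_mfd "tangent_bundle M"
  by unfold_locales (rule smooth_manifold_TM)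


subsection \<open>Functions on the tangent bundle\<close>

lemma charts_at_TM: "i \<in> charts_at TM \<xi> \<longleftrightarrow> i \<in> charts_at M (tbase \<xi>) \<and> tfib \<xi> \<in> tangent_space M (tbase \<xi>) \<and> \<xi> = Tan (tbase \<xi>) (tfib \<xi>)"
  by (auto simp: charts_at_def bundle_over_iff)

lemma charts_at_TM_base: "i \<in> charts_at TM \<xi> \<Longrightarrow> i \<in> charts_at M (tbase \<xi>)"
  and charts_at_TM_fibre: "i \<in> charts_at TM \<xi> \<Longrightarrow> tfib \<xi> \<in> tangent_space M (tbase \<xi>)"
  by (auto simp: charts_at_TM)

lemma charts_at_TM_eq: "i \<in> charts_at TM \<xi> \<Longrightarrow> charts_at TM \<xi> = charts_at M (tbase \<xi>)"
  by (auto simp: charts_at_TM)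

lemma cinv_TM:
  assumes i: "i \<in> charts M" and x: "x \<in> cylinder n (coord M i ` cdom M i)"
  shows "tbase (cinv TM i x) = cinv M i (trunc n x)"
proof -
  obtain \<xi> where \<xi>: "\<xi> \<in> bundle_over M (cdom M i)" "x = tcoord M i \<xi>"
    using x tcoord_image[OF i order_refl] by (metis imageE)
  have c: "i \<in> charts_at M (tbase \<xi>)" using \<xi> i by (auto simp: bundle_over_iff charts_at_iff)
  have "cinv TM i x = \<xi>" using tcoord_inj[OF i] \<xi> by (simp add: cinv_def)
  then show ?thesis using \<xi>(2) trunc_tcoord[OF c] cinv_coord[OF c] by simp
qed

lemma smooth_at_tbase:
  assumes f: "smooth_at M f (tbase \<xi>)" and i: "i \<in> charts_at TM \<xi>"
  shows "smooth_at TM (\<lambda>\<eta>. f (tbase \<eta>)) \<xi>"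
proof -
  note ib = charts_at_TM_base[OF i]
  then have ic: "i \<in> charts M" by (simp add: charts_at_iff)
  obtain W where W: "openin (Euclidean_space n) W" "coord M i (tbase \<xi>) \<in> W" "W \<subseteq> coord M i ` cdom M i"
    "smooth_real_on n W (\<lambda>x. f (cinv M i x))" by (rule smooth_at_chartD[OF f ib])
  show ?thesis
  proof (rule T.smooth_at_chartI[OF i, of "cylinder n W"])
    show "openin (Euclidean_space (mdim TM)) (cylinder n W)" using openin_cylinder[OF W(1)] by simp
    show "coord TM i \<xi> \<in> cylinder n W"
      using W(2) trunc_tcoord[OF ib] by (simp add: cylinder_def tcoord_beyond)
    have "smooth_real_on (2 * n) (cylinder n W) (\<lambda>x. f (tbase (cinv TM i x)))"
      by (rule smooth_real_on_cong[OF openin_cylinder[OF W(1)] smooth_real_on_cylinder[OF W(1,4)]])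
         (use W(3) in \<open>auto simp: cylinder_def intro!: arg_cong[where f=f] cinv_TM[OF ic, symmetric]\<close>)
    then show "smooth_real_on (mdim TM) (cylinder n W) (\<lambda>x. f (tbase (cinv TM i x)))" by simp
  qed
qed

lemma cpd_tbase:
  assumes i: "i \<in> charts_at TM \<xi>" and a: "a < 2 * n"
  shows "cpd TM i a (\<lambda>\<eta>. f (tbase \<eta>)) \<xi> = (if a < n then cpd M i a f (tbase \<xi>) else 0)"
proof -
  note ib = charts_at_TM_base[OF i]
  then have ic: "i \<in> charts M" by (simp add: charts_at_iff)
  let ?W = "cylinder n (coord M i ` cdom M i)"
  have W: "openin (Euclidean_space (2 * n)) ?W" by (rule openin_cylinder[OF coord_image_open[OF ic]])
  have "tcoord M i \<xi> \<in> ?W" using ib trunc_tcoord[OF ib] by (simp add: cylinder_def tcoord_beyond charts_at_iff)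
  then have "cpd TM i a (\<lambda>\<eta>. f (tbase \<eta>)) \<xi> = pderiv_at a (\<lambda>x. f (cinv M i (trunc n x))) (tcoord M i \<xi>)"
    unfolding cpd_def tangent_bundle_simps
    by (rule pderiv_at_cong[OF W _ a]) (simp add: cinv_TM[OF ic])
  also have "\<dots> = (if a < n then cpd M i a f (tbase \<xi>) else 0)"
  proof (cases "a < n")
    case True
    have "trunc n ((tcoord M i \<xi>)(a := t)) = (coord M i (tbase \<xi>))(a := t)" for t
      unfolding trunc_tcoord[OF ib, symmetric] using True by (auto simp: trunc_def fun_eq_iff)
    moreover have "tcoord M i \<xi> a = coord M i (tbase \<xi>) a" using True by (simp add: tcoord_def)
    ultimately show ?thesis using True by (simp add: pderiv_at_def cpd_def)
  next
    case False
    have "trunc n ((tcoord M i \<xi>)(a := t)) = trunc n (tcoord M i \<xi>)" for t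
      using False by (auto simp: trunc_def fun_eq_iff)
    with False show ?thesis by (simp add: pderiv_at_def)
  qed
  finally show ?thesis .
qed

lemma tfib_eq_coord: "a < n \<Longrightarrow> (\<lambda>\<eta>. tfib \<eta> i a) = (\<lambda>\<eta>. coord TM i \<eta> (n + a))"
  by (simp add: tcoord_fibre)

lemma smooth_at_tfib: "i \<in> charts_at TM \<xi> \<Longrightarrow> a < n \<Longrightarrow> smooth_at TM (\<lambda>\<eta>. tfib \<eta> i a) \<xi>"
  unfolding tfib_eq_coord by (rule T.smooth_at_coord)

lemma cpd_tfib: "i \<in> charts_at TM \<xi> \<Longrightarrow> a < n \<Longrightarrow> b < 2 * n \<Longrightarrow> cpd TM i b (\<lambda>\<eta>. tfib \<eta> i a) \<xi> = (if b = n + a then 1 else 0)"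
  unfolding tfib_eq_coord by (rule T.cpd_coord) auto

lemma vd_tbase: "i \<in> charts_at TM \<xi> \<Longrightarrow> vd TM i \<xi> w (\<lambda>\<eta>. f (tbase \<eta>)) = vd M i (tbase \<xi>) (hor_part M w) f"
  unfolding vd_def by (simp add: sum_lessThan_double cpd_tbase hor_part_def)

lemma vd_tfib: "i \<in> charts_at TM \<xi> \<Longrightarrow> a < n \<Longrightarrow> vd TM i \<xi> w (\<lambda>\<eta>. tfib \<eta> i a) = w i (n + a)"
  unfolding vd_def by (simp add: cpd_tfib if_distrib cong: if_cong)

text \<open>The Jacobian of the bundle in blocks. The lower left block comes from differentiating
  the transformation law of the fibre coordinates in the base directions; it makes the second half
  of the components transform inhomogeneously.\<close>

lemma jacobian_TM:
  assumes i: "i \<in> charts_at TM \<xi>" and j: "j \<in> charts_at TM \<xi>" and k: "k < n" and a: "a < n"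
  shows "jacobian TM i j \<xi> k a = jacobian M i j (tbase \<xi>) k a"
    "jacobian TM i j \<xi> k (n + a) = 0"
    "jacobian TM i j \<xi> (n + k) a = (\<Sum>b<n. cpd M i a (\<lambda>q. jacobian M i j q k b) (tbase \<xi>) * tfib \<xi> i b)"
    "jacobian TM i j \<xi> (n + k) (n + a) = jacobian M i j (tbase \<xi>) k a"
proof -
  note ib = charts_at_TM_base[OF i] and jb = charts_at_TM_base[OF j]
  have 1: "jacobian TM i j \<xi> k c = cpd TM i c (\<lambda>\<eta>. coord M j (tbase \<eta>) k) \<xi>" for c
    using k by (simp add: jacobian_cpd tcoord_def)
  show "jacobian TM i j \<xi> k a = jacobian M i j (tbase \<xi>) k a" "jacobian TM i j \<xi> k (n + a) = 0"
    unfolding 1 using a by (simp_all add: cpd_tbase[OF i, where f="\<lambda>q. coord M j q k"] jacobian_cpd)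
  have nr: "near TM \<xi> (\<lambda>\<eta>. tfib \<eta> j k = (\<Sum>b<n. jacobian M i j (tbase \<eta>) k b * tfib \<eta> i b))"
    by (rule near_mono[OF near_conj[OF T.near_chart[OF i] T.near_chart[OF j]]])
       (use k in \<open>auto simp: charts_at_TM intro!: tangent_transform\<close>)
  have sJ: "smooth_at TM (\<lambda>\<eta>. jacobian M i j (tbase \<eta>) k b) \<xi>" if "b < n" for b
    by (rule smooth_at_tbase[OF smooth_at_jacobian[OF ib jb that] i])
  have 2: "jacobian TM i j \<xi> (n + k) c = (\<Sum>b<n. cpd TM i c (\<lambda>\<eta>. jacobian M i j (tbase \<eta>) k b) \<xi> * tfib \<xi> i b
      + jacobian M i j (tbase \<xi>) k b * (if c = n + b then 1 else 0))" if c: "c < 2 * n" for c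
  proof -
    have c': "c < mdim TM" using c by simp
    have "jacobian TM i j \<xi> (n + k) c = cpd TM i c (\<lambda>\<eta>. tfib \<eta> j k) \<xi>"
      using k by (simp add: jacobian_cpd tcoord_fibre)
    also have "\<dots> = cpd TM i c (\<lambda>\<eta>. \<Sum>b<n. jacobian M i j (tbase \<eta>) k b * tfib \<eta> i b) \<xi>"
      by (rule T.cpd_cong[OF nr i c'])
    also have "\<dots> = (\<Sum>b<n. cpd TM i c (\<lambda>\<eta>. jacobian M i j (tbase \<eta>) k b * tfib \<eta> i b) \<xi>)"
      by (rule T.cpd_sum[OF _ i c']) (auto intro!: T.smooth_at_mult sJ smooth_at_tfib[OF i])
    also have "\<dots> = (\<Sum>b<n. cpd TM i c (\<lambda>\<eta>. jacobian M i j (tbase \<eta>) k b) \<xi> * tfib \<xi> i b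
      + jacobian M i j (tbase \<xi>) k b * (if c = n + b then 1 else 0))"
      by (intro sum.cong refl) (simp add: T.cpd_mult[OF sJ smooth_at_tfib[OF i] i c'] cpd_tfib[OF i _ c])
    finally show ?thesis .
  qed
  have J: "cpd TM i c (\<lambda>\<eta>. jacobian M i j (tbase \<eta>) k b) \<xi> =
      (if c < n then cpd M i c (\<lambda>q. jacobian M i j q k b) (tbase \<xi>) else 0)" if "c < 2 * n" for b c
    by (rule cpd_tbase[OF i that])
  show "jacobian TM i j \<xi> (n + k) a = (\<Sum>b<n. cpd M i a (\<lambda>q. jacobian M i j q k b) (tbase \<xi>) * tfib \<xi> i b)"
    using a by (simp add: 2 J)
  show "jacobian TM i j \<xi> (n + k) (n + a) = jacobian M i j (tbase \<xi>) k a"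
    using a by (simp add: 2 J if_distrib cong: if_cong)
qed

text \<open>The pullback has the components of the form on \<open>M\<close> in the base directions
  and 0 in the fibre directions, all constant along the fibres, so the integrability condition
  reduces to the one below. The assumption \<open>hp\<close> is met by
  \<open>hor_part_tangent\<close> once a connection is at hand.\<close>

lemma closed_form_pullback:
  assumes "closed_form M \<alpha>" and hp: "\<And>\<xi> w. w \<in> tangent_space TM \<xi> \<Longrightarrow> \<xi> \<in> topspace (mtop TM) \<Longrightarrow> hor_part M w \<in> tangent_space M (tbase \<xi>)"
  shows "closed_form TM (\<lambda>\<xi> w. \<alpha> (tbase \<xi>) (hor_part M w))"
proof -
  obtain c where c: "\<And>i p u. i \<in> charts_at M p \<Longrightarrow> u \<in> tangent_space M p \<Longrightarrow> \<alpha> p u = (\<Sum>a<n. c i a p * u i a)"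
    "\<And>i p a. i \<in> charts_at M p \<Longrightarrow> a < n \<Longrightarrow> smooth_at M (c i a) p"
    "\<And>i p a b. i \<in> charts_at M p \<Longrightarrow> a < n \<Longrightarrow> b < n \<Longrightarrow> cpd M i a (c i b) p = cpd M i b (c i a) p"
    by (rule closed_formE[OF assms(1)]) blast
  show ?thesis
  proof (rule closed_formI_comps[where c="\<lambda>i a \<xi>. if a < n then c i a (tbase \<xi>) else 0"])
    fix i \<xi> assume i: "i \<in> charts_at TM \<xi>"
    note ib = charts_at_TM_base[OF i]
    show "\<alpha> (tbase \<xi>) (hor_part M u) = (\<Sum>a<mdim TM. (if a < n then c i a (tbase \<xi>) else 0) * u i a)"
      if "u \<in> tangent_space TM \<xi>" for u
      unfolding c(1)[OF ib hp[OF that T.charts_at_topspace[OF i]]]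
      by (simp add: sum_lessThan_double hor_part_def)
    show "smooth_at TM (\<lambda>\<xi>. if a < n then c i a (tbase \<xi>) else 0) \<xi>" if "a < mdim TM" for a
      using smooth_at_tbase[OF c(2)[OF ib] i] T.smooth_at_const[OF i] by (cases "a < n") auto
    show "cpd TM i a (\<lambda>\<xi>. if b < n then c i b (tbase \<xi>) else 0) \<xi> = cpd TM i b (\<lambda>\<xi>. if a < n then c i a (tbase \<xi>) else 0) \<xi>"
      if "a < mdim TM" "b < mdim TM" for a b
      using that cpd_tbase[OF i, of a "c i b"] cpd_tbase[OF i, of b "c i a"] c(3)[OF ib, of a b]
      by (cases "a < n"; cases "b < n") (auto simp: T.cpd_const)
  qed
qed

end

section \<open>The canonical connection of the tangent bundle\<close>

text \<open>
  A vector field on the bundle is the same as a pair of vector fields along the projection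
  (\<open>section_on\<close>), its horizontal and its vertical part; the canonical connection differentiates both
  of them with the pullback \<open>pull_deriv\<close> of the connection.
\<close>

definition section_on :: "('a, 'i) tmanifold \<Rightarrow> ('a, 'i) tpoint set \<Rightarrow> ('a, 'i) tfield \<Rightarrow> bool" where
  "section_on M U W \<longleftrightarrow> (\<forall>\<xi>\<in>U. W \<xi> \<in> tangent_space M (tbase \<xi>) \<and>
     (\<forall>i\<in>charts_at (tangent_bundle M) \<xi>. \<forall>k<mdim M. smooth_at (tangent_bundle M) (\<lambda>\<eta>. W \<eta> i k) \<xi>))"

definition pull_deriv ::
  "('a, 'i) tmanifold \<Rightarrow> ('a, 'i) tconn \<Rightarrow> ('a, 'i) tfield \<Rightarrow> ('a, 'i) tfield \<Rightarrow> ('a, 'i) tfield" where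
  "pull_deriv M nab X W \<xi> = (\<lambda>i k.
     if i \<in> charts_at (tangent_bundle M) \<xi> \<and> k < mdim M
     then dirder (tangent_bundle M) \<xi> (X \<xi>) (\<lambda>\<eta>. W \<eta> i k)
       + (\<Sum>b<mdim M. conn_matrix M nab i (tbase \<xi>) (hor_part M (X \<xi>)) k b * W \<xi> i b) else 0)"

definition pull_conn :: "('a, 'i) tmanifold \<Rightarrow> ('a, 'i) tconn \<Rightarrow> ('a, 'i) tconn" where
  "pull_conn M nab X Y \<xi> =
     hor_at M nab \<xi> (pull_deriv M nab X (\<lambda>\<eta>. hor_part M (Y \<eta>)) \<xi>)
     + vert_at M \<xi> (pull_deriv M nab X (\<lambda>\<eta>. vert_part M nab \<eta> (Y \<eta>)) \<xi>)"

section \<open>Linearity of lifts and of horizontal and vertical parts\<close>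

lemma gamma_at_eq: "gamma_at M nab i p u v k = (\<Sum>b<mdim M. conn_matrix M nab i p u k b * v i b)"
  unfolding gamma_at_def conn_matrix_def sum_distrib_right by (rule sum.swap)

lemma conn_matrix_add: "conn_matrix M nab i p (u + v) k b = conn_matrix M nab i p u k b + conn_matrix M nab i p v k b"
  by (simp add: conn_matrix_def distrib_left sum.distrib)

lemma conn_matrix_scale: "conn_matrix M nab i p (tscale c u) k b = c * conn_matrix M nab i p u k b"
  by (simp add: conn_matrix_def tscale_def sum_distrib_left mult_ac)

lemma hor_part_add: "hor_part M (w + w') = hor_part M w + hor_part M w'"
  by (simp add: hor_part_def fun_eq_iff)

lemma hor_part_scale: "hor_part M (tscale c w) = tscale c (hor_part M w)"
  by (simp add: hor_part_def tscale_def fun_eq_iff)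

lemma vert_part_add: "vert_part M nab \<xi> (w + w') = vert_part M nab \<xi> w + vert_part M nab \<xi> w'"
  by (simp add: vert_part_def gamma_at_eq hor_part_add conn_matrix_add distrib_right sum.distrib fun_eq_iff)

lemma vert_part_scale: "vert_part M nab \<xi> (tscale c w) = tscale c (vert_part M nab \<xi> w)"
  by (simp add: vert_part_def gamma_at_eq hor_part_scale conn_matrix_scale fun_eq_iff tscale_apply
      distrib_left sum_distrib_left mult_ac)

lemma hor_part_minus: "hor_part M (- w) = - hor_part M w"
  by (simp add: hor_part_def fun_eq_iff)

lemma vert_part_minus: "vert_part M nab \<xi> (- w) = - vert_part M nab \<xi> w"
  using vert_part_scale[of M nab \<xi> "-1" w] by (simp add: tscale_def fun_eq_iff fun_Compl_def)

lemma hor_part_diff: "hor_part M (w - w') = hor_part M w - hor_part M w'"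
  by (simp add: hor_part_def fun_eq_iff)

lemma vert_part_diff: "vert_part M nab \<xi> (w - w') = vert_part M nab \<xi> w - vert_part M nab \<xi> w'"
  using vert_part_add[of M nab \<xi> w "- w'"] vert_part_minus[of M nab \<xi> w'] by (simp only: add_uminus_conv_diff)

lemma hor_at_add: "hor_at M nab \<xi> (u + v) = hor_at M nab \<xi> u + hor_at M nab \<xi> v"
  by (simp add: hor_at_def gamma_at_eq conn_matrix_add distrib_right sum.distrib fun_eq_iff)

lemma hor_at_scale: "hor_at M nab \<xi> (tscale c u) = tscale c (hor_at M nab \<xi> u)"
  by (simp add: hor_at_def gamma_at_eq conn_matrix_scale fun_eq_iff tscale_apply sum_distrib_left mult_ac)

lemma vert_at_add: "vert_at M \<xi> (u + v) = vert_at M \<xi> u + vert_at M \<xi> v"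
  by (simp add: vert_at_def fun_eq_iff)

lemma vert_at_scale: "vert_at M \<xi> (tscale c u) = tscale c (vert_at M \<xi> u)"
  by (simp add: vert_at_def fun_eq_iff tscale_apply)

lemma hor_at_zero: "hor_at M nab \<xi> 0 = 0"
  by (simp add: hor_at_def gamma_at_def fun_eq_iff)

lemma vert_at_zero: "vert_at M \<xi> 0 = 0"
  by (simp add: vert_at_def fun_eq_iff)

lemma hor_at_sum: "hor_at M nab \<xi> (\<Sum>a\<in>A. u a) = (\<Sum>a\<in>A. hor_at M nab \<xi> (u a))"
  by (induction A rule: infinite_finite_induct) (simp_all only: sum.infinite sum.empty sum.insert hor_at_zero hor_at_add simp_thms)

lemma vert_at_sum: "vert_at M \<xi> (\<Sum>a\<in>A. u a) = (\<Sum>a\<in>A. vert_at M \<xi> (u a))"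
  by (induction A rule: infinite_finite_induct) (simp_all only: sum.infinite sum.empty sum.insert vert_at_zero vert_at_add simp_thms)

locale tb_conn = tb_mfd M + conn_mfd M nab for M :: "('a, 'i) tmanifold" and nab
begin

section \<open>The splitting of tangent vectors of the bundle\<close>

lemma vert_part_apply:
  "i \<in> charts_at TM \<xi> \<Longrightarrow> k < n \<Longrightarrow> vert_part M nab \<xi> w i k =
     w i (n + k) + (\<Sum>b<n. conn_matrix M nab i (tbase \<xi>) (hor_part M w) k b * tfib \<xi> i b)"
  by (simp add: vert_part_def gamma_at_eq charts_at_TM)

lemma hor_at_apply:
  assumes "i \<in> charts_at TM \<xi>" "k < n"
  shows "hor_at M nab \<xi> u i k = u i k"
    "hor_at M nab \<xi> u i (n + k) = - (\<Sum>b<n. conn_matrix M nab i (tbase \<xi>) u k b * tfib \<xi> i b)"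
  using assms by (simp_all add: hor_at_def gamma_at_eq charts_at_TM)

lemma vert_at_apply:
  assumes "i \<in> charts_at TM \<xi>" "k < n"
  shows "vert_at M \<xi> u i k = 0" "vert_at M \<xi> u i (n + k) = u i k"
  using assms by (simp_all add: vert_at_def charts_at_TM)

text \<open>The law of the connection form under change of charts, applied to a vector
  \<open>v\<close>. The derivative of the Jacobian in it is the inhomogeneous term that appears
  whenever components of bundle vectors, or of derivatives of fields, change charts.\<close>

lemma transform_contracted:
  assumes u: "u \<in> tangent_space M p" and v: "v \<in> tangent_space M p"
    and i: "i \<in> charts_at M p" and j: "j \<in> charts_at M p" and k: "k < n"
  shows "(\<Sum>b<n. vd M i p u (\<lambda>q. jacobian M i j q k b) * v i b) + (\<Sum>c<n. conn_matrix M nab j p u k c * v j c)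
     = (\<Sum>a<n. jacobian M i j p k a * (\<Sum>b<n. conn_matrix M nab i p u a b * v i b))"
proof -
  have "(\<Sum>c<n. conn_matrix M nab j p u k c * v j c) = (\<Sum>c<n. \<Sum>b<n. conn_matrix M nab j p u k c * jacobian M i j p c b * v i b)"
    by (simp add: tangent_transform[OF v i j] sum_distrib_left mult.assoc)
  also have "\<dots> = (\<Sum>b<n. (\<Sum>c<n. conn_matrix M nab j p u k c * jacobian M i j p c b) * v i b)"
    by (subst sum.swap) (simp add: sum_distrib_right)
  finally have "(\<Sum>b<n. vd M i p u (\<lambda>q. jacobian M i j q k b) * v i b) + (\<Sum>c<n. conn_matrix M nab j p u k c * v j c)
     = (\<Sum>b<n. (vd M i p u (\<lambda>q. jacobian M i j q k b) + (\<Sum>c<n. conn_matrix M nab j p u k c * jacobian M i j p c b)) * v i b)"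
    by (simp add: distrib_right sum.distrib)
  also have "\<dots> = (\<Sum>b<n. (\<Sum>c<n. jacobian M i j p k c * conn_matrix M nab i p u c b) * v i b)"
    by (intro sum.cong refl arg_cong2[where f="(*)"]) (simp add: conn_matrix_transform[OF u i j k])
  also have "\<dots> = (\<Sum>a<n. jacobian M i j p k a * (\<Sum>b<n. conn_matrix M nab i p u a b * v i b))"
    unfolding sum_distrib_right sum_distrib_left by (subst sum.swap) (simp add: mult.assoc)
  finally show ?thesis .
qed

lemma jacobian_TM_sum:
  assumes i: "i \<in> charts_at TM \<xi>" and j: "j \<in> charts_at TM \<xi>" and k: "k < n"
  shows "(\<Sum>a<2 * n. jacobian TM i j \<xi> k a * w i a) = (\<Sum>a<n. jacobian M i j (tbase \<xi>) k a * w i a)"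
    "(\<Sum>a<2 * n. jacobian TM i j \<xi> (n + k) a * w i a) =
      (\<Sum>b<n. vd M i (tbase \<xi>) (hor_part M w) (\<lambda>q. jacobian M i j q k b) * tfib \<xi> i b)
      + (\<Sum>a<n. jacobian M i j (tbase \<xi>) k a * w i (n + a))"
proof -
  show "(\<Sum>a<2 * n. jacobian TM i j \<xi> k a * w i a) = (\<Sum>a<n. jacobian M i j (tbase \<xi>) k a * w i a)"
    unfolding sum_lessThan_double by (simp add: jacobian_TM(1,2)[OF i j k])
  have "(\<Sum>a<n. jacobian TM i j \<xi> (n + k) a * w i a)
     = (\<Sum>b<n. vd M i (tbase \<xi>) (hor_part M w) (\<lambda>q. jacobian M i j q k b) * tfib \<xi> i b)"
  proof -
    have "(\<Sum>a<n. jacobian TM i j \<xi> (n + k) a * w i a)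
      = (\<Sum>a<n. \<Sum>b<n. w i a * cpd M i a (\<lambda>q. jacobian M i j q k b) (tbase \<xi>) * tfib \<xi> i b)"
      by (simp add: jacobian_TM(3)[OF i j k] sum_distrib_right sum_distrib_left mult_ac)
    also have "\<dots> = (\<Sum>b<n. \<Sum>a<n. w i a * cpd M i a (\<lambda>q. jacobian M i j q k b) (tbase \<xi>) * tfib \<xi> i b)" by (rule sum.swap)
    finally show ?thesis by (simp add: vd_def hor_part_def sum_distrib_right)
  qed
  then show "(\<Sum>a<2 * n. jacobian TM i j \<xi> (n + k) a * w i a) =
      (\<Sum>b<n. vd M i (tbase \<xi>) (hor_part M w) (\<lambda>q. jacobian M i j q k b) * tfib \<xi> i b)
      + (\<Sum>a<n. jacobian M i j (tbase \<xi>) k a * w i (n + a))"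
    unfolding sum_lessThan_double by (simp add: jacobian_TM(4)[OF i j k])
qed

lemma topspace_TM_chart: "\<xi> \<in> topspace (mtop TM) \<Longrightarrow> \<exists>i. i \<in> charts_at TM \<xi>"
  using T.topspace_charts by blast

lemma hor_part_tangent:
  assumes w: "w \<in> tangent_space TM \<xi>" and \<xi>: "\<xi> \<in> topspace (mtop TM)"
  shows "hor_part M w \<in> tangent_space M (tbase \<xi>)"
proof -
  obtain i0 where "i0 \<in> charts_at TM \<xi>" using topspace_TM_chart[OF \<xi>] ..
  note ce = charts_at_TM_eq[OF this]
  show ?thesis
  proof (rule tangentI)
    fix i j k assume i: "i \<in> charts_at M (tbase \<xi>)" and j: "j \<in> charts_at M (tbase \<xi>)" and k: "k < n"
    then have iT: "i \<in> charts_at TM \<xi>" and jT: "j \<in> charts_at TM \<xi>" using ce by auto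
    show "hor_part M w j k = (\<Sum>a<n. jacobian M i j (tbase \<xi>) k a * hor_part M w i a)"
      using T.tangent_transform[OF w iT jT, of k] k jacobian_TM_sum(1)[OF iT jT k, of w] by (simp add: hor_part_def)
  qed (use T.tangent_outside[OF w] ce in \<open>auto simp: hor_part_def fun_eq_iff\<close>)
qed

text \<open>The inhomogeneous terms of the fibre components and of the connection form cancel: the
  connector has values in the tangent space of the base.\<close>

lemma vert_part_tangent:
  assumes w: "w \<in> tangent_space TM \<xi>" and \<xi>: "\<xi> \<in> topspace (mtop TM)"
  shows "vert_part M nab \<xi> w \<in> tangent_space M (tbase \<xi>)"
proof -
  obtain i0 where i0: "i0 \<in> charts_at TM \<xi>" using topspace_TM_chart[OF \<xi>] ..
  note ce = charts_at_TM_eq[OF i0]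
  show ?thesis
  proof (rule tangentI)
    fix i j k assume i: "i \<in> charts_at M (tbase \<xi>)" and j: "j \<in> charts_at M (tbase \<xi>)" and k: "k < n"
    then have iT: "i \<in> charts_at TM \<xi>" and jT: "j \<in> charts_at TM \<xi>" using ce by auto
    have "w j (n + k) = (\<Sum>a<2 * n. jacobian TM i j \<xi> (n + k) a * w i a)"
      using T.tangent_transform[OF w iT jT, of "n + k"] k by simp
    then show "vert_part M nab \<xi> w j k = (\<Sum>a<n. jacobian M i j (tbase \<xi>) k a * vert_part M nab \<xi> w i a)"
      using transform_contracted[OF hor_part_tangent[OF w \<xi>] charts_at_TM_fibre[OF i0] i j k]
      by (simp add: vert_part_apply[OF jT k] vert_part_apply[OF iT] jacobian_TM_sum(2)[OF iT jT k] distrib_left sum.distrib)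
  qed (auto simp: vert_part_def fun_eq_iff)
qed

text \<open>The converse cancellation: the correction by the connection form in the horizontal lift
  produces exactly the lower left block of the Jacobian of the bundle.\<close>

lemma lift_tangent:
  assumes u: "u \<in> tangent_space M (tbase \<xi>)" and u': "u' \<in> tangent_space M (tbase \<xi>)" and \<xi>: "\<xi> \<in> topspace (mtop TM)"
  shows "hor_at M nab \<xi> u + vert_at M \<xi> u' \<in> tangent_space TM \<xi>" (is "?w \<in> _")
proof -
  obtain i0 where i0: "i0 \<in> charts_at TM \<xi>" using topspace_TM_chart[OF \<xi>] ..
  note ce = charts_at_TM_eq[OF i0]
  show ?thesis
  proof (rule T.tangentI)
    fix i j k assume iT: "i \<in> charts_at TM \<xi>" and jT: "j \<in> charts_at TM \<xi>" and k: "k < mdim TM"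
    then have i: "i \<in> charts_at M (tbase \<xi>)" and j: "j \<in> charts_at M (tbase \<xi>)" using ce by auto
    have wi: "?w i a = u i a" "?w i (n + a) = u' i a - (\<Sum>b<n. conn_matrix M nab i (tbase \<xi>) u a b * tfib \<xi> i b)"
      if "a < n" "i \<in> charts_at TM \<xi>" for a i
      using hor_at_apply[OF that(2,1)] vert_at_apply[OF that(2,1)] by simp_all
    have hw: "hor_part M ?w i a = u i a" if "a < n" for a using wi(1)[OF that iT] that by (simp add: hor_part_def)
    show "?w j k = (\<Sum>a<mdim TM. jacobian TM i j \<xi> k a * ?w i a)"
    proof (cases "k < n")
      case True
      have "(\<Sum>a<mdim TM. jacobian TM i j \<xi> k a * ?w i a) = (\<Sum>a<n. jacobian M i j (tbase \<xi>) k a * ?w i a)"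
        using jacobian_TM_sum(1)[OF iT jT True, of ?w] by simp
      also have "\<dots> = (\<Sum>a<n. jacobian M i j (tbase \<xi>) k a * u i a)"
        by (intro sum.cong refl) (simp only: wi(1)[OF _ iT] lessThan_iff)
      also have "\<dots> = u j k" by (rule tangent_transform[OF u i j True, symmetric])
      also have "\<dots> = ?w j k" by (rule wi(1)[OF True jT, symmetric])
      finally show ?thesis by simp
    next
      case False
      define l where "l = k - n"
      have l: "l < n" "k = n + l" using False k by (auto simp: l_def)
      have "(\<Sum>a<mdim TM. jacobian TM i j \<xi> k a * ?w i a) =
         (\<Sum>b<n. vd M i (tbase \<xi>) (hor_part M ?w) (\<lambda>q. jacobian M i j q l b) * tfib \<xi> i b)
         + (\<Sum>a<n. jacobian M i j (tbase \<xi>) l a * ?w i (n + a))"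
        using jacobian_TM_sum(2)[OF iT jT l(1), of ?w] l(2) by simp
      also have "(\<Sum>b<n. vd M i (tbase \<xi>) (hor_part M ?w) (\<lambda>q. jacobian M i j q l b) * tfib \<xi> i b)
         = (\<Sum>b<n. vd M i (tbase \<xi>) u (\<lambda>q. jacobian M i j q l b) * tfib \<xi> i b)"
        unfolding vd_def using hw by simp
      also have "(\<Sum>a<n. jacobian M i j (tbase \<xi>) l a * ?w i (n + a)) = (\<Sum>a<n. jacobian M i j (tbase \<xi>) l a * u' i a)
         - (\<Sum>a<n. jacobian M i j (tbase \<xi>) l a * (\<Sum>b<n. conn_matrix M nab i (tbase \<xi>) u a b * tfib \<xi> i b))"
        unfolding sum_subtractf[symmetric] right_diff_distrib[symmetric]
        by (intro sum.cong refl) (simp only: wi(2)[OF _ iT] lessThan_iff)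
      also have "(\<Sum>a<n. jacobian M i j (tbase \<xi>) l a * u' i a) = u' j l"
        by (rule tangent_transform[OF u' i j l(1), symmetric])
      finally show ?thesis
        using transform_contracted[OF u charts_at_TM_fibre[OF i0] i j l(1)] wi(2)[OF l(1) jT] l(2) by simp
    qed
  next
    show "?w i = 0" if "i \<notin> charts_at TM \<xi>" for i
      using that ce by (simp add: hor_at_def vert_at_def fun_eq_iff)
    show "?w i k = 0" if "mdim TM \<le> k" for i k
      using that by (simp add: hor_at_def vert_at_def)
  qed
qed

lemma lift_parts:
  assumes u: "u \<in> tangent_space M (tbase \<xi>)" and u': "u' \<in> tangent_space M (tbase \<xi>)"
  shows "hor_part M (hor_at M nab \<xi> u + vert_at M \<xi> u') = u"
    "vert_part M nab \<xi> (hor_at M nab \<xi> u + vert_at M \<xi> u') = u'"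
  by (simp_all only: hor_part_add vert_part_add parts_hor_at[OF u] parts_vert_at[OF u'] add_0_left add_0_right)

lemma decompose:
  assumes w: "w \<in> tangent_space TM \<xi>" and \<xi>: "\<xi> \<in> topspace (mtop TM)"
  shows "w = hor_at M nab \<xi> (hor_part M w) + vert_at M \<xi> (vert_part M nab \<xi> w)"
proof -
  obtain i0 where i0: "i0 \<in> charts_at TM \<xi>" using topspace_TM_chart[OF \<xi>] ..
  show ?thesis
    by (rule hor_vert_decomposition)
       (use T.tangent_outside[OF w] T.tangent_beyond[OF w] charts_at_TM_eq[OF i0] in auto)
qed

text \<open>Identities on the bundle are reduced by this to pairs of identities in tangent spaces of
  \<open>M\<close>, where lifts and connection terms have disappeared.\<close>

lemma parts_eqI:
  assumes "w \<in> tangent_space TM \<xi>" "w' \<in> tangent_space TM \<xi>" "\<xi> \<in> topspace (mtop TM)"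
    "hor_part M w = hor_part M w'" "vert_part M nab \<xi> w = vert_part M nab \<xi> w'"
  shows "w = w'"
  using decompose[OF assms(1,3)] decompose[OF assms(2,3)] assms(4,5) by simp

lemma smooth_at_conn_matrix:
  assumes i: "i \<in> charts_at TM \<xi>" and W: "\<And>a. a < n \<Longrightarrow> smooth_at TM (\<lambda>\<eta>. W \<eta> i a) \<xi>" and kb: "k < n" "b < n"
  shows "smooth_at TM (\<lambda>\<eta>. conn_matrix M nab i (tbase \<eta>) (W \<eta>) k b) \<xi>"
  unfolding conn_matrix_def
  by (intro T.smooth_at_sum[OF T.charts_at_topspace[OF i]] T.smooth_at_mult
      smooth_at_tbase[OF smooth_at_christoffel[OF charts_at_TM_base[OF i]] i] W) (use kb in auto)

lemma vd_conn_matrix: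
  assumes i: "i \<in> charts_at TM \<xi>" and W: "\<And>a. a < n \<Longrightarrow> smooth_at TM (\<lambda>\<eta>. W \<eta> i a) \<xi>" and kb: "k < n" "b < n"
  shows "vd TM i \<xi> x (\<lambda>\<eta>. conn_matrix M nab i (tbase \<eta>) (W \<eta>) k b) =
    (\<Sum>a<n. vd M i (tbase \<xi>) (hor_part M x) (christoffel M nab i a b k) * W \<xi> i a)
    + (\<Sum>a<n. christoffel M nab i a b k (tbase \<xi>) * vd TM i \<xi> x (\<lambda>\<eta>. W \<eta> i a))"
proof -
  have s: "smooth_at TM (\<lambda>\<eta>. christoffel M nab i a b k (tbase \<eta>)) \<xi>" if "a < n" for a
    by (rule smooth_at_tbase[OF smooth_at_christoffel[OF charts_at_TM_base[OF i] that kb(2,1)] i])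
  have "vd TM i \<xi> x (\<lambda>\<eta>. \<Sum>a<n. christoffel M nab i a b k (tbase \<eta>) * W \<eta> i a)
     = (\<Sum>a<n. vd TM i \<xi> x (\<lambda>\<eta>. christoffel M nab i a b k (tbase \<eta>) * W \<eta> i a))"
    by (rule T.vd_sum[OF _ i]) (use T.smooth_at_mult[OF s W] in auto)
  also have "\<dots> = (\<Sum>a<n. vd TM i \<xi> x (\<lambda>\<eta>. christoffel M nab i a b k (tbase \<eta>)) * W \<xi> i a
       + christoffel M nab i a b k (tbase \<xi>) * vd TM i \<xi> x (\<lambda>\<eta>. W \<eta> i a))"
    by (intro sum.cong refl T.vd_mult s W i) auto
  also have "\<dots> = (\<Sum>a<n. vd M i (tbase \<xi>) (hor_part M x) (christoffel M nab i a b k) * W \<xi> i a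
       + christoffel M nab i a b k (tbase \<xi>) * vd TM i \<xi> x (\<lambda>\<eta>. W \<eta> i a))"
    by (simp add: vd_tbase[OF i])
  finally show ?thesis by (simp add: conn_matrix_def sum.distrib)
qed

section \<open>Vector fields along the projection and their derivative\<close>

lemma section_tangent: "section_on M U W \<Longrightarrow> \<xi> \<in> U \<Longrightarrow> W \<xi> \<in> tangent_space M (tbase \<xi>)"
  and section_smooth: "section_on M U W \<Longrightarrow> \<xi> \<in> U \<Longrightarrow> i \<in> charts_at TM \<xi> \<Longrightarrow> k < n \<Longrightarrow> smooth_at TM (\<lambda>\<eta>. W \<eta> i k) \<xi>"
  by (auto simp: section_on_def)

lemma section_conn_matrix:
  "section_on M U W \<Longrightarrow> \<xi> \<in> U \<Longrightarrow> i \<in> charts_at TM \<xi> \<Longrightarrow> k < n \<Longrightarrow> b < n \<Longrightarrow>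
   smooth_at TM (\<lambda>\<eta>. conn_matrix M nab i (tbase \<eta>) (W \<eta>) k b) \<xi>"
  by (rule smooth_at_conn_matrix) (auto intro: section_smooth)

lemma open_TM_topspace: "openin (mtop TM) U \<Longrightarrow> \<xi> \<in> U \<Longrightarrow> \<xi> \<in> topspace (mtop TM)"
  using openin_subset by blast

lemma hor_part_section:
  assumes U: "openin (mtop TM) U" and X: "vfield TM U X"
  shows "section_on M U (\<lambda>\<xi>. hor_part M (X \<xi>))"
  unfolding section_on_def
proof (intro ballI conjI allI impI)
  fix \<xi> assume \<xi>: "\<xi> \<in> U"
  show "hor_part M (X \<xi>) \<in> tangent_space M (tbase \<xi>)"
    by (rule hor_part_tangent[OF T.vfield_tangent[OF X \<xi>] open_TM_topspace[OF U \<xi>]])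
  fix i k assume i: "i \<in> charts_at TM \<xi>" and k: "k < n"
  show "smooth_at TM (\<lambda>\<eta>. hor_part M (X \<eta>) i k) \<xi>"
    using T.vfield_smooth_at[OF U X \<xi> i, of k] k by (simp add: hor_part_def)
qed

lemma vert_part_section:
  assumes U: "openin (mtop TM) U" and X: "vfield TM U X"
  shows "section_on M U (\<lambda>\<xi>. vert_part M nab \<xi> (X \<xi>))"
  unfolding section_on_def
proof (intro ballI conjI allI impI)
  fix \<xi> assume \<xi>: "\<xi> \<in> U"
  show "vert_part M nab \<xi> (X \<xi>) \<in> tangent_space M (tbase \<xi>)"
    by (rule vert_part_tangent[OF T.vfield_tangent[OF X \<xi>] open_TM_topspace[OF U \<xi>]])
  fix i k assume i: "i \<in> charts_at TM \<xi>" and k: "k < n"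
  have "near TM \<xi> (\<lambda>\<eta>. X \<eta> i (n + k) + (\<Sum>b<n. conn_matrix M nab i (tbase \<eta>) (hor_part M (X \<eta>)) k b * tfib \<eta> i b)
     = vert_part M nab \<eta> (X \<eta>) i k)"
    by (rule near_mono[OF T.near_chart[OF i]]) (simp add: vert_part_apply k)
  then show "smooth_at TM (\<lambda>\<eta>. vert_part M nab \<eta> (X \<eta>) i k) \<xi>"
  proof (rule T.smooth_at_cong)
    have "smooth_at TM (\<lambda>\<eta>. X \<eta> i (n + k)) \<xi>" using T.vfield_smooth_at[OF U X \<xi> i, of "n + k"] k by simp
    moreover have "smooth_at TM (\<lambda>\<eta>. conn_matrix M nab i (tbase \<eta>) (hor_part M (X \<eta>)) k b * tfib \<eta> i b) \<xi>" if "b < n" for b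
      by (rule T.smooth_at_mult[OF section_conn_matrix[OF hor_part_section[OF U X] \<xi> i k that] smooth_at_tfib[OF i that]])
    ultimately show "smooth_at TM (\<lambda>\<eta>. X \<eta> i (n + k) + (\<Sum>b<n. conn_matrix M nab i (tbase \<eta>) (hor_part M (X \<eta>)) k b * tfib \<eta> i b)) \<xi>"
      by (intro T.smooth_at_add T.smooth_at_sum[OF T.charts_at_topspace[OF i]]) auto
  qed
qed

lemma lift_vfield:
  assumes U: "openin (mtop TM) U" and W: "section_on M U W" and W': "section_on M U W'"
  shows "vfield TM U (\<lambda>\<xi>. hor_at M nab \<xi> (W \<xi>) + vert_at M \<xi> (W' \<xi>))"
proof (rule T.vfieldI[OF U])
  fix \<xi> assume \<xi>: "\<xi> \<in> U"
  show "hor_at M nab \<xi> (W \<xi>) + vert_at M \<xi> (W' \<xi>) \<in> tangent_space TM \<xi>"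
    by (rule lift_tangent[OF section_tangent[OF W \<xi>] section_tangent[OF W' \<xi>] open_TM_topspace[OF U \<xi>]])
  obtain i where i: "i \<in> charts_at TM \<xi>" using topspace_TM_chart[OF open_TM_topspace[OF U \<xi>]] ..
  have "smooth_at TM (\<lambda>\<eta>. (hor_at M nab \<eta> (W \<eta>) + vert_at M \<eta> (W' \<eta>)) i k) \<xi>" if k: "k < mdim TM" for k
  proof (cases "k < n")
    case True
    have "near TM \<xi> (\<lambda>\<eta>. W \<eta> i k = (hor_at M nab \<eta> (W \<eta>) + vert_at M \<eta> (W' \<eta>)) i k)"
      by (rule near_mono[OF T.near_chart[OF i]]) (simp add: hor_at_apply vert_at_apply True)
    then show ?thesis by (rule T.smooth_at_cong) (rule section_smooth[OF W \<xi> i True])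
  next
    case False
    define l where "l = k - n"
    have l: "l < n" "k = n + l" using False k by (auto simp: l_def)
    have "near TM \<xi> (\<lambda>\<eta>. W' \<eta> i l - (\<Sum>b<n. conn_matrix M nab i (tbase \<eta>) (W \<eta>) l b * tfib \<eta> i b)
       = (hor_at M nab \<eta> (W \<eta>) + vert_at M \<eta> (W' \<eta>)) i k)"
      by (rule near_mono[OF T.near_chart[OF i]]) (simp add: hor_at_apply vert_at_apply l)
    then show ?thesis
    proof (rule T.smooth_at_cong)
      have "smooth_at TM (\<lambda>\<eta>. conn_matrix M nab i (tbase \<eta>) (W \<eta>) l b * tfib \<eta> i b) \<xi>" if "b < n" for b
        by (rule T.smooth_at_mult[OF section_conn_matrix[OF W \<xi> i l(1) that] smooth_at_tfib[OF i that]])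
      then show "smooth_at TM (\<lambda>\<eta>. W' \<eta> i l - (\<Sum>b<n. conn_matrix M nab i (tbase \<eta>) (W \<eta>) l b * tfib \<eta> i b)) \<xi>"
        by (intro T.smooth_at_diff T.smooth_at_sum[OF T.charts_at_topspace[OF i]] section_smooth[OF W' \<xi> i l(1)]) auto
    qed
  qed
  with i show "\<exists>i\<in>charts_at TM \<xi>. \<forall>k<mdim TM. smooth_at TM (\<lambda>\<eta>. (hor_at M nab \<eta> (W \<eta>) + vert_at M \<eta> (W' \<eta>)) i k) \<xi>"
    by blast
qed

abbreviation "P \<equiv> pull_deriv M nab"

lemma pull_deriv_apply:
  assumes U: "openin (mtop TM) U" and X: "vfield TM U X" and W: "section_on M U W" and \<xi>: "\<xi> \<in> U"
    and i: "i \<in> charts_at TM \<xi>" and k: "k < n"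
  shows "P X W \<xi> i k = vd TM i \<xi> (X \<xi>) (\<lambda>\<eta>. W \<eta> i k)
     + (\<Sum>b<n. conn_matrix M nab i (tbase \<xi>) (hor_part M (X \<xi>)) k b * W \<xi> i b)"
  using i k T.dirder_eq[OF T.vfield_tangent[OF X \<xi>] section_smooth[OF W \<xi> i k] i] by (simp add: pull_deriv_def)

text \<open>When the components of \<open>W\<close> change charts, the product rule differentiates
  the Jacobian along the horizontal part of \<open>X\<close>; by \<open>transform_contracted\<close>
  the connection term absorbs this, so the values are tangent vectors.\<close>

lemma pull_deriv_section:
  assumes U: "openin (mtop TM) U" and X: "vfield TM U X" and W: "section_on M U W"
  shows "section_on M U (P X W)"
  unfolding section_on_def
proof (intro ballI conjI allI impI)
  fix \<xi> assume \<xi>: "\<xi> \<in> U"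
  note top = open_TM_topspace[OF U \<xi>] and Xt = T.vfield_tangent[OF X \<xi>] and Wt = section_tangent[OF W \<xi>]
  note hX = hor_part_section[OF U X]
  obtain i0 where i0: "i0 \<in> charts_at TM \<xi>" using topspace_TM_chart[OF top] ..
  note ce = charts_at_TM_eq[OF i0]
  note nU = nearI[OF U \<xi>]
  show "P X W \<xi> \<in> tangent_space M (tbase \<xi>)"
  proof (rule tangentI)
    fix i j k assume i: "i \<in> charts_at M (tbase \<xi>)" and j: "j \<in> charts_at M (tbase \<xi>)" and k: "k < n"
    then have iT: "i \<in> charts_at TM \<xi>" and jT: "j \<in> charts_at TM \<xi>" using ce by auto
    note sW = section_smooth[OF W \<xi> iT]
    have sJ: "smooth_at TM (\<lambda>\<eta>. jacobian M i j (tbase \<eta>) k a) \<xi>" if "a < n" for a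
      by (rule smooth_at_tbase[OF smooth_at_jacobian[OF i j that] iT])
    have nr: "near TM \<xi> (\<lambda>\<eta>. W \<eta> j k = (\<Sum>a<n. jacobian M i j (tbase \<eta>) k a * W \<eta> i a))"
      by (rule near_mono[OF near_conj[OF nU near_conj[OF T.near_chart[OF iT] T.near_chart[OF jT]]], of "\<lambda>\<eta>. \<eta> \<in> U"])
         (auto intro!: tangent_transform section_tangent[OF W] k charts_at_TM_base)
    have "vd TM j \<xi> (X \<xi>) (\<lambda>\<eta>. W \<eta> j k) = vd TM i \<xi> (X \<xi>) (\<lambda>\<eta>. W \<eta> j k)"
      by (rule T.vd_chart[OF Xt section_smooth[OF W \<xi> jT k] jT iT])
    also have "\<dots> = vd TM i \<xi> (X \<xi>) (\<lambda>\<eta>. \<Sum>a<n. jacobian M i j (tbase \<eta>) k a * W \<eta> i a)"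
      by (rule T.vd_cong[OF nr iT])
    also have "\<dots> = (\<Sum>a<n. vd TM i \<xi> (X \<xi>) (\<lambda>\<eta>. jacobian M i j (tbase \<eta>) k a * W \<eta> i a))"
      by (rule T.vd_sum[OF _ iT]) (use T.smooth_at_mult[OF sJ sW] in auto)
    also have "\<dots> = (\<Sum>a<n. vd TM i \<xi> (X \<xi>) (\<lambda>\<eta>. jacobian M i j (tbase \<eta>) k a) * W \<xi> i a
         + jacobian M i j (tbase \<xi>) k a * vd TM i \<xi> (X \<xi>) (\<lambda>\<eta>. W \<eta> i a))"
      by (intro sum.cong refl T.vd_mult sJ sW iT) auto
    also have "\<dots> = (\<Sum>a<n. vd M i (tbase \<xi>) (hor_part M (X \<xi>)) (\<lambda>q. jacobian M i j q k a) * W \<xi> i a)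
         + (\<Sum>a<n. jacobian M i j (tbase \<xi>) k a * vd TM i \<xi> (X \<xi>) (\<lambda>\<eta>. W \<eta> i a))"
      using vd_tbase[OF iT, where f="\<lambda>q. jacobian M i j q k _"] by (simp add: sum.distrib)
    finally show "P X W \<xi> j k = (\<Sum>a<n. jacobian M i j (tbase \<xi>) k a * P X W \<xi> i a)"
      using transform_contracted[OF section_tangent[OF hX \<xi>] Wt i j k]
      by (simp add: pull_deriv_apply[OF U X W \<xi> jT k] pull_deriv_apply[OF U X W \<xi> iT] distrib_left sum.distrib)
  qed (use ce in \<open>auto simp: pull_deriv_def fun_eq_iff\<close>)
  fix i k assume i: "i \<in> charts_at TM \<xi>" and k: "k < n"
  have nr: "near TM \<xi> (\<lambda>\<eta>. vd TM i \<eta> (X \<eta>) (\<lambda>\<eta>. W \<eta> i k)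
     + (\<Sum>b<n. conn_matrix M nab i (tbase \<eta>) (hor_part M (X \<eta>)) k b * W \<eta> i b) = P X W \<eta> i k)"
    by (rule near_mono[OF near_conj[OF nU T.near_chart[OF i]], of "\<lambda>\<eta>. \<eta> \<in> U"]) (auto simp: pull_deriv_apply[OF U X W _ _ k])
  have "smooth_at TM (\<lambda>\<eta>. vd TM i \<eta> (X \<eta>) (\<lambda>\<eta>. W \<eta> i k)) \<xi>"
    unfolding vd_def
    by (intro T.smooth_at_sum[OF top] T.smooth_at_mult T.vfield_smooth_at[OF U X \<xi> i] T.smooth_at_cpd[OF section_smooth[OF W \<xi> i k] i]) auto
  moreover have "smooth_at TM (\<lambda>\<eta>. conn_matrix M nab i (tbase \<eta>) (hor_part M (X \<eta>)) k b * W \<eta> i b) \<xi>" if "b < n" for b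
    by (rule T.smooth_at_mult[OF section_conn_matrix[OF hX \<xi> i k that] section_smooth[OF W \<xi> i that]])
  ultimately show "smooth_at TM (\<lambda>\<eta>. P X W \<eta> i k) \<xi>"
    by (intro T.smooth_at_cong[OF nr] T.smooth_at_add T.smooth_at_sum[OF top]) auto
qed

lemma pull_deriv_tangent:
  "openin (mtop TM) U \<Longrightarrow> vfield TM U X \<Longrightarrow> section_on M U W \<Longrightarrow> \<xi> \<in> U \<Longrightarrow> P X W \<xi> \<in> tangent_space M (tbase \<xi>)"
  using section_tangent[OF pull_deriv_section] by blast

text \<open>The direction enters through its value at the point, the differentiated field through
  its germ. So \<open>W\<close> may be replaced by a simpler expression valid on
  \<open>U\<close>.\<close>

lemma pull_deriv_cong:
  assumes U: "openin (mtop TM) U" "\<xi> \<in> U" and "X \<xi> = X' \<xi>" "\<And>\<eta>. \<eta> \<in> U \<Longrightarrow> W \<eta> = W' \<eta>"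
  shows "P X W \<xi> = P X' W' \<xi>"
proof -
  have "dirder TM \<xi> (X \<xi>) (\<lambda>\<eta>. W \<eta> i k) = dirder TM \<xi> (X' \<xi>) (\<lambda>\<eta>. W' \<eta> i k)" for i k
    unfolding assms(3) by (rule T.dirder_cong[OF nearI[OF U]]) (simp add: assms(4))
  then show ?thesis using assms(3) assms(4)[OF U(2)] by (simp add: pull_deriv_def cong: if_cong)
qed

lemma section_add:
  "section_on M U W \<Longrightarrow> section_on M U W' \<Longrightarrow> section_on M U (\<lambda>\<xi>. W \<xi> + W' \<xi>)"
  unfolding section_on_def by (auto intro!: tangent_add T.smooth_at_add)

lemma section_scale:
  "openin (mtop TM) U \<Longrightarrow> section_on M U W \<Longrightarrow> smooth_fun TM U f \<Longrightarrow> section_on M U (\<lambda>\<xi>. tscale (f \<xi>) (W \<xi>))"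
  unfolding section_on_def by (auto intro!: tangent_scale T.smooth_at_mult simp: tscale_apply T.smooth_fun_iff)

lemma pull_deriv_add1:
  assumes U: "openin (mtop TM) U" and X: "vfield TM U X" and X': "vfield TM U X'" and W: "section_on M U W" and \<xi>: "\<xi> \<in> U"
  shows "P (X + X') W \<xi> = P X W \<xi> + P X' W \<xi>"
proof -
  obtain i where i: "i \<in> charts_at TM \<xi>" using topspace_TM_chart[OF open_TM_topspace[OF U \<xi>]] ..
  note XX = T.vfield_add[OF U X X']
  show ?thesis
    by (rule tangent_eqI[OF pull_deriv_tangent[OF U XX W \<xi>] tangent_add[OF pull_deriv_tangent[OF U X W \<xi>] pull_deriv_tangent[OF U X' W \<xi>]]
          charts_at_TM_base[OF i]])
       (simp add: pull_deriv_apply[OF U XX W \<xi> i] pull_deriv_apply[OF U X W \<xi> i] pull_deriv_apply[OF U X' W \<xi> i]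
         T.vd_plus_vec hor_part_add conn_matrix_add distrib_right sum.distrib)
qed

lemma pull_deriv_scale1:
  assumes U: "openin (mtop TM) U" and X: "vfield TM U X" and f: "smooth_fun TM U f" and W: "section_on M U W" and \<xi>: "\<xi> \<in> U"
  shows "P (fscale f X) W \<xi> = tscale (f \<xi>) (P X W \<xi>)"
proof -
  obtain i where i: "i \<in> charts_at TM \<xi>" using topspace_TM_chart[OF open_TM_topspace[OF U \<xi>]] ..
  note XX = T.vfield_fscale[OF U f X]
  show ?thesis
    by (rule tangent_eqI[OF pull_deriv_tangent[OF U XX W \<xi>] tangent_scale[OF pull_deriv_tangent[OF U X W \<xi>]]
          charts_at_TM_base[OF i]])
       (simp add: pull_deriv_apply[OF U XX W \<xi> i] pull_deriv_apply[OF U X W \<xi> i] fscale_apply tscale_apply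
         T.vd_scale_vec hor_part_scale conn_matrix_scale distrib_left sum_distrib_left mult_ac)
qed

lemma pull_deriv_add2:
  assumes U: "openin (mtop TM) U" and X: "vfield TM U X" and W: "section_on M U W" and W': "section_on M U W'" and \<xi>: "\<xi> \<in> U"
  shows "P X (\<lambda>\<eta>. W \<eta> + W' \<eta>) \<xi> = P X W \<xi> + P X W' \<xi>"
proof -
  obtain i where i: "i \<in> charts_at TM \<xi>" using topspace_TM_chart[OF open_TM_topspace[OF U \<xi>]] ..
  note WW = section_add[OF W W']
  show ?thesis
    by (rule tangent_eqI[OF pull_deriv_tangent[OF U X WW \<xi>] tangent_add[OF pull_deriv_tangent[OF U X W \<xi>] pull_deriv_tangent[OF U X W' \<xi>]]
          charts_at_TM_base[OF i]])
       (simp add: pull_deriv_apply[OF U X WW \<xi> i] pull_deriv_apply[OF U X W \<xi> i] pull_deriv_apply[OF U X W' \<xi> i]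
         T.vd_add[OF section_smooth[OF W \<xi> i] section_smooth[OF W' \<xi> i] i] distrib_left sum.distrib)
qed

lemma pull_deriv_leibniz:
  assumes U: "openin (mtop TM) U" and X: "vfield TM U X" and f: "smooth_fun TM U f" and W: "section_on M U W" and \<xi>: "\<xi> \<in> U"
  shows "P X (\<lambda>\<eta>. tscale (f \<eta>) (W \<eta>)) \<xi> = tscale (dirder TM \<xi> (X \<xi>) f) (W \<xi>) + tscale (f \<xi>) (P X W \<xi>)"
proof -
  obtain i where i: "i \<in> charts_at TM \<xi>" using topspace_TM_chart[OF open_TM_topspace[OF U \<xi>]] ..
  note WW = section_scale[OF U W f]
  have fs: "smooth_at TM f \<xi>" using f \<xi> by (simp add: T.smooth_fun_iff[OF U])
  show ?thesis
    by (rule tangent_eqI[OF pull_deriv_tangent[OF U X WW \<xi>] tangent_add[OF tangent_scale[OF section_tangent[OF W \<xi>]]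
          tangent_scale[OF pull_deriv_tangent[OF U X W \<xi>]]] charts_at_TM_base[OF i]])
       (simp add: pull_deriv_apply[OF U X WW \<xi> i] pull_deriv_apply[OF U X W \<xi> i] tscale_apply
         T.dirder_eq[OF T.vfield_tangent[OF X \<xi>] fs i]
         T.vd_mult[OF fs section_smooth[OF W \<xi> i] i] distrib_left sum_distrib_left mult_ac)
qed

section \<open>Existence and uniqueness of the canonical connection\<close>

lemma pull_conn_parts:
  assumes U: "openin (mtop TM) U" and X: "vfield TM U X" and Y: "vfield TM U Y" and \<xi>: "\<xi> \<in> U"
  shows "hor_part M (pull_conn M nab X Y \<xi>) = P X (\<lambda>\<eta>. hor_part M (Y \<eta>)) \<xi>"
    "vert_part M nab \<xi> (pull_conn M nab X Y \<xi>) = P X (\<lambda>\<eta>. vert_part M nab \<eta> (Y \<eta>)) \<xi>"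
  unfolding pull_conn_def
  by (rule lift_parts[OF pull_deriv_tangent[OF U X hor_part_section[OF U Y] \<xi>] pull_deriv_tangent[OF U X vert_part_section[OF U Y] \<xi>]])+

lemma pull_conn_connection: "connection TM (pull_conn M nab)"
  unfolding connection_def
proof (intro allI impI)
  fix U X X' Y Y' f
  assume A: "openin (mtop TM) U \<and> vfield TM U X \<and> vfield TM U X' \<and> vfield TM U Y \<and> vfield TM U Y' \<and> smooth_fun TM U f"
  then have U: "openin (mtop TM) U" and X: "vfield TM U X" and X': "vfield TM U X'" and Y: "vfield TM U Y"
    and Y': "vfield TM U Y'" and f: "smooth_fun TM U f" by auto
  note hY = hor_part_section[OF U Y] and vY = vert_part_section[OF U Y]
  note hY' = hor_part_section[OF U Y'] and vY' = vert_part_section[OF U Y']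
  let ?N = "pull_conn M nab"
  show "vfield TM U (?N X Y) \<and>
    (\<forall>p\<in>U. ?N (X + X') Y p = ?N X Y p + ?N X' Y p) \<and>
    (\<forall>p\<in>U. ?N (fscale f X) Y p = tscale (f p) (?N X Y p)) \<and>
    (\<forall>p\<in>U. ?N X (Y + Y') p = ?N X Y p + ?N X Y' p) \<and>
    (\<forall>p\<in>U. ?N X (fscale f Y) p = tscale (dirder TM p (X p) f) (Y p) + tscale (f p) (?N X Y p)) \<and>
    ((\<forall>p\<in>U. X p = X' p \<and> Y p = Y' p) \<longrightarrow> (\<forall>p\<in>U. ?N X Y p = ?N X' Y' p))"
  proof (intro conjI ballI impI)
    show "vfield TM U (?N X Y)"
      using lift_vfield[OF U pull_deriv_section[OF U X hY] pull_deriv_section[OF U X vY]]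
      unfolding pull_conn_def[abs_def] .
    fix \<xi> assume \<xi>: "\<xi> \<in> U"
    show "?N (X + X') Y \<xi> = ?N X Y \<xi> + ?N X' Y \<xi>"
      unfolding pull_conn_def pull_deriv_add1[OF U X X' hY \<xi>] pull_deriv_add1[OF U X X' vY \<xi>] hor_at_add vert_at_add
      by (simp only: add_ac)
    show "?N (fscale f X) Y \<xi> = tscale (f \<xi>) (?N X Y \<xi>)"
      unfolding pull_conn_def pull_deriv_scale1[OF U X f hY \<xi>] pull_deriv_scale1[OF U X f vY \<xi>] hor_at_scale vert_at_scale tscale_plus ..
    show "?N X (Y + Y') \<xi> = ?N X Y \<xi> + ?N X Y' \<xi>"
      unfolding pull_conn_def plus_fun_apply hor_part_add vert_part_add
        pull_deriv_add2[OF U X hY hY' \<xi>] pull_deriv_add2[OF U X vY vY' \<xi>] hor_at_add vert_at_add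
      by (simp only: add_ac)
    show "?N X (fscale f Y) \<xi> = tscale (dirder TM \<xi> (X \<xi>) f) (Y \<xi>) + tscale (f \<xi>) (?N X Y \<xi>)"
    proof -
      \<comment> \<open>The derivative of \<open>f\<close> multiplies the two parts of
        \<open>Y\<close> separately; \<open>decompose\<close> then reassembles them.\<close>
      have "?N X (fscale f Y) \<xi> = tscale (dirder TM \<xi> (X \<xi>) f) (hor_at M nab \<xi> (hor_part M (Y \<xi>)) + vert_at M \<xi> (vert_part M nab \<xi> (Y \<xi>)))
          + tscale (f \<xi>) (?N X Y \<xi>)"
        unfolding pull_conn_def fscale_apply hor_part_scale vert_part_scale
          pull_deriv_leibniz[OF U X f hY \<xi>] pull_deriv_leibniz[OF U X f vY \<xi>] hor_at_add vert_at_add hor_at_scale vert_at_scale tscale_plus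
        by (simp only: add_ac)
      then show ?thesis
        by (simp only: decompose[OF T.vfield_tangent[OF Y \<xi>] open_TM_topspace[OF U \<xi>], symmetric])
    qed
    assume eq: "\<forall>p\<in>U. X p = X' p \<and> Y p = Y' p"
    show "?N X Y \<xi> = ?N X' Y' \<xi>"
      unfolding pull_conn_def
      by (intro arg_cong2[where f="(+)"] arg_cong[where f="hor_at M nab \<xi>"] arg_cong[where f="vert_at M \<xi>"] pull_deriv_cong[OF U \<xi>])
         (use eq \<xi> in auto)
  qed
qed

lemma base_section:
  assumes U: "openin (mtop M) U" and Y: "vfield M U Y"
  shows "section_on M (bundle_over M U) (\<lambda>\<xi>. Y (tbase \<xi>))"
  unfolding section_on_def
proof (intro ballI conjI allI impI)
  fix \<xi> assume "\<xi> \<in> bundle_over M U"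
  then have b: "tbase \<xi> \<in> U" by (simp add: bundle_over_iff)
  show "Y (tbase \<xi>) \<in> tangent_space M (tbase \<xi>)" by (rule vfield_tangent[OF Y b])
  fix i k assume i: "i \<in> charts_at TM \<xi>" and k: "k < n"
  show "smooth_at TM (\<lambda>\<eta>. Y (tbase \<eta>) i k) \<xi>"
    using smooth_at_tbase[OF vfield_smooth_at[OF U Y b charts_at_TM_base[OF i] k] i] .
qed

lemma zero_section: "openin (mtop TM) U \<Longrightarrow> section_on M U (\<lambda>\<xi>. 0)"
  unfolding section_on_def by (auto simp: tangent_space_zero intro: T.smooth_at_const)

lemma pull_deriv_zero: "P X (\<lambda>\<xi>. 0) \<xi> = 0"
proof -
  have "dirder TM \<xi> u (\<lambda>\<eta>. 0) = 0" for u
    unfolding dirder_def Let_def using T.cpd_const[where c=0] by (simp add: cpd_def)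
  then show ?thesis by (simp add: pull_deriv_def fun_eq_iff)
qed

lemma hor_lift_vfield: "openin (mtop M) U \<Longrightarrow> vfield M U X \<Longrightarrow> vfield TM (bundle_over M U) (hor_lift M nab X)"
  using lift_vfield[OF openin_bundle_over base_section zero_section[OF openin_bundle_over]]
  unfolding hor_lift_def vert_at_zero by simp

lemma vert_lift_vfield: "openin (mtop M) U \<Longrightarrow> vfield M U X \<Longrightarrow> vfield TM (bundle_over M U) (vert_lift M X)"
  using lift_vfield[OF openin_bundle_over zero_section[OF openin_bundle_over] base_section]
  unfolding vert_lift_def hor_at_zero by simp

text \<open>A field that factors through the base is constant along the fibres, so vertical
  directions give 0, and in horizontal directions the pullback derivative is that of the original
  connection. These are the values which the canonical connection must have on lifts.\<close>

lemma pull_deriv_base: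
  assumes U: "openin (mtop M) U" and X: "vfield M U X" and Y: "vfield M U Y" and \<xi>: "\<xi> \<in> bundle_over M U"
  shows "P (hor_lift M nab X) (\<lambda>\<eta>. Y (tbase \<eta>)) \<xi> = nab X Y (tbase \<xi>)"
    "P (vert_lift M X) (\<lambda>\<eta>. Y (tbase \<eta>)) \<xi> = 0"
proof -
  note V = openin_bundle_over[OF U] and b = base_section[OF U Y]
  have p: "tbase \<xi> \<in> U" using \<xi> by (simp add: bundle_over_iff)
  obtain i where i: "i \<in> charts_at TM \<xi>" using topspace_TM_chart[OF open_TM_topspace[OF V \<xi>]] ..
  note ib = charts_at_TM_base[OF i]
  have vb: "vd TM i \<xi> x (\<lambda>\<eta>. Y (tbase \<eta>) i k) = vd M i (tbase \<xi>) (hor_part M x) (\<lambda>q. Y q i k)" for x k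
    by (rule vd_tbase[OF i])
  have h: "hor_part M (hor_lift M nab X \<xi>) = X (tbase \<xi>)"
    unfolding hor_lift_def by (rule parts_hor_at[OF vfield_tangent[OF X p]])
  have h0: "hor_part M (vert_lift M X \<xi>) = 0"
    unfolding vert_lift_def by (rule parts_vert_at[OF vfield_tangent[OF X p]])
  show "P (hor_lift M nab X) (\<lambda>\<eta>. Y (tbase \<eta>)) \<xi> = nab X Y (tbase \<xi>)"
    by (rule tangent_eqI[OF pull_deriv_tangent[OF V hor_lift_vfield[OF U X] b \<xi>] vfield_tangent[OF nab_vfield[OF U X Y] p] ib])
       (simp add: pull_deriv_apply[OF V hor_lift_vfield[OF U X] b \<xi> i] vb h nab_formula[OF U X Y p ib])
  show "P (vert_lift M X) (\<lambda>\<eta>. Y (tbase \<eta>)) \<xi> = 0"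
    by (rule tangent_eqI[OF pull_deriv_tangent[OF V vert_lift_vfield[OF U X] b \<xi>] tangent_space_zero ib])
       (simp add: pull_deriv_apply[OF V vert_lift_vfield[OF U X] b \<xi> i] vb h0, simp add: vd_def conn_matrix_def)
qed

lemma pull_conn_canonical: "canonical_conn M nab (pull_conn M nab)"
  unfolding canonical_conn_def
proof (intro conjI pull_conn_connection allI impI)
  fix U X Y assume "openin (mtop M) U \<and> vfield M U X \<and> vfield M U Y"
  then have U: "openin (mtop M) U" and X: "vfield M U X" and Y: "vfield M U Y" by auto
  show "\<forall>\<xi>\<in>bundle_over M U.
     pull_conn M nab (hor_lift M nab X) (hor_lift M nab Y) \<xi> = hor_lift M nab (nab X Y) \<xi> \<and>
     pull_conn M nab (hor_lift M nab X) (vert_lift M Y) \<xi> = vert_lift M (nab X Y) \<xi> \<and>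
     pull_conn M nab (vert_lift M X) (hor_lift M nab Y) \<xi> = 0 \<and>
     pull_conn M nab (vert_lift M X) (vert_lift M Y) \<xi> = 0"
  proof
    fix \<xi> assume \<xi>: "\<xi> \<in> bundle_over M U"
    note V = openin_bundle_over[OF U]
    have t: "Y (tbase \<eta>) \<in> tangent_space M (tbase \<eta>)" if "\<eta> \<in> bundle_over M U" for \<eta>
      using that vfield_tangent[OF Y] by (simp add: bundle_over_iff)
    have hh: "P Z (\<lambda>\<eta>. hor_part M (hor_lift M nab Y \<eta>)) \<xi> = P Z (\<lambda>\<eta>. Y (tbase \<eta>)) \<xi>" for Z
      by (rule pull_deriv_cong[OF V \<xi> refl]) (simp add: hor_lift_def parts_hor_at[OF t])
    have hv: "P Z (\<lambda>\<eta>. vert_part M nab \<eta> (hor_lift M nab Y \<eta>)) \<xi> = P Z (\<lambda>\<eta>. 0) \<xi>" for Z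
      by (rule pull_deriv_cong[OF V \<xi> refl]) (simp add: hor_lift_def parts_hor_at[OF t])
    have vh: "P Z (\<lambda>\<eta>. hor_part M (vert_lift M Y \<eta>)) \<xi> = P Z (\<lambda>\<eta>. 0) \<xi>" for Z
      by (rule pull_deriv_cong[OF V \<xi> refl]) (simp add: vert_lift_def parts_vert_at[OF t])
    have vv: "P Z (\<lambda>\<eta>. vert_part M nab \<eta> (vert_lift M Y \<eta>)) \<xi> = P Z (\<lambda>\<eta>. Y (tbase \<eta>)) \<xi>" for Z
      by (rule pull_deriv_cong[OF V \<xi> refl]) (simp add: vert_lift_def parts_vert_at[OF t])
    show "pull_conn M nab (hor_lift M nab X) (hor_lift M nab Y) \<xi> = hor_lift M nab (nab X Y) \<xi> \<and>
     pull_conn M nab (hor_lift M nab X) (vert_lift M Y) \<xi> = vert_lift M (nab X Y) \<xi> \<and>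
     pull_conn M nab (vert_lift M X) (hor_lift M nab Y) \<xi> = 0 \<and>
     pull_conn M nab (vert_lift M X) (vert_lift M Y) \<xi> = 0"
      unfolding pull_conn_def hh hv vh vv pull_deriv_zero pull_deriv_base[OF U X Y \<xi>] hor_at_zero vert_at_zero
      by (simp add: hor_lift_def vert_lift_def)
  qed
qed

text \<open>Over a chart, the horizontal and vertical lifts of the coordinate fields form a frame on
  which the four equations prescribe the connection. Both connections have the same values on it,
  and \<open>nab_expand\<close> gives the same formula for both on arbitrary fields.\<close>

lemma canonical_conn_unique:
  assumes c: "canonical_conn M nab N" and U: "openin (mtop TM) U" and X: "vfield TM U X" and Y: "vfield TM U Y" and \<xi>: "\<xi> \<in> U"
  shows "N X Y \<xi> = pull_conn M nab X Y \<xi>"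
proof -
  obtain i where i: "i \<in> charts_at TM \<xi>" using topspace_TM_chart[OF open_TM_topspace[OF U \<xi>]] ..
  note ib = charts_at_TM_base[OF i]
  then have ic: "i \<in> charts M" by (simp add: charts_at_iff)
  note cd = cdom_open[OF ic]
  define V where "V = U \<inter> bundle_over M (cdom M i)"
  have V: "openin (mtop TM) V" using U openin_bundle_over[OF cd] by (auto simp: V_def)
  have \<xi>V: "\<xi> \<in> V" using \<xi> i by (simp add: V_def T.charts_at_iff)
  have XV: "vfield TM V X" and YV: "vfield TM V Y" using T.vfield_subset X Y unfolding V_def by blast+
  have ch: "i \<in> charts_at TM \<eta>" if "\<eta> \<in> V" for \<eta> using that ic by (simp add: V_def T.charts_at_iff)
  define E where "E a = (if a < n then hor_lift M nab (coord_field M i a) else vert_lift M (coord_field M i (a - n)))" for a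
  define f where "f X a \<eta> = (if a < n then hor_part M (X \<eta>) i a else vert_part M nab \<eta> (X \<eta>) i (a - n))" for X :: "('a, 'i) tfield" and a and \<eta>
  have E: "vfield TM V (E a)" if "a \<in> {..<2 * n}" for a
  proof (cases "a < n")
    case True
    show ?thesis using T.vfield_subset[OF _ hor_lift_vfield[OF cd coord_field_vfield[OF ic True]], of V] True
      by (auto simp: E_def V_def)
  next
    case False
    then have "a - n < n" using that by auto
    then show ?thesis using T.vfield_subset[OF _ vert_lift_vfield[OF cd coord_field_vfield[OF ic]], of V "a - n"] False
      by (auto simp: E_def V_def)
  qed
  have f: "smooth_fun TM V (f X a)" if X: "vfield TM V X" and a: "a \<in> {..<2 * n}" for X a
    unfolding T.smooth_fun_iff[OF V]
  proof
    fix \<eta> assume \<eta>: "\<eta> \<in> V"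
    show "smooth_at TM (f X a) \<eta>"
    proof (cases "a < n")
      case True
      then show ?thesis using section_smooth[OF hor_part_section[OF V X] \<eta> ch[OF \<eta>] True] by (simp add: f_def[abs_def])
    next
      case False
      then have "a - n < n" using a by auto
      from section_smooth[OF vert_part_section[OF V X] \<eta> ch[OF \<eta>] this] False show ?thesis by (simp add: f_def[abs_def])
    qed
  qed
  have ex: "X \<eta> = (\<Sum>a\<in>{..<2 * n}. tscale (f X a \<eta>) (E a \<eta>))" if X: "vfield TM V X" and \<eta>: "\<eta> \<in> V" for X \<eta>
  proof -
    note \<eta>t = open_TM_topspace[OF V \<eta>] and ib = charts_at_TM_base[OF ch[OF \<eta>]]
    have "X \<eta> = hor_at M nab \<eta> (hor_part M (X \<eta>)) + vert_at M \<eta> (vert_part M nab \<eta> (X \<eta>))"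
      by (rule decompose[OF T.vfield_tangent[OF X \<eta>] \<eta>t])
    also have "hor_part M (X \<eta>) = (\<Sum>a<n. tscale (hor_part M (X \<eta>) i a) (coord_field M i a (tbase \<eta>)))"
      by (rule tangent_expand[OF section_tangent[OF hor_part_section[OF V X] \<eta>] ib])
    also have "vert_part M nab \<eta> (X \<eta>) = (\<Sum>a<n. tscale (vert_part M nab \<eta> (X \<eta>) i a) (coord_field M i a (tbase \<eta>)))"
      by (rule tangent_expand[OF section_tangent[OF vert_part_section[OF V X] \<eta>] ib])
    finally have e: "X \<eta> = hor_at M nab \<eta> (\<Sum>a<n. tscale (hor_part M (X \<eta>) i a) (coord_field M i a (tbase \<eta>)))
       + vert_at M \<eta> (\<Sum>a<n. tscale (vert_part M nab \<eta> (X \<eta>) i a) (coord_field M i a (tbase \<eta>)))" .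
    show ?thesis
      by (rule trans[OF e], unfold sum_lessThan_double hor_at_sum vert_at_sum hor_at_scale vert_at_scale)
         (simp add: f_def E_def hor_lift_def vert_lift_def)
  qed
  have Nc: "connection TM N" using c by (simp add: canonical_conn_def)
  interpret N: conn_mfd TM N by unfold_locales (rule Nc)
  interpret K: conn_mfd TM "pull_conn M nab" by unfold_locales (rule pull_conn_connection)
  have eq: "N (E a) (E b) \<xi> = pull_conn M nab (E a) (E b) \<xi>" if ab: "a < 2 * n" "b < 2 * n" for a b
  proof -
    have \<xi>c: "\<xi> \<in> bundle_over M (cdom M i)" using \<xi>V by (simp add: V_def)
    have v: "vfield M (cdom M i) (coord_field M i a)" if "a < n" for a by (rule coord_field_vfield[OF ic that])
    have C: "K (hor_lift M nab A) (hor_lift M nab B) \<xi> = hor_lift M nab (nab A B) \<xi> \<and>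
        K (hor_lift M nab A) (vert_lift M B) \<xi> = vert_lift M (nab A B) \<xi> \<and>
        K (vert_lift M A) (hor_lift M nab B) \<xi> = 0 \<and> K (vert_lift M A) (vert_lift M B) \<xi> = 0"
      if "canonical_conn M nab K" "vfield M (cdom M i) A" "vfield M (cdom M i) B" for K A B
      using that cd \<xi>c unfolding canonical_conn_def by blast
    have l: "a - n < n" if "a < 2 * n" "\<not> a < n" for a using that by linarith
    consider "a < n" "b < n" | "a < n" "\<not> b < n" | "\<not> a < n" "b < n" | "\<not> a < n" "\<not> b < n" by blast
    then show ?thesis
    proof cases
      case 1
      then show ?thesis unfolding E_def
        using C[OF c v v, of a b] C[OF pull_conn_canonical v v, of a b] by simp
    next
      case 2
      then show ?thesis unfolding E_def
        using C[OF c v v, of a "b - n"] C[OF pull_conn_canonical v v, of a "b - n"] l[OF ab(2)] by simp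
    next
      case 3
      then show ?thesis unfolding E_def
        using C[OF c v v, of "a - n" b] C[OF pull_conn_canonical v v, of "a - n" b] l[OF ab(1)] by simp
    next
      case 4
      then show ?thesis unfolding E_def
        using C[OF c v v, of "a - n" "b - n"] C[OF pull_conn_canonical v v, of "a - n" "b - n"] l[OF ab(1)] l[OF ab(2)] by simp
    qed
  qed
  have "N X Y \<xi> = (\<Sum>a\<in>{..<2 * n}. \<Sum>b\<in>{..<2 * n}. tscale (f X a \<xi>)
     (tscale (dirder TM \<xi> (E a \<xi>) (f Y b)) (E b \<xi>) + tscale (f Y b \<xi>) (N (E a) (E b) \<xi>)))"
    by (rule N.nab_expand[OF V E E f[OF XV] f[OF YV] XV YV ex[OF XV] ex[OF YV] \<xi>V])
  also have "\<dots> = (\<Sum>a\<in>{..<2 * n}. \<Sum>b\<in>{..<2 * n}. tscale (f X a \<xi>)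
     (tscale (dirder TM \<xi> (E a \<xi>) (f Y b)) (E b \<xi>) + tscale (f Y b \<xi>) (pull_conn M nab (E a) (E b) \<xi>)))"
    by (intro sum.cong refl) (simp add: eq)
  also have "\<dots> = pull_conn M nab X Y \<xi>"
    by (rule K.nab_expand[OF V E E f[OF XV] f[OF YV] XV YV ex[OF XV] ex[OF YV] \<xi>V, symmetric])
  finally show ?thesis .
qed

section \<open>The chosen connection in terms of parts\<close>

lemma lift_conn_canonical: "canonical_conn M nab (lift_conn M nab)"
  unfolding lift_conn_def by (rule someI[of "canonical_conn M nab"]) (rule pull_conn_canonical)

lemma lift_conn_eq:
  "openin (mtop TM) U \<Longrightarrow> vfield TM U X \<Longrightarrow> vfield TM U Y \<Longrightarrow> \<xi> \<in> U \<Longrightarrow> lift_conn M nab X Y \<xi> = pull_conn M nab X Y \<xi>"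
  by (rule canonical_conn_unique[OF lift_conn_canonical])

lemma lift_conn_parts:
  assumes "openin (mtop TM) U" "vfield TM U X" "vfield TM U Y" "\<xi> \<in> U"
  shows "hor_part M (lift_conn M nab X Y \<xi>) = P X (\<lambda>\<eta>. hor_part M (Y \<eta>)) \<xi>"
    "vert_part M nab \<xi> (lift_conn M nab X Y \<xi>) = P X (\<lambda>\<eta>. vert_part M nab \<eta> (Y \<eta>)) \<xi>"
  unfolding lift_conn_eq[OF assms] by (rule pull_conn_parts[OF assms])+

end

section \<open>The lifted affine-Riemann structure\<close>

lemma sum_matrix_product:
  fixes A B :: "nat \<Rightarrow> nat \<Rightarrow> real"
  shows "(\<Sum>b<m. A k b * (\<Sum>c<m. B b c * v c)) = (\<Sum>c<m. (\<Sum>b<m. A k b * B b c) * v c)"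
  unfolding sum_distrib_left sum_distrib_right by (subst sum.swap) (simp add: mult.assoc)

context tb_conn
begin

sublocale N: conn_mfd "tangent_bundle M" "lift_conn M nab"
  by unfold_locales (use lift_conn_canonical in \<open>simp add: canonical_conn_def\<close>)

text \<open>The connection form of \<open>M\<close> pulled back by the projection and evaluated on a
  bundle vector \<open>w\<close>.\<close>

abbreviation "K i \<xi> w \<equiv> conn_matrix M nab i (tbase \<xi>) (hor_part M w)"

lemma section_uminus: "section_on M U W \<Longrightarrow> section_on M U (\<lambda>\<xi>. - W \<xi>)"
  unfolding section_on_def by (auto intro!: tangent_minus T.smooth_at_minus)

lemma pull_deriv_minus:
  assumes U: "openin (mtop TM) U" and X: "vfield TM U X" and W: "section_on M U W" and \<xi>: "\<xi> \<in> U"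
  shows "P X (\<lambda>\<eta>. - W \<eta>) \<xi> = - P X W \<xi>"
proof -
  obtain i where i: "i \<in> charts_at TM \<xi>" using topspace_TM_chart[OF open_TM_topspace[OF U \<xi>]] ..
  note WW = section_uminus[OF W]
  show ?thesis
    by (rule tangent_eqI[OF pull_deriv_tangent[OF U X WW \<xi>] tangent_minus[OF pull_deriv_tangent[OF U X W \<xi>]] charts_at_TM_base[OF i]])
       (simp add: pull_deriv_apply[OF U X WW \<xi> i] pull_deriv_apply[OF U X W \<xi> i]
         T.vd_minus[OF section_smooth[OF W \<xi> i] i] sum_negf)
qed

end

locale tb_affine = tb_conn M nab + affine_riem M nab g
  for M :: "('a, 'i) tmanifold" and nab and g +
  assumes flat_nab: "flat M nab"
begin

section \<open>Torsion and curvature of the lifted connection\<close>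

abbreviation "TN \<equiv> lift_conn M nab"
abbreviation "g1 \<equiv> lift_metric M nab g"
abbreviation "J1 \<equiv> lift_J M nab"

text \<open>The structure equation of the pulled back connection form \<open>K\<close>: its
  right-hand side is \<open>K\<close> on the bracket. Derivatives of Christoffel symbols and
  quadratic terms are disposed of by flatness through \<open>curvature_zero\<close>; derivatives of
  the components of the fields form the bracket.\<close>

lemma conn_matrix_bracket:
  assumes U: "openin (mtop TM) U" and X: "vfield TM U X" and Y: "vfield TM U Y" and \<xi>: "\<xi> \<in> U"
    and i: "i \<in> charts_at TM \<xi>" and k: "k < n" and b: "b < n"
  shows "vd TM i \<xi> (X \<xi>) (\<lambda>\<eta>. K i \<eta> (Y \<eta>) k b) - vd TM i \<xi> (Y \<xi>) (\<lambda>\<eta>. K i \<eta> (X \<eta>) k b)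
     + (\<Sum>d<n. K i \<xi> (X \<xi>) k d * K i \<xi> (Y \<xi>) d b - K i \<xi> (Y \<xi>) k d * K i \<xi> (X \<xi>) d b)
     = (\<Sum>a<n. christoffel M nab i a b k (tbase \<xi>) * bracket TM X Y \<xi> i a)"
proof -
  note hX = hor_part_section[OF U X] and hY = hor_part_section[OF U Y]
  have X': "(\<lambda>\<eta>. hor_part M (X \<eta>) i a) = (\<lambda>\<eta>. X \<eta> i a)" and Y': "(\<lambda>\<eta>. hor_part M (Y \<eta>) i a) = (\<lambda>\<eta>. Y \<eta> i a)" if "a < n" for a
    using that by (simp_all add: hor_part_def)
  have 1: "vd TM i \<xi> (X \<xi>) (\<lambda>\<eta>. K i \<eta> (Y \<eta>) k b) =
    (\<Sum>a<n. vd M i (tbase \<xi>) (hor_part M (X \<xi>)) (christoffel M nab i a b k) * hor_part M (Y \<xi>) i a)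
    + (\<Sum>a<n. christoffel M nab i a b k (tbase \<xi>) * vd TM i \<xi> (X \<xi>) (\<lambda>\<eta>. Y \<eta> i a))"
    using vd_conn_matrix[OF i, where W="\<lambda>\<eta>. hor_part M (Y \<eta>)", OF section_smooth[OF hY \<xi> i] k b, of "X \<xi>"] by (simp add: Y')
  have 2: "vd TM i \<xi> (Y \<xi>) (\<lambda>\<eta>. K i \<eta> (X \<eta>) k b) =
    (\<Sum>a<n. vd M i (tbase \<xi>) (hor_part M (Y \<xi>)) (christoffel M nab i a b k) * hor_part M (X \<xi>) i a)
    + (\<Sum>a<n. christoffel M nab i a b k (tbase \<xi>) * vd TM i \<xi> (Y \<xi>) (\<lambda>\<eta>. X \<eta> i a))"
    using vd_conn_matrix[OF i, where W="\<lambda>\<eta>. hor_part M (X \<eta>)", OF section_smooth[OF hX \<xi> i] k b, of "Y \<xi>"] by (simp add: X')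
  have 3: "(\<Sum>a<n. christoffel M nab i a b k (tbase \<xi>) * bracket TM X Y \<xi> i a) =
     (\<Sum>a<n. christoffel M nab i a b k (tbase \<xi>) * vd TM i \<xi> (X \<xi>) (\<lambda>\<eta>. Y \<eta> i a))
     - (\<Sum>a<n. christoffel M nab i a b k (tbase \<xi>) * vd TM i \<xi> (Y \<xi>) (\<lambda>\<eta>. X \<eta> i a))"
    by (simp add: N.bracket_apply[OF U X Y \<xi> i] right_diff_distrib sum_subtractf)
  show ?thesis
    unfolding 1 2 3 using curvature_zero[OF flat_nab charts_at_TM_base[OF i] k b, of "hor_part M (X \<xi>)" "hor_part M (Y \<xi>)"]
    by linarith
qed

text \<open>Arranged for antisymmetrisation: the third and fourth terms are interchanged when
  \<open>X\<close> and \<open>Y\<close> are, so they cancel in the torsion; the first gives a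
  bracket, and the second and last are combined by \<open>conn_matrix_bracket\<close>.\<close>

lemma pull_deriv_vert:
  assumes U: "openin (mtop TM) U" and X: "vfield TM U X" and Y: "vfield TM U Y" and \<xi>: "\<xi> \<in> U"
    and i: "i \<in> charts_at TM \<xi>" and l: "l < n"
  shows "P X (\<lambda>\<eta>. vert_part M nab \<eta> (Y \<eta>)) \<xi> i l = vd TM i \<xi> (X \<xi>) (\<lambda>\<eta>. Y \<eta> i (n + l))
     + (\<Sum>b<n. vd TM i \<xi> (X \<xi>) (\<lambda>\<eta>. K i \<eta> (Y \<eta>) l b) * tfib \<xi> i b)
     + (\<Sum>b<n. K i \<xi> (Y \<xi>) l b * X \<xi> i (n + b)) + (\<Sum>b<n. K i \<xi> (X \<xi>) l b * Y \<xi> i (n + b))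
     + (\<Sum>b<n. (\<Sum>d<n. K i \<xi> (X \<xi>) l d * K i \<xi> (Y \<xi>) d b) * tfib \<xi> i b)"
proof -
  note hY = hor_part_section[OF U Y] and vY = vert_part_section[OF U Y]
  have sK: "smooth_at TM (\<lambda>\<eta>. K i \<eta> (Y \<eta>) l b) \<xi>" if "b < n" for b by (rule section_conn_matrix[OF hY \<xi> i l that])
  have sY: "smooth_at TM (\<lambda>\<eta>. Y \<eta> i (n + l)) \<xi>" using T.vfield_smooth_at[OF U Y \<xi> i, of "n + l"] l by simp
  have sKv: "smooth_at TM (\<lambda>\<eta>. K i \<eta> (Y \<eta>) l b * tfib \<eta> i b) \<xi>" if "b < n" for b
    by (rule T.smooth_at_mult[OF sK[OF that] smooth_at_tfib[OF i that]])
  have nr: "near TM \<xi> (\<lambda>\<eta>. vert_part M nab \<eta> (Y \<eta>) i l = Y \<eta> i (n + l) + (\<Sum>b<n. K i \<eta> (Y \<eta>) l b * tfib \<eta> i b))"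
    by (rule near_mono[OF T.near_chart[OF i]]) (simp add: vert_part_apply l)
  have "vd TM i \<xi> (X \<xi>) (\<lambda>\<eta>. vert_part M nab \<eta> (Y \<eta>) i l)
     = vd TM i \<xi> (X \<xi>) (\<lambda>\<eta>. Y \<eta> i (n + l) + (\<Sum>b<n. K i \<eta> (Y \<eta>) l b * tfib \<eta> i b))"
    by (rule T.vd_cong[OF nr i])
  also have "\<dots> = vd TM i \<xi> (X \<xi>) (\<lambda>\<eta>. Y \<eta> i (n + l)) + vd TM i \<xi> (X \<xi>) (\<lambda>\<eta>. \<Sum>b<n. K i \<eta> (Y \<eta>) l b * tfib \<eta> i b)"
    by (rule T.vd_add[OF sY T.smooth_at_sum[OF T.charts_at_topspace[OF i]] i]) (use sKv in auto)
  also have "vd TM i \<xi> (X \<xi>) (\<lambda>\<eta>. \<Sum>b<n. K i \<eta> (Y \<eta>) l b * tfib \<eta> i b)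
     = (\<Sum>b<n. vd TM i \<xi> (X \<xi>) (\<lambda>\<eta>. K i \<eta> (Y \<eta>) l b * tfib \<eta> i b))"
    by (rule T.vd_sum[OF _ i]) (use sKv in auto)
  also have "\<dots> = (\<Sum>b<n. vd TM i \<xi> (X \<xi>) (\<lambda>\<eta>. K i \<eta> (Y \<eta>) l b) * tfib \<xi> i b + K i \<xi> (Y \<xi>) l b * X \<xi> i (n + b))"
    by (intro sum.cong refl) (simp add: T.vd_mult[OF sK smooth_at_tfib[OF i] i] vd_tfib[OF i])
  finally have 1: "vd TM i \<xi> (X \<xi>) (\<lambda>\<eta>. vert_part M nab \<eta> (Y \<eta>) i l) = vd TM i \<xi> (X \<xi>) (\<lambda>\<eta>. Y \<eta> i (n + l))
     + (\<Sum>b<n. vd TM i \<xi> (X \<xi>) (\<lambda>\<eta>. K i \<eta> (Y \<eta>) l b) * tfib \<xi> i b) + (\<Sum>b<n. K i \<xi> (Y \<xi>) l b * X \<xi> i (n + b))"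
    by (simp add: sum.distrib)
  have 2: "(\<Sum>b<n. K i \<xi> (X \<xi>) l b * vert_part M nab \<xi> (Y \<xi>) i b) = (\<Sum>b<n. K i \<xi> (X \<xi>) l b * Y \<xi> i (n + b))
     + (\<Sum>b<n. (\<Sum>d<n. K i \<xi> (X \<xi>) l d * K i \<xi> (Y \<xi>) d b) * tfib \<xi> i b)"
    unfolding sum_matrix_product[symmetric]
    by (simp add: vert_part_apply[OF i] distrib_left sum.distrib)
  show ?thesis unfolding pull_deriv_apply[OF U X vY \<xi> i l] 1 2 by simp
qed

text \<open>The horizontal components need only symmetric Christoffel symbols. In the fibre
  directions the torsion would contain the curvature of \<open>nab\<close> applied to the fibre
  vector, and this vanishes by flatness.\<close>

lemma lift_conn_torsionless: "torsionless TM TN"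
  unfolding torsionless_def
proof (intro allI impI ballI)
  fix U X Y \<xi> assume A: "openin (mtop TM) U \<and> vfield TM U X \<and> vfield TM U Y" and \<xi>: "\<xi> \<in> U"
  then have U: "openin (mtop TM) U" and X: "vfield TM U X" and Y: "vfield TM U Y" by auto
  let ?w = "TN X Y \<xi> - TN Y X \<xi>"
  have wt: "?w \<in> tangent_space TM \<xi>"
    by (intro T.tangent_diff T.vfield_tangent[OF N.nab_vfield \<xi>] U X Y)
  have hw: "hor_part M ?w = P X (\<lambda>\<eta>. hor_part M (Y \<eta>)) \<xi> - P Y (\<lambda>\<eta>. hor_part M (X \<eta>)) \<xi>"
    unfolding hor_part_diff lift_conn_parts(1)[OF U X Y \<xi>] lift_conn_parts(1)[OF U Y X \<xi>] ..
  have vw: "vert_part M nab \<xi> ?w = P X (\<lambda>\<eta>. vert_part M nab \<eta> (Y \<eta>)) \<xi> - P Y (\<lambda>\<eta>. vert_part M nab \<eta> (X \<eta>)) \<xi>"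
    unfolding vert_part_diff lift_conn_parts(2)[OF U X Y \<xi>] lift_conn_parts(2)[OF U Y X \<xi>] ..
  have h: "?w i k = bracket TM X Y \<xi> i k" if i: "i \<in> charts_at TM \<xi>" and k: "k < n" for i k
  proof -
    have "?w i k = hor_part M ?w i k" using k by (simp add: hor_part_def)
    also have "\<dots> = P X (\<lambda>\<eta>. hor_part M (Y \<eta>)) \<xi> i k - P Y (\<lambda>\<eta>. hor_part M (X \<eta>)) \<xi> i k" unfolding hw by simp
    also have "\<dots> = vd TM i \<xi> (X \<xi>) (\<lambda>\<eta>. Y \<eta> i k) - vd TM i \<xi> (Y \<xi>) (\<lambda>\<eta>. X \<eta> i k)"
      unfolding pull_deriv_apply[OF U X hor_part_section[OF U Y] \<xi> i k] pull_deriv_apply[OF U Y hor_part_section[OF U X] \<xi> i k]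
      using k conn_matrix_sym[OF charts_at_TM_base[OF i], of "hor_part M (X \<xi>)" k "hor_part M (Y \<xi>)"] by (simp add: hor_part_def)
    also have "\<dots> = bracket TM X Y \<xi> i k" using N.bracket_apply[OF U X Y \<xi> i, of k] k by simp
    finally show ?thesis .
  qed
  have v: "?w i (n + l) = bracket TM X Y \<xi> i (n + l)" if i: "i \<in> charts_at TM \<xi>" and l: "l < n" for i l
  proof -
    \<comment> \<open>\<open>K\<close> sees only horizontal components, and those of
      \<open>?w\<close> have just been identified by \<open>h\<close> with those of the
      bracket.\<close>
    have "K i \<xi> ?w l b = (\<Sum>a<n. christoffel M nab i a b l (tbase \<xi>) * bracket TM X Y \<xi> i a)" for b
      unfolding conn_matrix_def using h[OF i] by (simp add: hor_part_def)
    then have Kw: "K i \<xi> ?w l b = vd TM i \<xi> (X \<xi>) (\<lambda>\<eta>. K i \<eta> (Y \<eta>) l b) - vd TM i \<xi> (Y \<xi>) (\<lambda>\<eta>. K i \<eta> (X \<eta>) l b)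
       + ((\<Sum>d<n. K i \<xi> (X \<xi>) l d * K i \<xi> (Y \<xi>) d b) - (\<Sum>d<n. K i \<xi> (Y \<xi>) l d * K i \<xi> (X \<xi>) d b))" if "b < n" for b
      using conn_matrix_bracket[OF U X Y \<xi> i l that] by (simp add: sum_subtractf)
    have "?w i (n + l) = vert_part M nab \<xi> ?w i l - (\<Sum>b<n. K i \<xi> ?w l b * tfib \<xi> i b)"
      by (simp add: vert_part_apply[OF i l])
    also have "(\<Sum>b<n. K i \<xi> ?w l b * tfib \<xi> i b) =
        (\<Sum>b<n. vd TM i \<xi> (X \<xi>) (\<lambda>\<eta>. K i \<eta> (Y \<eta>) l b) * tfib \<xi> i b) - (\<Sum>b<n. vd TM i \<xi> (Y \<xi>) (\<lambda>\<eta>. K i \<eta> (X \<eta>) l b) * tfib \<xi> i b)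
        + ((\<Sum>b<n. (\<Sum>d<n. K i \<xi> (X \<xi>) l d * K i \<xi> (Y \<xi>) d b) * tfib \<xi> i b)
           - (\<Sum>b<n. (\<Sum>d<n. K i \<xi> (Y \<xi>) l d * K i \<xi> (X \<xi>) d b) * tfib \<xi> i b))"
      unfolding sum_subtractf[symmetric] sum.distrib[symmetric]
      by (intro sum.cong refl) (simp only: Kw lessThan_iff left_diff_distrib distrib_right)
    also have "vert_part M nab \<xi> ?w i l = P X (\<lambda>\<eta>. vert_part M nab \<eta> (Y \<eta>)) \<xi> i l - P Y (\<lambda>\<eta>. vert_part M nab \<eta> (X \<eta>)) \<xi> i l"
      unfolding vw by simp
    finally have "?w i (n + l) = vd TM i \<xi> (X \<xi>) (\<lambda>\<eta>. Y \<eta> i (n + l)) - vd TM i \<xi> (Y \<xi>) (\<lambda>\<eta>. X \<eta> i (n + l))"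
      unfolding pull_deriv_vert[OF U X Y \<xi> i l] pull_deriv_vert[OF U Y X \<xi> i l] by linarith
    also have "\<dots> = bracket TM X Y \<xi> i (n + l)" using N.bracket_apply[OF U X Y \<xi> i, of "n + l"] l by simp
    finally show ?thesis .
  qed
  show "?w = bracket TM X Y \<xi>"
  proof (intro ext)
    fix i k
    consider "i \<in> charts_at TM \<xi>" "k < n" | "i \<in> charts_at TM \<xi>" "n \<le> k" "k < 2 * n" | "i \<notin> charts_at TM \<xi> \<or> k \<ge> mdim TM"
      by fastforce
    then show "?w i k = bracket TM X Y \<xi> i k"
    proof cases
      case 1
      then show ?thesis by (rule h)
    next
      case 2
      then show ?thesis using v[OF 2(1), of "k - n"] by simp
    next
      case 3
      have "?w i k = 0"
        using 3 T.tangent_outside[OF wt, of i] T.tangent_beyond[OF wt, of k i] by (metis zero_fun_apply)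
      moreover have "bracket TM X Y \<xi> i k = 0" using 3 by (auto simp: bracket_def)
      ultimately show ?thesis by simp
    qed
  qed
qed

sublocale NT: tf_conn_mfd "tangent_bundle M" "lift_conn M nab"
  by unfold_locales (rule lift_conn_torsionless)

text \<open>The pullback of a flat connection is flat. In the commutator the second derivatives of
  \<open>W\<close> give its derivative along the bracket, the mixed terms cancel in pairs, and the
  zeroth-order terms are those of \<open>conn_matrix_bracket\<close>.\<close>

lemma pull_deriv_flat:
  assumes U: "openin (mtop TM) U" and X: "vfield TM U X" and Y: "vfield TM U Y" and W: "section_on M U W" and \<xi>: "\<xi> \<in> U"
  shows "P X (P Y W) \<xi> - P Y (P X W) \<xi> - P (bracket TM X Y) W \<xi> = 0"
proof -
  obtain i where i: "i \<in> charts_at TM \<xi>" using topspace_TM_chart[OF open_TM_topspace[OF U \<xi>]] ..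
  note B = NT.bracket_vfield[OF U X Y]
  \<comment> \<open>The third and fourth sums exchange roles when \<open>X\<close> and
    \<open>Y\<close> are swapped.\<close>
  have dd: "P X (P Y W) \<xi> i k = vd TM i \<xi> (X \<xi>) (\<lambda>\<eta>. vd TM i \<eta> (Y \<eta>) (\<lambda>\<zeta>. W \<zeta> i k))
      + (\<Sum>b<n. vd TM i \<xi> (X \<xi>) (\<lambda>\<eta>. K i \<eta> (Y \<eta>) k b) * W \<xi> i b)
      + (\<Sum>b<n. K i \<xi> (Y \<xi>) k b * vd TM i \<xi> (X \<xi>) (\<lambda>\<eta>. W \<eta> i b))
      + (\<Sum>b<n. K i \<xi> (X \<xi>) k b * vd TM i \<xi> (Y \<xi>) (\<lambda>\<eta>. W \<eta> i b))
      + (\<Sum>b<n. (\<Sum>d<n. K i \<xi> (X \<xi>) k d * K i \<xi> (Y \<xi>) d b) * W \<xi> i b)"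
    if X: "vfield TM U X" and Y: "vfield TM U Y" and k: "k < n" for X Y k
  proof -
    note PY = pull_deriv_section[OF U Y W]
    note sW = section_smooth[OF W \<xi> i]
    have sK: "smooth_at TM (\<lambda>\<eta>. K i \<eta> (Y \<eta>) k b) \<xi>" if "b < n" for b
      by (rule section_conn_matrix[OF hor_part_section[OF U Y] \<xi> i k that])
    have s1: "smooth_at TM (\<lambda>\<eta>. vd TM i \<eta> (Y \<eta>) (\<lambda>\<zeta>. W \<zeta> i k)) \<xi>"
      unfolding vd_def
      by (intro T.smooth_at_sum[OF T.charts_at_topspace[OF i]] T.smooth_at_mult T.vfield_smooth_at[OF U Y \<xi> i] T.smooth_at_cpd[OF sW[OF k] i]) auto
    have s2: "smooth_at TM (\<lambda>\<eta>. K i \<eta> (Y \<eta>) k b * W \<eta> i b) \<xi>" if "b < n" for b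
      by (rule T.smooth_at_mult[OF sK[OF that] sW[OF that]])
    have nr: "near TM \<xi> (\<lambda>\<eta>. P Y W \<eta> i k = vd TM i \<eta> (Y \<eta>) (\<lambda>\<zeta>. W \<zeta> i k) + (\<Sum>b<n. K i \<eta> (Y \<eta>) k b * W \<eta> i b))"
      by (rule near_mono[OF near_conj[OF nearI[OF U \<xi>] T.near_chart[OF i]], of "\<lambda>\<eta>. \<eta> \<in> U"])
         (auto simp: pull_deriv_apply[OF U Y W _ _ k])
    have "vd TM i \<xi> (X \<xi>) (\<lambda>\<eta>. P Y W \<eta> i k) = vd TM i \<xi> (X \<xi>) (\<lambda>\<eta>. vd TM i \<eta> (Y \<eta>) (\<lambda>\<zeta>. W \<zeta> i k) + (\<Sum>b<n. K i \<eta> (Y \<eta>) k b * W \<eta> i b))"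
      by (rule T.vd_cong[OF nr i])
    also have "\<dots> = vd TM i \<xi> (X \<xi>) (\<lambda>\<eta>. vd TM i \<eta> (Y \<eta>) (\<lambda>\<zeta>. W \<zeta> i k)) + vd TM i \<xi> (X \<xi>) (\<lambda>\<eta>. \<Sum>b<n. K i \<eta> (Y \<eta>) k b * W \<eta> i b)"
      by (rule T.vd_add[OF s1 T.smooth_at_sum[OF T.charts_at_topspace[OF i]] i]) (use s2 in auto)
    also have "vd TM i \<xi> (X \<xi>) (\<lambda>\<eta>. \<Sum>b<n. K i \<eta> (Y \<eta>) k b * W \<eta> i b) = (\<Sum>b<n. vd TM i \<xi> (X \<xi>) (\<lambda>\<eta>. K i \<eta> (Y \<eta>) k b * W \<eta> i b))"
      by (rule T.vd_sum[OF _ i]) (use s2 in auto)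
    also have "\<dots> = (\<Sum>b<n. vd TM i \<xi> (X \<xi>) (\<lambda>\<eta>. K i \<eta> (Y \<eta>) k b) * W \<xi> i b + K i \<xi> (Y \<xi>) k b * vd TM i \<xi> (X \<xi>) (\<lambda>\<eta>. W \<eta> i b))"
      by (intro sum.cong refl T.vd_mult sK sW i) auto
    finally have 1: "vd TM i \<xi> (X \<xi>) (\<lambda>\<eta>. P Y W \<eta> i k) = vd TM i \<xi> (X \<xi>) (\<lambda>\<eta>. vd TM i \<eta> (Y \<eta>) (\<lambda>\<zeta>. W \<zeta> i k))
      + (\<Sum>b<n. vd TM i \<xi> (X \<xi>) (\<lambda>\<eta>. K i \<eta> (Y \<eta>) k b) * W \<xi> i b)
      + (\<Sum>b<n. K i \<xi> (Y \<xi>) k b * vd TM i \<xi> (X \<xi>) (\<lambda>\<eta>. W \<eta> i b))" by (simp add: sum.distrib)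
    have 2: "(\<Sum>b<n. K i \<xi> (X \<xi>) k b * P Y W \<xi> i b) = (\<Sum>b<n. K i \<xi> (X \<xi>) k b * vd TM i \<xi> (Y \<xi>) (\<lambda>\<eta>. W \<eta> i b))
      + (\<Sum>b<n. (\<Sum>d<n. K i \<xi> (X \<xi>) k d * K i \<xi> (Y \<xi>) d b) * W \<xi> i b)"
      unfolding sum_matrix_product[symmetric]
      by (simp add: pull_deriv_apply[OF U Y W \<xi> i] distrib_left sum.distrib)
    show ?thesis unfolding pull_deriv_apply[OF U X PY \<xi> i k] 1 2 by simp
  qed
  have comp: "P X (P Y W) \<xi> i k - P Y (P X W) \<xi> i k - P (bracket TM X Y) W \<xi> i k = 0" if k: "k < n" for k
  proof -
    have KB: "K i \<xi> (bracket TM X Y \<xi>) k b = (\<Sum>a<n. christoffel M nab i a b k (tbase \<xi>) * bracket TM X Y \<xi> i a)" for b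
      by (simp add: conn_matrix_def hor_part_def)
    have "(\<Sum>b<n. K i \<xi> (bracket TM X Y \<xi>) k b * W \<xi> i b) =
        (\<Sum>b<n. vd TM i \<xi> (X \<xi>) (\<lambda>\<eta>. K i \<eta> (Y \<eta>) k b) * W \<xi> i b) - (\<Sum>b<n. vd TM i \<xi> (Y \<xi>) (\<lambda>\<eta>. K i \<eta> (X \<eta>) k b) * W \<xi> i b)
        + ((\<Sum>b<n. (\<Sum>d<n. K i \<xi> (X \<xi>) k d * K i \<xi> (Y \<xi>) d b) * W \<xi> i b)
           - (\<Sum>b<n. (\<Sum>d<n. K i \<xi> (Y \<xi>) k d * K i \<xi> (X \<xi>) d b) * W \<xi> i b))"
      unfolding sum_subtractf[symmetric] sum.distrib[symmetric]
    proof (intro sum.cong refl)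
      fix b assume "b \<in> {..<n}"
      then have b: "b < n" by simp
      show "K i \<xi> (bracket TM X Y \<xi>) k b * W \<xi> i b = vd TM i \<xi> (X \<xi>) (\<lambda>\<eta>. K i \<eta> (Y \<eta>) k b) * W \<xi> i b
         - vd TM i \<xi> (Y \<xi>) (\<lambda>\<eta>. K i \<eta> (X \<eta>) k b) * W \<xi> i b
         + ((\<Sum>d<n. K i \<xi> (X \<xi>) k d * K i \<xi> (Y \<xi>) d b) * W \<xi> i b - (\<Sum>d<n. K i \<xi> (Y \<xi>) k d * K i \<xi> (X \<xi>) d b) * W \<xi> i b)"
        unfolding KB conn_matrix_bracket[OF U X Y \<xi> i k b, symmetric] by (simp only: sum_subtractf left_diff_distrib distrib_right)
    qed
    moreover have "vd TM i \<xi> (X \<xi>) (\<lambda>\<eta>. vd TM i \<eta> (Y \<eta>) (\<lambda>\<zeta>. W \<zeta> i k)) - vd TM i \<xi> (Y \<xi>) (\<lambda>\<eta>. vd TM i \<eta> (X \<eta>) (\<lambda>\<zeta>. W \<zeta> i k))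
       = vd TM i \<xi> (bracket TM X Y \<xi>) (\<lambda>\<zeta>. W \<zeta> i k)"
      by (rule N.vd_bracket[OF U X Y \<xi> i section_smooth[OF W \<xi> i k]])
    ultimately show ?thesis
      unfolding dd[OF X Y k] dd[OF Y X k] pull_deriv_apply[OF U B W \<xi> i k] by linarith
  qed
  have t: "P X (P Y W) \<xi> - P Y (P X W) \<xi> - P (bracket TM X Y) W \<xi> \<in> tangent_space M (tbase \<xi>)"
    by (intro tangent_diff pull_deriv_tangent[OF U] pull_deriv_section[OF U] X Y W B \<xi>)
  show ?thesis by (rule tangent_eqI[OF t tangent_space_zero charts_at_TM_base[OF i]]) (simp add: comp)
qed

text \<open>The connection acts by the same derivative \<open>P\<close> on both parts of a field, so
  its curvature has the curvature of \<open>P\<close> as its parts.\<close>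

lemma lift_conn_flat: "flat TM TN"
  unfolding flat_def
proof (intro allI impI ballI)
  fix U X Y Z \<xi> assume A: "openin (mtop TM) U \<and> vfield TM U X \<and> vfield TM U Y \<and> vfield TM U Z" and \<xi>: "\<xi> \<in> U"
  then have U: "openin (mtop TM) U" and X: "vfield TM U X" and Y: "vfield TM U Y" and Z: "vfield TM U Z" by auto
  note B = NT.bracket_vfield[OF U X Y] and YZ = N.nab_vfield[OF U Y Z] and XZ = N.nab_vfield[OF U X Z]
  let ?w = "TN X (TN Y Z) \<xi> - TN Y (TN X Z) \<xi> - TN (bracket TM X Y) Z \<xi>"
  have wt: "?w \<in> tangent_space TM \<xi>"
    by (intro T.tangent_diff T.vfield_tangent[OF N.nab_vfield[OF U] \<xi>] X Y B YZ XZ Z)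
  have h: "P V (\<lambda>\<eta>. hor_part M (TN Y Z \<eta>)) \<xi> = P V (P Y (\<lambda>\<eta>. hor_part M (Z \<eta>))) \<xi>" if "vfield TM U Y" for V Y
    by (rule pull_deriv_cong[OF U \<xi> refl]) (rule lift_conn_parts(1)[OF U that Z])
  have v: "P V (\<lambda>\<eta>. vert_part M nab \<eta> (TN Y Z \<eta>)) \<xi> = P V (P Y (\<lambda>\<eta>. vert_part M nab \<eta> (Z \<eta>))) \<xi>" if "vfield TM U Y" for V Y
    by (rule pull_deriv_cong[OF U \<xi> refl]) (rule lift_conn_parts(2)[OF U that Z])
  have "hor_part M ?w = 0"
    unfolding hor_part_diff lift_conn_parts(1)[OF U X YZ \<xi>] lift_conn_parts(1)[OF U Y XZ \<xi>] lift_conn_parts(1)[OF U B Z \<xi>] h[OF Y] h[OF X]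
    by (rule pull_deriv_flat[OF U X Y hor_part_section[OF U Z] \<xi>])
  moreover have "vert_part M nab \<xi> ?w = 0"
    unfolding vert_part_diff lift_conn_parts(2)[OF U X YZ \<xi>] lift_conn_parts(2)[OF U Y XZ \<xi>] lift_conn_parts(2)[OF U B Z \<xi>] v[OF Y] v[OF X]
    by (rule pull_deriv_flat[OF U X Y vert_part_section[OF U Z] \<xi>])
  ultimately have "?w = hor_at M nab \<xi> 0 + vert_at M \<xi> 0"
    using decompose[OF wt open_TM_topspace[OF U \<xi>]] by (simp only:)
  then show "?w = 0" unfolding hor_at_zero vert_at_zero by (simp only: add_0_left)
qed


subsection \<open>The lifted metric\<close>

text \<open>The same expansion as for fields on \<open>M\<close>, now with the pulled back
  connection form. The components of \<open>g\<close> are constant along the fibres, so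
  \<open>C\<close> receives only the horizontal part of the direction.\<close>

lemma section_metric:
  assumes U: "openin (mtop TM) U" and X: "vfield TM U X" and W: "section_on M U W" and W': "section_on M U W'" and \<xi>: "\<xi> \<in> U"
  shows "smooth_at TM (\<lambda>\<eta>. g (tbase \<eta>) (W \<eta>) (W' \<eta>)) \<xi>"
    "dirder TM \<xi> (X \<xi>) (\<lambda>\<eta>. g (tbase \<eta>) (W \<eta>) (W' \<eta>)) = C (tbase \<xi>) (hor_part M (X \<xi>)) (W \<xi>) (W' \<xi>)
      + g (tbase \<xi>) (P X W \<xi>) (W' \<xi>) + g (tbase \<xi>) (W \<xi>) (P X W' \<xi>)"
proof -
  obtain i where i: "i \<in> charts_at TM \<xi>" using topspace_TM_chart[OF open_TM_topspace[OF U \<xi>]] ..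
  note ib = charts_at_TM_base[OF i] and top = T.charts_at_topspace[OF i]
  let ?p = "tbase \<xi>"
  have sG: "smooth_at TM (\<lambda>\<eta>. gcomp i b c (tbase \<eta>)) \<xi>" if "b < n" "c < n" for b c
    by (rule smooth_at_tbase[OF smooth_at_gcomp[OF ib that] i])
  note sW = section_smooth[OF W \<xi> i] and sW' = section_smooth[OF W' \<xi> i]
  let ?d = "vd TM i \<xi> (X \<xi>)"
  have nr: "near TM \<xi> (\<lambda>\<eta>. (\<Sum>b<n. \<Sum>c<n. gcomp i b c (tbase \<eta>) * W \<eta> i b * W' \<eta> i c) = g (tbase \<eta>) (W \<eta>) (W' \<eta>))"
    by (rule near_mono[OF near_conj[OF nearI[OF U \<xi>] T.near_chart[OF i]], of "\<lambda>\<eta>. \<eta> \<in> U"])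
       (auto intro!: g_chart[symmetric] section_tangent[OF W] section_tangent[OF W'] charts_at_TM_base)
  have s: "smooth_at TM (\<lambda>\<eta>. gcomp i b c (tbase \<eta>) * W \<eta> i b * W' \<eta> i c) \<xi>" if "b < n" "c < n" for b c
    by (rule T.smooth_at_mult[OF T.smooth_at_mult[OF sG sW] sW']) (use that in auto)
  have sc: "smooth_at TM (\<lambda>\<eta>. \<Sum>c<n. gcomp i b c (tbase \<eta>) * W \<eta> i b * W' \<eta> i c) \<xi>" if "b < n" for b
    by (rule T.smooth_at_sum[OF top]) (use s that in auto)
  have sg: "smooth_at TM (\<lambda>\<eta>. \<Sum>b<n. \<Sum>c<n. gcomp i b c (tbase \<eta>) * W \<eta> i b * W' \<eta> i c) \<xi>"
    by (rule T.smooth_at_sum[OF top]) (use sc in auto)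
  show sgg: "smooth_at TM (\<lambda>\<eta>. g (tbase \<eta>) (W \<eta>) (W' \<eta>)) \<xi>" by (rule T.smooth_at_cong[OF nr sg])
  have dG: "?d (\<lambda>\<eta>. gcomp i b c (tbase \<eta>)) = vd M i ?p (hor_part M (X \<xi>)) (gcomp i b c)" for b c by (rule vd_tbase[OF i])
  have "dirder TM \<xi> (X \<xi>) (\<lambda>\<eta>. g (tbase \<eta>) (W \<eta>) (W' \<eta>)) = ?d (\<lambda>\<eta>. \<Sum>b<n. \<Sum>c<n. gcomp i b c (tbase \<eta>) * W \<eta> i b * W' \<eta> i c)"
    unfolding T.dirder_cong[OF nr, symmetric] by (rule T.dirder_eq[OF T.vfield_tangent[OF X \<xi>] sg i])
  also have "\<dots> = (\<Sum>b<n. ?d (\<lambda>\<eta>. \<Sum>c<n. gcomp i b c (tbase \<eta>) * W \<eta> i b * W' \<eta> i c))"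
    by (rule T.vd_sum[OF _ i]) (use sc in auto)
  also have "\<dots> = (\<Sum>b<n. \<Sum>c<n. ?d (\<lambda>\<eta>. gcomp i b c (tbase \<eta>) * W \<eta> i b * W' \<eta> i c))"
    by (rule sum.cong[OF refl], rule T.vd_sum[OF _ i]) (use s in auto)
  also have "\<dots> = (\<Sum>b<n. \<Sum>c<n. vd M i ?p (hor_part M (X \<xi>)) (gcomp i b c) * W \<xi> i b * W' \<xi> i c + gcomp i b c ?p * ?d (\<lambda>\<eta>. W \<eta> i b) * W' \<xi> i c
       + gcomp i b c ?p * W \<xi> i b * ?d (\<lambda>\<eta>. W' \<eta> i c))"
    by (intro sum.cong refl)
       (simp add: T.vd_mult[OF T.smooth_at_mult[OF sG sW] sW' i] T.vd_mult[OF sG sW i] dG distrib_right)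
  also have "\<dots> = (\<Sum>b<n. \<Sum>c<n. nabla_g_matrix M nab g i ?p (hor_part M (X \<xi>)) b c * W \<xi> i b * W' \<xi> i c)
     + (\<Sum>b<n. \<Sum>c<n. gcomp i b c ?p * P X W \<xi> i b * W' \<xi> i c) + (\<Sum>b<n. \<Sum>c<n. gcomp i b c ?p * W \<xi> i b * P X W' \<xi> i c)"
    unfolding metric_derivative_expansion[where K="K i \<xi> (X \<xi>)"] nabla_g_matrix_eq
    by (simp add: pull_deriv_apply[OF U X W \<xi> i] pull_deriv_apply[OF U X W' \<xi> i])
  also have "\<dots> = C ?p (hor_part M (X \<xi>)) (W \<xi>) (W' \<xi>) + g ?p (P X W \<xi>) (W' \<xi>) + g ?p (W \<xi>) (P X W' \<xi>)"
    unfolding g_chart[OF ib pull_deriv_tangent[OF U X W \<xi>] section_tangent[OF W' \<xi>]]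
      g_chart[OF ib section_tangent[OF W \<xi>] pull_deriv_tangent[OF U X W' \<xi>]]
      nabla_g_chart[OF section_tangent[OF hor_part_section[OF U X] \<xi>] section_tangent[OF W \<xi>] section_tangent[OF W' \<xi>] ib] ..
  finally show "dirder TM \<xi> (X \<xi>) (\<lambda>\<eta>. g (tbase \<eta>) (W \<eta>) (W' \<eta>)) = C ?p (hor_part M (X \<xi>)) (W \<xi>) (W' \<xi>)
      + g ?p (P X W \<xi>) (W' \<xi>) + g ?p (W \<xi>) (P X W' \<xi>)" .
qed

lemma tbase_topspace: "\<xi> \<in> topspace (mtop TM) \<Longrightarrow> tbase \<xi> \<in> topspace (mtop M)"
  using topspace_TM_chart charts_at_TM_base charts_at_topspace by blast

lemma lift_metric_riemannian: "riemannian_metric TM g1"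
  unfolding riemannian_metric_def
proof (intro conjI ballI allI impI)
  fix \<xi> u assume \<xi>: "\<xi> \<in> topspace (mtop TM)" and u: "u \<in> tangent_space TM \<xi>"
  note top = tbase_topspace[OF \<xi>] and hu = hor_part_tangent[OF u \<xi>] and vu = vert_part_tangent[OF u \<xi>]
  show "0 < g1 \<xi> u u" if "u \<noteq> 0"
  proof -
    \<comment> \<open>A vector with both parts 0 is a lift of zero vectors, hence 0.\<close>
    have "hor_part M u \<noteq> 0 \<or> vert_part M nab \<xi> u \<noteq> 0"
      using that decompose[OF u \<xi>] hor_at_zero[of M nab \<xi>] vert_at_zero[of M \<xi>] by (metis add_0_left)
    then show ?thesis
      unfolding lift_metric_def
      using g_pos[OF top hu] g_pos[OF top vu] g_nonneg[OF top hu] g_nonneg[OF top vu] by fastforce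
  qed
  fix v assume v: "v \<in> tangent_space TM \<xi>"
  note hv = hor_part_tangent[OF v \<xi>] and vv = vert_part_tangent[OF v \<xi>]
  show "g1 \<xi> u v = g1 \<xi> v u"
    unfolding lift_metric_def by (simp only: g_sym[OF top hu hv] g_sym[OF top vu vv])
  show "g1 \<xi> (tscale c u) v = c * g1 \<xi> u v" for c
    unfolding lift_metric_def hor_part_scale vert_part_scale
      linear_at_scale[OF g_linear1[OF top hv] hu] linear_at_scale[OF g_linear1[OF top vv] vu] by (simp add: distrib_left)
  fix w assume w: "w \<in> tangent_space TM \<xi>"
  note hw = hor_part_tangent[OF w \<xi>] and vw = vert_part_tangent[OF w \<xi>]
  show "g1 \<xi> (u + v) w = g1 \<xi> u w + g1 \<xi> v w"
    unfolding lift_metric_def hor_part_add vert_part_add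
      linear_at_add[OF g_linear1[OF top hw] hu hv] linear_at_add[OF g_linear1[OF top vw] vu vv] by simp
next
  fix U X Y assume "openin (mtop TM) U \<and> vfield TM U X \<and> vfield TM U Y"
  then have U: "openin (mtop TM) U" and X: "vfield TM U X" and Y: "vfield TM U Y" by auto
  show "smooth_fun TM U (\<lambda>\<xi>. g1 \<xi> (X \<xi>) (Y \<xi>))"
    unfolding T.smooth_fun_iff[OF U] lift_metric_def
    by (intro ballI T.smooth_at_add section_metric(1)[OF U X] hor_part_section[OF U] vert_part_section[OF U] X Y)
qed

sublocale L: affine_riem "tangent_bundle M" "lift_conn M nab" "lift_metric M nab g"
  by unfold_locales (rule lift_metric_riemannian)

text \<open>The lifted metric is the sum of \<open>g\<close> on horizontal and on vertical parts,
  and \<open>section_metric\<close> differentiates each summand. The connection terms agree with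
  those of the lifted connection by \<open>lift_conn_parts\<close>, so comparing with the Leibniz
  rule on the bundle isolates the two values of \<open>C\<close>.\<close>

lemma nabla_g_lift:
  assumes \<xi>: "\<xi> \<in> topspace (mtop TM)" and u: "u \<in> tangent_space TM \<xi>" and v: "v \<in> tangent_space TM \<xi>" and w: "w \<in> tangent_space TM \<xi>"
  shows "nabla_g TM TN g1 \<xi> u v w = C (tbase \<xi>) (hor_part M u) (hor_part M v) (hor_part M w)
     + C (tbase \<xi>) (hor_part M u) (vert_part M nab \<xi> v) (vert_part M nab \<xi> w)"
proof -
  obtain i where i: "i \<in> charts_at TM \<xi>" using topspace_TM_chart[OF \<xi>] ..
  then have ic: "i \<in> charts TM" "\<xi> \<in> cdom TM i" by (simp_all only: T.charts_at_iff)
  note U = T.cdom_open[OF ic(1)]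
  obtain X where X: "vfield TM (cdom TM i) X" "X \<xi> = u" by (rule T.tangent_extend[OF u i])
  obtain Y where Y: "vfield TM (cdom TM i) Y" "Y \<xi> = v" by (rule T.tangent_extend[OF v i])
  obtain Z where Z: "vfield TM (cdom TM i) Z" "Z \<xi> = w" by (rule T.tangent_extend[OF w i])
  note hY = hor_part_section[OF U Y(1)] and vY = vert_part_section[OF U Y(1)]
  note hZ = hor_part_section[OF U Z(1)] and vZ = vert_part_section[OF U Z(1)]
  note h = section_metric[OF U X(1) hY hZ ic(2)] and vt = section_metric[OF U X(1) vY vZ ic(2)]
  note Xt = T.vfield_tangent[OF X(1) ic(2)]
  have "dirder TM \<xi> (X \<xi>) (\<lambda>\<eta>. g1 \<eta> (Y \<eta>) (Z \<eta>)) = dirder TM \<xi> (X \<xi>) (\<lambda>\<eta>. g (tbase \<eta>) (hor_part M (Y \<eta>)) (hor_part M (Z \<eta>)))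
     + dirder TM \<xi> (X \<xi>) (\<lambda>\<eta>. g (tbase \<eta>) (vert_part M nab \<eta> (Y \<eta>)) (vert_part M nab \<eta> (Z \<eta>)))"
    unfolding lift_metric_def T.dirder_eq[OF Xt T.smooth_at_add[OF h(1) vt(1)] i] T.dirder_eq[OF Xt h(1) i] T.dirder_eq[OF Xt vt(1) i]
    by (rule T.vd_add[OF h(1) vt(1) i])
  with L.nabla_g_field[OF U X(1) Y(1) Z(1) ic(2)] show ?thesis
    unfolding h(2) vt(2)
    unfolding lift_metric_def lift_conn_parts[OF U X(1) Y(1) ic(2)] lift_conn_parts[OF U X(1) Z(1) ic(2)] X(2) Y(2) Z(2)
    by linarith
qed

lemma lift_onb:
  assumes \<xi>: "\<xi> \<in> topspace (mtop TM)" and e: "onb (tbase \<xi>) e"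
  shows "L.onb \<xi> (\<lambda>a. if a < n then hor_at M nab \<xi> (e a) else vert_at M \<xi> (e (a - n)))"
proof -
  note top = tbase_topspace[OF \<xi>] and et = onb_tangent[OF e]
  have z: "g (tbase \<xi>) 0 v = 0" "g (tbase \<xi>) v 0 = 0" if "v \<in> tangent_space M (tbase \<xi>)" for v
    using linear_at_zero[OF g_linear1[OF top that]] linear_at_zero[OF g_linear2[OF top that]] by auto
  note z0 = z[OF tangent_space_zero]
  have t: "hor_at M nab \<xi> u \<in> tangent_space TM \<xi>" "vert_at M \<xi> u \<in> tangent_space TM \<xi>" if "u \<in> tangent_space M (tbase \<xi>)" for u
    using lift_tangent[OF that tangent_space_zero \<xi>] lift_tangent[OF tangent_space_zero that \<xi>]
    by (simp_all only: hor_at_zero vert_at_zero add_0_left add_0_right)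
  have l: "a - n < n" if "a < 2 * n" "\<not> a < n" for a using that by linarith
  show ?thesis
    unfolding L.onb_def
  proof (intro conjI allI impI)
    fix a assume a: "a < mdim TM"
    show "(if a < n then hor_at M nab \<xi> (e a) else vert_at M \<xi> (e (a - n))) \<in> tangent_space TM \<xi>"
      using t et l a by simp
    fix b assume b: "b < mdim TM"
    have ab: "a < 2 * n" "b < 2 * n" using a b by auto
    show "g1 \<xi> (if a < n then hor_at M nab \<xi> (e a) else vert_at M \<xi> (e (a - n)))
        (if b < n then hor_at M nab \<xi> (e b) else vert_at M \<xi> (e (b - n))) = (if a = b then 1 else 0)"
      unfolding lift_metric_def using l[OF ab(1)] l[OF ab(2)]
      by (cases "a < n"; cases "b < n")
         (auto simp: parts_hor_at[OF et] parts_vert_at[OF et] z et z0 onb_g[OF e])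
  qed
qed

text \<open>Evaluate on the basis of \<open>lift_onb\<close>. In \<alpha> horizontal and vertical
  basis vectors fill the two metric slots with the same vectors of \<open>M\<close>; in \<beta> a
  vertical basis vector also stands in the direction slot, where its horizontal part 0 kills both
  terms.\<close>

lemma trace_forms_lift:
  assumes \<xi>: "\<xi> \<in> topspace (mtop TM)" and u: "u \<in> tangent_space TM \<xi>"
  shows "L.aform \<xi> u = 2 * aform (tbase \<xi>) (hor_part M u)" "L.bform \<xi> u = bform (tbase \<xi>) (hor_part M u)"
proof -
  note top = tbase_topspace[OF \<xi>] and hu = hor_part_tangent[OF u \<xi>] and vu = vert_part_tangent[OF u \<xi>]
  obtain e where e: "onb (tbase \<xi>) e" using ex_onb[OF top] ..
  note et = onb_tangent[OF e] and le = lift_onb[OF \<xi> e]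
  note lt = L.onb_tangent[OF le]
  have t: "hor_at M nab \<xi> u \<in> tangent_space TM \<xi>" "vert_at M \<xi> u \<in> tangent_space TM \<xi>" if "u \<in> tangent_space M (tbase \<xi>)" for u
    using lift_tangent[OF that tangent_space_zero \<xi>] lift_tangent[OF tangent_space_zero that \<xi>]
    by (simp_all only: hor_at_zero vert_at_zero add_0_left add_0_right)
  have z: "C (tbase \<xi>) 0 v w = 0" "C (tbase \<xi>) v 0 w = 0" if "v \<in> tangent_space M (tbase \<xi>)" "w \<in> tangent_space M (tbase \<xi>)" for v w
    using linear_at_zero[OF nabla_g_linear(1)[OF top that]] linear_at_zero[OF nabla_g_linear(2)[OF top that]] by auto
  show "L.aform \<xi> u = 2 * aform (tbase \<xi>) (hor_part M u)"
    unfolding L.aform_eq[OF \<xi> u le] aform_eq[OF top hu e] tangent_bundle_simps sum_lessThan_double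
    by (simp add: nabla_g_lift[OF \<xi> u] t et parts_hor_at[OF et] parts_vert_at[OF et] z hu tangent_space_zero)
  show "L.bform \<xi> u = bform (tbase \<xi>) (hor_part M u)"
    unfolding L.bform_eq[OF \<xi> u le] bform_eq[OF top hu e] tangent_bundle_simps sum_lessThan_double
    by (simp add: nabla_g_lift[OF \<xi> _ _ u] t et parts_hor_at[OF et] parts_vert_at[OF et] z hu vu tangent_space_zero)
qed

lemma trace_forms_lift_closed:
  assumes "closed_form M aform" "closed_form M bform"
  shows "closed_form TM L.aform" "closed_form TM L.bform"
proof -
  note pa = closed_form_pullback[OF assms(1) hor_part_tangent] and pb = closed_form_pullback[OF assms(2) hor_part_tangent]
  show "closed_form TM L.aform"
    \<comment> \<open>The coefficients 2 and 0 produce the factor 2 of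
      \<open>trace_forms_lift\<close>.\<close>
    by (rule T.closed_form_cong[OF T.closed_form_combine[OF pa pa, of 2 0]]) (simp_all add: trace_forms_lift)
  show "closed_form TM L.bform"
    by (rule T.closed_form_cong[OF pb]) (simp_all add: trace_forms_lift)
qed


subsection \<open>The complex structure\<close>

text \<open>On pairs of parts \<open>J1\<close> is the rotation (h, v) \<mapsto> (-v, h). In this
  shape the lemmas on lifts apply to it.\<close>

lemma lift_J_eq: "J1 \<xi> w = hor_at M nab \<xi> (- vert_part M nab \<xi> w) + vert_at M \<xi> (hor_part M w)"
proof -
  have "hor_at M nab \<xi> (- u) = - hor_at M nab \<xi> u" for u
    using hor_at_scale[of M nab \<xi> "-1" u] by (simp only: tscale_minus_one)
  then show ?thesis by (simp only: lift_J_def) simp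
qed

lemma lift_J_parts:
  assumes w: "w \<in> tangent_space TM \<xi>" and \<xi>: "\<xi> \<in> topspace (mtop TM)"
  shows "J1 \<xi> w \<in> tangent_space TM \<xi>" "hor_part M (J1 \<xi> w) = - vert_part M nab \<xi> w" "vert_part M nab \<xi> (J1 \<xi> w) = hor_part M w"
  unfolding lift_J_eq using lift_tangent lift_parts tangent_minus[OF vert_part_tangent[OF w \<xi>]] hor_part_tangent[OF w \<xi>] \<xi>
  by blast+

lemma lift_J_add: "J1 \<xi> (u + v) = J1 \<xi> u + J1 \<xi> v"
  unfolding lift_J_def hor_part_add vert_part_add hor_at_add vert_at_add by (simp only: diff_conv_add_uminus minus_add_distrib add_ac)

lemma lift_J_scale: "J1 \<xi> (tscale c u) = tscale c (J1 \<xi> u)"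
  unfolding lift_J_def hor_part_scale vert_part_scale hor_at_scale vert_at_scale
  by (simp add: tscale_def fun_eq_iff right_diff_distrib)

lemma lift_J_minus: "J1 \<xi> (- u) = - J1 \<xi> u"
  using lift_J_scale[of \<xi> "-1" u] by (simp only: tscale_minus_one)

lemma lift_J_diff: "J1 \<xi> (u - v) = J1 \<xi> u - J1 \<xi> v"
  using lift_J_add[of \<xi> u "- v"] by (simp only: lift_J_minus add_uminus_conv_diff)

lemma lift_J_square:
  assumes w: "w \<in> tangent_space TM \<xi>" and \<xi>: "\<xi> \<in> topspace (mtop TM)"
  shows "J1 \<xi> (J1 \<xi> w) = - w"
proof -
  note j = lift_J_parts[OF w \<xi>]
  note jj = lift_J_parts[OF j(1) \<xi>]
  show ?thesis
    by (rule parts_eqI[OF jj(1) T.tangent_minus[OF w] \<xi>]) (simp_all only: jj j hor_part_minus vert_part_minus)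
qed

lemma lift_J_vfield:
  assumes U: "openin (mtop TM) U" and X: "vfield TM U X"
  shows "vfield TM U (apply_endo J1 X)"
  unfolding apply_endo_def lift_J_eq
  by (rule lift_vfield[OF U section_uminus[OF vert_part_section[OF U X]] hor_part_section[OF U X]])

text \<open>\<open>J1\<close> exchanges the parts up to a sign, and the connection differentiates
  both parts by the same operator \<open>P\<close>.\<close>

lemma lift_J_parallel:
  assumes U: "openin (mtop TM) U" and X: "vfield TM U X" and Y: "vfield TM U Y" and \<xi>: "\<xi> \<in> U"
  shows "TN X (apply_endo J1 Y) \<xi> = J1 \<xi> (TN X Y \<xi>)"
proof -
  note JY = lift_J_vfield[OF U Y] and top = open_TM_topspace[OF U]
  note Nt = T.vfield_tangent[OF N.nab_vfield[OF U X Y] \<xi>]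
  have "P X (\<lambda>\<eta>. hor_part M (apply_endo J1 Y \<eta>)) \<xi> = P X (\<lambda>\<eta>. - vert_part M nab \<eta> (Y \<eta>)) \<xi>"
    by (rule pull_deriv_cong[OF U \<xi> refl]) (simp only: apply_endo_def lift_J_parts(2)[OF T.vfield_tangent[OF Y] top])
  also have "\<dots> = - P X (\<lambda>\<eta>. vert_part M nab \<eta> (Y \<eta>)) \<xi>" by (rule pull_deriv_minus[OF U X vert_part_section[OF U Y] \<xi>])
  finally have h: "P X (\<lambda>\<eta>. hor_part M (apply_endo J1 Y \<eta>)) \<xi> = - P X (\<lambda>\<eta>. vert_part M nab \<eta> (Y \<eta>)) \<xi>" .
  have v: "P X (\<lambda>\<eta>. vert_part M nab \<eta> (apply_endo J1 Y \<eta>)) \<xi> = P X (\<lambda>\<eta>. hor_part M (Y \<eta>)) \<xi>"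
    by (rule pull_deriv_cong[OF U \<xi> refl]) (simp only: apply_endo_def lift_J_parts(3)[OF T.vfield_tangent[OF Y] top])
  show ?thesis
    by (rule parts_eqI[OF T.vfield_tangent[OF N.nab_vfield[OF U X JY] \<xi>] lift_J_parts(1)[OF Nt top[OF \<xi>]] top[OF \<xi>]])
       (simp_all only: lift_J_parts[OF Nt top[OF \<xi>]] lift_conn_parts[OF U X JY \<xi>] lift_conn_parts[OF U X Y \<xi>] h v)
qed

text \<open>All brackets are replaced by differences of derivatives of the torsionless connection
  \<open>TN\<close>; since \<open>J1\<close> commutes with these derivatives and has square -1, the
  terms cancel pairwise.\<close>

lemma lift_nijenhuis:
  assumes U: "openin (mtop TM) U" and X: "vfield TM U X" and Y: "vfield TM U Y" and \<xi>: "\<xi> \<in> U"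
  shows "nijenhuis TM J1 X Y \<xi> = 0"
proof -
  note JX = lift_J_vfield[OF U X] and JY = lift_J_vfield[OF U Y]
  have sq: "J1 \<xi> (J1 \<xi> (TN A B \<xi>)) = - TN A B \<xi>" if "vfield TM U A" "vfield TM U B" for A B
    by (rule lift_J_square[OF T.vfield_tangent[OF N.nab_vfield[OF U that] \<xi>] open_TM_topspace[OF U \<xi>]])
  have ap: "apply_endo J1 F \<xi> = J1 \<xi> (F \<xi>)" for F by (simp add: apply_endo_def)
  have "nijenhuis TM J1 X Y \<xi> = bracket TM (apply_endo J1 X) (apply_endo J1 Y) \<xi> - J1 \<xi> (bracket TM (apply_endo J1 X) Y \<xi>)
     - J1 \<xi> (bracket TM X (apply_endo J1 Y) \<xi>) - bracket TM X Y \<xi>"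
    by (simp add: nijenhuis_def ap)
  also have "\<dots> = (J1 \<xi> (TN (apply_endo J1 X) Y \<xi>) - J1 \<xi> (TN (apply_endo J1 Y) X \<xi>))
     - (J1 \<xi> (TN (apply_endo J1 X) Y \<xi>) - - TN Y X \<xi>) - (- TN X Y \<xi> - J1 \<xi> (TN (apply_endo J1 Y) X \<xi>)) - (TN X Y \<xi> - TN Y X \<xi>)"
    by (simp only: NT.bracket_eq[OF U JX JY \<xi>] NT.bracket_eq[OF U JX Y \<xi>] NT.bracket_eq[OF U X JY \<xi>] NT.bracket_eq[OF U X Y \<xi>]
        lift_J_parallel[OF U JX Y \<xi>] lift_J_parallel[OF U JY X \<xi>] lift_J_parallel[OF U X Y \<xi>] lift_J_parallel[OF U Y X \<xi>]
        lift_J_diff sq[OF X Y] sq[OF Y X])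
  also have "\<dots> = 0" by (simp add: fun_eq_iff)
  finally show ?thesis .
qed

text \<open>\<open>J1\<close> permutes the two parts up to sign and is thus an isometry of the sum
  metric; integrability is \<open>lift_nijenhuis\<close>.\<close>

lemma lift_hermitian: "hermitian_manifold TM J1 g1"
  unfolding hermitian_manifold_def
proof (intro conjI smooth_manifold_TM lift_metric_riemannian ballI)
  show "complex_structure TM J1"
    unfolding complex_structure_def almost_complex_def
    using lift_J_parts(1) lift_J_square lift_J_scale lift_J_add lift_J_vfield lift_nijenhuis by blast
  fix \<xi> u v assume \<xi>: "\<xi> \<in> topspace (mtop TM)" and u: "u \<in> tangent_space TM \<xi>" and v: "v \<in> tangent_space TM \<xi>"
  note top = tbase_topspace[OF \<xi>] and vu = vert_part_tangent[OF u \<xi>] and vv = vert_part_tangent[OF v \<xi>]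
  have "g (tbase \<xi>) (- vert_part M nab \<xi> u) (- vert_part M nab \<xi> v) = g (tbase \<xi>) (vert_part M nab \<xi> u) (vert_part M nab \<xi> v)"
    unfolding linear_at_minus[OF g_linear1[OF top tangent_minus[OF vv]] vu] linear_at_minus[OF g_linear2[OF top vu] vv] by simp
  then show "g1 \<xi> (J1 \<xi> u) (J1 \<xi> v) = g1 \<xi> u v"
    unfolding lift_metric_def lift_J_parts[OF u \<xi>] lift_J_parts[OF v \<xi>] by simp
qed

lemma lift_affine_riemann: "affine_riemann_manifold TM TN g1"
  unfolding affine_riemann_manifold_def
  using smooth_manifold_TM N.conn lift_conn_flat lift_conn_torsionless lift_metric_riemannian by blast

lemma lift_lcb:
  assumes "closed_form M aform" "closed_form M bform"
  shows "locally_conformally_balanced TM J1 g1"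
  by (rule L.parallel_complex_structure_lcb[OF lift_hermitian lift_J_parallel trace_forms_lift_closed[OF assms]])

end

section \<open>Induction along the canonical sequence\<close>

lemma affine_riemI:
  assumes "affine_riemann_manifold M nab g"
  shows "affine_riem M nab g"
  using assms unfolding affine_riemann_manifold_def by unfold_locales auto

lemma tb_affineI:
  assumes "affine_riemann_manifold M nab g"
  shows "tb_affine M nab g"
  using assms unfolding affine_riemann_manifold_def by unfold_locales auto

text \<open>The induction invariant. It includes the affine-Riemann structure, so that the lifting
  construction can be entered again at the next level.\<close>

definition closed_trace_forms :: "('p, 'i) manifold \<Rightarrow> ('p, 'i) conn \<Rightarrow> ('p, 'i) metric \<Rightarrow> bool" where
  "closed_trace_forms M nab g \<longleftrightarrow> affine_riemann_manifold M nab g \<and>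
     closed_form M (affine_riem.aform M nab g) \<and> closed_form M (affine_riem.bform M nab g)"

text \<open>The first conclusion is the induction step, the second the result one level above the
  invariant; so the invariant at level \<open>l\<close> yields the claim at level
  \<open>Suc l\<close>.\<close>

lemma closed_trace_forms_lift:
  assumes "closed_trace_forms M nab g"
  shows "closed_trace_forms (tangent_bundle M) (lift_conn M nab) (lift_metric M nab g)"
    and "locally_conformally_balanced (tangent_bundle M) (lift_J M nab) (lift_metric M nab g)"
proof -
  have "affine_riemann_manifold M nab g" and c: "closed_form M (affine_riem.aform M nab g)" "closed_form M (affine_riem.bform M nab g)"
    using assms unfolding closed_trace_forms_def by blast+
  then interpret tb_affine M nab g by (intro tb_affineI)
  show "closed_trace_forms TM TN g1"
    unfolding closed_trace_forms_def by (intro conjI lift_affine_riemann trace_forms_lift_closed[OF c])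
  show "locally_conformally_balanced TM J1 g1" by (rule lift_lcb[OF c])
qed

lemma closed_trace_forms_iter:
  assumes "closed_trace_forms M nab g"
  shows "closed_trace_forms (iter_tangent M k) (iter_conn M nab k) (iter_metric M nab g k)"
proof (induction k)
  case 0
  show ?case using assms by simp
next
  case (Suc k)
  from closed_trace_forms_lift(1)[OF this] show ?case by simp
qed

theorem proposition7p1:
  fixes M :: "('a, 'i) tmanifold"
    and nab D :: "('a, 'i) tconn"
    and g :: "('a, 'i) tmetric"
  assumes "affine_riemann_manifold M nab g"
    and "levi_civita M g D"
    and "parallel_21 M D (difference_tensor D nab)"
  shows "\<forall>k\<ge>1. locally_conformally_balanced
           (iter_tangent M k) (iter_J M nab k) (iter_metric M nab g k)"
proof (intro allI impI)
  fix k :: nat assume "k \<ge> 1"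
  \<comment> \<open>\<open>iter_J\<close> refers to level \<open>k - 1\<close>, which is then
    \<open>l\<close>, the level at which the invariant is used.\<close>
  then obtain l where k: "k = Suc l" by (cases k) auto
  interpret affine_riem M nab g by (rule affine_riemI[OF assms(1)])
  have "closed_trace_forms M nab g"
    unfolding closed_trace_forms_def using assms(1) trace_forms_closed[OF assms(2,3)] by blast
  from closed_trace_forms_lift(2)[OF closed_trace_forms_iter[OF this, of l]]
  show "locally_conformally_balanced (iter_tangent M k) (iter_J M nab k) (iter_metric M nab g k)"
    by (simp add: k iter_J_def)
qed

end
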